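(* Let $\mathbb{K}$ be a field of characteristic equal to zero or greater than $n+1$. Suppose $\phi \colon \mathrm{Out}(F_n) \to \mathrm{GL}(V)$ is an $m$-dimensional $\mathbb{K}$-linear representation of $\mathrm{Out}(F_n)$, where $n \geqslant 6$ and $m < \binom{n+1}{2}$. Then $\phi$ factors through the natural projection $p \colon \mathrm{Out}(F_n) \to \mathrm{GL}_n(\mathbb{Z})$.
   Context: $F_n$ is the free group of rank $n$ and $\mathrm{Out}(F_n)$ its outer automorphism group. The natural projection $p \colon \mathrm{Out}(F_n) \to \mathrm{GL}_n(\mathbb{Z})$ is the homomorphism induced by the action of $\mathrm{Out}(F_n)$ on the abelianisation $\mathbb{Z}^n$ of $F_n$. "$\phi$ factors through $p$" means that there is a homomorphism $\psi \colon \mathrm{GL}_n(\mathbb{Z}) \to \mathrm{GL}(V)$ with $\phi = \psi \circ p$. *)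

theory Defs
  imports
    "HOL-Algebra.Algebra"
    "Jordan_Normal_Form.Matrix"
begin

section \<open>Outer automorphism groups\<close>

definition Inn :: "('a, 'b) monoid_scheme \<Rightarrow> ('a \<Rightarrow> 'a) set" where
  "Inn G = {\<lambda>x \<in> carrier G. g \<otimes>\<^bsub>G\<^esub> x \<otimes>\<^bsub>G\<^esub> inv\<^bsub>G\<^esub> g | g. g \<in> carrier G}"

definition Out :: "('a, 'b) monoid_scheme \<Rightarrow> ('a \<Rightarrow> 'a) set monoid" where
  "Out G = AutoGroup G Mod Inn G"

lemma carrier_AutoGroup: "carrier (AutoGroup G) = auto G"
  by (simp add: AutoGroup_def)

lemma mult_AutoGroup:
  assumes "f \<in> auto G" "g \<in> auto G"
  shows "f \<otimes>\<^bsub>AutoGroup G\<^esub> g = compose (carrier G) f g"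
  using assms by (simp add: AutoGroup_def BijGroup_def auto_def)

lemma one_AutoGroup: "\<one>\<^bsub>AutoGroup G\<^esub> = (\<lambda>x \<in> carrier G. x)"
  by (simp add: AutoGroup_def BijGroup_def)

lemma auto_closed: "f \<in> auto G \<Longrightarrow> x \<in> carrier G \<Longrightarrow> f x \<in> carrier G"
  by (auto simp: auto_def hom_def)

lemma (in group) conj_in_auto:
  assumes g: "g \<in> carrier G"
  shows "(\<lambda>x \<in> carrier G. g \<otimes> x \<otimes> inv g) \<in> auto G"
proof -
  have *: "inv g \<otimes> (g \<otimes> x \<otimes> inv g) \<otimes> g = x" "g \<otimes> (inv g \<otimes> x \<otimes> g) \<otimes> inv g = x"
    if "x \<in> carrier G" for x
    using that g by (simp_all add: m_assoc flip: m_assoc[of "inv g" g] m_assoc[of g "inv g"])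
  have "bij_betw (\<lambda>x \<in> carrier G. g \<otimes> x \<otimes> inv g) (carrier G) (carrier G)"
    by (rule bij_betwI[where g = "\<lambda>x. inv g \<otimes> x \<otimes> g"]) (use g * in auto)
  moreover have "(g \<otimes> x \<otimes> inv g) \<otimes> (g \<otimes> y \<otimes> inv g) = g \<otimes> (x \<otimes> y) \<otimes> inv g"
    if "x \<in> carrier G" "y \<in> carrier G" for x y
    using that g by (simp add: m_assoc flip: m_assoc[of "inv g" g])
  ultimately show ?thesis
    using g by (auto simp: auto_def hom_def Bij_def)
qed

lemma (in group) Inn_normal: "Inn G \<lhd> AutoGroup G"
proof -
  interpret A: group "AutoGroup G" by (rule AutoGroup)
  let ?c = "\<lambda>g. \<lambda>x \<in> carrier G. g \<otimes> x \<otimes> inv g"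
  have c_mult: "?c g \<otimes>\<^bsub>AutoGroup G\<^esub> ?c h = ?c (g \<otimes> h)"
    if "g \<in> carrier G" "h \<in> carrier G" for g h
    unfolding mult_AutoGroup[OF that[THEN conj_in_auto]] using that
    by (auto simp: compose_def m_assoc inv_mult_group intro!: restrict_ext)
  have c_one: "?c \<one> = \<one>\<^bsub>AutoGroup G\<^esub>"
    by (auto simp: one_AutoGroup restrict_def fun_eq_iff)
  have c_inv: "inv\<^bsub>AutoGroup G\<^esub> (?c g) = ?c (inv g)" if "g \<in> carrier G" for g
    by (rule A.inv_equality)
      (use that c_one c_mult[of "inv g" g] conj_in_auto[of g] conj_in_auto[of "inv g"]
        in \<open>simp_all add: carrier_AutoGroup\<close>)
  have "subgroup (Inn G) (AutoGroup G)"
  proof (rule A.subgroupI)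
    show "Inn G \<subseteq> carrier (AutoGroup G)"
      by (auto simp: Inn_def carrier_AutoGroup conj_in_auto)
    show "Inn G \<noteq> {}" by (auto simp: Inn_def)
    show "inv\<^bsub>AutoGroup G\<^esub> a \<in> Inn G" if "a \<in> Inn G" for a
      using that c_inv inv_closed unfolding Inn_def by blast
    show "a \<otimes>\<^bsub>AutoGroup G\<^esub> b \<in> Inn G" if "a \<in> Inn G" "b \<in> Inn G" for a b
      using that c_mult m_closed unfolding Inn_def by blast
  qed
  moreover have "f \<otimes>\<^bsub>AutoGroup G\<^esub> h \<otimes>\<^bsub>AutoGroup G\<^esub> inv\<^bsub>AutoGroup G\<^esub> f \<in> Inn G"
    if f: "f \<in> carrier (AutoGroup G)" and h: "h \<in> Inn G" for f h
  proof -
    from h obtain g where g: "g \<in> carrier G" and h_eq: "h = ?c g"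
      by (auto simp: Inn_def)
    have f': "f \<in> auto G" using f by (simp add: carrier_AutoGroup)
    interpret f: group_hom G G f
      using f' by (unfold_locales) (auto simp: auto_def)
    have "f \<otimes>\<^bsub>AutoGroup G\<^esub> ?c g = ?c (f g) \<otimes>\<^bsub>AutoGroup G\<^esub> f"
      unfolding mult_AutoGroup[OF f' conj_in_auto[OF g]]
        mult_AutoGroup[OF conj_in_auto[OF f.hom_closed[OF g]] f']
      using g by (auto simp: compose_def intro!: restrict_ext)
    then have "f \<otimes>\<^bsub>AutoGroup G\<^esub> h \<otimes>\<^bsub>AutoGroup G\<^esub> inv\<^bsub>AutoGroup G\<^esub> f = ?c (f g)"
      using f conj_in_auto[OF f.hom_closed[OF g]]
        A.m_assoc[of "?c (f g)" f "inv\<^bsub>AutoGroup G\<^esub> f"] A.r_inv[OF f] A.r_one[of "?c (f g)"]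
      by (simp only: h_eq carrier_AutoGroup A.inv_closed[unfolded carrier_AutoGroup])
    then show ?thesis using f.hom_closed[OF g] unfolding Inn_def by blast
  qed
  ultimately show ?thesis using A.normal_inv_iff by blast
qed

lemma (in group) group_Out: "group (Out G)"
  unfolding Out_def using Inn_normal by (rule normal.factorgroup_is_group)


section \<open>Free groups of finite rank\<close>

text \<open>The letter \<^term>\<open>(i, True)\<close> is the generator \<open>x\<^sub>i\<close> and \<^term>\<open>(i, False)\<close> is its formal
  inverse. Elements of the free group are the reduced words.\<close>

type_synonym letter = "nat \<times> bool"

fun inv_letter :: "letter \<Rightarrow> letter" where
  "inv_letter (i, b) = (i, \<not> b)"

definition reduced :: "letter list \<Rightarrow> bool" where
  "reduced w \<longleftrightarrow> successively (\<lambda>a b. b \<noteq> inv_letter a) w"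

fun push_letter :: "letter \<Rightarrow> letter list \<Rightarrow> letter list" where
  "push_letter a [] = [a]"
| "push_letter a (b # w) = (if b = inv_letter a then w else a # b # w)"

definition free_group :: "nat \<Rightarrow> letter list monoid" where
  "free_group n =
    \<lparr>carrier = {w. reduced w \<and> set w \<subseteq> {..<n} \<times> UNIV},
     monoid.mult = foldr push_letter,
     one = []\<rparr>"

definition gen :: "nat \<Rightarrow> letter list" where
  "gen i = [(i, True)]"

lemma inv_letter_inv_letter [simp]: "inv_letter (inv_letter a) = a"
  by (cases a) simp

lemma inv_letter_eq_iff: "a = inv_letter b \<longleftrightarrow> b = inv_letter a"
  by (cases a; cases b) auto

lemma fst_inv_letter [simp]: "fst (inv_letter a) = fst a"
  by (cases a) simp

lemma reduced_simps [simp]: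
  "reduced []" "reduced [a]" "reduced (a # b # w) \<longleftrightarrow> b \<noteq> inv_letter a \<and> reduced (b # w)"
  by (auto simp: reduced_def)

lemma reduced_Cons: "reduced (a # w) \<Longrightarrow> reduced w"
  by (cases w) auto

lemma reduced_push: "reduced w \<Longrightarrow> reduced (push_letter a w)"
  by (cases w) (auto dest: reduced_Cons)

lemma push_reduced: "reduced (a # w) \<Longrightarrow> push_letter a w = a # w"
  by (cases w) auto

lemma push_inv_push: "reduced w \<Longrightarrow> push_letter (inv_letter a) (push_letter a w) = w"
  by (cases w) (auto simp: push_reduced)

lemma push_push_inv: "reduced w \<Longrightarrow> push_letter a (push_letter (inv_letter a) w) = w"
  using push_inv_push[of w "inv_letter a"] by simp

lemma reduced_foldr: "reduced v \<Longrightarrow> reduced (foldr push_letter u v)"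
  by (induction u) (auto intro: reduced_push)

lemma foldr_push_push:
  assumes "reduced u" "reduced v"
  shows "foldr push_letter (push_letter a u) v = push_letter a (foldr push_letter u v)"
proof (cases u)
  case (Cons b u')
  then show ?thesis
    using push_push_inv[OF reduced_foldr[OF assms(2)], of a u'] by auto
qed simp

lemma foldr_push_assoc:
  assumes "reduced v" "reduced w"
  shows "foldr push_letter (foldr push_letter u v) w
       = foldr push_letter u (foldr push_letter v w)"
  using assms by (induction u) (auto simp: foldr_push_push reduced_foldr)

lemma foldr_push_Nil: "reduced u \<Longrightarrow> foldr push_letter u [] = u"
proof (induction u)
  case (Cons a u)
  then show ?case using push_reduced[OF Cons.prems] reduced_Cons[OF Cons.prems] by simp
qed simp

lemma set_push: "set (push_letter a w) \<subseteq> insert a (set w)"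
  by (cases w) auto

lemma set_foldr_push: "set (foldr push_letter u v) \<subseteq> set u \<union> set v"
  by (induction u) (use set_push in fastforce)+

lemma foldr_push_inv:
  "reduced w \<Longrightarrow> foldr push_letter (rev (map inv_letter u)) (foldr push_letter u w) = w"
  by (induction u) (auto simp: push_inv_push reduced_foldr)

lemma free_group_simps:
  "carrier (free_group n) = {w. reduced w \<and> set w \<subseteq> {..<n} \<times> UNIV}"
  "u \<otimes>\<^bsub>free_group n\<^esub> v = foldr push_letter u v"
  "\<one>\<^bsub>free_group n\<^esub> = []"
  by (simp_all add: free_group_def)

lemma group_free_group: "group (free_group n)"
proof (rule groupI)
  fix x y assume "x \<in> carrier (free_group n)" "y \<in> carrier (free_group n)"
  then show "x \<otimes>\<^bsub>free_group n\<^esub> y \<in> carrier (free_group n)"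
    using set_foldr_push[of x y] by (auto simp: free_group_simps reduced_foldr)
next
  fix x assume x: "x \<in> carrier (free_group n)"
  define y where "y = foldr push_letter (rev (map inv_letter x)) []"
  have "foldr push_letter y x = []"
  proof -
    have "foldr push_letter y x = foldr push_letter (rev (map inv_letter x)) x"
      using x foldr_push_assoc[of "[]" x] by (simp add: y_def free_group_simps)
    also have "\<dots> = []"
      using foldr_push_inv[of "[]" x] x by (simp add: free_group_simps foldr_push_Nil)
    finally show ?thesis .
  qed
  moreover have "y \<in> carrier (free_group n)"
    using x set_foldr_push[of "rev (map inv_letter x)" "[]"]
    by (fastforce simp: y_def free_group_simps reduced_foldr)
  ultimately show "\<exists>y\<in>carrier (free_group n). y \<otimes>\<^bsub>free_group n\<^esub> x = \<one>\<^bsub>free_group n\<^esub>"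
    by (auto simp: free_group_simps)
qed (auto simp: free_group_simps foldr_push_assoc)

lemma gen_closed: "i < n \<Longrightarrow> gen i \<in> carrier (free_group n)"
  by (simp add: gen_def free_group_simps)

lemma inv_gen:
  assumes "i < n" shows "inv\<^bsub>free_group n\<^esub> (gen i) = [(i, False)]"
  by (rule group.inv_equality[OF group_free_group])
    (use assms in \<open>auto simp: gen_def free_group_simps\<close>)

lemma free_group_induct [consumes 1, case_names one gen inv]:
  assumes "w \<in> carrier (free_group n)"
    and "P \<one>\<^bsub>free_group n\<^esub>"
    and "\<And>i w. \<lbrakk>i < n; w \<in> carrier (free_group n); P w\<rbrakk> \<Longrightarrow> P (gen i \<otimes>\<^bsub>free_group n\<^esub> w)"
    and "\<And>i w. \<lbrakk>i < n; w \<in> carrier (free_group n); P w\<rbrakk>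
           \<Longrightarrow> P (inv\<^bsub>free_group n\<^esub> gen i \<otimes>\<^bsub>free_group n\<^esub> w)"
  shows "P w"
  using assms(1)
proof (induction w)
  case Nil
  then show ?case using assms(2) by (simp add: free_group_simps)
next
  case (Cons a w)
  obtain i b where a: "a = (i, b)" by (cases a)
  have w: "w \<in> carrier (free_group n)" and i: "i < n"
    using Cons.prems a by (auto simp: free_group_simps dest: reduced_Cons)
  have "a # w = [a] \<otimes>\<^bsub>free_group n\<^esub> w"
    using Cons.prems by (simp add: free_group_simps push_reduced)
  moreover have "[a] = (if b then gen i else inv\<^bsub>free_group n\<^esub> gen i)"
    using inv_gen[OF i] by (simp add: a gen_def)
  ultimately show ?case
    using assms(3)[OF i w Cons.IH[OF w]] assms(4)[OF i w Cons.IH[OF w]] by (simp split: if_splits)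
qed

lemma free_group_universal:
  assumes "group H" and h: "\<And>i. i < n \<Longrightarrow> h i \<in> carrier H"
  shows "\<exists>!f. f \<in> extensional (carrier (free_group n)) \<and> f \<in> hom (free_group n) H
           \<and> (\<forall>i<n. f (gen i) = h i)"
proof -
  interpret H: group H by fact
  interpret F: group "free_group n" by (rule group_free_group)
  let ?l = "\<lambda>a :: letter. if snd a then h (fst a) else inv\<^bsub>H\<^esub> h (fst a)"
  define e where "e w = foldr (\<lambda>a x. ?l a \<otimes>\<^bsub>H\<^esub> x) w \<one>\<^bsub>H\<^esub>" for w
  have l: "?l a \<in> carrier H" if "fst a < n" for a using that h by auto
  have e_closed: "e w \<in> carrier H" if "set w \<subseteq> {..<n} \<times> UNIV" for w
    using that by (induction w) (auto simp: e_def h)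
  have e_push: "e (push_letter a w) = ?l a \<otimes>\<^bsub>H\<^esub> e w"
    if "fst a < n" "set w \<subseteq> {..<n} \<times> UNIV" for a w
  proof (cases "\<exists>v. w = inv_letter a # v")
    case True
    then obtain v where v: "w = inv_letter a # v" by blast
    have "e v \<in> carrier H" using that v by (intro e_closed) auto
    moreover have "?l a \<otimes>\<^bsub>H\<^esub> (?l (inv_letter a) \<otimes>\<^bsub>H\<^esub> e v) = e v"
      using that(1) h \<open>e v \<in> carrier H\<close> by (cases a) (auto simp flip: H.m_assoc)
    ultimately show ?thesis by (simp add: v e_def)
  next
    case False
    then have "push_letter a w = a # w" by (cases w) auto
    then show ?thesis by (simp add: e_def)
  qed
  have e_foldr: "e (foldr push_letter u v) = e u \<otimes>\<^bsub>H\<^esub> e v"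
    if "set u \<subseteq> {..<n} \<times> UNIV" "set v \<subseteq> {..<n} \<times> UNIV" for u v
    using that(1)
  proof (induction u)
    case Nil
    then show ?case using e_closed[OF that(2)] by (simp add: e_def)
  next
    case (Cons a u)
    have "set (foldr push_letter u v) \<subseteq> {..<n} \<times> UNIV"
      using set_foldr_push[of u v] that(2) Cons.prems by auto
    moreover have "e (a # u) = ?l a \<otimes>\<^bsub>H\<^esub> e u" by (simp add: e_def)
    moreover have "fst a < n" "set u \<subseteq> {..<n} \<times> UNIV" using Cons.prems by auto
    ultimately show ?case
      using Cons.IH l[of a] e_closed[of u] e_closed[OF that(2)] e_push[of a "foldr push_letter u v"]
      by (simp only: foldr.simps comp_apply H.m_assoc)
  qed
  have "e \<in> hom (free_group n) H"
    by (rule homI) (auto simp: free_group_simps e_closed e_foldr)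
  then have r: "restrict e (carrier (free_group n)) \<in> hom (free_group n) H"
    by (auto simp: hom_def)
  have e_gen: "e (gen i) = h i" if "i < n" for i
    using h[OF that] by (simp add: e_def gen_def)
  show ?thesis
  proof (rule ex1I[of _ "restrict e (carrier (free_group n))"])
    fix f
    assume f: "f \<in> extensional (carrier (free_group n)) \<and> f \<in> hom (free_group n) H
           \<and> (\<forall>i<n. f (gen i) = h i)"
    interpret f: group_hom "free_group n" H f by unfold_locales (use f in auto)
    interpret e: group_hom "free_group n" H e by unfold_locales fact
    have "f w = e w" if "w \<in> carrier (free_group n)" for w
      using that by (induction w rule: free_group_induct) (use f in \<open>simp_all add: gen_closed e_gen\<close>)
    then show "f = restrict e (carrier (free_group n))"
      using f by (auto simp: extensional_def restrict_def fun_eq_iff)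
  qed (use r in \<open>simp add: e_gen gen_closed\<close>)
qed


section \<open>Abelianisation\<close>

text \<open>The \<open>i\<close>-th coordinate of \<open>abelianise n w\<close> is the exponent sum of the generator \<open>x\<^sub>i\<close>
  in \<open>w\<close>. By the three lemmas \<open>abelianise_mult\<close>, \<open>abelianise_surj\<close> and \<open>abelianise_kernel\<close>
  below, this map identifies the abelianisation of the free group with the integer vectors of
  length \<open>n\<close>.\<close>

definition abelianise :: "nat \<Rightarrow> letter list \<Rightarrow> int vec" where
  "abelianise n w = vec n (\<lambda>i. int (count_list w (i, True)) - int (count_list w (i, False)))"

lemma dim_abelianise [simp]: "dim_vec (abelianise n w) = n"
  by (simp add: abelianise_def)

lemma abelianise_carrier [simp]: "abelianise n w \<in> carrier_vec n"
  by (rule carrier_vecI) simp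

lemma abelianise_Cons: "abelianise n (a # w) = abelianise n [a] + abelianise n w"
  by (intro eq_vecI) (auto simp: abelianise_def)

lemma abelianise_inv_letter: "abelianise n [a] + abelianise n [inv_letter a] = 0\<^sub>v n"
  by (cases a, intro eq_vecI) (auto simp: abelianise_def)

lemma abelianise_push: "abelianise n (push_letter a w) = abelianise n [a] + abelianise n w"
proof (cases "\<exists>v. w = inv_letter a # v")
  case True
  then obtain v where v: "w = inv_letter a # v" by blast
  have "abelianise n [a] + abelianise n w
      = (abelianise n [a] + abelianise n [inv_letter a]) + abelianise n v"
    unfolding v abelianise_Cons[of n "inv_letter a" v] by (simp add: assoc_add_vec[of _ n])
  then show ?thesis by (simp add: v abelianise_inv_letter)
next
  case False
  then have "push_letter a w = a # w" by (cases w) auto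
  then show ?thesis using abelianise_Cons[of n a w] by (simp only:)
qed

lemma abelianise_mult:
  "abelianise n (u \<otimes>\<^bsub>free_group n\<^esub> v) = abelianise n u + abelianise n v"
proof -
  have "abelianise n (foldr push_letter u v) = abelianise n u + abelianise n v"
  proof (induction u)
    case Nil
    show ?case by (intro eq_vecI) (auto simp: abelianise_def)
  next
    case (Cons a u)
    then show ?case
      unfolding abelianise_Cons[of n a u]
      by (simp add: abelianise_push assoc_add_vec[of _ n])
  qed
  then show ?thesis by (simp add: free_group_simps)
qed

lemma abelianise_one: "abelianise n \<one>\<^bsub>free_group n\<^esub> = 0\<^sub>v n"
  by (auto simp: abelianise_def free_group_simps)

lemma abelianise_gen: "i < n \<Longrightarrow> abelianise n (gen i) = unit_vec n i"
  by (auto simp: abelianise_def gen_def)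

lemma abelianise_inv:
  assumes "w \<in> carrier (free_group n)"
  shows "abelianise n (inv\<^bsub>free_group n\<^esub> w) = - abelianise n w"
proof -
  interpret F: group "free_group n" by (rule group_free_group)
  have "abelianise n (inv\<^bsub>free_group n\<^esub> w) + abelianise n w = 0\<^sub>v n"
    using assms by (simp add: abelianise_one flip: abelianise_mult)
  then show ?thesis
    by (auto simp: vec_eq_iff add_eq_0_iff)
qed

lemma abelianise_surj: "abelianise n ` carrier (free_group n) = carrier_vec n"
proof
  have neq: "a \<noteq> inv_letter a" for a by (cases a) simp
  have red: "reduced (replicate k a)" for k a
    by (induction k) (auto simp: reduced_def successively_Cons neq)
  have "\<exists>w \<in> carrier (free_group n). abelianise n w = vec n (\<lambda>i. if i < k then v $ i else 0)"
    if "k \<le> n" for k and v :: "int vec"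
    using that
  proof (induction k)
    case 0
    have "abelianise n \<one>\<^bsub>free_group n\<^esub> = vec n (\<lambda>i. if i < 0 then v $ i else 0)"
      by (auto simp: abelianise_one)
    with monoid.one_closed[OF group.is_monoid[OF group_free_group]] show ?case by blast
  next
    case (Suc k)
    then obtain w where w: "w \<in> carrier (free_group n)"
      "abelianise n w = vec n (\<lambda>i. if i < k then v $ i else 0)" by auto
    define u where "u = replicate (nat \<bar>v $ k\<bar>) (k, 0 \<le> v $ k)"
    have u: "u \<in> carrier (free_group n)"
      using red Suc.prems by (auto simp: u_def free_group_simps)
    have "count_list (replicate m a) b = (if a = b then m else 0)" for m and a b :: letter
      by (induction m) auto
    then have "abelianise n u = vec n (\<lambda>i. if i = k then v $ k else 0)"
      by (intro eq_vecI) (auto simp: abelianise_def u_def)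
    then have "abelianise n (w \<otimes>\<^bsub>free_group n\<^esub> u) = vec n (\<lambda>i. if i < Suc k then v $ i else 0)"
      using w(2) by (intro eq_vecI) (auto simp: abelianise_mult less_Suc_eq)
    moreover have "w \<otimes>\<^bsub>free_group n\<^esub> u \<in> carrier (free_group n)"
      using w(1) u by (rule monoid.m_closed[OF group.is_monoid[OF group_free_group]])
    ultimately show ?case by blast
  qed
  from this[of n] have "\<exists>w \<in> carrier (free_group n). abelianise n w = v"
    if "v \<in> carrier_vec n" for v :: "int vec"
  proof -
    have "vec n (\<lambda>i. if i < n then v $ i else 0) = v"
      using that by auto
    with \<open>\<And>v. n \<le> n \<Longrightarrow> \<exists>w \<in> carrier (free_group n).
        abelianise n w = vec n (\<lambda>i. if i < n then v $ i else 0)\<close>[of v]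
    show ?thesis by simp
  qed
  then show "carrier_vec n \<subseteq> abelianise n ` carrier (free_group n)"
    by blast
qed auto

lemma abelianise_kernel:
  "{w \<in> carrier (free_group n). abelianise n w = 0\<^sub>v n}
     = derived (free_group n) (carrier (free_group n))"
proof
  let ?F = "free_group n"
  let ?D = "derived ?F (carrier ?F)"
  interpret F: group ?F by (rule group_free_group)
  interpret D: normal ?D ?F by (rule F.derived_self_is_normal)
  interpret Q: comm_group "?F Mod ?D" by (rule F.derived_quot_is_comm_group)
  interpret q: group_hom ?F "?F Mod ?D" "\<lambda>w. ?D #>\<^bsub>?F\<^esub> w"
    by unfold_locales (rule D.r_coset_hom_Mod)
  note [simp del] = one_FactGroup mult_FactGroup
  let ?h = "\<lambda>i. ?D #>\<^bsub>?F\<^esub> gen i"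
  have h: "?h i \<in> carrier (?F Mod ?D)" if "i < n" for i
    using q.hom_closed gen_closed that by blast
  have hp: "(\<lambda>i. ?h i [^]\<^bsub>?F Mod ?D\<^esub> (abelianise n w $ i)) \<in> {..<n} \<rightarrow> carrier (?F Mod ?D)"
    for w using h by auto
  have fin_delta: "finprod (?F Mod ?D) (\<lambda>i. ?h i [^]\<^bsub>?F Mod ?D\<^esub> (z * unit_vec n j $ i)) {..<n}
      = ?h j [^]\<^bsub>?F Mod ?D\<^esub> z" if "j < n" for j and z :: int
  proof -
    have "finprod (?F Mod ?D) (\<lambda>i. ?h i [^]\<^bsub>?F Mod ?D\<^esub> (z * unit_vec n j $ i)) {..<n}
      = finprod (?F Mod ?D) (\<lambda>i. if j = i then ?h i [^]\<^bsub>?F Mod ?D\<^esub> z else \<one>\<^bsub>?F Mod ?D\<^esub>) {..<n}"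
      using h that by (intro Q.finprod_cong') (auto simp: unit_vec_def)
    also have "\<dots> = ?h j [^]\<^bsub>?F Mod ?D\<^esub> z"
      using h that by (intro Q.finprod_singleton) auto
    finally show ?thesis .
  qed
  have split: "finprod (?F Mod ?D) (\<lambda>i. ?h i [^]\<^bsub>?F Mod ?D\<^esub> (abelianise n (u \<otimes>\<^bsub>?F\<^esub> w) $ i)) {..<n}
     = finprod (?F Mod ?D) (\<lambda>i. ?h i [^]\<^bsub>?F Mod ?D\<^esub> (abelianise n u $ i)) {..<n}
       \<otimes>\<^bsub>?F Mod ?D\<^esub> finprod (?F Mod ?D) (\<lambda>i. ?h i [^]\<^bsub>?F Mod ?D\<^esub> (abelianise n w $ i)) {..<n}"
    for u w
    using h by (subst Q.finprod_multf[OF hp hp, symmetric])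
      (intro Q.finprod_cong', auto simp: abelianise_mult Q.int_pow_mult)
  have key: "?D #>\<^bsub>?F\<^esub> w
      = finprod (?F Mod ?D) (\<lambda>i. ?h i [^]\<^bsub>?F Mod ?D\<^esub> (abelianise n w $ i)) {..<n}"
    if "w \<in> carrier ?F" for w
    using that
  proof (induction w rule: free_group_induct)
    case one
    have "finprod (?F Mod ?D) (\<lambda>i. ?h i [^]\<^bsub>?F Mod ?D\<^esub> (abelianise n \<one>\<^bsub>?F\<^esub> $ i)) {..<n}
      = finprod (?F Mod ?D) (\<lambda>i. \<one>\<^bsub>?F Mod ?D\<^esub>) {..<n}"
      by (intro Q.finprod_cong') (auto simp: abelianise_one)
    then show ?case using q.hom_one by simp
  next
    case (gen i w)
    have "finprod (?F Mod ?D) (\<lambda>k. ?h k [^]\<^bsub>?F Mod ?D\<^esub> (abelianise n (gen i) $ k)) {..<n} = ?h i"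
      using fin_delta[OF gen(1), of 1] h[OF gen(1)] by (simp add: abelianise_gen gen(1))
    then show ?case
      using gen by (simp only: split q.hom_mult[OF gen_closed])
  next
    case (inv i w)
    have "finprod (?F Mod ?D) (\<lambda>k. ?h k [^]\<^bsub>?F Mod ?D\<^esub> (abelianise n (inv\<^bsub>?F\<^esub> gen i) $ k)) {..<n}
      = finprod (?F Mod ?D) (\<lambda>k. ?h k [^]\<^bsub>?F Mod ?D\<^esub> (- 1 * unit_vec n i $ k :: int)) {..<n}"
    proof (rule Q.finprod_cong')
      fix k assume "k \<in> {..<n}"
      then have "abelianise n (inv\<^bsub>?F\<^esub> gen i) $ k = - 1 * (unit_vec n i $ k :: int)"
        using inv(1) by (simp add: abelianise_inv abelianise_gen gen_closed)
      then show "?h k [^]\<^bsub>?F Mod ?D\<^esub> (abelianise n (inv\<^bsub>?F\<^esub> gen i) $ k)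
          = ?h k [^]\<^bsub>?F Mod ?D\<^esub> (- 1 * unit_vec n i $ k :: int)" by (simp only:)
    qed (use h Q.int_pow_closed in blast)+
    also have "\<dots> = ?h i [^]\<^bsub>?F Mod ?D\<^esub> (- 1 :: int)"
      by (rule fin_delta[OF inv(1)])
    also have "\<dots> = ?D #>\<^bsub>?F\<^esub> (inv\<^bsub>?F\<^esub> gen i)"
      using q.hom_inv[OF gen_closed[OF inv(1)]] h[OF inv(1)]
      by (simp only: Q.int_pow_neg Q.int_pow_1)
    finally show ?case
      using inv by (simp only: split q.hom_mult[OF F.inv_closed[OF gen_closed]])
  qed
  show "{w \<in> carrier ?F. abelianise n w = 0\<^sub>v n} \<subseteq> ?D"
  proof safe
    fix w assume w: "w \<in> carrier ?F" "abelianise n w = 0\<^sub>v n"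
    have "finprod (?F Mod ?D) (\<lambda>i. ?h i [^]\<^bsub>?F Mod ?D\<^esub> (abelianise n w $ i)) {..<n}
        = finprod (?F Mod ?D) (\<lambda>i. \<one>\<^bsub>?F Mod ?D\<^esub>) {..<n}"
      by (intro Q.finprod_cong') (auto simp: w)
    also have "\<dots> = \<one>\<^bsub>?F Mod ?D\<^esub>" by simp
    finally have "?D #>\<^bsub>?F\<^esub> w = ?D" using key[OF w(1)] by (simp only: one_FactGroup)
    then show "w \<in> ?D"
      using F.rcos_self[OF w(1) D.subgroup_axioms] by simp
  qed
  have "subgroup {w \<in> carrier ?F. abelianise n w = 0\<^sub>v n} ?F"
  proof (rule F.subgroupI)
    show "{w \<in> carrier ?F. abelianise n w = 0\<^sub>v n} \<noteq> {}"
      using abelianise_one[of n] F.one_closed by blast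
  qed (auto simp: abelianise_mult abelianise_inv)
  moreover have "derived_set ?F (carrier ?F) \<subseteq> {w \<in> carrier ?F. abelianise n w = 0\<^sub>v n}"
    by (auto simp: abelianise_mult abelianise_inv intro!: eq_vecI)
  ultimately show "?D \<subseteq> {w \<in> carrier ?F. abelianise n w = 0\<^sub>v n}"
    unfolding derived_def by (intro F.generate_subgroup_incl)
qed


section \<open>The natural projection\<close>

definition GLZ :: "nat \<Rightarrow> int mat monoid" where
  "GLZ n = units_of (ring_mat TYPE(int) n ())"

text \<open>The matrix of the action on the abelianisation; existence and uniqueness, and independence
  of the representative automorphism, are established in \<open>natural_proj_coset\<close>.\<close>

definition natural_proj :: "nat \<Rightarrow> (letter list \<Rightarrow> letter list) set \<Rightarrow> int mat" where
  "natural_proj n \<Phi> = (THE A. A \<in> carrier_mat n n \<and>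
     (\<forall>f\<in>\<Phi>. \<forall>w\<in>carrier (free_group n). abelianise n (f w) = A *\<^sub>v abelianise n w))"

definition action_mat :: "nat \<Rightarrow> (letter list \<Rightarrow> letter list) \<Rightarrow> int mat" where
  "action_mat n f = mat n n (\<lambda>(i, j). abelianise n (f (gen j)) $ i)"

lemma action_mat_carrier [simp]: "action_mat n f \<in> carrier_mat n n"
  by (simp add: action_mat_def)

lemma action_mat_mult_vec:
  assumes f: "f \<in> hom (free_group n) (free_group n)" and w: "w \<in> carrier (free_group n)"
  shows "abelianise n (f w) = action_mat n f *\<^sub>v abelianise n w"
proof -
  interpret F: group "free_group n" by (rule group_free_group)
  interpret f: group_hom "free_group n" "free_group n" f by unfold_locales fact
  have g: "action_mat n f *\<^sub>v unit_vec n i = abelianise n (f (gen i))" if "i < n" for i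
    using that by (intro eq_vecI) (auto simp: action_mat_def)
  have neg: "action_mat n f *\<^sub>v (- unit_vec n i) = - (action_mat n f *\<^sub>v unit_vec n i)" for i
    by (intro eq_vecI) (auto simp: action_mat_def)
  show ?thesis
    using w
  proof (induction w rule: free_group_induct)
    case one
    show ?case by (auto simp: abelianise_one action_mat_def)
  next
    case (gen i w)
    then show ?case
      by (simp add: gen_closed abelianise_mult abelianise_gen g
          mult_add_distrib_mat_vec[of _ n n])
  next
    case (inv i w)
    then show ?case
      by (simp add: gen_closed abelianise_mult abelianise_gen abelianise_inv g neg
          mult_add_distrib_mat_vec[of _ n n])
  qed
qed

lemma natural_proj_coset:
  assumes f: "f \<in> auto (free_group n)"
  shows "natural_proj n (Inn (free_group n) #>\<^bsub>AutoGroup (free_group n)\<^esub> f) = action_mat n f"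
proof -
  let ?F = "free_group n"
  interpret F: group ?F by (rule group_free_group)
  have fh: "f \<in> hom ?F ?F" using f by (simp add: auto_def)
  have same: "abelianise n (h w) = abelianise n (f w)"
    if "h \<in> Inn ?F #>\<^bsub>AutoGroup ?F\<^esub> f" "w \<in> carrier ?F" for h w
  proof -
    from that obtain g where g: "g \<in> carrier ?F"
      and h: "h = (\<lambda>x \<in> carrier ?F. g \<otimes>\<^bsub>?F\<^esub> x \<otimes>\<^bsub>?F\<^esub> inv\<^bsub>?F\<^esub> g) \<otimes>\<^bsub>AutoGroup ?F\<^esub> f"
      by (auto simp: r_coset_def Inn_def)
    have "h w = g \<otimes>\<^bsub>?F\<^esub> f w \<otimes>\<^bsub>?F\<^esub> inv\<^bsub>?F\<^esub> g"
      unfolding h mult_AutoGroup[OF F.conj_in_auto[OF g] f]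
      using that(2) auto_closed[OF f that(2)] by (simp add: compose_def)
    then show ?thesis
      using g by (auto simp: abelianise_mult abelianise_inv intro!: eq_vecI)
  qed
  have self: "f \<in> Inn ?F #>\<^bsub>AutoGroup ?F\<^esub> f"
    using group.rcos_self[OF F.AutoGroup] F.Inn_normal f
    by (simp add: carrier_AutoGroup normal_imp_subgroup)
  show ?thesis
    unfolding natural_proj_def
  proof (rule the_equality)
    fix A assume A: "A \<in> carrier_mat n n \<and>
     (\<forall>h\<in>Inn ?F #>\<^bsub>AutoGroup ?F\<^esub> f. \<forall>w\<in>carrier ?F. abelianise n (h w) = A *\<^sub>v abelianise n w)"
    have "A *\<^sub>v unit_vec n j = action_mat n f *\<^sub>v unit_vec n j" if "j < n" for j
      using A self gen_closed[OF that] action_mat_mult_vec[OF fh gen_closed[OF that]] that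
      by (auto simp: abelianise_gen)
    moreover have entry: "(B *\<^sub>v unit_vec n j) $ i = B $$ (i, j)"
      if "B \<in> carrier_mat n n" "i < n" "j < n" for B :: "int mat" and i j
      using that by simp
    ultimately have "A $$ (i, j) = action_mat n f $$ (i, j)" if "i < n" "j < n" for i j
      using A that entry[of A i j] entry[of "action_mat n f" i j] by (simp only: action_mat_carrier)
    then show "A = action_mat n f"
      using A by (intro eq_matI) (auto simp: action_mat_def)
  qed (use same action_mat_mult_vec[OF fh] in auto)
qed

lemma action_mat_compose:
  assumes f: "f \<in> auto (free_group n)" and g: "g \<in> auto (free_group n)"
  shows "action_mat n (f \<otimes>\<^bsub>AutoGroup (free_group n)\<^esub> g) = action_mat n f * action_mat n g"
proof (rule mat_col_eqI)
  fix j assume "j < dim_col (action_mat n f * action_mat n g)"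
  then have j: "j < n" by (simp add: action_mat_def)
  have fh: "f \<in> hom (free_group n) (free_group n)" using f by (simp add: auto_def)
  have "col (action_mat n (f \<otimes>\<^bsub>AutoGroup (free_group n)\<^esub> g)) j = abelianise n (f (g (gen j)))"
    using j f g by (auto simp: action_mat_def mult_AutoGroup compose_def gen_closed intro!: eq_vecI)
  also have "\<dots> = action_mat n f *\<^sub>v abelianise n (g (gen j))"
    by (rule action_mat_mult_vec[OF fh auto_closed[OF g gen_closed[OF j]]])
  also have "abelianise n (g (gen j)) = col (action_mat n g) j"
    using j by (auto simp: action_mat_def intro!: eq_vecI)
  finally show "col (action_mat n (f \<otimes>\<^bsub>AutoGroup (free_group n)\<^esub> g)) j
      = col (action_mat n f * action_mat n g) j"
    using j by (simp add: col_mult2[of _ n n _ n])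
qed (auto simp: action_mat_def)

lemma natural_proj_hom: "natural_proj n \<in> hom (Out (free_group n)) (GLZ n)"
proof -
  let ?F = "free_group n" and ?A = "AutoGroup (free_group n)"
  interpret F: group ?F by (rule group_free_group)
  interpret A: group ?A by (rule F.AutoGroup)
  interpret I: normal "Inn ?F" ?A by (rule F.Inn_normal)
  have one: "action_mat n \<one>\<^bsub>?A\<^esub> = 1\<^sub>m n"
    by (auto simp: action_mat_def one_AutoGroup gen_closed abelianise_gen intro!: eq_matI)
  have unit: "action_mat n f \<in> carrier (GLZ n)" if f: "f \<in> auto ?F" for f
  proof -
    have "inv\<^bsub>?A\<^esub> f \<in> auto ?F"
      using A.inv_closed f by (simp add: carrier_AutoGroup)
    then show ?thesis
      using f one action_mat_compose[of f n "inv\<^bsub>?A\<^esub> f"] action_mat_compose[of "inv\<^bsub>?A\<^esub> f" n f]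
        A.r_inv[of f] A.l_inv[of f]
      by (auto simp: GLZ_def units_of_carrier Units_def ring_mat_simps carrier_AutoGroup
          intro!: bexI[of _ "action_mat n (inv\<^bsub>?A\<^esub> f)"])
  qed
  show ?thesis
    unfolding Out_def
  proof (rule homI)
    fix S assume "S \<in> carrier (?A Mod Inn ?F)"
    then show "natural_proj n S \<in> carrier (GLZ n)"
      by (auto simp: carrier_FactGroup carrier_AutoGroup natural_proj_coset unit)
  next
    fix S T assume "S \<in> carrier (?A Mod Inn ?F)" "T \<in> carrier (?A Mod Inn ?F)"
    then obtain f g where fg: "f \<in> auto ?F" "g \<in> auto ?F"
      "S = Inn ?F #>\<^bsub>?A\<^esub> f" "T = Inn ?F #>\<^bsub>?A\<^esub> g"
      by (auto simp: carrier_FactGroup carrier_AutoGroup)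
    then have "f \<otimes>\<^bsub>?A\<^esub> g \<in> auto ?F"
      using A.m_closed[of f g] by (simp add: carrier_AutoGroup)
    then show "natural_proj n (S \<otimes>\<^bsub>?A Mod Inn ?F\<^esub> T)
        = natural_proj n S \<otimes>\<^bsub>GLZ n\<^esub> natural_proj n T"
      using fg by (simp add: I.rcos_sum carrier_AutoGroup natural_proj_coset action_mat_compose
          GLZ_def units_of_mult ring_mat_simps)
  qed
qed


section \<open>The general linear group of a vector space\<close>

definition GL :: "('k::field \<Rightarrow> 'v::ab_group_add \<Rightarrow> 'v) \<Rightarrow> ('v \<Rightarrow> 'v) monoid" where
  "GL scale = \<lparr>carrier = {f. Vector_Spaces.linear scale scale f \<and> bij f}, monoid.mult = (\<circ>), one = id\<rparr>"

lemma group_GL: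
  assumes "vector_space scale"
  shows "group (GL scale)"
proof -
  interpret vector_space scale by fact
  interpret vector_space_pair scale scale by unfold_locales
  show ?thesis
  proof (rule groupI)
    fix f assume "f \<in> carrier (GL scale)"
    then have f: "Vector_Spaces.linear scale scale f" "bij f" by (auto simp: GL_def)
    then obtain g where g: "Vector_Spaces.linear scale scale g" "g \<circ> f = id"
      using linear_injective_left_inverse[of f] by (auto simp: bij_def)
    then have "g = inv_into UNIV f"
      using f(2) by (metis bij_is_surj fun.map_comp o_id surj_iff comp_id id_comp comp_assoc)
    then have "bij g" using f(2) bij_imp_bij_inv by auto
    then show "\<exists>g\<in>carrier (GL scale). g \<otimes>\<^bsub>GL scale\<^esub> f = \<one>\<^bsub>GL scale\<^esub>"
      using g by (auto simp: GL_def)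
  qed (auto simp: GL_def bij_comp comp_assoc linear_id module_hom_iff_linear
         intro: Vector_Spaces.linear_compose)
qed

end

(*
  Let e_i be the involution inverting x_i. The commuting operators phi(e_i) split V into weight
  spaces indexed by subsets of {0..<n}, and all subsets of a given size occur together. Since V is
  small, two consecutive sizes can only occur as 0, 1 or, after twisting by the determinant, as
  n, n - 1. If no consecutive sizes occur then the two Nielsen moves x_i -> x_i x_j and
  x_i -> x_j x_i, which are conjugate under e_i e_j, have equal images. In the remaining case V has
  only the weights of sizes 0 and 1 besides weights that do not interact with them; dimension counts
  and the fact that the product over i of all right moves by x_j and that of all left moves differ by
  an inner automorphism again force the images to be equal.

  So the images of the Nielsen moves satisfy the relations of the elementary matrices. A peak
  reduction on the image of the last basis vector, followed by induction on the rank, shows that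
  these relations and those of the signed permutation matrices present GL_n(Z). Together with
  Nielsen's theorem, which provides the generators of Aut(F_n), every automorphism acting trivially
  on the abelianisation acts trivially on V. Finally Aut(F_n) maps onto GL_n(Z) by Euclidean descent.
*)

theory Submission
  imports Defs
begin

section \<open>Representations of small dimension\<close>

text \<open>The characteristic enters by making 2 and n - 1 invertible: 2 splits V into weight
  spaces, and n - 1 is the number of equal summands in the identities drawn from
  \<open>outer\<close>. The dimension bound is n + (n choose 2). It is met three times: two
  consecutive middle levels give (n choose k) + (n choose k + 1) = (n + 1 choose k + 1) weights,
  levels 1 and 3 together give at least n + (n choose 2) weights, and a nonzero vector of type
  \<open>Zty\<close> yields n + (n choose 2) independent vectors. In the remaining case each
  \<open>U j\<close> splits into a part modelled on the standard representation (\<open>Fty\<close>)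
  and one modelled on its dual (\<open>Xty\<close>); \<open>B\<close> and \<open>C\<close> measure
  how the moves mix these parts with \<open>U0\<close>, and killing them is the core of the linear
  algebra. No generators of the kernel of Aut(F_n) \<rightarrow> GL_n(Z) are used. Instead, the
  pairs (\<open>rho f\<close>, \<open>action_mat n f\<close>) lie in the product of GL(V) and
  GL_n(Z) and satisfy the elementary relations there. By \<open>Gen_faithful\<close>, a product of
  such pairs with trivial matrix is trivial, so \<open>rho f\<close> depends on the matrix of f
  alone.\<close>

lemma (in finite_dimensional_vector_space) card_le_dim_separated:
  assumes S: "finite S"
    and lin: "\<And>x. x \<in> S \<Longrightarrow> Vector_Spaces.linear scale scale (T x)"
    and ne: "\<And>x. x \<in> S \<Longrightarrow> T x (u x) \<noteq> 0"
    and eq: "\<And>x y. x \<in> S \<Longrightarrow> y \<in> S \<Longrightarrow> x \<noteq> y \<Longrightarrow> T x (u y) = 0"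
  shows "card S \<le> dim UNIV"
proof -
  have inj: "inj_on u S"
    using ne eq by (metis inj_onI)
  have "independent (u ` S)"
  proof (rule independent_if_scalars_zero)
    fix c v assume s: "(\<Sum>x\<in>u ` S. scale (c x) x) = 0" and "v \<in> u ` S"
    then obtain x where x: "x \<in> S" "v = u x" by auto
    interpret T: Vector_Spaces.linear scale scale "T x" using lin[OF x(1)] .
    \<comment> \<open>The operators act like a dual basis: \<open>T x\<close> annihilates every term
      of the relation except the one at \<open>u x\<close>.\<close>
    have "0 = T x (\<Sum>y\<in>S. scale (c (u y)) (u y))"
      using s by (simp add: sum.reindex[OF inj] T.zero)
    also have "\<dots> = (\<Sum>y\<in>S. if y = x then scale (c (u x)) (T x (u x)) else 0)"
      unfolding T.sum by (rule sum.cong) (use eq x in \<open>auto simp: T.scale\<close>)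
    also have "\<dots> = scale (c v) (T x (u x))" using S x by simp
    finally show "c v = 0" using ne[OF x(1)] by simp
  qed (use S in auto)
  then have "card (u ` S) \<le> dim UNIV"
    by (metis dim_eq_card_independent dim_subset subset_UNIV)
  then show ?thesis by (simp add: card_image[OF inj])
qed

text \<open>The operators \<open>R i j\<close>, \<open>L i j\<close>, \<open>e i\<close> and \<open>P i j\<close> are the images of the automorphisms
  \<open>x\<^sub>i \<mapsto> x\<^sub>i x\<^sub>j\<close>, \<open>x\<^sub>i \<mapsto> x\<^sub>j x\<^sub>i\<close>, inversion of \<open>x\<^sub>i\<close> and exchange of \<open>x\<^sub>i\<close> and \<open>x\<^sub>j\<close>. The last assumption is the
  only one that fails in the automorphism group: the two products differ by the inner automorphism
  of \<open>x\<^sub>j\<close>.\<close>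

locale signed_rep = finite_dimensional_vector_space scale Basis
  for scale :: "'k::field \<Rightarrow> 'v::ab_group_add \<Rightarrow> 'v" and Basis +
  fixes n :: nat and R L P :: "nat \<Rightarrow> nat \<Rightarrow> 'v \<Rightarrow> 'v" and e :: "nat \<Rightarrow> 'v \<Rightarrow> 'v"
  assumes n6: "6 \<le> n"
    and two: "(2::'k) \<noteq> 0" and nm1: "of_nat (n - 1) \<noteq> (0::'k)"
    and dim_lt: "dim UNIV < (n + 1) choose 2"
    and linear_R: "Vector_Spaces.linear scale scale (R i j)"
    and linear_P: "Vector_Spaces.linear scale scale (P i j)"
    and linear_e: "Vector_Spaces.linear scale scale (e i)"
    and L_eq: "\<lbrakk>i < n; j < n; i \<noteq> j\<rbrakk> \<Longrightarrow> L i j v = e i (e j (R i j (e i (e j v))))"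
    and ee: "e i (e i v) = v"
    and e_comm: "e i (e j v) = e j (e i v)"
    and eR: "\<lbrakk>i < n; j < n; i \<noteq> j; k \<noteq> i; k \<noteq> j\<rbrakk> \<Longrightarrow> e k (R i j v) = R i j (e k v)"
    and ReR: "\<lbrakk>i < n; j < n; i \<noteq> j\<rbrakk> \<Longrightarrow> R i j (e j (R i j v)) = e j v"
    and R_comm: "\<lbrakk>i < n; j < n; k < n; l < n; i \<noteq> j; k \<noteq> l; i \<noteq> k; i \<noteq> l; j \<noteq> k\<rbrakk>
       \<Longrightarrow> R i j (R k l v) = R k l (R i j v)"
    and RL_comm: "\<lbrakk>i < n; j < n; k < n; i \<noteq> j; i \<noteq> k\<rbrakk> \<Longrightarrow> R i j (L i k v) = L i k (R i j v)"
    and steinberg: "\<lbrakk>i < n; j < n; k < n; i \<noteq> j; i \<noteq> k; j \<noteq> k\<rbrakk>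
       \<Longrightarrow> R j k (R i j v) = R i j (R j k (R i k v))"
    and PP: "P i j (P i j v) = v"
    and P_sym: "P i j v = P j i v"
    and PR: "\<lbrakk>a < n; b < n; i < n; j < n; i \<noteq> j\<rbrakk>
       \<Longrightarrow> P a b (R i j v) = R (transpose a b i) (transpose a b j) (P a b v)"
    and Pe: "\<lbrakk>a < n; b < n; i < n\<rbrakk> \<Longrightarrow> P a b (e i v) = e (transpose a b i) (P a b v)"
    and PPc: "\<lbrakk>a < n; b < n; c < n; d < n\<rbrakk>
       \<Longrightarrow> P a b (P c d v) = P (transpose a b c) (transpose a b d) (P a b v)"
    and weyl: "\<lbrakk>a < n; b < n; a \<noteq> b\<rbrakk>
       \<Longrightarrow> R a b (e a (R b a (e a (L a b v)))) = P a b (e b v)"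
    and outer: "\<lbrakk>i < n; j < n; i \<noteq> j\<rbrakk>
       \<Longrightarrow> R i j (foldr (\<lambda>k. R k j) (filter (\<lambda>k. k \<noteq> i \<and> k \<noteq> j) [0..<n]) v)
         = L i j (foldr (\<lambda>k. L k j) (filter (\<lambda>k. k \<noteq> i \<and> k \<noteq> j) [0..<n]) v)"
begin

lemma linear_simps:
  assumes "Vector_Spaces.linear scale scale f"
  shows "f (x + y) = f x + f y" "f (x - y) = f x - f y" "f (- x) = - f x" "f 0 = 0"
    "f (scale c x) = scale c (f x)"
proof -
  interpret f: Vector_Spaces.linear scale scale f by fact
  show "f (x + y) = f x + f y" "f (x - y) = f x - f y" "f (- x) = - f x" "f 0 = 0"
    "f (scale c x) = scale c (f x)"
    by (rule f.add f.diff f.neg f.zero f.scale)+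
qed

lemmas R_lin [simp] = linear_simps[OF linear_R]
lemmas P_lin [simp] = linear_simps[OF linear_P]
lemmas e_lin [simp] = linear_simps[OF linear_e]

lemma L_lin [simp]:
  assumes "i < n" "j < n" "i \<noteq> j"
  shows "L i j (x + y) = L i j x + L i j y" "L i j (x - y) = L i j x - L i j y"
    "L i j (- x) = - L i j x" "L i j 0 = 0"
  by (simp_all add: L_eq assms)

lemma double_eq_0: "x = 0" if "x + x = 0" for x :: 'v
proof -
  note that
  then have "scale 2 x = 0" using scale_left_distrib[of 1 1 x] by simp
  then show ?thesis using two by simp
qed

lemma eq_uminus_self: "x = - x \<longleftrightarrow> x = 0" "- x = x \<longleftrightarrow> x = 0" for x :: 'v
proof -
  have "x = 0" if "x = - x" using that double_eq_0[of x] add.right_inverse[of x] by simp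
  then show "x = - x \<longleftrightarrow> x = 0" "- x = x \<longleftrightarrow> x = 0" by fastforce+
qed

definition half :: "'v \<Rightarrow> 'v" where "half x = scale (1/2) x"

lemma half_add: "half x + half x = x"
proof -
  have "(1/2 :: 'k) + 1/2 = 1" using two by (simp add: divide_simps)
  then show ?thesis unfolding half_def using scale_left_distrib[of "1/2" "1/2" x] by simp
qed

lemma linear_comp: "Vector_Spaces.linear scale scale f \<Longrightarrow> Vector_Spaces.linear scale scale g
   \<Longrightarrow> Vector_Spaces.linear scale scale (\<lambda>x. f (g x))"
  using Vector_Spaces.linear_compose[of scale scale g scale f] by (simp add: comp_def)

lemma linear_sub_add:
  assumes "Vector_Spaces.linear scale scale f" "Vector_Spaces.linear scale scale g"
  shows "Vector_Spaces.linear scale scale (\<lambda>x. f x - g x)"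
    "Vector_Spaces.linear scale scale (\<lambda>x. f x + g x)"
proof -
  interpret vector_space_pair scale scale by unfold_locales
  show "Vector_Spaces.linear scale scale (\<lambda>x. f x - g x)"
    "Vector_Spaces.linear scale scale (\<lambda>x. f x + g x)"
    using assms by (simp_all add: linear_compose_sub linear_compose_add)
qed

lemma double_neq_0: "x + x \<noteq> 0" if "x \<noteq> 0" for x :: 'v
  using double_eq_0[of x] that by blast

text \<open>The weight spaces of the commuting involutions \<open>e i\<close>, indexed by the set where \<open>e i\<close> is \<open>-1\<close>;
  \<open>U0\<close> and \<open>U k\<close> are those of the empty set and of \<open>{k}\<close>.\<close>

definition wt :: "nat set \<Rightarrow> 'v \<Rightarrow> bool" where
  "wt I v \<longleftrightarrow> (\<forall>i<n. e i v = (if i \<in> I then - v else v))"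

definition U0 :: "'v \<Rightarrow> bool" where "U0 v \<longleftrightarrow> (\<forall>i<n. e i v = v)"
definition U :: "nat \<Rightarrow> 'v \<Rightarrow> bool" where
  "U k v \<longleftrightarrow> k < n \<and> e k v = - v \<and> (\<forall>i<n. i \<noteq> k \<longrightarrow> e i v = v)"

lemma U0_e [simp]: "U0 v \<Longrightarrow> i < n \<Longrightarrow> e i v = v" by (simp add: U0_def)
lemma U_e [simp]: "U k v \<Longrightarrow> e k v = - v" "U k v \<Longrightarrow> i < n \<Longrightarrow> i \<noteq> k \<Longrightarrow> e i v = v"
  by (simp_all add: U_def)
lemma U_less: "U k v \<Longrightarrow> k < n" unfolding U_def by blast

lemma U0_closed [simp]: "U0 0" "U0 x \<Longrightarrow> U0 y \<Longrightarrow> U0 (x + y)"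
  by (auto simp: U0_def simp del: U0_e)
lemma U_closed [simp]: "k < n \<Longrightarrow> U k 0" "U k x \<Longrightarrow> U k y \<Longrightarrow> U k (x + y)"
  "U k x \<Longrightarrow> U k y \<Longrightarrow> U k (x - y)" "U k x \<Longrightarrow> U k (- x)" "U k x \<Longrightarrow> U k (half x)"
  by (auto simp: U_def half_def simp del: U_e)

lemma U_P:
  assumes "U k v" "a < n" "b < n" shows "U (transpose a b k) (P a b v)"
proof -
  have tr: "transpose a b i < n" if "i < n" for i using that assms by (auto simp: transpose_def)
  have e: "e (transpose a b i) (P a b v) = P a b (e i v)" if "i < n" for i
    using Pe[of a b i v] that assms by simp
  show ?thesis unfolding U_def
  proof (intro conjI allI impI)
    show "transpose a b k < n" using tr U_less[OF assms(1)] .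
    show "e (transpose a b k) (P a b v) = - P a b v"
      using e[of k] U_less[OF assms(1)] assms(1) by simp
    fix i assume i: "i < n" "i \<noteq> transpose a b k"
    then have "transpose a b i \<noteq> k" by auto
    then show "e i (P a b v) = P a b v"
      using e[of "transpose a b i"] tr[OF i(1)] assms(1) by simp
  qed
qed

text \<open>The right side is the number of independent vectors produced in
  \<open>trivial_on_U\<close>.\<close>

lemma binom2_less: "(n + 1) choose 2 \<le> n * (n - 2)"
proof -
  have "(n + 1) choose 2 = n * (n + 1) div 2" by (simp add: choose_two)
  also have "\<dots> \<le> n * (n - 2)"
  proof -
    have "n + 1 \<le> 2 * (n - 2)" using n6 by simp
    then have "n * (n + 1) \<le> n * (2 * (n - 2))" by (rule mult_le_mono2)
    also have "\<dots> = 2 * (n * (n - 2))" by simp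
    finally show ?thesis by (metis div_le_mono nonzero_mult_div_cancel_left zero_neq_numeral)
  qed
  finally show ?thesis .
qed

text \<open>Three successive transpositions carry any triple of distinct indices to any other one,
  each fixing the entries already in place.\<close>

lemma transport3:
  assumes inv: "\<And>a b x y z. \<lbrakk>a < n; b < n; x < n; y < n; z < n; x \<noteq> y; x \<noteq> z; y \<noteq> z; Q x y z\<rbrakk>
      \<Longrightarrow> Q (transpose a b x) (transpose a b y) (transpose a b z)"
    and Q: "Q x y z" and d: "x < n" "y < n" "z < n" "x \<noteq> y" "x \<noteq> z" "y \<noteq> z"
    and d': "x' < n" "y' < n" "z' < n" "x' \<noteq> y'" "x' \<noteq> z'" "y' \<noteq> z'"
  shows "Q x' y' z'"
proof -
  have tr: "transpose a b i < n" if "i < n" "a < n" "b < n" for a b i :: nat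
    using that by (auto simp: transpose_def)
  have ne: "transpose a b i \<noteq> transpose a b j" if "i \<noteq> j" for a b i j :: nat
    using that by (metis transpose_involutory)
  define y1 where "y1 = transpose x x' y"
  define z1 where "z1 = transpose x x' z"
  have Q1: "Q x' y1 z1"
    using inv[of x x' x y z] d d' Q unfolding y1_def z1_def by simp
  have 1: "y1 < n" "z1 < n" "x' \<noteq> y1" "x' \<noteq> z1" "y1 \<noteq> z1"
    unfolding y1_def z1_def using d d' tr ne by (metis transpose_apply_first)+
  define z2 where "z2 = transpose y1 y' z1"
  have fix1: "transpose y1 y' x' = x'" using 1 d' by (simp add: transpose_apply_other)
  have Q2: "Q x' y' z2"
    using inv[of y1 y' x' y1 z1] 1 d' Q1 fix1 unfolding z2_def by simp
  have 2: "z2 < n" "x' \<noteq> z2" "y' \<noteq> z2"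
    unfolding z2_def using 1 d' tr ne fix1 by (metis transpose_apply_first)+
  have "transpose z2 z' x' = x'" "transpose z2 z' y' = y'"
    using 2 d' by (simp_all add: transpose_apply_other)
  then show ?thesis using inv[of z2 z' x' y' z2] 2 d' Q2 by simp
qed

end

section \<open>Small weights: moves that avoid the index of the weight\<close>

locale low_rep = signed_rep scale Basis n R L P e
  for scale :: "'k::field \<Rightarrow> 'v::ab_group_add \<Rightarrow> 'v" and Basis n R L P e +
  assumes no23: "\<lbrakk>I \<subseteq> {..<n}; card I = 2 \<or> card I = 3; wt I v\<rbrakk> \<Longrightarrow> v = 0"
begin

text \<open>Only the sign at \<open>q\<close> is undetermined, so the components of \<open>y\<close>
  have weights of sizes 2 and 3. These sizes are what \<open>no23\<close> has to exclude:
  \<open>R i j\<close> commutes with the other involutions and hence takes the weight {k} only to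
  {k} enlarged by indices among i and j.\<close>

lemma weight_pair_zero:
  assumes "e p y = - y" "e k y = - y" "\<And>l. l < n \<Longrightarrow> l \<noteq> p \<Longrightarrow> l \<noteq> q \<Longrightarrow> l \<noteq> k \<Longrightarrow> e l y = y"
    and "p < n" "q < n" "k < n" "p \<noteq> q" "p \<noteq> k" "q \<noteq> k"
  shows "y = 0"
proof -
  define z where "z = y - e q y"
  have "e q z = - z" unfolding z_def by (simp add: ee)
  moreover have "e l z = z" if "l < n" "l \<noteq> p" "l \<noteq> q" "l \<noteq> k" for l
    unfolding z_def using that assms(3)[of l] e_comm[of l q y] by simp
  moreover have "e p z = - z" "e k z = - z"
    unfolding z_def using assms(1,2) e_comm[of p q y] e_comm[of k q y] by simp_all
  ultimately have "wt {k, p, q} z" unfolding wt_def by auto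
  moreover have "{k, p, q} \<subseteq> {..<n}" "card {k, p, q} = 3" "{k, p} \<subseteq> {..<n}" "card {k, p} = 2"
    using assms by auto
  ultimately have "z = 0" using no23 by blast
  then have "e q y = y" unfolding z_def by simp
  then have "wt {k, p} y" unfolding wt_def using assms(1-3) by auto
  then show ?thesis using no23[of "{k, p}"] \<open>{k, p} \<subseteq> {..<n}\<close> \<open>card {k, p} = 2\<close> by blast
qed

lemma R_U:
  assumes w: "U k w" and ij: "i < n" "j < n" "i \<noteq> j" "k \<noteq> i" "k \<noteq> j"
  shows "U k (R i j w)"
proof -
  define x where "x = R i j w"
  have k: "k < n" using w U_less by blast
  have ek: "e k x = - x" unfolding x_def using eR[of i j k w] w ij k by simp
  have el: "e l x = x" if "l < n" "l \<noteq> i" "l \<noteq> j" "l \<noteq> k" for l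
    unfolding x_def using eR[of i j l w] w ij k that by simp
  have *: "e p x = x" if pq: "{p, q} = {i, j}" "p < n" "q < n" "p \<noteq> q" "k \<noteq> p" "k \<noteq> q" for p q
  proof -
    define y where "y = x - e p x"
    have "y = 0"
    proof (rule weight_pair_zero)
      show "e p y = - y" unfolding y_def by (simp add: ee)
      show "e k y = - y" unfolding y_def using ek e_comm[of k p x] by simp
      fix l assume l: "l < n" "l \<noteq> p" "l \<noteq> q" "l \<noteq> k"
      then have "l \<noteq> i" "l \<noteq> j" using pq(1) by blast+
      then have elx: "e l x = x" using el l by blast
      show "e l y = y" unfolding y_def e_lin e_comm[of l p x] elx ..
    qed (use pq k in blast)+
    then show ?thesis unfolding y_def by simp
  qed
  from *[of i j] *[of j i] ij have "e i x = x" "e j x = x" by auto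
  then show ?thesis using ek el k unfolding x_def[symmetric] U_def by metis
qed

lemma R_R_U:
  assumes w: "U k w" and ij: "i < n" "j < n" "i \<noteq> j" "k \<noteq> i" "k \<noteq> j"
  shows "R i j (R i j w) = w"
  using ReR[of i j w] R_U[OF assms] w ij by simp

lemma L_U:
  assumes w: "U k w" and ij: "i < n" "j < n" "i \<noteq> j" "k \<noteq> i" "k \<noteq> j"
  shows "L i j w = R i j w"
  using L_eq[of i j w] R_U[OF assms] w ij by simp

text \<open>Otherwise every \<open>U k\<close> contains, for each \<open>a\<close>, a joint eigenvector of the commuting involutions
  \<open>R b j\<close> on which only \<open>R a j\<close> is \<open>-1\<close>: these are \<open>n (n - 2)\<close> independent vectors, too many.\<close>

lemma trivial_on_U:
  assumes w: "U k w" and aj: "a < n" "j < n" "a \<noteq> j" "k \<noteq> a" "k \<noteq> j"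
  shows "R a j w = w"
proof (rule ccontr)
  assume neq: "R a j w \<noteq> w"
  define Q where "Q k j a \<longleftrightarrow> (\<exists>w. U k w \<and> R a j w \<noteq> w)" for k j a
  have Qinv: "Q (transpose p q k) (transpose p q j) (transpose p q a)"
    if lt: "p < n" "q < n" "k < n" "j < n" "a < n" "k \<noteq> j" "k \<noteq> a" "j \<noteq> a" and Q: "Q k j a" for p q k j a
  proof -
    obtain w where w: "U k w" "R a j w \<noteq> w" using Q Q_def by auto
    then have "P p q (R a j w) \<noteq> P p q w" by (metis PP)
    then show ?thesis unfolding Q_def using PR[of p q a j w] U_P[of k w p q] w lt by metis
  qed
  have "Q k j a" using neq w unfolding Q_def by blast
  note transport3[of Q, OF Qinv this]
  then have Qall: "Q k' j' a'" if "k' < n" "j' < n" "a' < n" "k' \<noteq> j'" "k' \<noteq> a'" "j' \<noteq> a'" for k' j' a'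
    using that aj U_less[OF w] by simp
  \<comment> \<open>Induction on the set of indices b for which \<open>R b j\<close> is already
    trivial on u. It starts from \<open>w - R a j w\<close>, which the involution
    \<open>R a j\<close> negates.\<close>
  have ex: "\<exists>u. u \<noteq> 0 \<and> U k u \<and> R a j u = - u \<and> (\<forall>b\<in>B. R b j u = u)"
    if d: "k < n" "j < n" "a < n" "k \<noteq> j" "k \<noteq> a" "j \<noteq> a"
      and B: "finite B" "B \<subseteq> {..<n} - {k, j, a}" for k j a B
    using B
  proof (induction B)
    case empty
    have "Q k j a" by (rule Qall) (use d in auto)
    then obtain w where w: "U k w" "R a j w \<noteq> w" unfolding Q_def by auto
    then show ?case
      using R_U[OF w(1), of a j] R_R_U[OF w(1), of a j] d
      by (intro exI[of _ "w - R a j w"]) auto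
  next
    case (insert b B)
    then obtain u where u: "u \<noteq> 0" "U k u" "R a j u = - u" "\<And>c. c \<in> B \<Longrightarrow> R c j u = u" by auto
    have b: "b < n" "b \<noteq> k" "b \<noteq> j" "b \<noteq> a" and B: "\<And>c. c \<in> B \<Longrightarrow> c < n \<and> c \<noteq> k \<and> c \<noteq> j \<and> c \<noteq> a \<and> c \<noteq> b"
      using insert by auto
    show ?case
    proof (cases "u + R b j u = 0")
      case False
      let ?v = "u + R b j u"
      have "U k ?v" using u R_U[OF u(2), of b j] b d by simp
      moreover have "R a j ?v = - ?v" using R_comm[of a j b j u] u b d by simp
      moreover have "R b j ?v = ?v" using R_R_U[OF u(2), of b j] b d by simp
      moreover have "R c j ?v = ?v" if "c \<in> B" for c using R_comm[of c j b j u] u b d B that by simp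
      ultimately show ?thesis using False by blast
    next
      case True
      then have bu: "R b j u = - u" by (simp add: eq_neg_iff_add_eq_0 add.commute)
      \<comment> \<open>Here both \<open>R a j\<close> and \<open>R b j\<close> negate u. The two
        signs cancel in the Steinberg relation, so \<open>R b j\<close> fixes
        \<open>R a b u\<close>.\<close>
      let ?v = "R a b u"
      have Uv: "U k ?v" using R_U[OF u(2), of a b] b d by simp
      have "R a b ?v = u" using R_R_U[OF u(2), of a b] b d by simp
      then have "?v \<noteq> 0" using u by auto
      moreover have "R b j ?v = ?v" using steinberg[of a b j u] u bu b d by simp
      moreover have "R a j ?v = - ?v"
      proof -
        \<comment> \<open>The relations let \<open>R a b\<close> commute with \<open>L a j\<close>
          rather than with \<open>R a j\<close>; on \<open>U k\<close> the two moves agree.\<close>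
        have "R a j ?v = L a j ?v" using L_U[OF Uv, of a j] d by simp
        also have "\<dots> = R a b (L a j u)" using RL_comm[of a b j u] b d by simp
        also have "L a j u = - u" using L_U[OF u(2), of a j] u d by simp
        finally show ?thesis by simp
      qed
      moreover have "R c j ?v = ?v" if "c \<in> B" for c using R_comm[of c j a b u] u b d B that by simp
      ultimately show ?thesis using Uv by blast
    qed
  qed
  \<comment> \<open>One auxiliary index per k is enough for the count: a then ranges over n - 2
    values.\<close>
  define J where "J k = (if k = 0 then 1 else 0 :: nat)" for k :: nat
  define S where "S = (SIGMA k:{..<n}. {..<n} - {k, J k})"
  have J: "J k < n" "J k \<noteq> k" for k using n6 by (auto simp: J_def)
  define G where "G x w \<longleftrightarrow> w \<noteq> 0 \<and> U (fst x) w \<and> R (snd x) (J (fst x)) w = - w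
      \<and> (\<forall>b\<in>{..<n} - {fst x, J (fst x), snd x}. R b (J (fst x)) w = w)" for x w
  have "\<forall>x\<in>S. \<exists>w. G x w"
  proof
    fix x assume "x \<in> S"
    then have "fst x < n" "snd x < n" "fst x \<noteq> J (fst x)" "fst x \<noteq> snd x" "J (fst x) \<noteq> snd x"
      using J[of "fst x"] by (auto simp: S_def)
    then show "\<exists>w. G x w"
      using ex[of "fst x" "J (fst x)" "snd x" "{..<n} - {fst x, J (fst x), snd x}"] J[of "fst x"]
      unfolding G_def by blast
  qed
  then obtain u where u: "G x (u x)" if "x \<in> S" for x using bchoice[of S G] by blast
  \<comment> \<open>This multiplies a vector negated by both operators by 4. It annihilates the
    chosen vectors in any other \<open>U k\<close>, and those in the same \<open>U k\<close> which
    the move fixes.\<close>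
  define T where "T x v = (v - e (fst x) v) - R (snd x) (J (fst x)) (v - e (fst x) v)" for x v
  have "card S \<le> dim UNIV"
  proof (rule card_le_dim_separated[of S T u])
    show "finite S" by (simp add: S_def)
    fix x assume x: "x \<in> S"
    have idl: "Vector_Spaces.linear scale scale (\<lambda>x. x)" using linear_id by (simp add: id_def)
    show "Vector_Spaces.linear scale scale (T x)"
      unfolding T_def[abs_def]
      by (intro linear_sub_add linear_comp[OF linear_R] linear_e idl)
    have ux: "u x \<noteq> 0" "e (fst x) (u x) = - u x" "R (snd x) (J (fst x)) (u x) = - u x"
      using u[OF x] unfolding G_def by auto
    then have "T x (u x) = (u x + u x) + (u x + u x)" unfolding T_def by simp
    then show "T x (u x) \<noteq> 0" using double_neq_0[OF double_neq_0[OF ux(1)]] by metis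
    fix y assume y: "y \<in> S" "x \<noteq> y"
    note Gy = u[OF y(1), unfolded G_def]
    have xn: "fst x < n" "snd x < n" "snd x \<noteq> fst x" "snd x \<noteq> J (fst x)"
      using x by (auto simp: S_def)
    show "T x (u y) = 0"
    proof (cases "fst x = fst y")
      case True
      then have "snd x \<noteq> snd y" using y(2) by (simp add: prod_eq_iff)
      then have "R (snd x) (J (fst x)) (u y) = u y" using Gy xn True by auto
      moreover have "e (fst x) (u y) = - u y" using Gy True by simp
      ultimately show ?thesis unfolding T_def by simp
    next
      case False
      then have "e (fst x) (u y) = u y" using Gy xn by auto
      then show ?thesis unfolding T_def by simp
    qed
  qed
  moreover have "card S = n * (n - 2)"
  proof -
    have "card ({..<n} - {k, J k}) = n - 2" if "k < n" for k
      using that J[of k] by (subst card_Diff_subset) auto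
    then show ?thesis unfolding S_def by (subst card_SigmaI) auto
  qed
  ultimately show False using dim_lt binom2_less by linarith
qed

end

section \<open>Eigenprojections, and relations for the left moves\<close>

context signed_rep begin

text \<open>\<open>D k\<close> projects onto the \<open>-1\<close>-eigenspace of \<open>e k\<close>.\<close>

definition D :: "nat \<Rightarrow> 'v \<Rightarrow> 'v" where "D k x = half (x - e k x)"

lemma half_lin: "half (x + y) = half x + half y" "half (x - y) = half x - half y"
    "half (- x) = - half x" "half 0 = 0"
  by (simp_all add: half_def scale_right_distrib scale_right_diff_distrib)

lemma D_lin [simp]: "D k (x + y) = D k x + D k y" "D k (x - y) = D k x - D k y"
    "D k (- x) = - D k x" "D k 0 = 0"
proof -
  have "x + y - e k (x + y) = (x - e k x) + (y - e k y)"
    "x - y - e k (x - y) = (x - e k x) - (y - e k y)"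
    "- x - e k (- x) = - (x - e k x)" by simp_all
  then show "D k (x + y) = D k x + D k y" "D k (x - y) = D k x - D k y" "D k (- x) = - D k x"
    by (simp_all only: D_def half_lin)
  show "D k 0 = 0" by (simp add: D_def half_lin)
qed

lemma D_U0 [simp]: "U0 a \<Longrightarrow> k < n \<Longrightarrow> D k a = 0" by (simp add: D_def half_lin)
lemma D_U [simp]: "U k x \<Longrightarrow> D k x = x" "U l x \<Longrightarrow> k < n \<Longrightarrow> k \<noteq> l \<Longrightarrow> D k x = 0"
  by (simp_all add: D_def half_lin half_add)

lemma half_R: "half (R i j x) = R i j (half x)" by (simp add: half_def)
lemma half_e: "half (e i x) = e i (half x)" by (simp add: half_def)
lemma half_P: "half (P i j x) = P i j (half x)" by (simp add: half_def)

lemma D_R: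
  assumes "i < n" "j < n" "i \<noteq> j" "k \<noteq> i" "k \<noteq> j" shows "D k (R i j x) = R i j (D k x)"
  by (simp only: D_def half_R[symmetric] R_lin eR[OF assms])

lemma D_P:
  assumes "a < n" "b < n" "k < n" shows "D (transpose a b k) (P a b x) = P a b (D k x)"
  by (simp only: D_def half_P[symmetric] P_lin Pe[OF assms])

lemma U_zero: "U k x \<Longrightarrow> U l x \<Longrightarrow> k \<noteq> l \<Longrightarrow> x = 0"
  using D_U(1)[of k x] D_U(2)[of l x k] U_less[of k x] by simp

lemma eL: "\<lbrakk>i < n; j < n; i \<noteq> j; k \<noteq> i; k \<noteq> j\<rbrakk> \<Longrightarrow> e k (L i j v) = L i j (e k v)"
  by (simp add: L_eq eR e_comm[of k])

lemma D_L:
  assumes "i < n" "j < n" "i \<noteq> j" "k \<noteq> i" "k \<noteq> j" shows "D k (L i j x) = L i j (D k x)"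
proof -
  have "half (L i j y) = L i j (half y)" for y
    by (simp only: L_eq[OF assms(1-3)] half_R half_e)
  then show ?thesis
    by (simp only: D_def eL[OF assms] L_lin(2)[OF assms(1-3), symmetric])
qed

text \<open>Both products of left moves are the corresponding products of right moves conjugated by
  the involutions at i, j and k, so \<open>R_comm\<close> carries over.\<close>

lemma L_comm:
  assumes "i < n" "j < n" "k < n" "i \<noteq> j" "k \<noteq> j" "i \<noteq> k"
  shows "L i j (L k j v) = L k j (L i j v)"
proof -
  have *: "L i j (L k j v) = e i (e j (e k (R i j (R k j (e i (e k (e j v)))))))"
    if "i < n" "j < n" "k < n" "i \<noteq> j" "k \<noteq> j" "i \<noteq> k" for i k
  proof -
    have "L i j (L k j v) = e i (e j (R i j (e i (e j (e k (e j (R k j (e k (e j v)))))))))"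
      by (simp only: L_eq[OF that(1,2,4)] L_eq[OF that(3,2,5)])
    also have "e i (e j (e k (e j (R k j (e k (e j v)))))) = e k (e i (R k j (e k (e j v))))"
      by (simp only: e_comm ee)
    also have "\<dots> = e k (R k j (e i (e k (e j v))))"
      using eR[of k j i] that by (metis e_comm)
    also have "R i j \<dots> = e k (R i j (R k j (e i (e k (e j v)))))"
      using eR[of i j k] that by metis
    finally show ?thesis .
  qed
  have "e i (e j (e k x)) = e k (e j (e i x))" "e i (e k x) = e k (e i x)" for x
    by (simp_all only: e_comm)
  then show ?thesis
    using *[of i k] *[of k i] assms R_comm[of i j k j] by metis
qed

lemma R_foldr_comm:
  assumes "i < n" "j < n" "i \<noteq> j" "\<forall>k\<in>set xs. k < n \<and> k \<noteq> i \<and> k \<noteq> j"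
  shows "R i j (foldr (\<lambda>k. R k j) xs v) = foldr (\<lambda>k. R k j) xs (R i j v)"
    "L i j (foldr (\<lambda>k. L k j) xs v) = foldr (\<lambda>k. L k j) xs (L i j v)"
  using assms by (induction xs) (auto simp: R_comm[of i j] L_comm[of i j])

end

section \<open>Consequences of triviality for exchanges, left moves and U0\<close>

context low_rep begin

lemma L_trivial_on_U: "\<lbrakk>U k w; i < n; j < n; i \<noteq> j; k \<noteq> i; k \<noteq> j\<rbrakk> \<Longrightarrow> L i j w = w"
  using L_U trivial_on_U by simp

text \<open>\<open>weyl\<close> writes the exchange as moves and sign changes at a and b, all of
  which are trivial on \<open>U k\<close>.\<close>

lemma P_trivial_on_U:
  assumes "U k w" "a < n" "b < n" "a \<noteq> b" "k \<noteq> a" "k \<noteq> b"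
  shows "P a b w = w"
  using weyl[of a b w] L_trivial_on_U[of k w a b] trivial_on_U[of k w b a]
    trivial_on_U[of k w a b] assms by simp

lemma foldr_trivial_on_U:
  assumes "U i v" "j < n" "i \<noteq> j" "\<forall>k\<in>set xs. k < n \<and> k \<noteq> i \<and> k \<noteq> j"
  shows "foldr (\<lambda>k. R k j) xs v = v" "foldr (\<lambda>k. L k j) xs v = v"
  using assms by (induction xs) (auto simp: trivial_on_U L_trivial_on_U)

text \<open>In the relation \<open>outer\<close> all factors but one act trivially on \<open>U i\<close>.\<close>

lemma L_eq_R_on_U:
  assumes "U i v" "j < n" "i \<noteq> j"
  shows "L i j v = R i j v"
  using outer[of i j v] foldr_trivial_on_U[OF assms, of "filter (\<lambda>k. k \<noteq> i \<and> k \<noteq> j) [0..<n]"]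
    U_less[OF assms(1)] assms by simp

text \<open>The weights of x are subsets of {i, j}, and {i, j} itself is excluded by
  \<open>no23\<close>.\<close>

lemma decomp:
  assumes fx: "\<And>l. l < n \<Longrightarrow> l \<noteq> i \<Longrightarrow> l \<noteq> j \<Longrightarrow> e l x = x" and ij: "i < n" "j < n" "i \<noteq> j"
  shows "U i (D i x)" "U j (D j x)" "U0 (x - D i x - D j x)"
proof -
  have *: "U p (D p x)" if pq: "{p, q} = {i, j}" "p < n" "q < n" "p \<noteq> q" for p q
  proof -
    have ep: "e p (D p x) = - D p x" unfolding D_def half_e[symmetric]
      by (simp add: half_lin ee)
    have el: "e l (D p x) = D p x" if "l < n" "l \<noteq> p" "l \<noteq> q" for l
    proof -
      have "e l x = x" using that pq(1) fx[of l] by blast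
      then show ?thesis unfolding D_def half_e[symmetric] e_lin e_comm[of l p x] by simp
    qed
    define z where "z = D p x - e q (D p x)"
    have "e q z = - z" unfolding z_def by (simp add: ee)
    moreover have "e p z = - z" unfolding z_def using ep e_comm[of p q "D p x"] by simp
    moreover have "e l z = z" if "l < n" "l \<noteq> p" "l \<noteq> q" for l
      unfolding z_def using el[OF that] e_comm[of l q "D p x"] by simp
    ultimately have "wt {p, q} z" unfolding wt_def by auto
    moreover have "{p, q} \<subseteq> {..<n}" "card {p, q} = 2" using pq(2-4) by auto
    ultimately have "z = 0" using no23 by blast
    then have "e q (D p x) = D p x" unfolding z_def by simp
    then have "e l (D p x) = D p x" if "l < n" "l \<noteq> p" for l
      using el[of l] that by (cases "l = q") auto
    then show ?thesis unfolding U_def using pq ep by blast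
  qed
  have i: "U i (D i x)" and j: "U j (D j x)" using *[of i j] *[of j i] ij by auto
  have h: "x - e p x = D p x + D p x" for p unfolding D_def by (simp add: half_add)
  have ex: "e p x = x - (D p x + D p x)" for p unfolding h[symmetric] by simp
  have e4: "e i (D i x) = - D i x" "e j (D j x) = - D j x" "e i (D j x) = D j x" "e j (D i x) = D i x"
    using i j ij by (auto simp: U_def simp del: U_e)
  have "e i (x - D i x - D j x) = x - D i x - D j x" "e j (x - D i x - D j x) = x - D i x - D j x"
    unfolding e_lin e4 ex by (simp_all add: algebra_simps)
  moreover have "e l (x - D i x - D j x) = x - D i x - D j x" if "l < n" "l \<noteq> i" "l \<noteq> j" for l
  proof -
    have "e l (D i x) = D i x" "e l (D j x) = D j x" using i j that by (auto simp: U_def simp del: U_e)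
    then show ?thesis unfolding e_lin using fx[OF that] by simp
  qed
  ultimately show "U i (D i x)" "U j (D j x)" "U0 (x - D i x - D j x)"
    unfolding U0_def using i j by metis+
qed

text \<open>The \<open>U i\<close>-components of \<open>R i j v\<close> and \<open>L i j v\<close>
  are negatives of each other, since \<open>L i j v = e i (e j (R i j v))\<close> on
  \<open>U0\<close>. The remaining factors in \<open>outer\<close> are trivial on
  \<open>U i\<close>, so the relation equates the component with its negative.\<close>

lemma R_U0_fixed:
  assumes v: "U0 v" and ij: "i < n" "j < n" "i \<noteq> j"
  shows "D i (R i j v) = 0"
proof -
  let ?xs = "filter (\<lambda>k. k \<noteq> i \<and> k \<noteq> j) [0..<n]"
  let ?x = "R i j v" and ?y = "L i j v"
  have fx: "e l ?x = ?x" if "l < n" "l \<noteq> i" "l \<noteq> j" for l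
    using eR[of i j l v] ij that v by simp
  have b: "U i (D i ?x)" using decomp(1)[of i j ?x] fx ij by simp
  have y: "?y = e i (e j ?x)" using L_eq[of i j v] v ij by simp
  have Dy: "D i ?y = - D i ?x"
  proof -
    have "D i ?y = half (e i (e j ?x) - e j ?x)" unfolding D_def y by (simp add: ee)
    also have "\<dots> = - e j (D i ?x)"
      unfolding D_def half_e[symmetric] by (simp add: half_lin e_comm[of i j])
    finally show ?thesis using b ij by simp
  qed
  have DR: "D i (foldr (\<lambda>k. R k j) ys z) = foldr (\<lambda>k. R k j) ys (D i z)"
    "D i (foldr (\<lambda>k. L k j) ys z) = foldr (\<lambda>k. L k j) ys (D i z)"
    if "\<forall>k\<in>set ys. k < n \<and> k \<noteq> i \<and> k \<noteq> j" for ys z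
    using that ij by (induction ys) (auto simp: D_R D_L)
  have xs: "\<forall>k\<in>set ?xs. k < n \<and> k \<noteq> i \<and> k \<noteq> j" by simp
  have "foldr (\<lambda>k. R k j) ?xs ?x = foldr (\<lambda>k. L k j) ?xs ?y"
    using outer[OF ij, of v] unfolding R_foldr_comm[OF ij xs] .
  from arg_cong[OF this, of "D i"]
  have "foldr (\<lambda>k. R k j) ?xs (D i ?x) = foldr (\<lambda>k. L k j) ?xs (- D i ?x)"
    unfolding DR(1)[OF xs] DR(2)[OF xs] Dy .
  then have "D i ?x = - D i ?x"
    using foldr_trivial_on_U(1)[OF b ij(2,3) xs] foldr_trivial_on_U(2)[OF U_closed(4)[OF b] ij(2,3) xs]
    by simp
  then show ?thesis by (simp add: eq_uminus_self)
qed

end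

context signed_rep begin

lemma P_R:
  assumes "a < n" "b < n" "a \<noteq> b"
  shows "P a b (R a b v) = R b a (P a b v)" "P a b (R b a v) = R a b (P a b v)"
    and "\<lbrakk>i < n; i \<noteq> a; i \<noteq> b\<rbrakk> \<Longrightarrow> P a b (R a i v) = R b i (P a b v)"
    and "\<lbrakk>i < n; i \<noteq> a; i \<noteq> b\<rbrakk> \<Longrightarrow> P a b (R b i v) = R a i (P a b v)"
    and "\<lbrakk>i < n; i \<noteq> a; i \<noteq> b\<rbrakk> \<Longrightarrow> P a b (R i a v) = R i b (P a b v)"
    and "\<lbrakk>i < n; i \<noteq> a; i \<noteq> b\<rbrakk> \<Longrightarrow> P a b (R i b v) = R i a (P a b v)"
  using PR[of a b a b v] PR[of a b b a v] PR[of a b a i v] PR[of a b b i v]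
    PR[of a b i a v] PR[of a b i b v] assms by auto

lemma D_P_swap:
  assumes "a < n" "b < n"
  shows "D b (P a b x) = P a b (D a x)" "D a (P a b x) = P a b (D b x)"
    and "\<lbrakk>i < n; i \<noteq> a; i \<noteq> b\<rbrakk> \<Longrightarrow> D i (P a b x) = P a b (D i x)"
  using D_P[of a b a x] D_P[of a b b x] D_P[of a b i x] assms by auto

lemma U_P_swap:
  assumes "a < n" "b < n"
  shows "U a v \<Longrightarrow> U b (P a b v)" "U b v \<Longrightarrow> U a (P a b v)"
  using U_P[of a v a b] U_P[of b v a b] assms by auto

lemma R_inj: "\<lbrakk>i < n; j < n; i \<noteq> j; R i j x = R i j y\<rbrakk> \<Longrightarrow> x = y"
  by (metis ReR ee)

lemma fresh:
  assumes "finite S" "card S < n" obtains k where "k < n" "k \<notin> S"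
proof -
  have "\<not> {..<n} \<subseteq> S" using card_mono[OF assms(1), of "{..<n}"] assms(2) by auto
  then show ?thesis using that by blast
qed

lemma fresh2: obtains k where "k < n" "k \<noteq> i" "k \<noteq> j"
  by (rule fresh[of "{i, j}"]) (use n6 card_insert_le_m1[of 2 "{j}" i] in \<open>auto simp: card_insert_if\<close>)

end

section \<open>Moves whose source index carries the weight\<close>

context low_rep begin

text \<open>As left and right moves agree on \<open>U i\<close>, \<open>L_eq\<close> shows that
  \<open>e i (e j x) = - x\<close> for x = \<open>R i j v\<close>. On a component in
  \<open>U0\<close> that operator would be the identity, so this component vanishes.\<close>

lemma source_decomp:
  assumes v: "U i v" and j: "j < n" "i \<noteq> j"
  shows "R i j v = D i (R i j v) + D j (R i j v)" "U i (D i (R i j v))" "U j (D j (R i j v))"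
proof -
  define x where "x = R i j v"
  have i: "i < n" using v U_less by blast
  have fx: "e l x = x" if "l < n" "l \<noteq> i" "l \<noteq> j" for l
    unfolding x_def using eR[of i j l v] i j that v by simp
  note d = decomp[of i j x, OF fx i j]
  have "e i (e j x) = - x"
    using L_eq_R_on_U[OF v j] L_eq[OF i j, of v] v j i unfolding x_def by (simp add: eq_neg_iff_add_eq_0 neg_eq_iff_add_eq_0 add.commute)
  define a where "a = x - D i x - D j x"
  have xa: "x = a + (D i x + D j x)" unfolding a_def by simp
  have e4: "e i (D i x) = - D i x" "e j (D j x) = - D j x" "e i (D j x) = D j x" "e j (D i x) = D i x"
     "e i a = a" "e j a = a"
    using d i j unfolding a_def[symmetric] by simp_all
  have "e i (e j (a + (D i x + D j x))) = a - (D i x + D j x)"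
    unfolding e_lin e4 by simp
  then have "a - (D i x + D j x) = - (a + (D i x + D j x))"
    using \<open>e i (e j x) = - x\<close> xa by metis
  then have "a = - a" by (simp add: algebra_simps)
  then have "a = 0" by (simp add: eq_uminus_self)
  then show "R i j v = D i (R i j v) + D j (R i j v)" using xa unfolding x_def by simp
  show "U i (D i (R i j v))" "U j (D j (R i j v))" using d unfolding x_def by auto
qed

text \<open>For k different from i, \<open>R k j\<close> commutes with \<open>R i j\<close> and
  fixes both v and the \<open>U i\<close>-component of \<open>R i j v\<close>. The case k = i
  follows by exchanging i with a third index, which is trivial on \<open>U j\<close>.\<close>

lemma source_image_fixed:
  assumes v: "U i v" and j: "j < n" "i \<noteq> j" and k: "k < n" "k \<noteq> j"
  shows "R k j (D j (R i j v)) = D j (R i j v)"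
proof -
  have i: "i < n" using v U_less by blast
  note d = source_decomp[OF v j]
  have *: "R k j (D j (R i j v)) = D j (R i j v)" if k: "k < n" "k \<noteq> j" "k \<noteq> i" for k
  proof -
    have "R k j (R i j v) = R i j v"
      using R_comm[of k j i j v] trivial_on_U[OF v, of k j] i j k by simp
    then have "R k j (D i (R i j v)) + R k j (D j (R i j v)) = D i (R i j v) + D j (R i j v)"
      using d(1) by (metis R_lin(1))
    then show ?thesis using trivial_on_U[OF d(2), of k j] i j k by simp
  qed
  show ?thesis
  proof (cases "k = i")
    case True
    obtain l where l: "l < n" "l \<noteq> i" "l \<noteq> j" by (rule fresh2)
    have "P i l (R l j (D j (R i j v))) = R i j (P i l (D j (R i j v)))"
      using P_R(4)[of i l j] i j l by simp
    then show ?thesis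
      using *[of l] l P_trivial_on_U[OF d(3), of i l] i j True by simp
  qed (use * k in blast)
qed

text \<open>The diagonal part of \<open>R i j\<close> on \<open>U i\<close> is idempotent, by the
  \<open>U i\<close>-components of the Steinberg relation. It is injective, because a vector w in
  its kernel satisfies \<open>R i j w = w\<close> and so lies in both \<open>U i\<close> and
  \<open>U j\<close>. An injective idempotent is the identity.\<close>

lemma source_unipotent:
  assumes v: "U i v" and j: "j < n" "i \<noteq> j"
  shows "D i (R i j v) = v"
proof -
  have i: "i < n" using v U_less by blast
  obtain k where k: "k < n" "k \<noteq> i" "k \<noteq> j" by (rule fresh2)
  note d = source_decomp[OF v j] and d' = source_decomp[OF v k(1) k(2)[symmetric]]
  have "P j k (R i j v) = R i k v"
    using P_R(5)[of j k i v] P_trivial_on_U[OF v, of j k] i j k by simp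
  then have h: "D i (R i k v) = D i (R i j v)"
    using D_P_swap(3)[of j k i "R i j v"] P_trivial_on_U[OF d(2), of j k] i j k by simp
  let ?h = "D i (R i j v)"
  have "R j k (R i j v) = R i j (R j k (R i k v))" using steinberg[of i j k v] i j k by simp
  moreover have "R j k (R i j v) = R j k (D j (R i j v)) + ?h"
    using arg_cong[OF d(1), of "R j k"] trivial_on_U[OF d(2), of j k] i j k by (simp add: add.commute)
  moreover have "R i j (R j k (R i k v)) = D k (R i k v) + R i j ?h"
  proof -
    have "R j k (R i k v) = ?h + D k (R i k v)"
      using arg_cong[OF d'(1), of "R j k"] source_image_fixed[OF v, of k j] h
        trivial_on_U[OF d(2), of j k] i j k by simp
    then show ?thesis using trivial_on_U[OF d'(3), of i j] i j k by (simp add: add.commute)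
  qed
  ultimately have eq: "R j k (D j (R i j v)) + ?h = D k (R i k v) + R i j ?h" by simp
  note d2 = source_decomp[OF d(3) k(1) k(3)[symmetric]]
  have "D i (R j k (D j (R i j v))) = 0"
    using D_U(2)[OF d2(2) i j(2)] D_U(2)[OF d2(3) i k(2)[symmetric]] arg_cong[OF d2(1), of "D i"] by simp
  then have hh: "D i (R i j ?h) = ?h"
    using arg_cong[OF eq, of "D i"] d(2) d'(3) i k by simp
  define w where "w = v - ?h"
  have w: "U i w" unfolding w_def using v d(2) by simp
  have "D i (R i j w) = 0" unfolding w_def using hh by simp
  then have Rw: "R i j w = D j (R i j w)" using source_decomp(1)[OF w j] by simp
  then have "R i j (R i j w) = R i j w" using source_image_fixed[OF w j i j(2)] by simp
  then have "R i j w = w" using R_inj i j by blast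
  then have "w = 0" using U_zero[of j w i] source_decomp(3)[OF w j] Rw w j by simp
  then show ?thesis unfolding w_def by simp
qed

section \<open>The standard part and the dual part of a weight space of size one\<close>

definition F :: "nat \<Rightarrow> nat \<Rightarrow> 'v \<Rightarrow> 'v" where "F i j v = R i j v - v"

lemma R_F: "R i j v = v + F i j v" by (simp add: F_def)
lemma F_diff [simp]: "F i j (x - y) = F i j x - F i j y" by (simp add: F_def)
lemma F_eq: "\<lbrakk>U i v; j < n; i \<noteq> j\<rbrakk> \<Longrightarrow> F i j v = D j (R i j v)"
  using source_decomp(1)[of i v j] source_unipotent[of i v j] by (simp add: F_def algebra_simps)

lemma U_F: "\<lbrakk>U i v; j < n; i \<noteq> j\<rbrakk> \<Longrightarrow> U j (F i j v)"
  using F_eq source_decomp(3) by simp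

lemma R_F_fixed: "\<lbrakk>U i v; j < n; i \<noteq> j; k < n; k \<noteq> j\<rbrakk> \<Longrightarrow> R k j (F i j v) = F i j v"
  using F_eq source_image_fixed by simp

lemma P_F:
  assumes "U i v" "j < n" "k < n" "i \<noteq> j" "i \<noteq> k" "j \<noteq> k"
  shows "P j k (F i j v) = F i k v"
  using P_R(5)[of j k i v] P_trivial_on_U[of i v j k] assms U_less[of i v] by (simp add: F_def)

text \<open>By \<open>source_unipotent\<close>, \<open>F i j\<close> is the off-diagonal part of
  \<open>R i j\<close>, mapping \<open>U i\<close> to \<open>U j\<close>. The Steinberg relation
  makes these parts compose like matrix units.\<close>

lemma F_F:
  assumes v: "U i v" and jk: "j < n" "k < n" "i \<noteq> j" "i \<noteq> k" "j \<noteq> k"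
  shows "F j k (F i j v) = F i k v"
proof -
  have i: "i < n" using v U_less by blast
  have "R j k (v + F i j v) = R i j (R j k (v + F i k v))"
    using steinberg[of i j k v] i jk unfolding R_F[of i j v] R_F[of i k v] by simp
  moreover have "R j k v = v" using trivial_on_U[OF v] jk by simp
  moreover have "R j k (F i k v) = F i k v" using R_F_fixed[OF v] jk by simp
  moreover have "R i j (F i k v) = F i k v" using trivial_on_U[OF U_F[OF v]] i jk by simp
  ultimately have "v + R j k (F i j v) = v + F i j v + F i k v" using R_F[of i j v] by simp
  then show ?thesis unfolding F_def[of j k] by (simp add: algebra_simps)
qed

text \<open>\<open>Fty\<close> collects the properties of the components \<open>F i j v\<close> with \<open>v\<close> in \<open>U i\<close>; the space \<open>U j\<close> is the sum
  of \<open>Fty j\<close> and \<open>Xty j\<close>.\<close>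

definition Fty :: "nat \<Rightarrow> 'v \<Rightarrow> bool" where
  "Fty j y \<longleftrightarrow> U j y \<and> (\<forall>k<n. k \<noteq> j \<longrightarrow> F j k y = P j k y)"

lemma Fty_I:
  assumes y: "U j y" and l: "l < n" "l \<noteq> j" "F j l y = P j l y"
  shows "Fty j y"
  unfolding Fty_def
proof (intro conjI allI impI)
  fix k assume k: "k < n" "k \<noteq> j"
  have j: "j < n" using y U_less by blast
  show "F j k y = P j k y"
  proof (cases "k = l")
    case False
    have "F j k y = P l k (P j l y)" using P_F[OF y, of l k] l k False by simp
    also have "\<dots> = P j k (P l k y)" using PPc[of l k j l y] j k l False by simp
    also have "P l k y = y" using P_trivial_on_U[OF y] k l False by simp
    finally show ?thesis .
  qed (use l in simp)
qed fact

lemma Fty_F: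
  assumes "U i v" "j < n" "i \<noteq> j" shows "Fty j (F i j v)"
proof -
  obtain l where l: "l < n" "l \<noteq> i" "l \<noteq> j" by (rule fresh2)
  show ?thesis
    by (rule Fty_I[of j _ l]) (use U_F[OF assms] F_F[OF assms(1), of j l] P_F[OF assms(1), of j l] assms l in auto)
qed

text \<open>For y of this type, \<open>P j l y\<close> is a value of \<open>F j l\<close> and hence
  fixed by all moves into l. Exchanging j and l turns this into the claim.\<close>

lemma Fty_fixed:
  assumes y: "Fty j y" and i: "i < n" "i \<noteq> j"
  shows "R i j y = y"
proof -
  have Uy: "U j y" and j: "j < n" using y U_less unfolding Fty_def by auto
  obtain l where l: "l < n" "l \<noteq> i" "l \<noteq> j" by (rule fresh2)
  have "R i l (P j l y) = P j l y"
    using R_F_fixed[OF Uy, of l i] y l i unfolding Fty_def by simp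
  then have "P j l (R i l (P j l y)) = y" by (simp add: PP)
  then show ?thesis using P_R(6)[of j l i "P j l y"] i j l by (simp add: PP)
qed

text \<open>The model is the dual of the standard representation, in which \<open>R j k\<close>
  fixes the basis vector of weight {j}, while \<open>R i j\<close> subtracts from it the one of
  weight {i}.\<close>

definition Xty :: "nat \<Rightarrow> 'v \<Rightarrow> bool" where
  "Xty j x \<longleftrightarrow> U j x \<and> (\<forall>k<n. k \<noteq> j \<longrightarrow> R j k x = x)"

lemma Xty_I:
  assumes x: "U j x" and l: "l < n" "l \<noteq> j" "R j l x = x"
  shows "Xty j x"
  unfolding Xty_def
proof (intro conjI allI impI)
  fix k assume k: "k < n" "k \<noteq> j"
  have j: "j < n" using x U_less by blast
  show "R j k x = x"
  proof (cases "k = l")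
    case False
    then show ?thesis
      using P_R(5)[of l k j x] P_trivial_on_U[OF x, of l k] l k j by simp
  qed (use l in simp)
qed fact

text \<open>\<open>P j l\<close> after \<open>F j l\<close> is idempotent on \<open>U j\<close>,
  because \<open>F l j\<close> acts on values of \<open>F j l\<close> as the exchange. Its image
  gives the first summand and its kernel the second.\<close>

lemma U_decomp:
  assumes w: "U j w"
  obtains y x where "w = y + x" "Fty j y" "Xty j x"
proof -
  have j: "j < n" using w U_less by blast
  obtain l where l: "l < n" "l \<noteq> j" by (rule fresh2)
  define y where "y = P j l (F j l w)"
  have Uy: "U j y" unfolding y_def using U_P_swap(2)[of j l] U_F[OF w] l j by simp
  have Py: "P j l y = F j l w" unfolding y_def by (simp add: PP)
  have "F j l y = P j l (F l j (F j l w))"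
    unfolding y_def F_def using P_R(2)[of j l] l j by simp
  also have "F l j (F j l w) = P l j (F j l w)"
    using Fty_F[OF w, of l] l j unfolding Fty_def by simp
  also have "\<dots> = y" unfolding y_def by (rule P_sym)
  finally have Fy: "F j l y = P j l y" .
  have "Fty j y" by (rule Fty_I[OF Uy l Fy])
  moreover have "F j l (w - y) = 0" using Fy Py by simp
  then have "Xty j (w - y)" by (intro Xty_I[OF _ l]) (use w Uy in \<open>auto simp: F_def\<close>)
  ultimately show ?thesis using that[of y "w - y"] by simp
qed

lemma target_zero_all:
  assumes x: "U j x" and k: "k < n" "k \<noteq> j" "D k (R k j x) = 0" and i: "i < n" "i \<noteq> j"
  shows "D i (R i j x) = 0"
proof (cases "i = k")
  case False
  have j: "j < n" using x U_less by blast
  have "R i j x = P k i (R k j x)"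
    using P_R(3)[of k i j x] P_trivial_on_U[OF x, of k i] i j k False by simp
  then show ?thesis using D_P_swap(1)[of k i "R k j x"] i k by simp
qed (use k in simp)

lemma R_on_U0:
  assumes v: "U0 v" and ij: "i < n" "j < n" "i \<noteq> j"
  shows "U0 (R i j v - D j (R i j v))" "U j (D j (R i j v))"
proof -
  have "e l (R i j v) = R i j v" if "l < n" "l \<noteq> i" "l \<noteq> j" for l
    using eR[of i j l v] ij that v by simp
  note d = decomp[of i j "R i j v", OF this ij]
  show "U0 (R i j v - D j (R i j v))" "U j (D j (R i j v))"
    using d R_U0_fixed[OF v ij] by simp_all
qed

lemma target_decomp:
  assumes w: "U j w" and i: "i < n" "i \<noteq> j"
  shows "U i (D i (R i j w))" "U j (D j (R i j w))" "U0 (R i j w - D i (R i j w) - D j (R i j w))"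
proof -
  have j: "j < n" using w U_less by blast
  have "e l (R i j w) = R i j w" if "l < n" "l \<noteq> i" "l \<noteq> j" for l
    using eR[of i j l w] i j that w by simp
  from decomp[of i j "R i j w", OF this i(1) j i(2)]
  show "U i (D i (R i j w))" "U j (D j (R i j w))" "U0 (R i j w - D i (R i j w) - D j (R i j w))"
    by simp_all
qed

text \<open>Conjugating \<open>R j k\<close> by \<open>e j\<close> gives the move x_j \<mapsto>
  x_k^-1 x_j, and this is the Steinberg relation for it. The proof applies \<open>steinberg\<close>
  to \<open>e j (R i j v)\<close> and cancels with \<open>ReR\<close>.\<close>

lemma steinberg_signed:
  assumes "i < n" "j < n" "k < n" "i \<noteq> j" "i \<noteq> k" "j \<noteq> k"
  shows "R i j (e j (R j k (e j v))) = R i k (e j (R j k (e j (R i j v))))"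
proof -
  have a: "R i j (e j (R i j x)) = e j x" for x using ReR assms by simp
  have b: "R i k (e j x) = e j (R i k x)" for x using eR[of i k j x] assms by simp
  have c: "R i k (R j k x) = R j k (R i k x)" for x using R_comm[of i k j k x] assms by simp
  have "R j k (e j v) = R i j (R j k (R i k (e j (R i j v))))"
    using steinberg[of i j k "e j (R i j v)"] a assms by metis
  then have "R i j (e j (R j k (e j v))) = e j (R j k (R i k (e j (R i j v))))"
    using a by metis
  then show ?thesis unfolding b c .
qed

section \<open>Excluding vectors of size one that a move carries into U0\<close>

definition Zty :: "nat \<Rightarrow> 'v \<Rightarrow> bool" where
  "Zty j z \<longleftrightarrow> Xty j z \<and> (\<forall>i<n. i \<noteq> j \<longrightarrow> D i (R i j z) = 0)"

lemma Zty_U: "Zty j z \<Longrightarrow> U j z" unfolding Zty_def Xty_def by blast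

lemma Xty_P_swap:
  assumes "Xty a x" "b < n" "a \<noteq> b" shows "Xty b (P a b x)"
proof -
  have U: "U a x" and a: "a < n" using assms U_less unfolding Xty_def by auto
  obtain l where l: "l < n" "l \<noteq> a" "l \<noteq> b" by (rule fresh2)
  have "R b l (P a b x) = P a b (R a l x)"
    using P_R(3)[of a b l x] a assms l by simp
  then show ?thesis
    using Xty_I[OF U_P_swap(1)[OF a assms(2) U], of l] assms l unfolding Xty_def by simp
qed

lemma Zty_I:
  assumes x: "Xty j x" and k: "k < n" "k \<noteq> j" "D k (R k j x) = 0" shows "Zty j x"
  using target_zero_all[OF _ k] x unfolding Zty_def Xty_def by blast

lemma Zty_P_swap:
  assumes "Zty a z" "b < n" "a \<noteq> b" shows "Zty b (P a b z)"
proof -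
  have U: "U a z" and a: "a < n" using assms Zty_U U_less by blast+
  obtain l where l: "l < n" "l \<noteq> a" "l \<noteq> b" by (rule fresh2)
  have "R l b (P a b z) = P a b (R l a z)"
    using P_R(5)[of a b l z] a assms l by simp
  then have "D l (R l b (P a b z)) = 0"
    using D_P_swap(3)[of a b l] assms a l unfolding Zty_def by simp
  then show ?thesis using Zty_I[of b _ l] Xty_P_swap[of a z b] assms l unfolding Zty_def by blast
qed

text \<open>Write \<open>R b a z\<close> as C + E with C in \<open>U0\<close> and E in
  \<open>U a\<close>. The relation \<open>weyl\<close> becomes
  \<open>R a b (E - C) = P a b z\<close>, whose right side lies in \<open>U b\<close>; its
  \<open>U a\<close>-component is E by \<open>source_unipotent\<close> and
  \<open>R_U0_fixed\<close>, so E = 0. The second claim is then \<open>ReR\<close>.\<close>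

lemma Zty_R:
  assumes z: "Zty a z" and b: "b < n" "b \<noteq> a"
  shows "U0 (R b a z)" "R b a (R b a z) = - z"
proof -
  have Uz: "U a z" and a: "a < n" using z Zty_U U_less by blast+
  have Rz: "R a b z = z" using z b unfolding Zty_def Xty_def by simp
  note d = target_decomp[OF Uz b]
  have G: "D b (R b a z) = 0" using z b unfolding Zty_def by simp
  define C where "C = R b a z - D a (R b a z)"
  define E where "E = D a (R b a z)"
  have C: "U0 C" and E: "U a E" using d G unfolding C_def E_def by simp_all
  have RCE: "R b a z = C + E" unfolding C_def E_def by simp
  have "R a b (e a (R b a (e a (L a b z)))) = P a b (e b z)" using weyl a b by simp
  then have "R a b (E - C) = P a b z"
    using L_eq_R_on_U[OF Uz b(1) b(2)[symmetric]] Rz Uz C E RCE a b by simp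
  then have "D a (R a b E) - D a (R a b C) = D a (P a b z)" by (metis D_lin(2) R_lin(2))
  moreover have "D a (R a b C) = 0" using R_U0_fixed[OF C] a b by simp
  moreover have "D a (R a b E) = E" using source_unipotent[OF E] b by simp
  moreover have "D a (P a b z) = 0" using U_P_swap(1)[OF a b(1) Uz] a b by simp
  ultimately have E0: "E = 0" by simp
  then show U0: "U0 (R b a z)" using RCE C by simp
  have "R b a (e a (R b a z)) = e a z" using ReR a b by simp
  then show "R b a (R b a z) = - z" using U0 Uz a by simp
qed

text \<open>A nonzero such vector would generate \<open>n\<close> independent vectors in the spaces \<open>U i\<close> and one more
  for every pair of indices in \<open>U0\<close>, which exceeds the dimension.\<close>

lemma Zty_eq_0:
  assumes z: "Zty j z" shows "z = 0"
proof (rule ccontr)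
  assume z0: "z \<noteq> 0"
  have j: "j < n" using z Zty_U U_less by blast
  define w where "w a = (if a = j then z else P j a z)" for a
  have w: "Zty a (w a)" if "a < n" for a
    unfolding w_def using z Zty_P_swap[OF z that] by auto
  have w0: "w a \<noteq> 0" for a
    unfolding w_def using z0 PP[of j a z] P_lin(4) by (metis (full_types))
  have Uw: "U a (w a)" if "a < n" for a using Zty_U[OF w[OF that]] .
  have c: "U0 (R b a (w a))" "R b a (R b a (w a)) = - w a" if "a < n" "b < n" "b \<noteq> a" for a b
    using Zty_R[OF w] that by auto
  have wX: "R a b (w a) = w a" if "a < n" "b < n" "b \<noteq> a" for a b
    using w[OF that(1)] that unfolding Zty_def Xty_def by simp
  define S where "S = (SIGMA b:{..<n}. {..b})"
  \<comment> \<open>Off the diagonal a second application of \<open>R b a\<close> returns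
    \<open>- w a\<close>, which the projection to \<open>U a\<close> detects.\<close>
  define T where "T x v = (if snd x = fst x then D (snd x) v else D (snd x) (R (fst x) (snd x) v))" for x v
  define u where "u x = (if snd x = fst x then w (snd x) else R (fst x) (snd x) (w (snd x)))" for x
  have linD: "Vector_Spaces.linear scale scale (D k)" for k
  proof -
    have "linear_half": "Vector_Spaces.linear scale scale half"
      using linear_scale_self[of "1/2"] unfolding half_def[abs_def] by simp
    have "Vector_Spaces.linear scale scale (\<lambda>x. x)" using linear_id by (simp add: id_def)
    then show ?thesis unfolding D_def[abs_def]
      by (intro linear_comp[OF linear_half] linear_sub_add linear_e)
  qed
  \<comment> \<open>The cases are the ways in which the two pairs of indices can overlap: disjoint,
    common first, common second, or the first entry of one equal to the second of the other.\<close>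
  have sep: "D a (R b a (R d c (w c))) = 0"
    if lt: "a < b" "b < n" "c < d" "d < n" "(a, b) \<noteq> (c, d)" for a b c d
  proof -
    have ltn: "a < n" "c < n" using lt by auto
    consider "a \<noteq> c" "a \<noteq> d" "b \<noteq> c" "b \<noteq> d" | "a = c" "b \<noteq> d" | "b = d" "a \<noteq> c"
      | "a = d" "b \<noteq> c" | "b = c" "a \<noteq> d" using lt by (metis order.asym)
    then show ?thesis
    proof cases
      case 1
      have "R b a (R d c (w c)) = R d c (R b a (w c))" using R_comm[of b a d c] 1 lt ltn by simp
      also have "R b a (w c) = w c" using trivial_on_U[OF Uw] 1 lt ltn by simp
      finally show ?thesis using c lt ltn by simp
    next
      case 2
      have "R b d (e d (R d a (e d (w a)))) = R b a (e d (R d a (e d (R b d (w a)))))"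
        using steinberg_signed[of b d a] 2 lt ltn by simp
      moreover have "R b d (w a) = w a" using trivial_on_U[OF Uw] 2 lt ltn by simp
      ultimately have "R b d (R d a (w a)) = R b a (R d a (w a))"
        using c[of a d] Uw[of a] 2 lt ltn by simp
      moreover have "D a (R b d (R d a (w a))) = 0"
        using D_R[of b d a] c[of a d] 2 lt ltn by simp
      ultimately show ?thesis using 2 by simp
    next
      case 3
      \<comment> \<open>The right moves of x_b by x_a and by x_c do not commute, but a right and a
        left move do. The left move differs from the right one on \<open>w c\<close> by a sign
        only.\<close>
      have "R b a (L b c (w c)) = L b c (R b a (w c))" using RL_comm[of b a c] 3 lt ltn by simp
      also have "R b a (w c) = w c" using trivial_on_U[OF Uw] 3 lt ltn by simp
      finally have "R b a (L b c (w c)) = L b c (w c)" .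
      moreover have "L b c (w c) = - R b c (w c)"
        using L_eq[of b c "w c"] c[of c b] Uw[of c] 3 lt ltn by simp
      ultimately have "R b a (R b c (w c)) = R b c (w c)" by simp
      then show ?thesis using c[of c b] 3 lt ltn by simp
    next
      case 4
      have "R b a (e a (R a c (e a (w c)))) = R b c (e a (R a c (e a (R b a (w c)))))"
        using steinberg_signed[of b a c] 4 lt ltn by simp
      moreover have "R b a (w c) = w c" using trivial_on_U[OF Uw] 4 lt ltn by simp
      ultimately have "R b a (R a c (w c)) = R b c (R a c (w c))"
        using c[of c a] Uw[of c] 4 lt ltn by simp
      moreover have "D a (R b c (R a c (w c))) = 0"
        using D_R[of b c a] c[of c a] 4 lt ltn by simp
      ultimately show ?thesis using 4 by simp
    next
      case 5
      have "R b a (R d b (w b)) = R d b (R b a (R d a (w b)))"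
        using steinberg[of d b a] 5 lt ltn by simp
      also have "R d a (w b) = w b" using trivial_on_U[OF Uw] 5 lt ltn by simp
      also have "R b a (w b) = w b" using wX 5 lt ltn by simp
      finally show ?thesis using c[of b d] 5 lt ltn by simp
    qed
  qed
  have "card S \<le> dim UNIV"
  proof (rule card_le_dim_separated[of S T u])
    show "finite S" by (simp add: S_def)
    fix x assume "x \<in> S"
    then obtain a b where x: "x = (b, a)" "a \<le> b" "b < n" by (auto simp: S_def)
    have a: "a < n" using x by simp
    show "Vector_Spaces.linear scale scale (T x)"
      unfolding T_def[abs_def]
      by (cases "snd x = fst x") (simp_all add: linD linear_comp[OF linD linear_R])
    show "T x (u x) \<noteq> 0"
    proof (cases "a = b")
      case True
      then show ?thesis using w0 Uw[OF a] unfolding T_def u_def x(1) by simp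
    next
      case False
      then have "T x (u x) = D a (- w a)" unfolding T_def u_def x(1) using c[of a b] x a by simp
      also have "\<dots> = - w a" using Uw[OF a] by simp
      finally show ?thesis using w0[of a] by simp
    qed
    fix y assume y': "y \<in> S" "x \<noteq> y"
    then obtain c' d where y: "y = (d, c')" "c' \<le> d" "d < n" by (auto simp: S_def)
    have c': "c' < n" using y by simp
    have ne: "(a, b) \<noteq> (c', d)" using y' x y by auto
    show "T x (u y) = 0"
    proof (cases "a = b")
      case ab: True
      show ?thesis
      proof (cases "c' = d")
        case True
        then show ?thesis using ab ne Uw[OF c'] a unfolding T_def u_def x(1) y(1) by simp
      next
        case False
        then show ?thesis using ab c[of c' d] c' y a unfolding T_def u_def x(1) y(1) by simp
      qed
    next
      case ab: False
      show ?thesis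
      proof (cases "c' = d")
        case True
        consider "c' = a" | "c' = b" | "c' \<noteq> a" "c' \<noteq> b" by blast
        then have "D a (R b a (w c')) = 0"
        proof cases
          case 1 then show ?thesis using c[of a b] ab x a by simp
        next
          case 2
          then have "R b a (w c') = w c'" using wX[of b a] ab x a by simp
          then show ?thesis using Uw[OF c'] 2 ab a by simp
        next
          case 3
          then have "R b a (w c') = w c'" using trivial_on_U[OF Uw[OF c'], of b a] ab x a by simp
          then show ?thesis using Uw[OF c'] 3 a by simp
        qed
        then show ?thesis using ab True unfolding T_def u_def x(1) y(1) by simp
      next
        case False
        then have "D a (R b a (R d c' (w c'))) = 0" using sep[of a b c' d] ab ne x y by simp
        then show ?thesis using ab False unfolding T_def u_def x(1) y(1) by simp
      qed
    qed
  qed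
  moreover have "card S = (n + 1) choose 2"
  proof -
    have "card S = (\<Sum>b<n. Suc b)" unfolding S_def by (subst card_SigmaI) auto
    also have "\<dots> = n * (n + 1) div 2" by (induction n) auto
    also have "\<dots> = (n + 1) choose 2" by (simp add: choose_two)
    finally show ?thesis .
  qed
  ultimately show False using dim_lt by linarith
qed

text \<open>The standard part of b is fixed by \<open>R i j\<close>, so the hypothesis passes to the
  dual part, which is then of type \<open>Zty\<close> and vanishes.\<close>

lemma Fty_of_target_zero:
  assumes b: "U j b" and i: "i < n" "i \<noteq> j" "D i (R i j b) = 0"
  shows "Fty j b"
proof -
  obtain y x where yx: "b = y + x" "Fty j y" "Xty j x" using U_decomp[OF b] .
  have "U j y" using yx(2) unfolding Fty_def by blast
  then have "D i (R i j y) = 0" using Fty_fixed[OF yx(2) i(1,2)] i by simp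
  then have "D i (R i j x) = 0" using i(3) yx(1) by simp
  then have "x = 0" by (intro Zty_eq_0[OF Zty_I[OF yx(3) i(1,2)]])
  then show ?thesis using yx(1,2) by simp
qed

lemma Fty_U: "Fty j y \<Longrightarrow> U j y" unfolding Fty_def by blast
lemma Xty_U: "Xty j y \<Longrightarrow> U j y" unfolding Xty_def by blast

section \<open>Moves on U0\<close>

definition B :: "nat \<Rightarrow> nat \<Rightarrow> 'v \<Rightarrow> 'v" where "B i j v = D j (R i j v)"
text \<open>For v in \<open>U0\<close> the vector \<open>R i j v\<close> has no component in
  \<open>U i\<close>, by \<open>R_U0_fixed\<close>. So \<open>A\<close> is its part in
  \<open>U0\<close> and \<open>B\<close> its part in \<open>U j\<close>.\<close>

definition A :: "nat \<Rightarrow> nat \<Rightarrow> 'v \<Rightarrow> 'v" where "A i j v = R i j v - B i j v"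

lemma R_A_B: "R i j v = A i j v + B i j v" by (simp add: A_def)

lemma U0_A: "\<lbrakk>U0 v; i < n; j < n; i \<noteq> j\<rbrakk> \<Longrightarrow> U0 (A i j v)"
  and U_B: "\<lbrakk>U0 v; i < n; j < n; i \<noteq> j\<rbrakk> \<Longrightarrow> U j (B i j v)"
  using R_on_U0 unfolding A_def B_def by simp_all

text \<open>\<open>R k j\<close> commutes with \<open>R i j\<close>, and
  \<open>R i j (R k j v)\<close> has no component in \<open>U k\<close>. Neither has
  \<open>R k j (A i j v)\<close>, so \<open>R k j (B i j v)\<close> has none, and
  \<open>Fty_of_target_zero\<close> applies.\<close>

lemma Fty_B:
  assumes v: "U0 v" and ij: "i < n" "j < n" "i \<noteq> j"
  shows "Fty j (B i j v)"
proof -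
  obtain k where k: "k < n" "k \<noteq> i" "k \<noteq> j" by (rule fresh2)
  have "R k j (A i j v) + R k j (B i j v) = R i j (R k j v)"
    using R_comm[of k j i j v] R_A_B[of i j v] ij k by simp
  then have "D k (R k j (A i j v)) + D k (R k j (B i j v)) = D k (R i j (R k j v))"
    using D_lin(1)[of k] by metis
  moreover have "D k (R k j (A i j v)) = 0" using R_U0_fixed[OF U0_A[OF v ij]] ij k by simp
  moreover have "D k (R i j (R k j v)) = 0" using D_R[of i j k "R k j v"] R_U0_fixed[OF v k(1) ij(2) k(3)] ij k by simp
  ultimately have "D k (R k j (B i j v)) = 0" by simp
  then show ?thesis using Fty_of_target_zero[OF U_B[OF v ij] k(1) k(3)] by blast
qed

lemma R_B: "\<lbrakk>U0 v; i < n; j < n; i \<noteq> j; k < n; k \<noteq> j\<rbrakk> \<Longrightarrow> R k j (B i j v) = B i j v"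
  using Fty_fixed[OF Fty_B] by simp

lemma R_A:
  assumes v: "U0 v" and ij: "i < n" "j < n" "i \<noteq> j"
  shows "R i j (A i j v) = v + B i j v"
proof -
  have "e j (R i j v) = A i j v - B i j v"
    using U0_A[OF assms] U_B[OF assms] ij by (simp add: R_A_B)
  then have "R i j (A i j v - B i j v) = v" using ReR[of i j v] v ij by simp
  then have "R i j (A i j v) - B i j v = v" using R_B[OF v ij ij(1) ij(3)] by simp
  then show ?thesis by (simp add: algebra_simps)
qed

lemma B_A: "\<lbrakk>U0 v; i < n; j < n; i \<noteq> j\<rbrakk> \<Longrightarrow> B i j (A i j v) = B i j v"
  using R_A[of v i j] U_B[of v i j] by (simp add: B_def[of i j "A i j v"])

lemma A_A: "\<lbrakk>U0 v; i < n; j < n; i \<noteq> j\<rbrakk> \<Longrightarrow> A i j (A i j v) = v"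
  using R_A[of v i j] B_A[of v i j] by (simp add: A_def[of i j "A i j v"])

lemma same_target:
  assumes v: "U0 v" and d: "i < n" "j < n" "k < n" "i \<noteq> k" "j \<noteq> k" "i \<noteq> j"
  shows "A j k (A i k v) + (B j k (A i k v) + B i k v) = A i k (A j k v) + (B i k (A j k v) + B j k v)"
proof -
  have *: "R j k (R i k v) = A j k (A i k v) + (B j k (A i k v) + B i k v)"
    if "i < n" "j < n" "i \<noteq> k" "j \<noteq> k" for i j
    using R_A_B[of i k v] R_A_B[of j k "A i k v"] R_B[OF v, of i k j] that d by (simp add: add.assoc)
  show ?thesis using *[of i j] *[of j i] R_comm[of j k i k v] d by simp
qed

text \<open>Let X and Y be the changes of \<open>B j k\<close> and \<open>B i k\<close> caused by
  applying \<open>A i k\<close> and \<open>A j k\<close> first. The \<open>U k\<close>-components of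
  the commutation relation give X = Y at v and X + Y = 0 at \<open>A j k v\<close>.\<close>

lemma B_A_same_target:
  assumes v: "U0 v" and d: "i < n" "j < n" "k < n" "i \<noteq> k" "j \<noteq> k" "i \<noteq> j"
  shows "B j k (A i k v) = B j k v"
proof -
  have U: "U k (B j k x)" "U0 (A j k x)" "U k (B i k x)" "U0 (A i k x)" if "U0 x" for x
    using U_B U0_A that d by auto
  have eq: "B j k (A i k x) + B i k x = B i k (A j k x) + B j k x" if x: "U0 x" for x
  proof -
    have "D k (A j k (A i k x) + (B j k (A i k x) + B i k x))
       = D k (A i k (A j k x) + (B i k (A j k x) + B j k x))"
      using same_target[OF x d] by simp
    then show ?thesis using U x d by simp
  qed
  have "A j k (A i k v) = A i k (A j k v)"
    using same_target[OF v d] eq[OF v] by simp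
  then have "B j k (A i k (A j k v)) = B j k (A i k v)"
    using B_A[of "A i k v" j k] U v d by simp
  then have eq2: "B j k (A i k v) + B i k (A j k v) = B i k v + B j k v"
    using eq[of "A j k v"] A_A[of v j k] B_A[of v j k] U v d by simp
  have "(B j k (A i k v) - B j k v) + (B j k (A i k v) - B j k v)
      = (B j k (A i k v) + B i k v) - (B i k (A j k v) + B j k v)
        + ((B j k (A i k v) + B i k (A j k v)) - (B i k v + B j k v))"
    by (simp add: algebra_simps)
  also have "\<dots> = 0" unfolding eq[OF v] eq2 by simp
  finally show ?thesis using double_eq_0[of "B j k (A i k v) - B j k v"] by simp
qed

lemma L_on_U0:
  "\<lbrakk>U0 v; i < n; j < n; i \<noteq> j\<rbrakk> \<Longrightarrow> L i j v = A i j v - B i j v"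
  using L_eq[of i j v] U0_A[of v i j] U_B[of v i j] R_A_B[of i j v] by simp

text \<open>Two right moves of x_i by different generators do not commute, so the
  \<open>U k\<close>-components of the relation between \<open>R i j\<close> and
  \<open>L i k\<close> are compared instead.\<close>

lemma B_A_same_source:
  assumes v: "U0 v" and d: "i < n" "j < n" "k < n" "i \<noteq> j" "i \<noteq> k" "j \<noteq> k"
  shows "B i k (A i j v) = B i k v"
proof -
  have "R i j (L i k v) = L i k (R i j v)" using RL_comm d by simp
  moreover have "R i j (L i k v) = R i j (A i k v) - B i k v"
    using L_on_U0[OF v, of i k] trivial_on_U[OF U_B[OF v], of i k i j] d by simp
  moreover have "L i k (R i j v) = A i k (A i j v) - B i k (A i j v) + B i j v"
    using L_on_U0[OF U0_A[OF v], of i j i k] R_A_B[of i j v] L_trivial_on_U[OF U_B[OF v], of i j i k] d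
    by simp
  ultimately have "D k (R i j (A i k v)) - B i k v = D k (A i k (A i j v)) - D k (B i k (A i j v)) + D k (B i j v)"
    using U_B[OF v, of i k] d by (metis D_U(1) D_lin(1,2))
  moreover have "D k (R i j (A i k v)) = 0"
    using D_R[of i j k "A i k v"] U0_A[OF v, of i k] d by simp
  ultimately show ?thesis
    using U0_A[OF U0_A[OF v], of i j i k] U_B[OF U0_A[OF v], of i j i k] U_B[OF v, of i j] d by simp
qed

text \<open>The term with the exchange appears because \<open>B i j v\<close> is of standard type.
  The \<open>U k\<close>-components of the Steinberg relation at v and at \<open>A i j v\<close> add
  up to twice the claim.\<close>

lemma P_B:
  assumes v: "U0 v" and d: "i < n" "j < n" "k < n" "i \<noteq> j" "i \<noteq> k" "j \<noteq> k"
  shows "P j k (B i j v) = B i k v"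
proof -
  have s: "B j k (A i j x) + P j k (B i j x) = B j k x + B i k x" if x: "U0 x" for x
  proof -
    have "R j k (R i j x) = R i j (R j k (R i k x))" using steinberg d by simp
    moreover have "R j k (R i j x) = R j k (A i j x) + B i j x + P j k (B i j x)"
      using R_A_B[of i j x] R_F[of j k "B i j x"] Fty_B[OF x, of i j] d unfolding Fty_def by (simp add: add.assoc)
    moreover have "R i j (R j k (R i k x)) = R i j (A j k (A i k x)) + B j k x + B i k x"
    proof -
      have "R j k (R i k x) = A j k (A i k x) + B j k x + B i k x"
        using R_A_B[of i k x] R_A_B[of j k "A i k x"] R_B[OF x, of i k j] B_A_same_target[OF x, of i j k] d
        by simp
      then show ?thesis
        using trivial_on_U[OF U_B[OF x], of j k i j] trivial_on_U[OF U_B[OF x], of i k i j] d by simp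
    qed
    ultimately have "D k (R j k (A i j x) + B i j x + P j k (B i j x)) = D k (R i j (A j k (A i k x)) + B j k x + B i k x)"
      by simp
    moreover have "D k (R i j (A j k (A i k x))) = 0"
      using D_R[of i j k "A j k (A i k x)"] U0_A[OF U0_A[OF x], of i k j k] d by simp
    moreover have "D k (P j k (B i j x)) = P j k (B i j x)"
      using U_P_swap(1)[OF d(2,3) U_B[OF x, of i j]] d by simp
    ultimately show ?thesis
      using U_B[OF x, of i j] U_B[OF x, of j k] U_B[OF x, of i k] d unfolding B_def[of j k "A i j x"] by simp
  qed
  have s2: "B j k v + P j k (B i j v) = B j k (A i j v) + B i k v"
    using s[of "A i j v"] A_A[OF v, of i j] B_A[OF v, of i j] B_A_same_source[OF v, of i j k] U0_A[OF v, of i j] d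
    by simp
  have "(P j k (B i j v) - B i k v) + (P j k (B i j v) - B i k v)
      = (B j k (A i j v) + P j k (B i j v)) + (B j k v + P j k (B i j v))
        - (B j k v + B i k v) - (B j k (A i j v) + B i k v)"
    by (simp add: algebra_simps)
  also have "\<dots> = 0" unfolding s[OF v] s2 by simp
  finally show ?thesis using double_eq_0[of "P j k (B i j v) - B i k v"] by simp
qed

lemma sum_list_others:
  assumes "i < n" "i \<noteq> j"
  shows "sum_list (map f (i # filter (\<lambda>k. k \<noteq> i \<and> k \<noteq> j) [0..<n])) = (\<Sum>k\<in>{..<n} - {j}. f k)"
proof -
  have d: "distinct (i # filter (\<lambda>k. k \<noteq> i \<and> k \<noteq> j) [0..<n])" by simp
  have "set (i # filter (\<lambda>k. k \<noteq> i \<and> k \<noteq> j) [0..<n]) = {..<n} - {j}" using assms by auto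
  then show ?thesis using sum_list_distinct_conv_sum_set[OF d, of f] by (simp only:)
qed

text \<open>The sum consists of n - 1 equal terms, and n - 1 is invertible by
  \<open>nm1\<close>.\<close>

lemma vanishing:
  fixes f :: "nat \<Rightarrow> 'v"
  assumes s: "(\<Sum>k\<in>{..<n} - {j}. f k) = 0" and j: "j < n"
    and c: "\<And>k l. \<lbrakk>k < n; l < n; k \<noteq> j; l \<noteq> j; k \<noteq> l\<rbrakk> \<Longrightarrow> f k = f l" and i: "i < n" "i \<noteq> j"
  shows "f i = 0"
proof -
  have "(\<Sum>k\<in>{..<n} - {j}. f k) = (\<Sum>k\<in>{..<n} - {j}. f i)"
    by (rule sum.cong) (use c[of _ i] i in \<open>auto\<close>)
  also have "\<dots> = scale (of_nat (n - 1)) (f i)"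
    using j by (simp add: sum_constant_scale)
  finally show ?thesis using s nm1 by simp
qed

text \<open>On v the two sides of \<open>outer\<close> have the same part in \<open>U0\<close>, and
  their parts in \<open>U j\<close> are this sum and its negative.\<close>

lemma sum_B:
  assumes v: "U0 v" and j: "j < n"
  shows "(\<Sum>k\<in>{..<n} - {j}. B k j v) = 0"
proof -
  \<comment> \<open>The induction also records that a further factor still produces
    \<open>B k j v\<close>, by \<open>B_A_same_target\<close>, and fixes the sum collected so far.
    Hence the right product adds the terms and the left product subtracts them.\<close>
  have *: "foldr (\<lambda>k. A k j) xs v = foldr (\<lambda>k. A k j) xs v \<and> U0 (foldr (\<lambda>k. A k j) xs v)
      \<and> (\<forall>k<n. k \<noteq> j \<longrightarrow> k \<notin> set xs \<longrightarrow> B k j (foldr (\<lambda>k. A k j) xs v) = B k j v)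
      \<and> U j (sum_list (map (\<lambda>k. B k j v) xs))
      \<and> (\<forall>k<n. k \<noteq> j \<longrightarrow> R k j (sum_list (map (\<lambda>k. B k j v) xs)) = sum_list (map (\<lambda>k. B k j v) xs))
      \<and> foldr (\<lambda>k. R k j) xs v = foldr (\<lambda>k. A k j) xs v + sum_list (map (\<lambda>k. B k j v) xs)
      \<and> foldr (\<lambda>k. L k j) xs v = foldr (\<lambda>k. A k j) xs v - sum_list (map (\<lambda>k. B k j v) xs)"
    if "distinct xs" "\<forall>k\<in>set xs. k < n \<and> k \<noteq> j" for xs
    using that
  proof (induction xs)
    case Nil
    then show ?case using v j by simp
  next
    case (Cons k xs)
    define a where "a = foldr (\<lambda>k. A k j) xs v"
    define s where "s = sum_list (map (\<lambda>k. B k j v) xs)"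
    have k: "k < n" "k \<noteq> j" "k \<notin> set xs" using Cons.prems by auto
    have IH: "U0 a" "\<And>k. k < n \<Longrightarrow> k \<noteq> j \<Longrightarrow> k \<notin> set xs \<Longrightarrow> B k j a = B k j v" "U j s"
      "\<And>k. k < n \<Longrightarrow> k \<noteq> j \<Longrightarrow> R k j s = s"
      "foldr (\<lambda>k. R k j) xs v = a + s" "foldr (\<lambda>k. L k j) xs v = a - s"
      using Cons unfolding a_def s_def by auto
    have 1: "U0 (A k j a)" using U0_A IH(1) k j by simp
    have 2: "B l j (A k j a) = B l j v" if "l < n" "l \<noteq> j" "l \<notin> set (k # xs)" for l
      using B_A_same_target[OF IH(1), of k l j] IH(2)[of l] k j that by auto
    have 3: "U j (B k j v + s)" using U_B[OF v k(1) j k(2)] IH(3) by simp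
    have 4: "R l j (B k j v + s) = B k j v + s" if "l < n" "l \<noteq> j" for l
      using IH(4)[OF that] R_B[OF v k(1) j k(2) that] by simp
    have 5: "R k j (a + s) = A k j a + (B k j v + s)"
      using R_A_B[of k j a] IH(2)[OF k] IH(4)[OF k(1,2)] by (simp add: add.assoc)
    have "L k j s = s"
      using L_eq[of k j s] IH(3) IH(4)[OF k(1,2)] k j by simp
    then have 6: "L k j (a - s) = A k j a - (B k j v + s)"
      using L_on_U0[OF IH(1), of k j] IH(2)[OF k] k j by (simp add: algebra_simps)
    show ?case using 1 2 3 4 5 6 unfolding list.map foldr.simps sum_list.Cons comp_apply
      IH(5) IH(6) a_def[symmetric] s_def[symmetric] by blast
  qed
  obtain i where i: "i < n" "i \<noteq> j" by (rule fresh2)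
  let ?xs = "i # filter (\<lambda>k. k \<noteq> i \<and> k \<noteq> j) [0..<n]"
  let ?s = "sum_list (map (\<lambda>k. B k j v) ?xs)"
  have "distinct ?xs" "\<forall>k\<in>set ?xs. k < n \<and> k \<noteq> j" using i by auto
  from *[OF this]
  have "foldr (\<lambda>k. R k j) ?xs v = foldr (\<lambda>k. A k j) ?xs v + ?s"
    "foldr (\<lambda>k. L k j) ?xs v = foldr (\<lambda>k. A k j) ?xs v - ?s" by blast+
  moreover have "foldr (\<lambda>k. R k j) ?xs v = foldr (\<lambda>k. L k j) ?xs v"
    using outer[OF i(1) j i(2), of v] by simp
  ultimately have "foldr (\<lambda>k. A k j) ?xs v + ?s = foldr (\<lambda>k. A k j) ?xs v + - ?s"
    by (simp only: add_uminus_conv_diff)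
  then have "?s = - ?s" by (simp only: add_left_cancel)
  then have "?s = 0" by (simp only: eq_uminus_self)
  then show ?thesis using sum_list_others[OF i, of "\<lambda>k. B k j v"] by (simp only:)
qed

text \<open>The Steinberg relation gives \<open>P j k (B i j v) = B i k v\<close>, and the sum of all \<open>B i j v\<close> over \<open>i\<close> vanishes by
  \<open>outer\<close>. So \<open>B i j v\<close> does not depend on \<open>i\<close>, and \<open>n - 1\<close> times it vanishes.\<close>

lemma B_eq_0:
  assumes v: "U0 v" and ij: "i < n" "j < n" "i \<noteq> j"
  shows "B i j v = 0"
proof -
  \<comment> \<open>\<open>P_B\<close> covers the terms whose index is neither j nor k. Comparing
    the two vanishing sums for j and for k leaves just the remaining term of each.\<close>
  have sw: "P j k (B k j v) = B j k v" if jk: "j < n" "k < n" "j \<noteq> k" for j k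
  proof -
    have d: "{..<n} - {j} = insert k ({..<n} - {j, k})" "{..<n} - {k} = insert j ({..<n} - {j, k})"
      using jk by auto
    interpret P: Vector_Spaces.linear scale scale "P j k" by (rule linear_P)
    have "0 = P j k (\<Sum>i\<in>{..<n} - {j}. B i j v)" using sum_B[OF v jk(1)] by simp
    also have "\<dots> = P j k (B k j v) + (\<Sum>i\<in>{..<n} - {j, k}. P j k (B i j v))"
      unfolding d(1) P.sum by (subst sum.insert) auto
    also have "(\<Sum>i\<in>{..<n} - {j, k}. P j k (B i j v)) = (\<Sum>i\<in>{..<n} - {j, k}. B i k v)"
      by (rule sum.cong) (use P_B[OF v] jk in auto)
    finally have 1: "P j k (B k j v) + (\<Sum>i\<in>{..<n} - {j, k}. B i k v) = 0" by simp
    have "(\<Sum>i\<in>{..<n} - {k}. B i k v) = B j k v + (\<Sum>i\<in>{..<n} - {j, k}. B i k v)"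
      unfolding d(2) by (subst sum.insert) (use jk in auto)
    then show ?thesis using 1 sum_B[OF v jk(2)] by (metis add_right_cancel)
  qed
  have "B k j v = B l j v" if d: "k < n" "l < n" "k \<noteq> j" "l \<noteq> j" "k \<noteq> l" for k l
  proof -
    have "B l j v = P j l (B j l v)" using sw[of j l] d ij by (metis PP)
    also have "B j l v = P k l (B j k v)" using P_B[OF v, of j k l] d ij by simp
    also have "P j l (P k l (B j k v)) = P k j (P j l (B j k v))"
      using PPc[of j l k l "B j k v"] d ij by simp
    also have "P j l (B j k v) = B j k v" using P_trivial_on_U[OF U_B[OF v], of j k j l] d ij by simp
    also have "P k j (B j k v) = B k j v" using sw[of j k] d ij by (metis PP P_sym)
    finally show ?thesis by simp
  qed
  then show ?thesis by (rule vanishing[OF sum_B[OF v ij(2)] ij(2)]) (use ij in auto)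
qed

lemma U0_R: "\<lbrakk>U0 v; i < n; j < n; i \<noteq> j\<rbrakk> \<Longrightarrow> U0 (R i j v)"
  using U0_A R_A_B B_eq_0 by simp

lemma R_R_U0: "\<lbrakk>U0 v; i < n; j < n; i \<noteq> j\<rbrakk> \<Longrightarrow> R i j (R i j v) = v"
  using ReR[of i j v] U0_R[of v i j] by simp

section \<open>Moves whose target index carries the weight\<close>

definition G :: "nat \<Rightarrow> nat \<Rightarrow> 'v \<Rightarrow> 'v" where "G i j x = D i (R i j x)"
text \<open>For x of dual type this is the part of \<open>R i j x\<close> in \<open>U0\<close>, once
  \<open>target_diagonal\<close> shows that the part in \<open>U j\<close> is x.\<close>

definition C :: "nat \<Rightarrow> nat \<Rightarrow> 'v \<Rightarrow> 'v" where "C i j x = R i j x - x - G i j x"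

lemma R_C_G: "R i j x = C i j x + x + G i j x" by (simp add: C_def)

text \<open>Let E be the \<open>U j\<close>-component of \<open>R i j x\<close>. The Steinberg
  relation with a third index shows that E is again of dual type, and \<open>ReR\<close> that E and
  x have the same \<open>U i\<close>-component after the move. So \<open>E - x\<close> is of type
  \<open>Zty\<close>, hence zero.\<close>

lemma target_diagonal:
  assumes x: "Xty j x" and i: "i < n" "i \<noteq> j"
  shows "D j (R i j x) = x"
proof -
  note Ux = Xty_U[OF x]
  have j: "j < n" using Ux U_less by blast
  obtain k where k: "k < n" "k \<noteq> i" "k \<noteq> j" by (rule fresh2)
  note d = target_decomp[OF Ux i]
  define g where "g = D i (R i j x)"
  define E where "E = D j (R i j x)"
  define c where "c = R i j x - g - E"
  have mem: "U i g" "U j E" "U0 c" using d unfolding c_def E_def g_def by simp_all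
  have R: "R i j x = c + E + g" unfolding c_def by simp
  have "R j k (R i j x) = R i j (R j k (R i k x))" using steinberg i j k by simp
  also have "R i k x = x" using trivial_on_U[OF Ux] i j k by simp
  also have "R j k x = x" using x j k unfolding Xty_def by simp
  finally have "D k (R j k (c + E + g)) = 0"
    using D_R[of i j k x] Ux i j k unfolding R by simp
  moreover have "R j k g = g" using trivial_on_U[OF mem(1)] i j k by simp
  moreover have "R j k E = E + F j k E" by (rule R_F)
  ultimately have "F j k E = 0"
    using U0_R[OF mem(3), of j k] U_F[OF mem(2), of k] mem i j k by simp
  then have RE: "R j k E = E" by (simp add: R_F)
  have "R i j (e j (R i j x)) = e j x" using ReR i j by simp
  then have "R i j (c - E + g) = - x" using mem Ux i j unfolding R by simp
  then have "D i (R i j c) - D i (R i j E) + D i (R i j g) = D i (- x)" by (metis D_lin(1,2) R_lin(1,2))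
  moreover have "D i (R i j c) = 0" using R_U0_fixed[OF mem(3)] i j by simp
  moreover have "D i (R i j g) = g" using source_unipotent[OF mem(1)] i j by simp
  moreover have "D i (- x) = 0" using Ux i j by simp
  ultimately have "- D i (R i j E) + g = 0" by simp
  from neg_eq_iff_add_eq_0[THEN iffD2, OF this] have "D i (R i j E) = g" by simp
  then have DE: "D i (R i j (E - x)) = 0" unfolding g_def by simp
  have "Xty j (E - x)"
  proof (rule Xty_I[OF _ k(1,3)])
    have "R j k x = x" using x k unfolding Xty_def by blast
    then show "R j k (E - x) = E - x" using RE by simp
  qed (use mem(2) Ux in simp)
  then have "E - x = 0" using Zty_eq_0[OF Zty_I[OF _ i DE]] by blast
  then show ?thesis unfolding E_def by simp
qed

lemma U_G: "\<lbrakk>Xty j x; i < n; i \<noteq> j\<rbrakk> \<Longrightarrow> U i (G i j x)"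
  unfolding G_def by (rule target_decomp(1)[OF Xty_U])

lemma U0_C:
  assumes x: "Xty j x" and i: "i < n" "i \<noteq> j"
  shows "U0 (C i j x)"
proof -
  have "C i j x = R i j x - D i (R i j x) - D j (R i j x)"
    unfolding C_def G_def target_diagonal[OF assms] by (simp add: algebra_simps)
  then show ?thesis using target_decomp(3)[OF Xty_U[OF x] i] by (simp only:)
qed

text \<open>\<open>R j k\<close> and \<open>R i k\<close> are trivial on x, so the Steinberg
  relation shows that \<open>R j k\<close> fixes \<open>R i j x\<close>. The other two claims are
  the components in \<open>U0\<close> and \<open>U k\<close> of the relation between
  \<open>R i j\<close> and \<open>L i k\<close>.\<close>

lemma R_C_other:
  assumes x: "Xty j x" and ik: "i < n" "i \<noteq> j" "k < n" "k \<noteq> i" "k \<noteq> j"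
  shows "R j k (C i j x) = C i j x" "R i k (C i j x) = C i j x" "F i k (G i j x) = 0"
proof -
  note Ux = Xty_U[OF x] and c = U0_C[OF x ik(1,2)] and g = U_G[OF x ik(1,2)]
  have j: "j < n" using Ux U_less by blast
  have xk: "R j k x = x" using x ik unfolding Xty_def by simp
  have ikx: "R i k x = x" using trivial_on_U[OF Ux] ik j by simp
  have "R j k (R i j x) = R i j x" using steinberg[of i j k x] xk ikx ik j by simp
  moreover have "R j k (G i j x) = G i j x" using trivial_on_U[OF g] ik j by simp
  ultimately show "R j k (C i j x) = C i j x" using xk by (simp add: R_C_G[of i j x])
  have "R i j (L i k x) = L i k (R i j x)" using RL_comm ik j by simp
  moreover have "L i k x = x" using L_trivial_on_U[OF Ux] ik j by simp
  moreover have "L i k (G i j x) = G i j x + F i k (G i j x)"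
    using L_eq_R_on_U[OF g ik(3)] R_F ik by simp
  moreover have "L i k (C i j x) = R i k (C i j x)"
    using L_eq[of i k "C i j x"] U0_R[OF c, of i k] c ik by simp
  ultimately have eq: "C i j x = R i k (C i j x) + F i k (G i j x)"
    using ik by (simp add: R_C_G[of i j x])
  have "D k (C i j x) = D k (R i k (C i j x)) + D k (F i k (G i j x))"
    using arg_cong[OF eq, of "D k"] by (simp only: D_lin)
  then show F0: "F i k (G i j x) = 0"
    using U0_R[OF c, of i k] U_F[OF g, of k] c ik by simp
  then show "R i k (C i j x) = C i j x" using eq by simp
qed

lemma Xty_G:
  assumes x: "Xty j x" and i: "i < n" "i \<noteq> j" shows "Xty i (G i j x)"
proof -
  obtain k where k: "k < n" "k \<noteq> i" "k \<noteq> j" by (rule fresh2)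
  then show ?thesis
    using Xty_I[OF U_G[OF assms], of k] R_C_other(3)[OF x i k(1)] by (simp add: F_def)
qed

lemma R_C_self:
  assumes x: "Xty j x" and i: "i < n" "i \<noteq> j"
  shows "R i j (C i j x) = C i j x"
proof -
  note Ux = Xty_U[OF x] and c = U0_C[OF x i] and g = U_G[OF x i]
  have j: "j < n" using Ux U_less by blast
  have gg: "R i j (G i j x) = G i j x" using Xty_G[OF x i] i j unfolding Xty_def by simp
  have "e j (R i j x) = C i j x - x + G i j x"
    using c g Ux i j by (simp add: R_C_G[of i j x])
  then have "R i j (C i j x - x + G i j x) = e j x" using ReR[of i j x] i j by simp
  then have "R i j (C i j x) - R i j x + G i j x = - x" using Ux gg by simp
  then show ?thesis by (simp add: R_C_G[of i j x] algebra_simps)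
qed

text \<open>The moves \<open>R k j\<close> and \<open>R i j\<close> commute on x. Their relation and
  its image under \<open>R k j\<close> differ by twice the claim.\<close>

lemma R_C_same_target:
  assumes x: "Xty j x" and d: "i < n" "k < n" "i \<noteq> j" "k \<noteq> j" "i \<noteq> k"
  shows "R k j (C i j x) = C i j x"
proof -
  note Ux = Xty_U[OF x]
  have j: "j < n" using Ux U_less by blast
  have *: "R k j (R i j x) = R k j (C i j x) + C k j x + x + G k j x + G i j x"
    if "i < n" "k < n" "i \<noteq> j" "k \<noteq> j" "i \<noteq> k" for i k
  proof -
    have "R k j (G i j x) = G i j x" using trivial_on_U[OF U_G[OF x]] that j by simp
    then show ?thesis by (simp add: R_C_G[of i j x] R_C_G[of k j x] add.assoc)
  qed
  have c: "U0 (C i j x)" "U0 (C k j x)" using U0_C[OF x] d by auto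
  have "R k j (R i j x) = R i j (R k j x)" using R_comm[of k j i j x] d j by simp
  then have 1: "R k j (C i j x) + C k j x = R i j (C k j x) + C i j x"
    using *[of i k] *[of k i] d by (simp add: algebra_simps)
  have "R k j (R k j (C i j x) + C k j x) = R k j (R i j (C k j x) + C i j x)" using 1 by simp
  then have 2: "C i j x + C k j x = R i j (C k j x) + R k j (C i j x)"
    using R_R_U0[OF c(1), of k j] R_C_self[OF x, of k] R_comm[of k j i j "C k j x"] d j by simp
  have "(R k j (C i j x) - C i j x) + (R k j (C i j x) - C i j x)
     = (R k j (C i j x) + C k j x - (R i j (C k j x) + C i j x))
       - (C i j x + C k j x - (R i j (C k j x) + R k j (C i j x)))"
    by (simp add: algebra_simps)
  also have "\<dots> = 0" unfolding 1 2 by simp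
  finally show ?thesis using double_eq_0[of "R k j (C i j x) - C i j x"] by simp
qed

text \<open>The components in \<open>U0\<close> and \<open>U i\<close> of
  \<open>steinberg_signed\<close> applied to x.\<close>

lemma signed_steinberg_C:
  assumes x: "Xty k x" and d: "i < n" "j < n" "i \<noteq> j" "i \<noteq> k" "j \<noteq> k"
  shows "R i j (C j k x) - C i j (G j k x) = C j k x + C i k x"
    and "G i j (G j k x) = - G i k x"
proof -
  note Ux = Xty_U[OF x]
  have k: "k < n" using Ux U_less by blast
  let ?u = "G j k x"
  have u: "Xty j ?u" "U j ?u" using Xty_G[OF x] U_G[OF x] d by auto
  have c: "U0 (C j k x)" "U0 (C i k x)" "U0 (C i j ?u)" using U0_C[OF x] U0_C[OF u(1)] d by auto
  have M: "e j (R j k x) = C j k x + x - ?u"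
    using c u Ux d by (simp add: R_C_G[of j k x])
  have "R i j (e j (R j k (e j x))) = R i k (e j (R j k (e j (R i j x))))"
    using steinberg_signed d k by simp
  moreover have "R i j x = x" using trivial_on_U[OF Ux] d k by simp
  ultimately have "R i j (C j k x + x - ?u) = R i k (C j k x + x - ?u)"
    using Ux d M by simp
  moreover have "R i j (C j k x + x - ?u) = R i j (C j k x) + x - (C i j ?u + ?u + G i j ?u)"
    using \<open>R i j x = x\<close> by (simp add: R_C_G[of i j ?u])
  moreover have "R i k (C j k x + x - ?u) = C j k x + (C i k x + x + G i k x) - ?u"
    using R_C_same_target[OF x, of j i] trivial_on_U[OF u(2), of i k] d k by (simp add: R_C_G[of i k x])
  ultimately have eq: "R i j (C j k x) + x - (C i j ?u + ?u + G i j ?u)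
     = C j k x + (C i k x + x + G i k x) - ?u" by simp
  have "D i (R i j (C j k x)) = 0" using U0_R[OF c(1)] d by simp
  then have g: "- G i j ?u = G i k x"
    using arg_cong[OF eq, of "D i"] c u Ux U_G[OF x, of i] U_G[OF u(1), of i] d by simp
  then show "G i j ?u = - G i k x" by (metis minus_minus)
  from eq have "(R i j (C j k x) - C i j ?u) + - G i j ?u = (C j k x + C i k x) + G i k x"
    by (simp add: algebra_simps)
  then show "R i j (C j k x) - C i j ?u = C j k x + C i k x" unfolding g by simp
qed

text \<open>\<open>R i j\<close> fixes both \<open>C i j (G j k x)\<close> and
  \<open>C i k x\<close> and is an involution on \<open>U0\<close>. Subtracting from the preceding
  identity its image under \<open>R i j\<close> gives twice the claim.\<close>

lemma C_G:
  assumes x: "Xty k x" and d: "i < n" "j < n" "i \<noteq> j" "i \<noteq> k" "j \<noteq> k"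
  shows "C i j (G j k x) = - C i k x"
proof -
  note Ux = Xty_U[OF x]
  have k: "k < n" using Ux U_less by blast
  let ?u = "G j k x"
  have u: "Xty j ?u" using Xty_G[OF x] d by auto
  have c: "U0 (C j k x)" using U0_C[OF x] d by auto
  note eq = signed_steinberg_C(1)[OF x d]
  have "R i j (R i j (C j k x) - C i j ?u) = R i j (C j k x + C i k x)" using eq by simp
  then have eq2: "C j k x - C i j ?u = R i j (C j k x) + C i k x"
    using R_R_U0[OF c, of i j] R_C_self[OF u, of i] R_C_other(2)[OF x, of i j] d by simp
  have "(C i j ?u + C i k x) + (C i j ?u + C i k x)
     = (C j k x + C i k x - (R i j (C j k x) - C i j ?u))
       - (C j k x - C i j ?u - (R i j (C j k x) + C i k x))"
    by (simp add: algebra_simps)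
  also have "\<dots> = 0" unfolding eq eq2 by simp
  finally show ?thesis using double_eq_0 eq_neg_iff_add_eq_0 by blast
qed

text \<open>The action is that of the dual representation up to the part \<open>C\<close>. The rule
  for composing \<open>G\<close> makes \<open>x + P j k (G j k x)\<close> a vector of type
  \<open>Zty\<close>.\<close>

lemma G_eq_P:
  assumes x: "Xty k x" and d: "j < n" "j \<noteq> k"
  shows "G j k x = - P j k x"
proof -
  note Ux = Xty_U[OF x]
  have k: "k < n" using Ux U_less by blast
  obtain i where i: "i < n" "i \<noteq> j" "i \<noteq> k" by (rule fresh2)
  let ?u = "G j k x"
  have u: "Xty j ?u" using Xty_G[OF x] d by auto
  have Pu: "Xty k (P j k ?u)" using Xty_P_swap[OF u k] d by simp
  have "R i k (P j k ?u) = P j k (R i j ?u)" using P_R(5)[of j k i ?u] d k i by simp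
  then have "D i (R i k (P j k ?u)) = P j k (G i j ?u)"
    unfolding G_def[of i j] using D_P_swap(3)[of j k i] d k i by simp
  also have "\<dots> = - G i k x"
    using signed_steinberg_C(2)[OF x i(1) d(1)] P_trivial_on_U[OF U_G[OF x], of i j k] d k i by simp
  finally have DE: "D i (R i k (x + P j k ?u)) = 0" by (simp add: G_def)
  have "Xty k (x + P j k ?u)" using x Pu unfolding Xty_def by simp
  then have "x + P j k ?u = 0" using Zty_eq_0[OF Zty_I[OF _ i(1,3) DE]] by blast
  then have "P j k (x + P j k ?u) = 0" by simp
  then have "P j k x + ?u = 0" by (simp add: PP)
  then show ?thesis by (simp add: eq_neg_iff_add_eq_0 add.commute)
qed

lemma C_P:
  assumes "Xty k x" "i < n" "j < n" "i \<noteq> j" "i \<noteq> k" "j \<noteq> k"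
  shows "C i j (P j k x) = C i k x"
proof -
  have "C i j (- P j k x) = - C i k x" using C_G[OF assms] G_eq_P[OF assms(1,3,6)] by simp
  moreover have "C i j (- P j k x) = - C i j (P j k x)" by (simp add: C_def G_def)
  ultimately show ?thesis by simp
qed

text \<open>The argument of \<open>sum_B\<close> on the dual part: the two sides of
  \<open>outer\<close> have the same components outside \<open>U0\<close>, and their components in
  \<open>U0\<close> are this sum and its negative.\<close>

lemma sum_C:
  assumes x: "Xty j x"
  shows "(\<Sum>k\<in>{..<n} - {j}. C k j x) = 0"
proof -
  note Ux = Xty_U[OF x]
  have j: "j < n" using Ux U_less by blast
  have *: "U0 (sum_list (map (\<lambda>k. C k j x) xs))
      \<and> (\<forall>l<n. l \<noteq> j \<longrightarrow> R l j (sum_list (map (\<lambda>k. C k j x) xs)) = sum_list (map (\<lambda>k. C k j x) xs))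
      \<and> (\<forall>l<n. l \<noteq> j \<longrightarrow> l \<notin> set xs \<longrightarrow>
            R l j (sum_list (map (\<lambda>k. G k j x) xs)) = sum_list (map (\<lambda>k. G k j x) xs)
          \<and> L l j (sum_list (map (\<lambda>k. G k j x) xs)) = sum_list (map (\<lambda>k. G k j x) xs))
      \<and> foldr (\<lambda>k. R k j) xs x = x + sum_list (map (\<lambda>k. G k j x) xs) + sum_list (map (\<lambda>k. C k j x) xs)
      \<and> foldr (\<lambda>k. L k j) xs x = x + sum_list (map (\<lambda>k. G k j x) xs) - sum_list (map (\<lambda>k. C k j x) xs)"
    if "distinct xs" "\<forall>k\<in>set xs. k < n \<and> k \<noteq> j" for xs
    using that
  proof (induction xs)
    case Nil
    then show ?case using j by simp
  next
    case (Cons k xs)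
    define g where "g = sum_list (map (\<lambda>k. G k j x) xs)"
    define s where "s = sum_list (map (\<lambda>k. C k j x) xs)"
    have k: "k < n" "k \<noteq> j" "k \<notin> set xs" using Cons.prems by auto
    have IH: "U0 s" "\<And>l. l < n \<Longrightarrow> l \<noteq> j \<Longrightarrow> R l j s = s"
      "\<And>l. l < n \<Longrightarrow> l \<noteq> j \<Longrightarrow> l \<notin> set xs \<Longrightarrow> R l j g = g"
      "\<And>l. l < n \<Longrightarrow> l \<noteq> j \<Longrightarrow> l \<notin> set xs \<Longrightarrow> L l j g = g"
      "foldr (\<lambda>k. R k j) xs x = x + g + s" "foldr (\<lambda>k. L k j) xs x = x + g - s"
      using Cons unfolding g_def s_def by auto
    note c = U0_C[OF x k(1,2)]
    have 1: "U0 (C k j x + s)" using c IH(1) by simp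
    have "R l j (C k j x) = C k j x" if "l < n" "l \<noteq> j" for l
      using R_C_self[OF x k(1,2)] R_C_same_target[OF x, of k l] k that by (cases "l = k") auto
    then have 2: "R l j (C k j x + s) = C k j x + s" if "l < n" "l \<noteq> j" for l
      using IH(2)[OF that] that by simp
    have 3: "R l j (G k j x + g) = G k j x + g" "L l j (G k j x + g) = G k j x + g"
      if "l < n" "l \<noteq> j" "l \<notin> set (k # xs)" for l
      using trivial_on_U[OF U_G[OF x k(1,2)], of l j] L_trivial_on_U[OF U_G[OF x k(1,2)], of l j]
        IH(3)[of l] IH(4)[of l] k j that by auto
    have 4: "R k j (x + g + s) = x + (G k j x + g) + (C k j x + s)"
      using IH(2)[OF k(1,2)] IH(3)[OF k] by (simp add: R_C_G[of k j x] algebra_simps)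
    have "L k j x = x + G k j x - C k j x"
      using L_eq[of k j x] Ux c U_G[OF x k(1,2)] k j by (simp add: R_C_G[of k j x])
    moreover have "L k j s = s"
      using L_eq[of k j s] IH(1) IH(2)[OF k(1,2)] k j by simp
    ultimately have 5: "L k j (x + g - s) = x + (G k j x + g) - (C k j x + s)"
      using IH(4)[OF k] k j by (simp add: algebra_simps)
    show ?case using 1 2 3 4 5 unfolding list.map foldr.simps sum_list.Cons comp_apply
      IH(5) IH(6) g_def[symmetric] s_def[symmetric] by blast
  qed
  obtain i where i: "i < n" "i \<noteq> j" by (rule fresh2)
  let ?xs = "i # filter (\<lambda>k. k \<noteq> i \<and> k \<noteq> j) [0..<n]"
  let ?s = "sum_list (map (\<lambda>k. C k j x) ?xs)" and ?g = "sum_list (map (\<lambda>k. G k j x) ?xs)"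
  have "distinct ?xs" "\<forall>k\<in>set ?xs. k < n \<and> k \<noteq> j" using i by auto
  from *[OF this]
  have "foldr (\<lambda>k. R k j) ?xs x = (x + ?g) + ?s" "foldr (\<lambda>k. L k j) ?xs x = (x + ?g) - ?s" by blast+
  moreover have "foldr (\<lambda>k. R k j) ?xs x = foldr (\<lambda>k. L k j) ?xs x"
    using outer[OF i(1) j i(2), of x] by simp
  ultimately have "(x + ?g) + ?s = (x + ?g) + - ?s"
    by (simp only: add_uminus_conv_diff)
  then have "?s = - ?s" by (simp only: add_left_cancel)
  then have "?s = 0" by (simp only: eq_uminus_self)
  then show ?thesis using sum_list_others[OF i, of "\<lambda>k. C k j x"] by (simp only:)
qed

text \<open>As for \<open>B_eq_0\<close>, with \<open>C_P\<close> in place of \<open>P_B\<close>: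
  the terms of the vanishing sum do not depend on the first index.\<close>

lemma C_eq_0:
  assumes x: "Xty k x" and i: "i < n" "i \<noteq> k"
  shows "C i k x = 0"
proof -
  have k: "k < n" using Xty_U[OF x] U_less by blast
  have sw: "C k j (P j k x) = C j k x" if j: "j < n" "j \<noteq> k" for j
  proof -
    have d: "{..<n} - {j} = insert k ({..<n} - {j, k})" "{..<n} - {k} = insert j ({..<n} - {j, k})"
      using j k by auto
    have "Xty j (P j k x)" using Xty_P_swap[OF x, of j] j P_sym[of k j x] by simp
    from sum_C[OF this] have "0 = (\<Sum>i\<in>{..<n} - {j}. C i j (P j k x))" by simp
    also have "\<dots> = C k j (P j k x) + (\<Sum>i\<in>{..<n} - {j, k}. C i j (P j k x))"
      unfolding d(1) by (subst sum.insert) auto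
    also have "(\<Sum>i\<in>{..<n} - {j, k}. C i j (P j k x)) = (\<Sum>i\<in>{..<n} - {j, k}. C i k x)"
      by (rule sum.cong) (use C_P[OF x] j k in auto)
    finally have 1: "C k j (P j k x) + (\<Sum>i\<in>{..<n} - {j, k}. C i k x) = 0" by simp
    have "(\<Sum>i\<in>{..<n} - {k}. C i k x) = C j k x + (\<Sum>i\<in>{..<n} - {j, k}. C i k x)"
      unfolding d(2) by (subst sum.insert) (use j in auto)
    then show ?thesis using 1 sum_C[OF x] by (metis add_right_cancel)
  qed
  have "C j k x = C l k x" if d: "j < n" "l < n" "j \<noteq> k" "l \<noteq> k" "j \<noteq> l" for j l
  proof -
    have X: "Xty j (P j k x)" using Xty_P_swap[OF x, of j] d P_sym[of k j x] by simp
    have "C j k x = C k j (P j k x)" using sw d by simp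
    also have "\<dots> = C k l (P l j (P j k x))" using C_P[OF X, of k l] d k by simp
    also have "P l j (P j k x) = P l k (P l j x)" using PPc[of l j j k x] d k by simp
    also have "P l j x = x" using P_trivial_on_U[OF Xty_U[OF x]] d by simp
    also have "C k l (P l k x) = C l k x" using sw d by simp
    finally show ?thesis .
  qed
  then show ?thesis by (rule vanishing[OF sum_C[OF x] k]) (use i in auto)
qed

theorem R_eq_L_U0:
  assumes v: "U0 v" and ij: "i < n" "j < n" "i \<noteq> j"
  shows "R i j v = L i j v"
  using L_on_U0[OF assms] R_A_B[of i j v] B_eq_0[OF assms] by simp

text \<open>If k = j, the standard part is fixed by the move. The dual part x goes to
  \<open>x + G i j x\<close>, and \<open>e i\<close> followed by \<open>e j\<close> negates both
  terms as well as x, so the signs cancel in \<open>L_eq\<close>.\<close>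

theorem R_eq_L_U:
  assumes w: "U k w" and ij: "i < n" "j < n" "i \<noteq> j"
  shows "R i j w = L i j w"
proof -
  consider "k = i" | "k = j" | "k \<noteq> i" "k \<noteq> j" by blast
  then show ?thesis
  proof cases
    case 1
    then show ?thesis using L_eq_R_on_U[of i w j] w ij by simp
  next
    case 2
    obtain y x where yx: "w = y + x" "Fty j y" "Xty j x" using U_decomp w 2 by blast
    have y: "R i j y = y" using Fty_fixed[OF yx(2)] ij by simp
    have Rx: "R i j x = x + G i j x"
      using R_C_G[of i j x] C_eq_0[OF yx(3) ij(1,3)] by simp
    have "L i j x = R i j x"
      using L_eq[OF ij, of x] Rx U_G[OF yx(3) ij(1,3)] Xty_U[OF yx(3)] ij by simp
    moreover have "L i j y = y" using L_eq[OF ij, of y] y Fty_U[OF yx(2)] ij by simp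
    ultimately show ?thesis using y yx(1) ij by simp
  next
    case 3
    then show ?thesis using L_trivial_on_U[OF w] trivial_on_U[OF w] ij by simp
  qed
qed

end

section \<open>Which sizes of weights can occur\<close>

context signed_rep begin

definition occ :: "nat set \<Rightarrow> bool" where
  "occ I \<longleftrightarrow> I \<subseteq> {..<n} \<and> (\<exists>v. v \<noteq> 0 \<and> wt I v)"

text \<open>The projection to the weights that agree with \<open>I\<close> below k, up to a power of
  2.\<close>

fun proj :: "nat set \<Rightarrow> nat \<Rightarrow> 'v \<Rightarrow> 'v" where
  "proj I 0 x = x"
| "proj I (Suc k) x = (if k \<in> I then proj I k x - e k (proj I k x) else proj I k x + e k (proj I k x))"

lemma linear_proj: "Vector_Spaces.linear scale scale (proj I k)"
proof (induction k)
  case 0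
  have "proj I 0 = (\<lambda>x. x)" by (simp add: fun_eq_iff)
  then show ?case using linear_id by (simp add: id_def)
next
  case (Suc k)
  have "proj I (Suc k) = (\<lambda>x. if k \<in> I then proj I k x - e k (proj I k x) else proj I k x + e k (proj I k x))"
    by (simp add: fun_eq_iff)
  then show ?case
    using linear_sub_add[OF Suc linear_comp[OF linear_e Suc]] by (cases "k \<in> I") simp_all
qed

lemma proj_wt:
  assumes v: "wt J v" and k: "k \<le> n"
  shows "\<exists>c. proj I k v = scale c v \<and> (c \<noteq> 0 \<longleftrightarrow> (\<forall>i<k. i \<in> I \<longleftrightarrow> i \<in> J))"
  using k
proof (induction k)
  case 0
  show ?case by (rule exI[of _ 1]) simp
next
  case (Suc k)
  then have "k \<le> n" by simp
  from Suc.IH[OF this] obtain c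
    where c: "proj I k v = scale c v" "c \<noteq> 0 \<longleftrightarrow> (\<forall>i<k. i \<in> I \<longleftrightarrow> i \<in> J)" by blast
  have ek: "e k v = (if k \<in> J then - v else v)"
    by (rule v[unfolded wt_def, rule_format]) (use Suc.prems in simp)
  have dbl: "scale c v + scale c v = scale (2 * c) v"
    by (simp only: mult_2 scale_left_distrib)
  show ?case
  proof (cases "k \<in> I \<longleftrightarrow> k \<in> J")
    case True
    then have "proj I (Suc k) v = scale c v + scale c v" using c(1) ek by (cases "k \<in> J") simp_all
    then have "proj I (Suc k) v = scale (2 * c) v" by (simp only: dbl)
    moreover have "2 * c \<noteq> 0 \<longleftrightarrow> (\<forall>i<Suc k. i \<in> I \<longleftrightarrow> i \<in> J)"
      using c True two by (auto simp: less_Suc_eq)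
    ultimately show ?thesis by blast
  next
    case False
    then have "proj I (Suc k) v = scale 0 v" using c(1) ek by (cases "k \<in> J") simp_all
    then show ?thesis using False by blast
  qed
qed

lemma card_occ: "card {I. occ I} \<le> dim UNIV"
proof -
  have fin: "finite {I. occ I}"
    by (rule finite_subset[of _ "Pow {..<n}"]) (auto simp: occ_def)
  define u where "u I = (SOME v. v \<noteq> 0 \<and> wt I v)" for I
  have u: "u I \<noteq> 0" "wt I (u I)" if "occ I" for I
    using someI_ex[of "\<lambda>v. v \<noteq> 0 \<and> wt I v"] that unfolding occ_def u_def by auto
  show ?thesis
  proof (rule card_le_dim_separated[OF fin, of "\<lambda>I. proj I n" u])
    fix I J assume IJ: "I \<in> {I. occ I}" "J \<in> {I. occ I}" "I \<noteq> J"
    then have "\<not> (\<forall>i<n. i \<in> I \<longleftrightarrow> i \<in> J)" unfolding occ_def by blast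
    then show "proj I n (u J) = 0" using proj_wt[OF u(2), of J n I] IJ by auto
  next
    fix I assume "I \<in> {I. occ I}"
    then show "proj I n (u I) \<noteq> 0" using proj_wt[OF u(2), of I n I] u(1) by auto
  qed (rule linear_proj)
qed

lemma wt_P:
  assumes v: "wt I v" and ab: "a < n" "b < n"
  shows "wt (transpose a b ` I) (P a b v)"
  unfolding wt_def
proof (intro allI impI)
  fix i assume i: "i < n"
  let ?i = "transpose a b i"
  have "?i < n" using i ab by (auto simp: transpose_def)
  then have "e i (P a b v) = P a b (e ?i v)" "e ?i v = (if ?i \<in> I then - v else v)"
    using Pe[of a b ?i v] v ab unfolding wt_def by auto
  moreover have "i \<in> transpose a b ` I \<longleftrightarrow> ?i \<in> I"
    by (metis imageE image_eqI transpose_involutory)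
  ultimately show "e i (P a b v) = (if i \<in> transpose a b ` I then - P a b v else P a b v)" by auto
qed

text \<open>Exchanges permute the weight spaces; each one replaces an element of \<open>I\<close>
  outside \<open>J\<close> by one of \<open>J\<close> outside \<open>I\<close>.\<close>

lemma occ_same_card:
  assumes "occ I" "J \<subseteq> {..<n}" "card J = card I"
  shows "occ J"
  using assms
proof (induction "card (I - J)" arbitrary: I rule: less_induct)
  case less
  have I: "I \<subseteq> {..<n}" using less.prems(1) unfolding occ_def by blast
  have fin: "finite I" "finite J" using I less.prems(2) finite_subset by blast+
  show ?case
  proof (cases "I \<subseteq> J")
    case True
    then have "I = J" using card_subset_eq[OF fin(2)] less.prems(3) by simp
    then show ?thesis using less.prems(1) by simp
  next
    case False
    then obtain a where a: "a \<in> I" "a \<notin> J" by blast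
    have "\<not> J \<subseteq> I" using card_subset_eq[OF fin(1), of J] less.prems(3) a by auto
    then obtain b where b: "b \<in> J" "b \<notin> I" by blast
    have ab: "a < n" "b < n" "a \<noteq> b" using a b I less.prems(2) by auto
    define I' where "I' = transpose a b ` I"
    have I': "I' = insert b (I - {a})"
    proof -
      have "transpose a b ` (I - {a}) = I - {a}" using b by (auto simp: transpose_def image_iff)
      then show ?thesis using a(1) unfolding I'_def by (metis image_insert insert_Diff transpose_apply_first)
    qed
    obtain v where v: "v \<noteq> 0" "wt I v" using less.prems(1) unfolding occ_def by blast
    have "P a b v \<noteq> 0" using v(1) PP[of a b v] by auto
    then have "occ I'" unfolding occ_def using wt_P[OF v(2) ab(1,2)] I ab I' I'_def by auto
    moreover have "card I' = card I" unfolding I'_def by (rule card_image) (rule inj_on_transpose)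
    moreover have "card (I' - J) < card (I - J)"
    proof -
      have "I' - J = (I - J) - {a}" using I' a b by auto
      moreover have "card ((I - J) - {a}) < card (I - J)"
        by (rule card_Diff1_less) (use a fin in auto)
      ultimately show ?thesis by (simp only:)
    qed
    ultimately show ?thesis using less.hyps less.prems by simp
  qed
qed

definition level :: "nat \<Rightarrow> bool" where "level k \<longleftrightarrow> (\<exists>I. occ I \<and> card I = k)"

lemma level_le: "level k \<Longrightarrow> k \<le> n"
  unfolding level_def occ_def using card_mono[of "{..<n}"] by auto

lemma levels_bound:
  assumes "level j" "level k" "j \<noteq> k"
  shows "(n choose j) + (n choose k) < (n + 1) choose 2"
proof -
  let ?S = "\<lambda>k. {I. I \<subseteq> {..<n} \<and> card I = k}"
  have fin: "finite (?S k)" for k by (rule finite_subset[of _ "Pow {..<n}"]) auto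
  have S: "card (?S k) = n choose k" for k using n_subsets[of "{..<n}" k] by simp
  have sub: "?S l \<subseteq> {I. occ I}" if "level l" for l
  proof
    fix J assume "J \<in> ?S l"
    then have J: "J \<subseteq> {..<n}" "card J = l" by simp_all
    obtain I where I: "occ I" "card I = l" using \<open>level l\<close> unfolding level_def by blast
    from occ_same_card[OF I(1) J(1)] J(2) I(2) show "J \<in> {I. occ I}" by simp
  qed
  have "finite {I. occ I}" by (rule finite_subset[of _ "Pow {..<n}"]) (auto simp: occ_def)
  moreover have "?S j \<union> ?S k \<subseteq> {I. occ I}" using sub assms by blast
  ultimately have "card (?S j \<union> ?S k) \<le> card {I. occ I}" by (rule card_mono)
  moreover have "card (?S j \<union> ?S k) = (n choose j) + (n choose k)"
    using card_Un_disjoint[OF fin fin, of j k] assms(3) S by auto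
  ultimately show ?thesis using card_occ dim_lt by linarith
qed

lemma binomial2_le:
  assumes "2 \<le> k" "k + 1 \<le> N" "3 \<le> N" "k + 2 \<le> N"
  shows "N choose 2 \<le> N choose k"
proof (cases "2 * k \<le> N")
  case True
  then show ?thesis using binomial_mono[of 2 k N] assms by simp
next
  case False
  have "N choose 2 = N choose (N - 2)" using binomial_symmetric[of 2 N] assms by simp
  also have "\<dots> \<le> N choose k" using binomial_antimono[of k "N - 2" N] False assms by simp
  finally show ?thesis .
qed

text \<open>By Pascal's rule the two levels have (n + 1 choose k + 1) weights, which is at least (n
  + 1 choose 2) unless k = 0 or k + 1 = n.\<close>

lemma level_consecutive:
  assumes "level k" "level (Suc k)" shows "k = 0 \<or> Suc k = n"
proof (rule ccontr)
  assume "\<not> ?thesis"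
  then have "2 \<le> Suc k" "Suc k + 2 \<le> n + 1" using level_le[OF assms(2)] by auto
  then have "(n + 1) choose 2 \<le> (n + 1) choose Suc k" using n6 by (intro binomial2_le) auto
  also have "(n + 1) choose Suc k = (n choose k) + (n choose Suc k)" by simp
  finally show False using levels_bound[OF assms] by simp
qed

text \<open>From n \<ge> 6 the two levels have at least n + (n choose 2) weights. The second claim
  is the same count for complements.\<close>

lemma level_1_3: "\<not> (level 1 \<and> level 3)" "\<not> (level (n - 1) \<and> level (n - 3))"
proof -
  have "n choose 2 \<le> n choose 3" using binomial_mono[of 2 3 n] n6 by simp
  moreover have "(n + 1) choose 2 = (n choose 1) + (n choose 2)"
    using binomial_Suc_Suc[of n 1] by (simp add: numeral_2_eq_2)
  ultimately have b: "(n + 1) choose 2 \<le> (n choose 1) + (n choose 3)" by simp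
  then show "\<not> (level 1 \<and> level 3)" using levels_bound[of 1 3] by auto
  have "n choose (n - 1) = n choose 1" "n choose (n - 3) = n choose 3"
    using binomial_symmetric[of 1 n] binomial_symmetric[of 3 n] n6 by simp_all
  moreover have "n - 1 \<noteq> n - 3" using n6 by simp
  ultimately show "\<not> (level (n - 1) \<and> level (n - 3))"
    using b levels_bound[of "n - 1" "n - 3"] by linarith
qed

lemma wt_zero: "\<lbrakk>I \<subseteq> {..<n}; wt I v; \<not> level (card I)\<rbrakk> \<Longrightarrow> v = 0"
  unfolding level_def occ_def by blast

lemma low_rep_level_1:
  assumes "level 1" shows "low_rep scale Basis n R L P e"
proof
  fix I v assume I: "I \<subseteq> {..<n}" "card I = 2 \<or> card I = 3" "wt I v"
  have "\<not> level 2" using level_consecutive[of 1] assms n6 by (auto simp: numeral_2_eq_2)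
  then show "v = 0" using wt_zero[OF I(1,3)] I(2) level_1_3(1) assms by auto
qed

text \<open>Twisting by the determinant replaces each weight by its complement.\<close>

lemma signed_rep_twist: "signed_rep scale Basis n R L (\<lambda>i j v. - P i j v) (\<lambda>i v. - e i v)"
proof -
  interpret vector_space_pair scale scale by unfold_locales
  have neg: "Vector_Spaces.linear scale scale (\<lambda>v. - f v)" if "Vector_Spaces.linear scale scale f" for f
    using linear_compose_neg[OF that] .
  \<comment> \<open>In each relation the numbers of factors \<open>e\<close> and \<open>P\<close> on
    the two sides have the same parity, so the signs cancel.\<close>
  show ?thesis
  proof (intro signed_rep.intro signed_rep_axioms.intro)
    show "finite_dimensional_vector_space scale Basis" by unfold_locales
    show "6 \<le> n" "(2::'k) \<noteq> 0" "of_nat (n - 1) \<noteq> (0::'k)" "dim UNIV < (n + 1) choose 2"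
      using n6 two nm1 dim_lt by blast+
    show "Vector_Spaces.linear scale scale (R i j)" "Vector_Spaces.linear scale scale (\<lambda>v. - P i j v)"
      "Vector_Spaces.linear scale scale (\<lambda>v. - e i v)" for i j
      using neg linear_R linear_P linear_e by blast+
    fix i j k l a b c d v
    show "i < n \<Longrightarrow> j < n \<Longrightarrow> i \<noteq> j \<Longrightarrow> L i j v = - e i (- e j (R i j (- e i (- e j v))))"
      using L_eq[of i j v] by simp
    show "- e i (- e i v) = v" by (simp add: ee)
    show "- e i (- e j v) = - e j (- e i v)" using e_comm[of i j v] by simp
    show "i < n \<Longrightarrow> j < n \<Longrightarrow> i \<noteq> j \<Longrightarrow> k \<noteq> i \<Longrightarrow> k \<noteq> j \<Longrightarrow> - e k (R i j v) = R i j (- e k v)"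
      using eR[of i j k v] by simp
    show "i < n \<Longrightarrow> j < n \<Longrightarrow> i \<noteq> j \<Longrightarrow> R i j (- e j (R i j v)) = - e j v"
      using ReR[of i j v] by simp
    show "- P i j (- P i j v) = v" by (simp add: PP)
    show "- P i j v = - P j i v" using P_sym[of i j v] by simp
    show "a < n \<Longrightarrow> b < n \<Longrightarrow> i < n \<Longrightarrow> j < n \<Longrightarrow> i \<noteq> j \<Longrightarrow>
       - P a b (R i j v) = R (transpose a b i) (transpose a b j) (- P a b v)"
      using PR[of a b i j v] by simp
    show "a < n \<Longrightarrow> b < n \<Longrightarrow> i < n \<Longrightarrow> - P a b (- e i v) = - e (transpose a b i) (- P a b v)"
      using Pe[of a b i v] by simp
    show "a < n \<Longrightarrow> b < n \<Longrightarrow> c < n \<Longrightarrow> d < n \<Longrightarrow>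
       - P a b (- P c d v) = - P (transpose a b c) (transpose a b d) (- P a b v)"
      using PPc[of a b c d v] by simp
    show "a < n \<Longrightarrow> b < n \<Longrightarrow> a \<noteq> b \<Longrightarrow> R a b (- e a (R b a (- e a (L a b v)))) = - P a b (- e b v)"
      using weyl[of a b v] by simp
  qed (fact R_comm RL_comm steinberg outer)+
qed

lemma low_rep_twist:
  assumes "level (n - 1)"
  shows "low_rep scale Basis n R L (\<lambda>i j v. - P i j v) (\<lambda>i v. - e i v)"
proof -
  interpret tw: signed_rep scale Basis n R L "\<lambda>i j v. - P i j v" "\<lambda>i v. - e i v"
    by (rule signed_rep_twist)
  show ?thesis
  proof
    fix I v assume I: "I \<subseteq> {..<n}" "card I = 2 \<or> card I = 3" "tw.wt I v"
    have "wt ({..<n} - I) v"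
      unfolding wt_def
    proof (intro allI impI)
      fix l assume l: "l < n"
      have "- e l v = (if l \<in> I then - v else v)" using I(3) l unfolding tw.wt_def by blast
      then have "e l v = - (if l \<in> I then - v else v)" by (metis minus_minus)
      then show "e l v = (if l \<in> {..<n} - I then - v else v)" using l by simp
    qed
    moreover have "card ({..<n} - I) = n - card I"
      using I(1) by (simp add: card_Diff_subset finite_subset)
    moreover have "\<not> level (n - 2)"
    proof -
      have "Suc (n - 2) = n - 1" "n - 2 \<noteq> 0" "Suc (n - 2) \<noteq> n" using n6 by simp_all
      then show ?thesis using level_consecutive[of "n - 2"] assms by metis
    qed
    ultimately show "v = 0"
      using wt_zero[of "{..<n} - I" v] I(2) level_1_3(2) assms by auto
  qed
qed

text \<open>Here k counts the involutions not yet acting by a sign; each step splits v into its two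
  halves for the next one.\<close>

lemma weight_induct:
  assumes wt: "\<And>I v. I \<subseteq> {..<n} \<Longrightarrow> wt I v \<Longrightarrow> Q v"
    and add: "\<And>x y. Q x \<Longrightarrow> Q y \<Longrightarrow> Q (x + y)"
  shows "Q v"
proof -
  have "\<forall>I v. (\<forall>i<n - k. e i v = (if i \<in> I then - v else v)) \<longrightarrow> Q v" if "k \<le> n" for k
    using that
  proof (induction k)
    case 0
    show ?case
    proof (intro allI impI)
      fix I v assume "\<forall>i<n - 0. e i v = (if i \<in> I then - v else v)"
      then have "wt (I \<inter> {..<n}) v" unfolding wt_def by auto
      then show "Q v" using wt[of "I \<inter> {..<n}" v] by auto
    qed
  next
    case (Suc k)
    show ?case
    proof (intro allI impI)
      fix I v assume v: "\<forall>i<n - Suc k. e i v = (if i \<in> I then - v else v)"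
      define l where "l = n - Suc k"
      have l: "n - k = Suc l" using Suc.prems unfolding l_def by simp
      have sgn: "e i (half x) = (if i \<in> J then - half x else half x)"
        if "e i x = (if i \<in> J then - x else x)" for i x J
        using that unfolding half_def by (simp split: if_splits)
      have ev: "e i (e l v) = (if i \<in> I then - e l v else e l v)" if "i < l" for i
        using v that e_comm[of i l v] unfolding l_def by simp
      have "e i (half (v + e l v)) = (if i \<in> I - {l} then - half (v + e l v) else half (v + e l v))"
        if "i < Suc l" for i
        by (rule sgn) (use ev[of i] v that in \<open>auto simp: less_Suc_eq l_def ee\<close>)
      then have 1: "Q (half (v + e l v))" using Suc l by (metis Suc_leD)
      have "e i (half (v - e l v)) = (if i \<in> insert l I then - half (v - e l v) else half (v - e l v))"
        if "i < Suc l" for i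
        by (rule sgn) (use ev[of i] v that in \<open>auto simp: less_Suc_eq l_def ee\<close>)
      then have 2: "Q (half (v - e l v))" using Suc l by (metis Suc_leD)
      have "half (v + e l v) + half (v - e l v) = half v + half v"
        unfolding half_lin by simp
      then show "Q v" using add[OF 1 2] by (simp add: half_add)
    qed
  qed
  from this[of n] show ?thesis by simp
qed

text \<open>If all weights in \<open>R i j v\<close> have the size of \<open>I\<close>, then \<open>e i\<close> and \<open>e j\<close> conjugate \<open>R i j\<close> to itself on \<open>v\<close>, and
  \<open>L i j v = R i j v\<close> by \<open>L_eq\<close>.\<close>

lemma R_L_consecutive:
  assumes I: "I \<subseteq> {..<n}" and v: "wt I v" and ij: "i < n" "j < n" "i \<noteq> j" and ne: "R i j v \<noteq> L i j v"
  shows "level (card I)" "\<exists>k. level k \<and> (k = Suc (card I) \<or> card I = Suc k)"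
proof -
  have v0: "v \<noteq> 0" using ne ij by auto
  then show "level (card I)" unfolding level_def occ_def using I v by blast
  define r where "r = R i j v"
  \<comment> \<open>The sign by which \<open>e i\<close> followed by \<open>e j\<close> acts on v.
    The vector y below is then the difference of the right and the left move.\<close>
  define s where "s x = (if (i \<in> I) = (j \<in> I) then x else - x)" for x :: 'v
  have s: "s (s x) = x" "e l (s x) = s (e l x)" "s (x - y) = s x - s y" for x y l by (auto simp: s_def)
  define y where "y = r - s (e i (e j r))"
  have evi: "e i v = (if i \<in> I then - v else v)" "e j v = (if j \<in> I then - v else v)"
    using v ij unfolding wt_def by auto
  have "L i j v = s (e i (e j r))"
    using L_eq[OF ij, of v] evi unfolding r_def s_def by (auto split: if_splits)
  then have y0: "y \<noteq> 0" using ne unfolding y_def r_def by simp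
  have el: "e l y = (if l \<in> I then - y else y)" if l: "l < n" "l \<noteq> i" "l \<noteq> j" for l
  proof -
    have lr: "e l r = (if l \<in> I then - r else r)"
      using eR[of i j l v] v l ij unfolding r_def wt_def by auto
    have "e l y = e l r - s (e i (e j (e l r)))"
      unfolding y_def by (simp add: s e_comm[of l])
    then show ?thesis unfolding lr y_def by (simp add: s_def)
  qed
  have eij: "e i (e j y) = - s y" "e j (e i y) = - s y"
    unfolding y_def by (simp_all add: s e_comm[of j i] ee)
  have ejy: "e j y = - s (e i y)" using arg_cong[OF eij(1), of "e i"] by (simp add: s ee)
  \<comment> \<open>y need not be an eigenvector of \<open>e i\<close>, but one of its two
    eigencomponents is nonzero.\<close>
  obtain z p where z: "z \<noteq> 0" "e i z = (if p then - z else z)" "e j z = - s (e i z)"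
    "\<And>l. \<lbrakk>l < n; l \<noteq> i; l \<noteq> j\<rbrakk> \<Longrightarrow> e l z = (if l \<in> I then - z else z)"
  proof (cases "y + e i y = 0")
    case False
    show ?thesis
    proof (rule that[of "y + e i y" False])
      show "e j (y + e i y) = - s (e i (y + e i y))"
        unfolding e_lin eij(2) ejy by (simp add: s_def ee)
      show "e l (y + e i y) = (if l \<in> I then - (y + e i y) else y + e i y)"
        if "l < n" "l \<noteq> i" "l \<noteq> j" for l
        unfolding e_lin e_comm[of l i y] el[OF that] by simp
    qed (use False in \<open>simp_all add: ee add.commute\<close>)
  next
    case True
    have nz: "y - e i y \<noteq> 0"
    proof
      assume "y - e i y = 0"
      then have "y + y = 0" using True by simp
      then show False using double_eq_0 y0 by blast
    qed
    show ?thesis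
    proof (rule that[of "y - e i y" True])
      show "e j (y - e i y) = - s (e i (y - e i y))"
        unfolding e_lin eij(2) ejy by (simp add: s_def ee)
      show "e l (y - e i y) = (if l \<in> I then - (y - e i y) else y - e i y)"
        if "l < n" "l \<noteq> i" "l \<noteq> j" for l
        unfolding e_lin e_comm[of l i y] el[OF that] by simp
    qed (use nz in \<open>simp_all add: ee\<close>)
  qed
  \<comment> \<open>The product of the signs of z at i and j is opposite to that of v. So exactly
    one of the two memberships changes, and the sizes of I and J differ by one.\<close>
  define q where "q = (if (i \<in> I) = (j \<in> I) then \<not> p else p)"
  define J where "J = (I - {i, j}) \<union> (if p then {i} else {}) \<union> (if q then {j} else {})"
  have ez: "e j z = (if q then - z else z)"
    unfolding z(3) z(2) s_def q_def by simp
  have "wt J z"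
    unfolding wt_def
  proof (intro allI impI)
    fix l assume l: "l < n"
    consider "l = i" | "l = j" | "l \<noteq> i" "l \<noteq> j" by blast
    then show "e l z = (if l \<in> J then - z else z)"
    proof cases
      case 1
      then have "l \<in> J \<longleftrightarrow> p" unfolding J_def using ij by auto
      then show ?thesis using z(2) 1 by simp
    next
      case 2
      then have "l \<in> J \<longleftrightarrow> q" unfolding J_def using ij by auto
      then show ?thesis using ez 2 by simp
    next
      case 3
      then have "l \<in> J \<longleftrightarrow> l \<in> I" unfolding J_def by auto
      then show ?thesis using z(4)[OF l 3] by simp
    qed
  qed
  moreover have "J \<subseteq> {..<n}" unfolding J_def using I ij by auto
  ultimately have "level (card J)" unfolding level_def occ_def using z(1) by blast
  moreover have "card J = Suc (card I) \<or> card I = Suc (card J)"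
  proof -
    have fin: "finite I" using I finite_subset by blast
    have c: "card A = card (A - {i, j}) + of_bool (i \<in> A) + of_bool (j \<in> A)" if "finite A" for A
    proof -
      have "A = (A - {i, j}) \<union> (A \<inter> {i, j})" by blast
      then have "card A = card (A - {i, j}) + card (A \<inter> {i, j})"
        using card_Un_disjoint[of "A - {i, j}" "A \<inter> {i, j}"] that by auto
      moreover have "card (A \<inter> {i, j}) = of_bool (i \<in> A) + of_bool (j \<in> A)"
        using ij(3) by (cases "i \<in> A"; cases "j \<in> A") (simp_all add: Int_insert_right)
      ultimately show ?thesis by (simp only: add.assoc)
    qed
    have "J - {i, j} = I - {i, j}" "i \<in> J \<longleftrightarrow> p" "j \<in> J \<longleftrightarrow> q" "finite J"
      unfolding J_def using ij fin by auto
    then show ?thesis using c[OF fin] c[of J] unfolding q_def by (auto split: if_splits)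
  qed
  ultimately show "\<exists>k. level k \<and> (k = Suc (card I) \<or> card I = Suc k)" by blast
qed

text \<open>A weight vector on which the moves differ has a neighbouring level, so its size is 0 or
  1, or n - 1 or n. The twist reduces the second pair of sizes to the first.\<close>

theorem R_eq_L:
  assumes ij: "i < n" "j < n" "i \<noteq> j"
  shows "R i j v = L i j v"
proof (induction v rule: weight_induct)
  case (1 I v)
  show ?case
  proof (rule ccontr)
    assume ne: "R i j v \<noteq> L i j v"
    note Iv = 1 and lv = R_L_consecutive[OF 1 ij ne]
    from lv obtain k where k: "level k" "k = Suc (card I) \<or> card I = Suc k" by blast
    have fin: "finite I" using 1(1) finite_subset by blast
    consider "card I = 0" "level 1" | "card I = 1" | "card I = n - 1" | "card I = n" "level (n - 1)"
      using k(2)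
    proof
      assume kI: "k = Suc (card I)"
      then consider "card I = 0" | "k = n" using level_consecutive[of "card I"] lv(1) k(1) by auto
      then show ?thesis using that kI k(1) by cases auto
    next
      assume Ik: "card I = Suc k"
      then consider "k = 0" | "card I = n" using level_consecutive[of k] lv(1) k(1) by auto
      then show ?thesis using that Ik k(1) by cases auto
    qed
    then show False
    proof cases
      case 1
      from low_rep_level_1[OF 1(2)] interpret lr: low_rep scale Basis n R L P e .
      have "I = {}" using 1 fin by simp
      then have "U0 v" using Iv(2) unfolding U0_def wt_def by simp
      then show ?thesis using lr.R_eq_L_U0 ij ne by blast
    next
      case 2
      with lv(1) have "level 1" by simp
      from low_rep_level_1[OF this] interpret lr: low_rep scale Basis n R L P e .
      obtain a where a: "I = {a}" using 2 card_1_singletonE by blast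
      then have "a < n" using Iv(1) by simp
      then have "U a v" using Iv(2) a unfolding U_def wt_def by auto
      then show ?thesis using lr.R_eq_L_U ij ne by blast
    next
      case 3
      with lv(1) have "level (n - 1)" by simp
      from low_rep_twist[OF this]
      interpret lr: low_rep scale Basis n R L "\<lambda>i j v. - P i j v" "\<lambda>i v. - e i v" .
      have "card ({..<n} - I) = 1" using 3 Iv(1) fin n6 by (simp add: card_Diff_subset)
      then obtain a where a: "{..<n} - I = {a}" using card_1_singletonE by blast
      then have a': "a < n" "a \<notin> I" "\<And>i. i < n \<Longrightarrow> i \<noteq> a \<Longrightarrow> i \<in> I" by auto
      then have "lr.U a v" using Iv(2) unfolding lr.U_def wt_def by simp
      then show ?thesis using lr.R_eq_L_U ij ne by blast
    next
      case 4
      from low_rep_twist[OF 4(2)]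
      interpret lr: low_rep scale Basis n R L "\<lambda>i j v. - P i j v" "\<lambda>i v. - e i v" .
      have "I = {..<n}" using Iv(1) 4 card_subset_eq[of "{..<n}" I] by simp
      then have "lr.U0 v" using Iv(2) unfolding lr.U0_def wt_def by simp
      then show ?thesis using lr.R_eq_L_U0 ij ne by blast
    qed
  qed
next
  case (2 x y)
  then show ?case using ij by simp
qed

end

section \<open>Elementary automorphisms of the free group\<close>

abbreviation FG :: "nat \<Rightarrow> letter list monoid" where "FG \<equiv> free_group"
abbreviation AFG :: "nat \<Rightarrow> (letter list \<Rightarrow> letter list) monoid" where "AFG n \<equiv> AutoGroup (free_group n)"

lemma inv_letter_neq [simp]: "inv_letter a \<noteq> a" "a \<noteq> inv_letter a"
  by (cases a, simp)+

lemma same_index: "fst a = fst b \<Longrightarrow> a = b \<or> a = inv_letter b"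
  by (cases a; cases b) auto

lemma inv_letter_inject [simp]: "inv_letter a = inv_letter b \<longleftrightarrow> a = b"
  by (metis inv_letter_inv_letter)

lemma letter_closed [simp]: "fst a < n \<Longrightarrow> [a] \<in> carrier (FG n)"
  by (cases a) (simp add: free_group_simps)

lemma letter_mult [simp]: "[a] \<otimes>\<^bsub>FG n\<^esub> [inv_letter a] = \<one>\<^bsub>FG n\<^esub>"
  "[inv_letter a] \<otimes>\<^bsub>FG n\<^esub> [a] = \<one>\<^bsub>FG n\<^esub>"
  by (simp_all add: free_group_simps)

lemma letter_inv [simp]: "fst a < n \<Longrightarrow> inv\<^bsub>FG n\<^esub> [a] = [inv_letter a]"
  by (rule group.inv_equality[OF group_free_group]) simp_all

lemma letter_mult_left [simp]:
  assumes "fst a < n" "w \<in> carrier (FG n)"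
  shows "[a] \<otimes>\<^bsub>FG n\<^esub> ([inv_letter a] \<otimes>\<^bsub>FG n\<^esub> w) = w"
    "[inv_letter a] \<otimes>\<^bsub>FG n\<^esub> ([a] \<otimes>\<^bsub>FG n\<^esub> w) = w"
proof -
  interpret F: group "FG n" by (rule group_free_group)
  show "[a] \<otimes>\<^bsub>FG n\<^esub> ([inv_letter a] \<otimes>\<^bsub>FG n\<^esub> w) = w"
    "[inv_letter a] \<otimes>\<^bsub>FG n\<^esub> ([a] \<otimes>\<^bsub>FG n\<^esub> w) = w"
    using assms by (simp_all flip: F.m_assoc)
qed

text \<open>One sign per generator suffices, so an identity of automorphisms can be checked on the
  letter for which the computation is easiest.\<close>

lemma hom_eqI:
  assumes H: "group H" and f: "f \<in> hom (FG n) H" and g: "g \<in> hom (FG n) H"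
    and eq: "\<And>i. i < n \<Longrightarrow> \<exists>s. f [(i, s)] = g [(i, s)]" and w: "w \<in> carrier (FG n)"
  shows "f w = g w"
proof -
  interpret F: group "FG n" by (rule group_free_group)
  interpret f: group_hom "FG n" H f
    using H f by (simp add: group_hom_def group_hom_axioms_def group_free_group)
  interpret g: group_hom "FG n" H g
    using H g by (simp add: group_hom_def group_hom_axioms_def group_free_group)
  have gen: "f (gen i) = g (gen i)" if i: "i < n" for i
  proof -
    obtain s where s: "f [(i, s)] = g [(i, s)]" using eq[OF i] by blast
    show ?thesis
    proof (cases s)
      case True then show ?thesis using s by (simp add: gen_def)
    next
      case False
      have "gen i = inv\<^bsub>FG n\<^esub> [(i, s)]" using i False by (simp add: gen_def)
      then show ?thesis using f.hom_inv[of "[(i, s)]"] g.hom_inv[of "[(i, s)]"] s i by simp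
    qed
  qed
  show ?thesis using w
    by (induction w rule: free_group_induct) (simp_all add: gen gen_closed)
qed

definition lext :: "nat \<Rightarrow> (letter \<Rightarrow> letter list) \<Rightarrow> letter list \<Rightarrow> letter list" where
  "lext n q = (THE f. f \<in> extensional (carrier (FG n)) \<and> f \<in> hom (FG n) (FG n)
     \<and> (\<forall>i<n. f (gen i) = q (i, True)))"

definition compatible :: "nat \<Rightarrow> (letter \<Rightarrow> letter list) \<Rightarrow> bool" where
  "compatible n q \<longleftrightarrow> (\<forall>c. fst c < n \<longrightarrow> q c \<in> carrier (FG n) \<and> q (inv_letter c) = inv\<^bsub>FG n\<^esub> (q c))"

lemma lext:
  assumes q: "compatible n q"
  shows "lext n q \<in> extensional (carrier (FG n))" "lext n q \<in> hom (FG n) (FG n)"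
    and "fst c < n \<Longrightarrow> lext n q [c] = q c"
proof -
  interpret F: group "FG n" by (rule group_free_group)
  have "\<exists>!f. f \<in> extensional (carrier (FG n)) \<and> f \<in> hom (FG n) (FG n) \<and> (\<forall>i<n. f (gen i) = q (i, True))"
    by (rule free_group_universal[OF group_free_group]) (use q in \<open>auto simp: compatible_def\<close>)
  from theI'[OF this] have l: "lext n q \<in> extensional (carrier (FG n))" "lext n q \<in> hom (FG n) (FG n)"
    "\<And>i. i < n \<Longrightarrow> lext n q (gen i) = q (i, True)" unfolding lext_def by blast+
  then show "lext n q \<in> extensional (carrier (FG n))" "lext n q \<in> hom (FG n) (FG n)" by auto
  interpret l: group_hom "FG n" "FG n" "lext n q"
    using l by (simp add: group_hom_def group_hom_axioms_def group_free_group)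
  assume c: "fst c < n"
  obtain i s where cs: "c = (i, s)" by (cases c)
  show "lext n q [c] = q c"
  proof (cases s)
    case True then show ?thesis using l(3)[of i] c cs by (simp add: gen_def)
  next
    case False
    have "lext n q [c] = lext n q (inv\<^bsub>FG n\<^esub> (gen i))" using c cs False by (simp add: gen_def)
    also have "\<dots> = inv\<^bsub>FG n\<^esub> (q (i, True))" using l.hom_inv[OF gen_closed] l(3)[of i] c cs by simp
    also have "\<dots> = q c" using q c cs False unfolding compatible_def by (metis fst_conv inv_letter.simps)
    finally show ?thesis .
  qed
qed

lemma auto_hom: "f \<in> auto (FG n) \<Longrightarrow> f \<in> hom (FG n) (FG n)"
  by (simp add: auto_def)

lemma auto_group_hom: "f \<in> auto (FG n) \<Longrightarrow> group_hom (FG n) (FG n) f"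
  by (simp add: auto_def group_hom_def group_hom_axioms_def group_free_group)

lemma auto_mult: "f \<in> auto (FG n) \<Longrightarrow> u \<in> carrier (FG n) \<Longrightarrow> v \<in> carrier (FG n)
    \<Longrightarrow> f (u \<otimes>\<^bsub>FG n\<^esub> v) = f u \<otimes>\<^bsub>FG n\<^esub> f v"
  by (auto simp: auto_def hom_def)

lemma AFG_mult_apply:
  "\<lbrakk>f \<in> auto (FG n); g \<in> auto (FG n); w \<in> carrier (FG n)\<rbrakk> \<Longrightarrow> (f \<otimes>\<^bsub>AFG n\<^esub> g) w = f (g w)"
  by (simp add: mult_AutoGroup compose_def)

lemma group_AFG: "group (AFG n)"
  using group.AutoGroup[OF group_free_group] .

lemma AFG_closed: "f \<in> auto (FG n) \<Longrightarrow> g \<in> auto (FG n) \<Longrightarrow> f \<otimes>\<^bsub>AFG n\<^esub> g \<in> auto (FG n)"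
  using monoid.m_closed[OF group.is_monoid[OF group_AFG], of f n g] by (simp add: carrier_AutoGroup)

lemma auto_eqI:
  assumes f: "f \<in> auto (FG n)" and g: "g \<in> auto (FG n)"
    and eq: "\<And>i. i < n \<Longrightarrow> \<exists>s. f [(i, s)] = g [(i, s)]"
  shows "f = g"
proof (rule extensionalityI[of f "carrier (FG n)"])
  show "f \<in> extensional (carrier (FG n))" "g \<in> extensional (carrier (FG n))"
    using f g by (auto simp: auto_def Bij_def)
qed (use hom_eqI[OF group_free_group auto_hom[OF f] auto_hom[OF g] eq] in blast)

lemma lext_auto:
  assumes q: "compatible n q" and q': "compatible n q'"
    and 1: "\<And>c. fst c < n \<Longrightarrow> lext n q (q' c) = [c]" and 2: "\<And>c. fst c < n \<Longrightarrow> lext n q' (q c) = [c]"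
  shows "lext n q \<in> auto (FG n)"
proof -
  note l = lext[OF q] and l' = lext[OF q']
  have cl: "lext n q w \<in> carrier (FG n)" "lext n q' w \<in> carrier (FG n)" if "w \<in> carrier (FG n)" for w
    using l(2) l'(2) that by (auto simp: hom_def)
  have id: "(\<lambda>w. w) \<in> hom (FG n) (FG n)" by (auto simp: hom_def)
  have "(\<lambda>w. lext n q (lext n q' w)) \<in> hom (FG n) (FG n)"
    "(\<lambda>w. lext n q' (lext n q w)) \<in> hom (FG n) (FG n)"
    using hom_compose[OF l'(2) l(2)] hom_compose[OF l(2) l'(2)] by (simp_all add: comp_def)
  note h = this
  have "lext n q (lext n q' w) = w" if "w \<in> carrier (FG n)" for w
    by (rule hom_eqI[OF group_free_group h(1) id _ that]) (simp add: l'(3) 1)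
  moreover have "lext n q' (lext n q w) = w" if "w \<in> carrier (FG n)" for w
    by (rule hom_eqI[OF group_free_group h(2) id _ that]) (simp add: l(3) 2)
  ultimately have "bij_betw (lext n q) (carrier (FG n)) (carrier (FG n))"
    using cl by (intro bij_betwI[where g = "lext n q'"]) auto
  then show ?thesis using l by (simp add: auto_def Bij_def)
qed

definition tvq :: "letter \<Rightarrow> letter \<Rightarrow> letter \<Rightarrow> letter list" where
  "tvq a b c = (if c = a then [a, b] else if c = inv_letter a then [inv_letter b, inv_letter a] else [c])"

definition valid :: "nat \<Rightarrow> letter \<Rightarrow> letter \<Rightarrow> bool" where
  "valid n a b \<longleftrightarrow> fst a < n \<and> fst b < n \<and> fst a \<noteq> fst b"

text \<open>\<open>tv n a b\<close> maps the letter \<open>a\<close> to \<open>a b\<close> and fixes the letters of other indices; it is the identity if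
  \<open>a\<close> and \<open>b\<close> have the same index.\<close>

definition tv :: "nat \<Rightarrow> letter \<Rightarrow> letter \<Rightarrow> letter list \<Rightarrow> letter list" where
  "tv n a b = lext n (if valid n a b then tvq a b else (\<lambda>c. [c]))"

lemma pair_mult: "fst a \<noteq> fst b \<Longrightarrow> [a, b] = [a] \<otimes>\<^bsub>FG n\<^esub> [b]"
  by (cases a; cases b) (auto simp: free_group_simps)

lemma compatible_id: "compatible n (\<lambda>c. [c])"
  by (simp add: compatible_def)

lemma compatible_tvq: "valid n a b \<Longrightarrow> compatible n (tvq a b)"
proof -
  interpret F: group "FG n" by (rule group_free_group)
  assume v: "valid n a b"
  then have p: "[a, b] = [a] \<otimes>\<^bsub>FG n\<^esub> [b]"
    "[inv_letter b, inv_letter a] = [inv_letter b] \<otimes>\<^bsub>FG n\<^esub> [inv_letter a]"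
    using pair_mult[of a b n] pair_mult[of "inv_letter b" "inv_letter a" n] by (auto simp: valid_def)
  show ?thesis
    unfolding compatible_def tvq_def p
    using v by (auto simp: valid_def F.inv_mult_group inv_letter_eq_iff)
qed

lemma tv_letter:
  assumes "valid n a b"
  shows "tv n a b [a] = [a] \<otimes>\<^bsub>FG n\<^esub> [b]"
    "tv n a b [inv_letter a] = [inv_letter b] \<otimes>\<^bsub>FG n\<^esub> [inv_letter a]"
    "\<lbrakk>fst c < n; fst c \<noteq> fst a\<rbrakk> \<Longrightarrow> tv n a b [c] = [c]"
  using lext(3)[OF compatible_tvq[OF assms]] assms pair_mult[of a b n]
    pair_mult[of "inv_letter b" "inv_letter a" n]
  by (auto simp: tv_def tvq_def valid_def)

lemma tv_auto: "tv n a b \<in> auto (FG n)"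
proof (cases "valid n a b")
  case True
  interpret F: group "FG n" by (rule group_free_group)
  have v': "valid n a (inv_letter b)" using True by (simp add: valid_def)
  have *: "lext n (tvq a b) (tvq a (inv_letter b) c) = [c]"
    if v: "valid n a b" and c: "fst c < n" for a b c
  proof -
    interpret l: group_hom "FG n" "FG n" "lext n (tvq a b)"
      using lext(2)[OF compatible_tvq[OF v]] by (simp add: group_hom_def group_hom_axioms_def group_free_group)
    have v': "valid n a (inv_letter b)" using v by (simp add: valid_def)
    have t: "lext n (tvq a b) = tv n a b" using v by (simp add: tv_def)
    have b: "fst a < n" "fst b < n" "fst a \<noteq> fst b" using v by (auto simp: valid_def)
    consider "c = a" | "c = inv_letter a" | "fst c \<noteq> fst a" using same_index by blast
    then show ?thesis
    proof cases
      case 1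
      then have "lext n (tvq a b) (tvq a (inv_letter b) c) = tv n a b ([a] \<otimes>\<^bsub>FG n\<^esub> [inv_letter b])"
        using pair_mult[of a "inv_letter b" n] b by (simp add: t tvq_def)
      also have "\<dots> = [a]"
        using b l.hom_mult tv_letter[OF v] unfolding t by (simp add: F.m_assoc)
      finally show ?thesis using 1 by simp
    next
      case 2
      then have "lext n (tvq a b) (tvq a (inv_letter b) c) = tv n a b ([b] \<otimes>\<^bsub>FG n\<^esub> [inv_letter a])"
        using pair_mult[of b "inv_letter a" n] b by (simp add: t tvq_def)
      also have "\<dots> = [inv_letter a]"
        using b l.hom_mult tv_letter[OF v] unfolding t by (simp flip: F.m_assoc)
      finally show ?thesis using 2 by simp
    next
      case 3
      then have "c \<noteq> a" "c \<noteq> inv_letter a" by auto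
      then show ?thesis using 3 c tv_letter(3)[OF v, of c] by (simp add: t tvq_def)
    qed
  qed
  have "lext n (tvq a b) \<in> auto (FG n)"
    by (rule lext_auto[OF compatible_tvq[OF True] compatible_tvq[OF v'] *[OF True]])
      (use *[OF v'] in auto)
  then show ?thesis using True by (simp add: tv_def)
next
  case False
  have "lext n (\<lambda>c. [c]) \<in> auto (FG n)"
    by (rule lext_auto[OF compatible_id compatible_id]) (use lext(3)[OF compatible_id] in auto)
  then show ?thesis using False by (simp add: tv_def)
qed

text \<open>Signed permutations of the generators, as permutations of the letters.\<close>

definition sperm :: "nat \<Rightarrow> (letter \<Rightarrow> letter) set" where
  "sperm n = {\<sigma>. bij \<sigma> \<and> (\<forall>c. \<sigma> (inv_letter c) = inv_letter (\<sigma> c)) \<and> (\<forall>c. n \<le> fst c \<longrightarrow> \<sigma> c = c)}"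

lemma spermD:
  assumes "\<sigma> \<in> sperm n"
  shows "bij \<sigma>" and sperm_inv_letter: "\<sigma> (inv_letter c) = inv_letter (\<sigma> c)"
    and "n \<le> fst c \<Longrightarrow> \<sigma> c = c"
  using assms unfolding sperm_def by blast+

lemma spermI:
  assumes "bij \<sigma>" "\<And>c. \<sigma> (inv_letter c) = inv_letter (\<sigma> c)" "\<And>c. n \<le> fst c \<Longrightarrow> \<sigma> c = c"
  shows "\<sigma> \<in> sperm n"
  using assms unfolding sperm_def by blast

lemma sperm_less:
  assumes s: "\<sigma> \<in> sperm n" and c: "fst c < n" shows "fst (\<sigma> c) < n"
proof (rule ccontr)
  assume n: "\<not> fst (\<sigma> c) < n"
  then have "\<sigma> (\<sigma> c) = \<sigma> c" using spermD(3)[OF s, of "\<sigma> c"] by simp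
  then have "\<sigma> c = c" using spermD(1)[OF s] by (simp add: bij_def inj_eq)
  then show False using n c by simp
qed

lemma sperm_inj: "\<sigma> \<in> sperm n \<Longrightarrow> \<sigma> c = \<sigma> d \<longleftrightarrow> c = d"
  using spermD(1) by (metis bij_def inj_eq)

lemma sperm_fst:
  assumes "\<sigma> \<in> sperm n" shows "fst (\<sigma> c) = fst (\<sigma> d) \<longleftrightarrow> fst c = fst d"
proof -
  have "fst a = fst b \<longleftrightarrow> a = b \<or> a = inv_letter b" for a b :: letter
    using same_index[of a b] by auto
  then show ?thesis
    using sperm_inj[OF assms] spermD(2)[OF assms] by metis
qed

lemma sperm_comp: "\<sigma> \<in> sperm n \<Longrightarrow> \<tau> \<in> sperm n \<Longrightarrow> \<sigma> \<circ> \<tau> \<in> sperm n"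
  by (rule spermI) (simp_all add: spermD bij_comp del: split_paired_All)

lemma sperm_id: "id \<in> sperm n" by (rule spermI) simp_all

lemma sperm_inverse:
  assumes "\<sigma> \<in> sperm n" shows "inv_into UNIV \<sigma> \<in> sperm n" "\<sigma> \<circ> inv_into UNIV \<sigma> = id" "inv_into UNIV \<sigma> \<circ> \<sigma> = id"
proof -
  note b = spermD(1)[OF assms]
  then show "\<sigma> \<circ> inv_into UNIV \<sigma> = id" "inv_into UNIV \<sigma> \<circ> \<sigma> = id"
    by (simp_all add: bij_is_surj bij_is_inj surj_iff[symmetric] inj_iff[symmetric])
  show "inv_into UNIV \<sigma> \<in> sperm n"
  proof (rule spermI)
    show "inv_into UNIV \<sigma> (inv_letter c) = inv_letter (inv_into UNIV \<sigma> c)" for c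
      using b by (metis bij_inv_eq_iff spermD(2)[OF assms])
    show "inv_into UNIV \<sigma> c = c" if "n \<le> fst c" for c
      using spermD(3)[OF assms that] b by (metis bij_inv_eq_iff)
  qed (use b bij_imp_bij_inv in blast)
qed

definition sp :: "nat \<Rightarrow> (letter \<Rightarrow> letter) \<Rightarrow> letter list \<Rightarrow> letter list" where
  "sp n \<sigma> = lext n (\<lambda>c. [\<sigma> c])"

lemma compatible_sp: "\<sigma> \<in> sperm n \<Longrightarrow> compatible n (\<lambda>c. [\<sigma> c])"
  by (simp add: compatible_def sperm_less sperm_inv_letter)

lemma sp_letter: "\<sigma> \<in> sperm n \<Longrightarrow> fst c < n \<Longrightarrow> sp n \<sigma> [c] = [\<sigma> c]"
  unfolding sp_def by (rule lext(3)[OF compatible_sp])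

lemma sp_auto:
  assumes "\<sigma> \<in> sperm n" shows "sp n \<sigma> \<in> auto (FG n)"
proof -
  note s' = sperm_inverse[OF assms]
  have "\<sigma> (inv_into UNIV \<sigma> c) = c" "inv_into UNIV \<sigma> (\<sigma> c) = c" for c
    using s'(2,3) by (metis comp_apply id_apply)+
  then show ?thesis
    unfolding sp_def
    by (intro lext_auto[OF compatible_sp[OF assms] compatible_sp[OF s'(1)]])
      (use sp_letter[OF assms] sp_letter[OF s'(1)] sperm_less[OF assms] sperm_less[OF s'(1)] in \<open>simp_all add: sp_def\<close>)
qed

lemma sp_mult:
  assumes "\<sigma> \<in> sperm n" "\<tau> \<in> sperm n" shows "sp n \<sigma> \<otimes>\<^bsub>AFG n\<^esub> sp n \<tau> = sp n (\<sigma> \<circ> \<tau>)"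
proof (rule auto_eqI)
  show "sp n \<sigma> \<otimes>\<^bsub>AFG n\<^esub> sp n \<tau> \<in> auto (FG n)" "sp n (\<sigma> \<circ> \<tau>) \<in> auto (FG n)"
    using assms by (simp_all add: AFG_closed sp_auto sperm_comp)
  show "\<exists>s. (sp n \<sigma> \<otimes>\<^bsub>AFG n\<^esub> sp n \<tau>) [(i, s)] = sp n (\<sigma> \<circ> \<tau>) [(i, s)]" if "i < n" for i
    using that assms by (simp add: AFG_mult_apply sp_auto sp_letter sperm_less sperm_comp)
qed

lemma sp_id: "sp n id = \<one>\<^bsub>AFG n\<^esub>"
proof (rule auto_eqI)
  show "sp n id \<in> auto (FG n)" by (simp add: sp_auto sperm_id)
  show "\<one>\<^bsub>AFG n\<^esub> \<in> auto (FG n)"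
    using monoid.one_closed[OF group.is_monoid[OF group_AFG]] by (simp add: carrier_AutoGroup)
  show "\<exists>s. sp n id [(i, s)] = \<one>\<^bsub>AFG n\<^esub> [(i, s)]" if "i < n" for i
    using that by (simp add: sp_letter sperm_id one_AutoGroup)
qed

lemma ex_letter: "(\<And>c. fst c = i \<Longrightarrow> P c \<or> P (inv_letter c)) \<Longrightarrow> \<exists>s. P (i, s)" for i :: nat
  by (metis fst_conv inv_letter.simps)

lemma sp_tv:
  assumes s: "\<sigma> \<in> sperm n" and v: "valid n a b"
  shows "sp n \<sigma> \<otimes>\<^bsub>AFG n\<^esub> tv n a b = tv n (\<sigma> a) (\<sigma> b) \<otimes>\<^bsub>AFG n\<^esub> sp n \<sigma>"
proof (rule auto_eqI)
  have v': "valid n (\<sigma> a) (\<sigma> b)"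
    using s v by (simp add: valid_def sperm_less sperm_fst)
  show "sp n \<sigma> \<otimes>\<^bsub>AFG n\<^esub> tv n a b \<in> auto (FG n)" "tv n (\<sigma> a) (\<sigma> b) \<otimes>\<^bsub>AFG n\<^esub> sp n \<sigma> \<in> auto (FG n)"
    using s by (simp_all add: AFG_closed sp_auto tv_auto)
  fix i assume i: "i < n"
  show "\<exists>r. (sp n \<sigma> \<otimes>\<^bsub>AFG n\<^esub> tv n a b) [(i, r)] = (tv n (\<sigma> a) (\<sigma> b) \<otimes>\<^bsub>AFG n\<^esub> sp n \<sigma>) [(i, r)]"
  proof (rule ex_letter)
    fix c :: letter assume c: "fst c = i"
    have *: "(sp n \<sigma> \<otimes>\<^bsub>AFG n\<^esub> tv n a b) [a] = (tv n (\<sigma> a) (\<sigma> b) \<otimes>\<^bsub>AFG n\<^esub> sp n \<sigma>) [a]"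
      using v s v' tv_letter(1)[OF v] tv_letter(1)[OF v'] auto_mult[OF sp_auto[OF s], of "[a]" "[b]"]
      by (simp add: AFG_mult_apply sp_auto tv_auto valid_def sp_letter)
    show "(sp n \<sigma> \<otimes>\<^bsub>AFG n\<^esub> tv n a b) [c] = (tv n (\<sigma> a) (\<sigma> b) \<otimes>\<^bsub>AFG n\<^esub> sp n \<sigma>) [c] \<or>
      (sp n \<sigma> \<otimes>\<^bsub>AFG n\<^esub> tv n a b) [inv_letter c] = (tv n (\<sigma> a) (\<sigma> b) \<otimes>\<^bsub>AFG n\<^esub> sp n \<sigma>) [inv_letter c]"
    proof (cases "fst c = fst a")
      case True
      then show ?thesis using * same_index[of c a] by (metis inv_letter_inv_letter)
    next
      case False
      then show ?thesis
        using v s v' c i tv_letter(3)[OF v, of c] tv_letter(3)[OF v', of "\<sigma> c"] sperm_fst[OF s, of c a]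
        by (simp add: AFG_mult_apply sp_auto tv_auto sp_letter sperm_less)
    qed
  qed
qed

lemma auto_eqI_letters:
  assumes f: "f \<in> auto (FG n)" and g: "g \<in> auto (FG n)"
    and eq: "\<And>c. fst c < n \<Longrightarrow> f [c] = g [c] \<or> f [inv_letter c] = g [inv_letter c]"
  shows "f = g"
proof (rule auto_eqI[OF f g])
  fix i assume "i < n"
  then show "\<exists>s. f [(i, s)] = g [(i, s)]" using eq[of "(i, True)"] by auto
qed

lemma valid_inv [simp]: "valid n (inv_letter a) b \<longleftrightarrow> valid n a b" "valid n a (inv_letter b) \<longleftrightarrow> valid n a b"
  by (auto simp: valid_def)

lemma one_AFG: "\<one>\<^bsub>AFG n\<^esub> \<in> auto (FG n)" "w \<in> carrier (FG n) \<Longrightarrow> \<one>\<^bsub>AFG n\<^esub> w = w"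
proof -
  show "\<one>\<^bsub>AFG n\<^esub> \<in> auto (FG n)"
    using monoid.one_closed[OF group.is_monoid[OF group_AFG]] by (simp add: carrier_AutoGroup)
qed (simp add: one_AutoGroup)

lemma tv_inv:
  assumes v: "valid n a b" shows "tv n a b \<otimes>\<^bsub>AFG n\<^esub> tv n a (inv_letter b) = \<one>\<^bsub>AFG n\<^esub>"
proof (rule auto_eqI_letters)
  interpret F: group "FG n" by (rule group_free_group)
  have v': "valid n a (inv_letter b)" using v by simp
  have lt: "fst a < n" "fst b < n" "fst a \<noteq> fst b" using v by (auto simp: valid_def)
  fix c :: letter assume c: "fst c < n"
  have *: "(tv n a b \<otimes>\<^bsub>AFG n\<^esub> tv n a (inv_letter b)) [a] = \<one>\<^bsub>AFG n\<^esub> [a]"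
    using tv_letter[OF v] tv_letter[OF v'] lt
    by (simp add: AFG_mult_apply tv_auto auto_mult[OF tv_auto] one_AFG F.m_assoc)
  show "(tv n a b \<otimes>\<^bsub>AFG n\<^esub> tv n a (inv_letter b)) [c] = \<one>\<^bsub>AFG n\<^esub> [c] \<or>
    (tv n a b \<otimes>\<^bsub>AFG n\<^esub> tv n a (inv_letter b)) [inv_letter c] = \<one>\<^bsub>AFG n\<^esub> [inv_letter c]"
  proof (cases "fst c = fst a")
    case True
    then show ?thesis using * same_index[of c a] by auto
  next
    case False
    then show ?thesis using tv_letter(3)[OF v c] tv_letter(3)[OF v' c] c
      by (simp add: AFG_mult_apply tv_auto one_AFG)
  qed
qed (simp_all add: AFG_closed tv_auto one_AFG)

text \<open>The case \<open>c = inv_letter a\<close> is included: it says that multiplying a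
  generator on the right and on the left commute.\<close>

lemma tv_commute:
  assumes v: "valid n a b" and v': "valid n c d"
    and ne: "a \<noteq> c" "fst a \<noteq> fst d" "fst b \<noteq> fst c"
  shows "tv n a b \<otimes>\<^bsub>AFG n\<^esub> tv n c d = tv n c d \<otimes>\<^bsub>AFG n\<^esub> tv n a b"
proof (rule auto_eqI_letters)
  interpret F: group "FG n" by (rule group_free_group)
  have lt: "fst a < n" "fst b < n" "fst a \<noteq> fst b" using v by (auto simp: valid_def)
  have lt': "fst c < n" "fst d < n" "fst c \<noteq> fst d" using v' by (auto simp: valid_def)
  note t = tv_letter[OF v] tv_letter[OF v']
  fix l :: letter assume l: "fst l < n"
  let ?f = "tv n a b \<otimes>\<^bsub>AFG n\<^esub> tv n c d" and ?g = "tv n c d \<otimes>\<^bsub>AFG n\<^esub> tv n a b"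
  show "?f [l] = ?g [l] \<or> ?f [inv_letter l] = ?g [inv_letter l]"
  proof (cases "fst l = fst a")
    case la: True
    have "?f [a] = ?g [a]"
    proof (cases "fst a = fst c")
      case True
      then have "a = inv_letter c" using ne same_index by blast
      then show ?thesis using t lt lt' ne
        by (simp add: AFG_mult_apply tv_auto auto_mult[OF tv_auto] F.m_assoc)
    next
      case False
      then show ?thesis using t(1) t(6)[of a] t(6)[of b] lt lt' ne
        by (simp add: AFG_mult_apply tv_auto auto_mult[OF tv_auto])
    qed
    then show ?thesis using la same_index[of l a] by auto
  next
    case la: False
    show ?thesis
    proof (cases "fst l = fst c")
      case True
      then have "fst a \<noteq> fst c" using la by simp
      then have "?f [c] = ?g [c]" using t(4) t(3)[of c] t(3)[of d] lt lt' ne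
        by (simp add: AFG_mult_apply tv_auto auto_mult[OF tv_auto])
      then show ?thesis using True same_index[of l c] by auto
    next
      case False
      then show ?thesis using t(3)[OF l la] t(6)[OF l False] l by (simp add: AFG_mult_apply tv_auto)
    qed
  qed
qed (simp_all add: AFG_closed tv_auto)

lemma tv_steinberg:
  assumes v: "valid n a b" "valid n b c" "valid n a c"
  shows "tv n b c \<otimes>\<^bsub>AFG n\<^esub> tv n a b = tv n a b \<otimes>\<^bsub>AFG n\<^esub> tv n b c \<otimes>\<^bsub>AFG n\<^esub> tv n a c"
proof (rule auto_eqI_letters)
  interpret F: group "FG n" by (rule group_free_group)
  have lt: "fst a < n" "fst b < n" "fst c < n" "fst a \<noteq> fst b" "fst b \<noteq> fst c" "fst a \<noteq> fst c"
    using v by (auto simp: valid_def)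
  note t = tv_letter[OF v(1)] tv_letter[OF v(2)] tv_letter[OF v(3)]
  fix l :: letter assume l: "fst l < n"
  let ?f = "tv n b c \<otimes>\<^bsub>AFG n\<^esub> tv n a b" and ?g = "tv n a b \<otimes>\<^bsub>AFG n\<^esub> tv n b c \<otimes>\<^bsub>AFG n\<^esub> tv n a c"
  have f: "?f w = tv n b c (tv n a b w)" if "w \<in> carrier (FG n)" for w
    using that by (simp add: AFG_mult_apply tv_auto)
  have g: "?g w = tv n a b (tv n b c (tv n a c w))" if "w \<in> carrier (FG n)" for w
    using that by (simp add: AFG_mult_apply tv_auto AFG_closed auto_closed[OF tv_auto])
  have "?f [a] = ?g [a]"
    using t lt by (simp add: f g auto_mult[OF tv_auto] F.m_assoc)
  moreover have "?f [b] = ?g [b]"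
    using t lt by (simp add: f g auto_mult[OF tv_auto])
  moreover have "?f [l] = ?g [l]" if "fst l \<noteq> fst a" "fst l \<noteq> fst b"
    using t(3)[of l] t(6)[of l] t(9)[of l] that l by (simp add: f g)
  ultimately show "?f [l] = ?g [l] \<or> ?f [inv_letter l] = ?g [inv_letter l]"
    using same_index[of l a] same_index[of l b] by (metis inv_letter_inv_letter)
qed (simp_all add: AFG_closed tv_auto)

text \<open>The quarter turn in the coordinates of a and b, a \<mapsto> b \<mapsto> a^-1.\<close>

definition wperm :: "letter \<Rightarrow> letter \<Rightarrow> letter \<Rightarrow> letter" where
  "wperm a b c = (if c = a then b else if c = inv_letter a then inv_letter b
     else if c = b then inv_letter a else if c = inv_letter b then a else c)"

lemma wperm_sperm:
  assumes v: "valid n a b" shows "wperm a b \<in> sperm n"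
proof (rule spermI)
  have ne: "a \<noteq> b" "a \<noteq> inv_letter b" "b \<noteq> inv_letter a" "inv_letter a \<noteq> b" "inv_letter b \<noteq> a"
    using v by (auto simp: valid_def)
  have 1: "wperm b a (wperm a b c) = c" for c
    using ne by (auto simp: wperm_def)
  have 2: "wperm a b (wperm b a c) = c" for c
    using ne by (auto simp: wperm_def)
  from 1 2 show "bij (wperm a b)" by (intro bijI') metis+
  show "wperm a b (inv_letter c) = inv_letter (wperm a b c)" for c
    using ne by (auto simp: wperm_def inv_letter_eq_iff)
  show "wperm a b c = c" if "n \<le> fst c" for c
    using v that by (auto simp: wperm_def valid_def)
qed

text \<open>The lift of the identity that writes a quarter turn as three elementary 2 by 2 matrices.
  The last factor is the left move a \<mapsto> b a, so that no conjugation is left over.\<close>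

lemma tv_weyl:
  assumes v: "valid n a b"
  shows "tv n a b \<otimes>\<^bsub>AFG n\<^esub> tv n b (inv_letter a) \<otimes>\<^bsub>AFG n\<^esub> tv n (inv_letter a) (inv_letter b)
    = sp n (wperm a b)"
proof (rule auto_eqI_letters)
  interpret F: group "FG n" by (rule group_free_group)
  have lt: "fst a < n" "fst b < n" "fst a \<noteq> fst b" using v by (auto simp: valid_def)
  have v2: "valid n b (inv_letter a)" "valid n (inv_letter a) (inv_letter b)" using v by (auto simp: valid_def)
  note t = tv_letter[OF v] tv_letter[OF v2(1)] tv_letter[OF v2(2)]
  have ne: "a \<noteq> b" "a \<noteq> inv_letter b" "b \<noteq> inv_letter a" "inv_letter a \<noteq> b" "inv_letter b \<noteq> a"
    using lt by auto
  let ?f = "tv n a b \<otimes>\<^bsub>AFG n\<^esub> tv n b (inv_letter a) \<otimes>\<^bsub>AFG n\<^esub> tv n (inv_letter a) (inv_letter b)"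
  fix l :: letter assume l: "fst l < n"
  have f: "?f w = tv n a b (tv n b (inv_letter a) (tv n (inv_letter a) (inv_letter b) w))"
    if "w \<in> carrier (FG n)" for w
    using that by (simp add: AFG_mult_apply tv_auto AFG_closed auto_closed[OF tv_auto])
  have g: "sp n (wperm a b) [c] = [wperm a b c]" if "fst c < n" for c
    using sp_letter[OF wperm_sperm[OF v] that] .
  have "?f [a] = sp n (wperm a b) [a]"
    using t lt ne by (simp add: f g auto_mult[OF tv_auto] F.m_assoc wperm_def)
  moreover have "?f [b] = sp n (wperm a b) [b]"
    using t lt ne by (simp add: f g auto_mult[OF tv_auto] wperm_def)
  moreover have "?f [l] = sp n (wperm a b) [l]" if d: "fst l \<noteq> fst a" "fst l \<noteq> fst b"
  proof -
    have "l \<noteq> a" "l \<noteq> b" "l \<noteq> inv_letter a" "l \<noteq> inv_letter b" using d by auto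
    then show ?thesis using t(3)[of l] t(6)[of l] t(9)[of l] d l by (simp add: f g wperm_def)
  qed
  ultimately show "?f [l] = sp n (wperm a b) [l] \<or> ?f [inv_letter l] = sp n (wperm a b) [inv_letter l]"
    using same_index[of l a] same_index[of l b] by (metis inv_letter_inv_letter)
qed (simp_all add: AFG_closed tv_auto sp_auto wperm_sperm[OF v])

definition tvprod :: "nat \<Rightarrow> bool \<Rightarrow> nat \<Rightarrow> nat list \<Rightarrow> letter list \<Rightarrow> letter list" where
  "tvprod n s j xs = foldr (\<lambda>k f. tv n (k, s) (j, s) \<otimes>\<^bsub>AFG n\<^esub> f) xs \<one>\<^bsub>AFG n\<^esub>"

lemma tvprod:
  assumes "distinct xs" "\<forall>k\<in>set xs. k < n \<and> k \<noteq> j" "j < n"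
  shows "tvprod n s j xs \<in> auto (FG n) \<and> (\<forall>c. fst c < n \<longrightarrow> tvprod n s j xs [c]
    = (if fst c \<in> set xs then (if snd c = s then [c] \<otimes>\<^bsub>FG n\<^esub> [(j, s)]
         else [(j, \<not> s)] \<otimes>\<^bsub>FG n\<^esub> [c]) else [c]))"
  using assms(1,2)
proof (induction xs)
  case Nil
  show ?case by (simp add: tvprod_def one_AFG)
next
  case (Cons k xs)
  have k: "k < n" "k \<noteq> j" "k \<notin> set xs" using Cons.prems by auto
  have IH: "tvprod n s j xs \<in> auto (FG n)"
    "\<And>c. fst c < n \<Longrightarrow> tvprod n s j xs [c] = (if fst c \<in> set xs then (if snd c = s then [c] \<otimes>\<^bsub>FG n\<^esub> [(j, s)]
         else [(j, \<not> s)] \<otimes>\<^bsub>FG n\<^esub> [c]) else [c])"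
    using Cons by auto
  have v: "valid n (k, s) (j, s)" using k assms(3) by (simp add: valid_def)
  have eq: "tvprod n s j (k # xs) = tv n (k, s) (j, s) \<otimes>\<^bsub>AFG n\<^esub> tvprod n s j xs" by (simp add: tvprod_def)
  have A: "tvprod n s j (k # xs) \<in> auto (FG n)" unfolding eq using IH(1) by (simp add: AFG_closed tv_auto)
  have [simp]: "tv n (k, s) (j, s) [(j, r)] = [(j, r)]" for r
    using tv_letter(3)[OF v, of "(j, r)"] k assms(3) by simp
  have "tvprod n s j (k # xs) [c] = (if fst c \<in> set (k # xs) then (if snd c = s then [c] \<otimes>\<^bsub>FG n\<^esub> [(j, s)]
         else [(j, \<not> s)] \<otimes>\<^bsub>FG n\<^esub> [c]) else [c])" if c: "fst c < n" for c
  proof -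
    have *: "tvprod n s j (k # xs) [c] = tv n (k, s) (j, s) (tvprod n s j xs [c])"
      unfolding eq using IH(1) c by (simp add: AFG_mult_apply tv_auto)
    show ?thesis
    proof (cases "fst c = k")
      case True
      then have T: "tvprod n s j (k # xs) [c] = tv n (k, s) (j, s) [c]" using * IH(2)[OF c] k by simp
      consider "c = (k, s)" | "c = (k, \<not> s)" using True by (cases c) auto
      then show ?thesis
      proof cases
        case 1
        then show ?thesis using T tv_letter(1)[OF v] by simp
      next
        case 2
        then show ?thesis using T tv_letter(2)[OF v] by simp
      qed
    next
      case False
      then have "tv n (k, s) (j, s) [c] = [c]" using tv_letter(3)[OF v c] by simp
      then show ?thesis using * IH(2)[OF c] False c assms(3) by (simp add: auto_mult[OF tv_auto])
    qed
  qed
  with A show ?case by blast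
qed

text \<open>Conjugating x_k x_j by x_j gives x_j x_k, and x_j itself is fixed. This is the source of
  the assumption \<open>outer\<close>.\<close>

lemma tvprod_outer:
  assumes j: "j < n"
    and xs: "distinct xs" "set xs = {..<n} - {j}"
  shows "tvprod n False j xs
     = (\<lambda>x \<in> carrier (FG n). [(j, True)] \<otimes>\<^bsub>FG n\<^esub> x \<otimes>\<^bsub>FG n\<^esub> inv\<^bsub>FG n\<^esub> [(j, True)]) \<otimes>\<^bsub>AFG n\<^esub> tvprod n True j xs"
proof (rule auto_eqI_letters)
  interpret F: group "FG n" by (rule group_free_group)
  have cj: "(\<lambda>x \<in> carrier (FG n). [(j, True)] \<otimes>\<^bsub>FG n\<^esub> x \<otimes>\<^bsub>FG n\<^esub> inv\<^bsub>FG n\<^esub> [(j, True)]) \<in> auto (FG n)"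
    by (rule F.conj_in_auto) (use j in simp)
  have P: "tvprod n s j xs \<in> auto (FG n)" for s using tvprod[of xs n j s] xs j by auto
  then show "tvprod n False j xs \<in> auto (FG n)" by blast
  show "(\<lambda>x \<in> carrier (FG n). [(j, True)] \<otimes>\<^bsub>FG n\<^esub> x \<otimes>\<^bsub>FG n\<^esub> inv\<^bsub>FG n\<^esub> [(j, True)]) \<otimes>\<^bsub>AFG n\<^esub> tvprod n True j xs \<in> auto (FG n)"
    using P cj by (simp add: AFG_closed)
  fix c :: letter assume c: "fst c < n"
  obtain k s where ks: "c = (k, s)" by (cases c)
  have i: "inv\<^bsub>FG n\<^esub> [(j, True)] = [(j, False)]" using j letter_inv[of "(j, True)" n] by simp
  have c1: "[(j, True)] \<otimes>\<^bsub>FG n\<^esub> [(j, False)] = \<one>\<^bsub>FG n\<^esub>" using letter_mult(1)[where a = "(j, True)" and n = n] by simp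
  have t: "tvprod n r j xs [(k, True)] = (if k \<noteq> j then (if r then [(k, True)] \<otimes>\<^bsub>FG n\<^esub> [(j, r)]
         else [(j, \<not> r)] \<otimes>\<^bsub>FG n\<^esub> [(k, True)]) else [(k, True)])" for r
    using tvprod[of xs n j r] xs j c ks by (cases r) auto
  have "tvprod n False j xs [(k, True)] = ((\<lambda>x \<in> carrier (FG n). [(j, True)] \<otimes>\<^bsub>FG n\<^esub> x \<otimes>\<^bsub>FG n\<^esub> inv\<^bsub>FG n\<^esub> [(j, True)]) \<otimes>\<^bsub>AFG n\<^esub> tvprod n True j xs) [(k, True)]"
    using t[of True] t[of False] j c ks P cj by (auto simp: AFG_mult_apply F.m_assoc i c1)
  then show "tvprod n False j xs [c] = ((\<lambda>x \<in> carrier (FG n). [(j, True)] \<otimes>\<^bsub>FG n\<^esub> x \<otimes>\<^bsub>FG n\<^esub> inv\<^bsub>FG n\<^esub> [(j, True)]) \<otimes>\<^bsub>AFG n\<^esub> tvprod n True j xs) [c] \<or>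
    tvprod n False j xs [inv_letter c] = ((\<lambda>x \<in> carrier (FG n). [(j, True)] \<otimes>\<^bsub>FG n\<^esub> x \<otimes>\<^bsub>FG n\<^esub> inv\<^bsub>FG n\<^esub> [(j, True)]) \<otimes>\<^bsub>AFG n\<^esub> tvprod n True j xs) [inv_letter c]"
    using ks by (cases s) auto
qed

section \<open>Nielsen's theorem\<close>

definition winv :: "letter list \<Rightarrow> letter list" where "winv w = rev (map inv_letter w)"

lemma winv_simps [simp]: "winv [] = []" "winv (u @ v) = winv v @ winv u" "length (winv w) = length w"
  "winv (winv w) = w" "winv w = [] \<longleftrightarrow> w = []"
  by (simp_all add: winv_def rev_map comp_def)

lemma winv_Cons: "winv (a # w) = winv w @ [inv_letter a]" by (simp add: winv_def)

lemma reduced_append: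
  "reduced (u @ v) \<longleftrightarrow> reduced u \<and> reduced v \<and> (u \<noteq> [] \<longrightarrow> v \<noteq> [] \<longrightarrow> hd v \<noteq> inv_letter (last u))"
  unfolding reduced_def successively_append_iff by auto

lemma reduced_winv: "reduced w \<Longrightarrow> reduced (winv w)"
  by (induction w rule: induct_list012)
    (auto simp: winv_Cons reduced_append inv_letter_eq_iff)

lemma winv_closed: "w \<in> carrier (FG n) \<Longrightarrow> winv w \<in> carrier (FG n)"
  using reduced_winv[of w] unfolding free_group_simps winv_def by (auto simp: mem_Times_iff)

lemma inv_FG: "w \<in> carrier (FG n) \<Longrightarrow> inv\<^bsub>FG n\<^esub> w = winv w"
proof (rule group.inv_equality[OF group_free_group])
  assume w: "w \<in> carrier (FG n)"
  have "foldr push_letter (winv w) w = []"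
    using foldr_push_inv[of "[]" w] w by (simp add: winv_def free_group_simps foldr_push_Nil)
  then show "winv w \<otimes>\<^bsub>FG n\<^esub> w = \<one>\<^bsub>FG n\<^esub>" by (simp add: free_group_simps)
qed (simp_all add: winv_closed)

lemma foldr_push_reduced: "reduced (u @ v) \<Longrightarrow> foldr push_letter u v = u @ v"
proof (induction u)
  case (Cons a u)
  then have "reduced (u @ v)" using reduced_Cons by simp
  then show ?case using Cons push_reduced[of a "u @ v"] by simp
qed simp

lemma foldr_push_cancel: "reduced v \<Longrightarrow> reduced (p @ v) \<Longrightarrow> foldr push_letter (winv p) (p @ v) = v"
  using foldr_push_inv[of v p] foldr_push_reduced[of p v] by (simp add: winv_def)

lemma cancellation:
  assumes "reduced u" "reduced v"
  obtains a p y where "u = a @ winv p" "v = p @ y" "reduced (a @ y)" "foldr push_letter u v = a @ y"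
proof -
  have "\<exists>a p y. u = a @ winv p \<and> v = p @ y \<and> reduced (a @ y)"
    using assms
  proof (induction u arbitrary: v rule: rev_induct)
    case Nil
    then have "[] = [] @ winv [] \<and> v = [] @ v \<and> reduced ([] @ v)" by simp
    then show ?case by blast
  next
    case (snoc x u)
    have u: "reduced u" using snoc.prems by (simp add: reduced_append)
    show ?case
    proof (cases "\<exists>v'. v = inv_letter x # v'")
      case True
      then obtain v' where v: "v = inv_letter x # v'" by blast
      then have "reduced v'" using snoc.prems reduced_Cons by blast
      from snoc.IH[OF u this] obtain a p y where *: "u = a @ winv p" "v' = p @ y" "reduced (a @ y)" by blast
      then have "u @ [x] = a @ winv (inv_letter x # p)" "v = (inv_letter x # p) @ y"
        using v by (simp_all add: winv_Cons)
      then show ?thesis using *(3) by blast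
    next
      case False
      then have "reduced ((u @ [x]) @ v)"
        using snoc.prems by (cases v) (auto simp: reduced_append)
      then have "u @ [x] = (u @ [x]) @ winv [] \<and> v = [] @ v \<and> reduced ((u @ [x]) @ v)" by simp
      then show ?thesis by blast
    qed
  qed
  then obtain a p y where *: "u = a @ winv p" "v = p @ y" "reduced (a @ y)" by blast
  have "reduced y" using *(3) by (simp add: reduced_append)
  then have "foldr push_letter u v = foldr push_letter a y"
    using foldr_push_cancel[of y p] assms(2) * by simp
  then show ?thesis using that[OF *] foldr_push_reduced[OF *(3)] by simp
qed

text \<open>The number of letters that cancel at the junction, that is, the Gromov product of u^-1
  and v in the Cayley tree.\<close>

definition canc :: "letter list \<Rightarrow> letter list \<Rightarrow> nat" where
  "canc u v = (length u + length v - length (foldr push_letter u v)) div 2"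

lemma canc:
  assumes "reduced u" "reduced v"
  obtains a p y where "u = a @ winv p" "v = p @ y" "reduced (a @ y)" "foldr push_letter u v = a @ y"
    "length p = canc u v"
proof -
  obtain a p y where *: "u = a @ winv p" "v = p @ y" "reduced (a @ y)" "foldr push_letter u v = a @ y"
    using cancellation[OF assms] by blast
  then have "length p = canc u v" unfolding canc_def by simp
  with that * show ?thesis by blast
qed

text \<open>If half of u cancelled in u u, then opposite letters of u would be inverse to each
  other. The two middle letters contradict reducedness, and a single middle letter would be its own
  inverse.\<close>

lemma canc_self:
  assumes u: "reduced u" "u \<noteq> []" shows "2 * canc u u < length u"
proof (rule ccontr)
  assume n: "\<not> ?thesis"
  obtain a p y where d: "u = a @ winv p" "u = p @ y" "length p = canc u u"
    using canc[OF u(1) u(1)] by blast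
  define m where "m = length u"
  have m: "m \<ge> 1" using u(2) unfolding m_def by (cases u) auto
  have "winv u = p @ winv a" using d(1) by simp
  then have nth: "u ! i = inv_letter (u ! (m - 1 - i))" if "i < length p" for i
  proof -
    have "i < m" using that d(2) unfolding m_def by simp
    have "u ! i = winv u ! i" using that d(2) \<open>winv u = p @ winv a\<close> by (simp add: nth_append)
    also have "\<dots> = inv_letter (u ! (m - 1 - i))"
      using \<open>i < m\<close> unfolding winv_def m_def by (simp add: rev_nth)
    finally show ?thesis .
  qed
  show False
  proof (cases "even m")
    case True
    define i where "i = m div 2 - 1"
    have i: "i < length p" "m - 1 - i = Suc i" "Suc i < m"
      using True m n d(3) unfolding i_def m_def by (auto elim!: evenE)
    then have "u ! i = inv_letter (u ! Suc i)" using nth by metis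
    moreover have "u ! Suc i \<noteq> inv_letter (u ! i)"
      using u(1) i(3) unfolding reduced_def m_def by (auto simp: successively_conv_nth)
    ultimately show False by simp
  next
    case False
    define i where "i = m div 2"
    have i: "i < length p" "m - 1 - i = i"
      using False n d(3) unfolding i_def m_def by (auto elim!: oddE)
    then show False using nth[of i] by simp
  qed
qed

definition code :: "nat \<Rightarrow> letter list \<Rightarrow> nat" where
  "code n w = foldl (\<lambda>x a. x * (2 * n) + (2 * fst a + of_bool (snd a))) 0 w"

lemma code_simps: "code n [] = 0" "code n (w @ [a]) = code n w * (2 * n) + (2 * fst a + of_bool (snd a))"
  by (simp_all add: code_def)

lemma digit_less: "fst a < n \<Longrightarrow> 2 * fst a + of_bool (snd a) < 2 * (n::nat)"
  by (cases "snd a") auto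

lemma code_mono:
  assumes "length c = length d" "\<forall>a\<in>set c \<union> set d. fst a < n" "code n p < code n q"
  shows "code n (p @ c) < code n (q @ d)"
  using assms(1,2)
proof (induction c d rule: rev_induct2)
  case 1
  then show ?case using assms(3) by simp
next
  case (4 x xs y ys)
  then have IH: "code n (p @ xs) < code n (q @ ys)" by simp
  have "2 * fst x + of_bool (snd x) < 2 * n" using digit_less[of x n] 4 by simp
  then have "code n ((p @ xs) @ [x]) < (code n (p @ xs) + 1) * (2 * n)"
    unfolding code_simps by (simp add: algebra_simps)
  also have "\<dots> \<le> code n (q @ ys) * (2 * n)" using IH by (intro mult_le_mono1) simp
  also have "\<dots> \<le> code n ((q @ ys) @ [y])" unfolding code_simps by simp
  finally show ?case by simp
qed simp_all

lemma code_inj: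
  assumes "length c = length d" "\<forall>a\<in>set c \<union> set d. fst a < n" "code n c = code n d"
  shows "c = d"
  using assms
proof (induction c d rule: rev_induct2)
  case (4 x xs y ys)
  have xy: "2 * fst x + of_bool (snd x) < 2 * n" "2 * fst y + of_bool (snd y) < 2 * n"
    using digit_less[of x n] digit_less[of y n] 4 by simp_all
  have eq: "code n xs * (2 * n) + (2 * fst x + of_bool (snd x)) = code n ys * (2 * n) + (2 * fst y + of_bool (snd y))"
    using 4(4) by (simp add: code_simps)
  have "code n xs = (code n xs * (2 * n) + (2 * fst x + of_bool (snd x))) div (2 * n)" using xy by simp
  also have "\<dots> = code n ys" unfolding eq using xy by simp
  finally have "code n xs = code n ys" .
  then have "xs = ys" using 4 by simp
  have "(2 * fst x + of_bool (snd x)) = (2 * fst y + of_bool (snd y) :: nat)" using eq \<open>code n xs = code n ys\<close> by simp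
  then have "x = y" by (cases x; cases y) (auto simp: of_bool_def split: if_splits, presburger+)
  with \<open>xs = ys\<close> show ?case by simp
qed simp_all

text \<open>Breaks ties between images of equal length: \<open>code\<close> orders words of equal length
  lexicographically, and \<open>half_code\<close> applies it to the initial halves of a word and its inverse.\<close>

definition half_code :: "nat \<Rightarrow> letter list \<Rightarrow> nat" where
  "half_code n w = code n (take (length w div 2) w) + code n (take (length w div 2) (winv w))"

lemma half_code_winv: "half_code n (winv w) = half_code n w"
  by (simp add: half_code_def)

text \<open>Since the prefix is at most half of the word, it lies inside the initial half and leaves
  the initial half of the inverse unchanged.\<close>

lemma half_code_mono:
  assumes pq: "length p = length q" "code n p < code n q"
    and z: "length q \<le> length z" "\<forall>a\<in>set z. fst a < n"
  shows "half_code n (p @ z) < half_code n (q @ z)"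
proof -
  define m where "m = length (q @ z) div 2"
  have m: "length q \<le> m" "m \<le> length z" using z unfolding m_def by auto
  have "take m (p @ z) = p @ take (m - length q) z" "take m (q @ z) = q @ take (m - length q) z"
    using pq(1) m by auto
  moreover have "take m (winv (p @ z)) = take m (winv z)" "take m (winv (q @ z)) = take m (winv z)"
    using m by simp_all
  moreover have "code n (p @ take (m - length q) z) < code n (q @ take (m - length q) z)"
    using z(2) pq(2) by (intro code_mono) (auto dest: in_set_takeD)
  moreover have "length (p @ z) div 2 = m" "length (q @ z) div 2 = m" using pq(1) unfolding m_def by simp_all
  ultimately show ?thesis unfolding half_code_def by simp
qed

section \<open>Nielsen reduction\<close>

inductive_set elem :: "nat \<Rightarrow> (letter list \<Rightarrow> letter list) set" for n where
  elem_sp: "\<sigma> \<in> sperm n \<Longrightarrow> sp n \<sigma> \<in> elem n"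
| elem_tv: "f \<in> elem n \<Longrightarrow> valid n a b \<Longrightarrow> f \<otimes>\<^bsub>AFG n\<^esub> tv n a b \<in> elem n"

lemma elem_auto: "f \<in> elem n \<Longrightarrow> f \<in> auto (FG n)"
  by (induction rule: elem.induct) (simp_all add: sp_auto AFG_closed tv_auto)

context
  fixes n :: nat and f :: "letter list \<Rightarrow> letter list"
  assumes f: "f \<in> auto (FG n)"
begin

private abbreviation img :: "letter \<Rightarrow> letter list" where "img a \<equiv> f [a]"

lemma img_closed: "fst a < n \<Longrightarrow> img a \<in> carrier (FG n)"
  using auto_closed[OF f] by simp

lemma img_reduced: "fst a < n \<Longrightarrow> reduced (img a)"
  using img_closed by (simp add: free_group_simps)

lemma img_letters: "fst a < n \<Longrightarrow> c \<in> set (img a) \<Longrightarrow> fst c < n"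
  using img_closed[of a] by (auto simp: free_group_simps)

lemma img_inv: "fst a < n \<Longrightarrow> img (inv_letter a) = winv (img a)"
  using group_hom.hom_inv[OF auto_group_hom[OF f], of "[a]"] inv_FG[OF img_closed, of a] by simp

lemma img_neq_Nil: "fst a < n \<Longrightarrow> img a \<noteq> []"
proof
  assume a: "fst a < n" "img a = []"
  have "f [] = []" using group_hom.hom_one[OF auto_group_hom[OF f]] by (simp add: free_group_simps)
  then have "f [a] = f []" using a by simp
  moreover have "inj_on f (carrier (FG n))" using f by (auto simp: auto_def Bij_def bij_betw_def)
  moreover have "[] \<in> carrier (FG n)" by (simp add: free_group_simps)
  ultimately show False using letter_closed[OF a(1)] by (auto dest: inj_onD)
qed

definition nielsen_measure :: "(letter list \<Rightarrow> letter list) \<Rightarrow> nat \<times> nat" where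
  "nielsen_measure g = (\<Sum>i<n. length (g [(i, True)]), \<Sum>i<n. half_code n (g [(i, True)]))"

lemma tv_words:
  assumes v: "valid n a b"
  shows "i < n \<Longrightarrow> i \<noteq> fst a \<Longrightarrow> (f \<otimes>\<^bsub>AFG n\<^esub> tv n a b) [(i, True)] = img (i, True)"
    and "length ((f \<otimes>\<^bsub>AFG n\<^esub> tv n a b) [(fst a, True)]) = length (foldr push_letter (img a) (img b))"
    and "half_code n ((f \<otimes>\<^bsub>AFG n\<^esub> tv n a b) [(fst a, True)]) = half_code n (foldr push_letter (img a) (img b))"
proof -
  have lt: "fst a < n" "fst b < n" using v by (auto simp: valid_def)
  show "i < n \<Longrightarrow> i \<noteq> fst a \<Longrightarrow> (f \<otimes>\<^bsub>AFG n\<^esub> tv n a b) [(i, True)] = img (i, True)"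
    using tv_letter(3)[OF v, of "(i, True)"] by (simp add: AFG_mult_apply f tv_auto)
  let ?w = "foldr push_letter (img a) (img b)"
  have w: "f ([a] \<otimes>\<^bsub>FG n\<^esub> [b]) = ?w" using auto_mult[OF f, of "[a]" "[b]"] lt by (simp add: free_group_simps(2))
  have ab: "[a] \<otimes>\<^bsub>FG n\<^esub> [b] \<in> carrier (FG n)"
    using monoid.m_closed[OF group.is_monoid[OF group_free_group]] lt by simp
  have "(f \<otimes>\<^bsub>AFG n\<^esub> tv n a b) [(fst a, True)] = ?w \<or> (f \<otimes>\<^bsub>AFG n\<^esub> tv n a b) [(fst a, True)] = winv ?w"
  proof (cases "snd a")
    case True
    then have "(fst a, True) = a" by (simp add: prod_eq_iff)
    then show ?thesis using tv_letter(1)[OF v] lt by (simp add: AFG_mult_apply f tv_auto w)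
  next
    case False
    then have i: "(fst a, True) = inv_letter a" by (cases a) simp
    have "tv n a b [inv_letter a] = inv\<^bsub>FG n\<^esub> ([a] \<otimes>\<^bsub>FG n\<^esub> [b])"
      using tv_letter(2)[OF v] group.inv_mult_group[OF group_free_group, of "[a]" n "[b]"] lt by simp
    then have "(f \<otimes>\<^bsub>AFG n\<^esub> tv n a b) [(fst a, True)] = winv ?w"
      using group_hom.hom_inv[OF auto_group_hom[OF f] ab] inv_FG[OF auto_closed[OF f ab]] lt
      by (simp add: AFG_mult_apply f tv_auto w i)
    then show ?thesis by blast
  qed
  then show "length ((f \<otimes>\<^bsub>AFG n\<^esub> tv n a b) [(fst a, True)]) = length ?w"
    "half_code n ((f \<otimes>\<^bsub>AFG n\<^esub> tv n a b) [(fst a, True)]) = half_code n ?w"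
    by (auto simp: half_code_winv)
qed

lemma length_img: "fst a < n \<Longrightarrow> length (img a) = length (img (fst a, True))"
  and half_img: "fst a < n \<Longrightarrow> half_code n (img a) = half_code n (img (fst a, True))"
proof -
  assume a: "fst a < n"
  obtain i s where s: "a = (i, s)" by (cases a)
  have "img a = img (i, True) \<or> img a = winv (img (i, True))"
    using img_inv[of "(i, True)"] a s by (cases s) auto
  then show "length (img a) = length (img (fst a, True))" "half_code n (img a) = half_code n (img (fst a, True))"
    using s by (auto simp: half_code_winv)
qed

lemma sum_change:
  fixes g h :: "nat \<Rightarrow> nat"
  assumes "j < n" "\<And>i. i < n \<Longrightarrow> i \<noteq> j \<Longrightarrow> g i = h i"
  shows "sum g {..<n} < sum h {..<n} \<longleftrightarrow> g j < h j" "sum g {..<n} = sum h {..<n} \<longleftrightarrow> g j = h j"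
proof -
  have "sum g {..<n} = g j + sum g ({..<n} - {j})" "sum h {..<n} = h j + sum h ({..<n} - {j})"
    using assms(1) by (simp_all add: sum.remove)
  moreover have "sum g ({..<n} - {j}) = sum h ({..<n} - {j})"
    by (rule sum.cong) (use assms(2) in auto)
  ultimately show "sum g {..<n} < sum h {..<n} \<longleftrightarrow> g j < h j" "sum g {..<n} = sum h {..<n} \<longleftrightarrow> g j = h j"
    by simp_all
qed

context
  assumes minimal: "\<And>a b. valid n a b \<Longrightarrow>
    (nielsen_measure (f \<otimes>\<^bsub>AFG n\<^esub> tv n a b), nielsen_measure f) \<notin> less_than <*lex*> less_than"
begin

lemma min_length:
  assumes v: "valid n a b" shows "length (img a) \<le> length (foldr push_letter (img a) (img b))"
proof (rule ccontr)
  have a: "fst a < n" using v by (simp add: valid_def)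
  assume "\<not> ?thesis"
  then have "length ((f \<otimes>\<^bsub>AFG n\<^esub> tv n a b) [(fst a, True)]) < length (img (fst a, True))"
    using tv_words(2)[OF v] length_img[OF a] by simp
  then have "(\<Sum>i<n. length ((f \<otimes>\<^bsub>AFG n\<^esub> tv n a b) [(i, True)])) < (\<Sum>i<n. length (img (i, True)))"
    using sum_change(1)[OF a, of "\<lambda>i. length ((f \<otimes>\<^bsub>AFG n\<^esub> tv n a b) [(i, True)])" "\<lambda>i. length (img (i, True))"]
      tv_words(1)[OF v] by simp
  then show False using minimal[OF v] by (simp add: nielsen_measure_def)
qed

text \<open>Minimality for the move b^-1 \<mapsto> b^-1 a^-1, whose image word is the inverse of the
  product of the images of a and b.\<close>

lemma min_length':
  assumes v: "valid n a b" shows "length (img b) \<le> length (foldr push_letter (img a) (img b))"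
proof -
  have lt: "fst a < n" "fst b < n" using v by (auto simp: valid_def)
  have v': "valid n (inv_letter b) (inv_letter a)" using v by (auto simp: valid_def)
  have ab: "img a \<otimes>\<^bsub>FG n\<^esub> img b \<in> carrier (FG n)"
    using monoid.m_closed[OF group.is_monoid[OF group_free_group]] img_closed lt by simp
  have "winv (img b) \<otimes>\<^bsub>FG n\<^esub> winv (img a) = winv (img a \<otimes>\<^bsub>FG n\<^esub> img b)"
    using group.inv_mult_group[OF group_free_group img_closed img_closed, of a b] inv_FG[OF ab]
      inv_FG[OF img_closed] lt by simp
  then have "foldr push_letter (winv (img b)) (winv (img a)) = winv (foldr push_letter (img a) (img b))"
    by (simp only: free_group_simps(2))
  then show ?thesis using min_length[OF v'] img_inv lt by simp
qed

lemma min_half: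
  assumes v: "valid n a b" and l: "length (foldr push_letter (img a) (img b)) = length (img a)"
  shows "half_code n (img a) \<le> half_code n (foldr push_letter (img a) (img b))"
proof (rule ccontr)
  have a: "fst a < n" using v by (simp add: valid_def)
  assume "\<not> ?thesis"
  then have "half_code n ((f \<otimes>\<^bsub>AFG n\<^esub> tv n a b) [(fst a, True)]) < half_code n (img (fst a, True))"
    using tv_words(3)[OF v] half_img[OF a] by simp
  then have "(\<Sum>i<n. half_code n ((f \<otimes>\<^bsub>AFG n\<^esub> tv n a b) [(i, True)])) < (\<Sum>i<n. half_code n (img (i, True)))"
    using sum_change(1)[OF a, of "\<lambda>i. half_code n ((f \<otimes>\<^bsub>AFG n\<^esub> tv n a b) [(i, True)])" "\<lambda>i. half_code n (img (i, True))"]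
      tv_words(1)[OF v] by simp
  moreover have "(\<Sum>i<n. length ((f \<otimes>\<^bsub>AFG n\<^esub> tv n a b) [(i, True)])) = (\<Sum>i<n. length (img (i, True)))"
    using sum_change(2)[OF a, of "\<lambda>i. length ((f \<otimes>\<^bsub>AFG n\<^esub> tv n a b) [(i, True)])" "\<lambda>i. length (img (i, True))"]
      tv_words(1,2)[OF v] l length_img[OF a] by simp
  ultimately show False using minimal[OF v] by (simp add: nielsen_measure_def)
qed

text \<open>The first of Nielsen's conditions: for different indices, shorter products are ruled out
  by minimality. Equal indices leave a = b, which is \<open>canc_self\<close>.\<close>

lemma canc_le:
  assumes lt: "fst a < n" "fst b < n" and ab: "b \<noteq> inv_letter a"
  shows "2 * canc (img a) (img b) \<le> length (img a)" "2 * canc (img a) (img b) \<le> length (img b)"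
    and "fst a = fst b \<Longrightarrow> 2 * canc (img a) (img b) < length (img b)"
proof -
  have self: "2 * canc (img a) (img b) < length (img b)" "2 * canc (img a) (img b) < length (img a)" if "fst a = fst b"
  proof -
    have "a = b" using that ab same_index[of b a] by auto
    then show "2 * canc (img a) (img b) < length (img b)" "2 * canc (img a) (img b) < length (img a)"
      using canc_self[OF img_reduced img_neq_Nil] lt by auto
  qed
  then show "fst a = fst b \<Longrightarrow> 2 * canc (img a) (img b) < length (img b)" by blast
  have "2 * canc (img a) (img b) \<le> length (img a) \<and> 2 * canc (img a) (img b) \<le> length (img b)"
  proof (cases "fst a = fst b")
    case True
    then show ?thesis using self by simp
  next
    case False
    then have v: "valid n a b" using lt by (simp add: valid_def)
    obtain A p y where d: "img a = A @ winv p" "img b = p @ y" "foldr push_letter (img a) (img b) = A @ y"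
      "length p = canc (img a) (img b)" using canc[OF img_reduced img_reduced] lt by metis
    then show ?thesis using min_length[OF v] min_length'[OF v] by simp
  qed
  then show "2 * canc (img a) (img b) \<le> length (img a)" "2 * canc (img a) (img b) \<le> length (img b)" by auto
qed

text \<open>The second of Nielsen's conditions. If it failed, the middle word would be p q^-1 with
  both halves cancelled. As p and q are distinct of equal length, exchanging one for the other in a
  neighbour keeps its length and lowers the tie-breaking code.\<close>

lemma canc_sum_less:
  assumes lt: "fst a < n" "fst b < n" "fst c < n" and ab: "b \<noteq> inv_letter a" "c \<noteq> inv_letter b"
  shows "canc (img a) (img b) + canc (img b) (img c) < length (img b)"
proof (rule ccontr)
  assume nl: "\<not> ?thesis"
  note c1 = canc_le[OF lt(1,2) ab(1)] and c2 = canc_le[OF lt(2,3) ab(2)]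
  obtain A p y where d: "img a = A @ winv p" "img b = p @ y" "foldr push_letter (img a) (img b) = A @ y"
    "length p = canc (img a) (img b)" using canc[OF img_reduced img_reduced] lt by metis
  obtain A' q z where d': "img b = A' @ winv q" "img c = q @ z" "foldr push_letter (img b) (img c) = A' @ z"
    "length q = canc (img b) (img c)" using canc[OF img_reduced img_reduced] lt by metis
  have h: "2 * length p = length (img b)" "2 * length q = length (img b)"
    using nl c1(2) c2(1) d(4) d'(4) by linarith+
  have ne: "fst a \<noteq> fst b" using c1(3) h(1) d(4) by auto
  have ne': "fst b \<noteq> fst c"
  proof
    assume "fst b = fst c"
    then have "2 * canc (img b) (img c) < length (img c)" "b = c" using c2(3) ab(2) same_index[of c b] by auto
    then show False using h(2) d'(4) by simp
  qed
  have "p @ y = A' @ winv q" using d(2) d'(1) by simp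
  then have A': "A' = p" and y: "y = winv q"
    using h d(2) d'(1) by (auto simp: append_eq_append_conv)
  have pn: "p \<noteq> []" using h(1) img_neq_Nil[OF lt(2)] by auto
  have pq: "p \<noteq> q"
  proof
    assume "p = q"
    then have "reduced (p @ winv p)" using img_reduced[OF lt(2)] d'(1) A' by simp
    then have "hd (winv p) \<noteq> inv_letter (last p)" using pn by (simp add: reduced_append)
    moreover have "hd (winv p) = inv_letter (last p)" using pn by (simp add: winv_def hd_rev last_map)
    ultimately show False by simp
  qed
  have let_pq: "\<forall>a\<in>set p \<union> set q. fst a < n"
    using img_letters[OF lt(2)] img_letters[OF lt(3)] d(2) d'(2) by auto
  have lpq: "length p = length q" using h by simp
  consider "code n p < code n q" | "code n q < code n p"
    using code_inj[OF lpq let_pq] pq by linarith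
  then show False
  proof cases
    case 1
    \<comment> \<open>The move c \<mapsto> b c replaces the image q z of c by p z.\<close>
    have v: "valid n (inv_letter c) (inv_letter b)" using lt ne' by (simp add: valid_def)
    have bc: "img b \<otimes>\<^bsub>FG n\<^esub> img c \<in> carrier (FG n)"
      using monoid.m_closed[OF group.is_monoid[OF group_free_group]] img_closed lt by simp
    have "winv (img c) \<otimes>\<^bsub>FG n\<^esub> winv (img b) = winv (img b \<otimes>\<^bsub>FG n\<^esub> img c)"
      using group.inv_mult_group[OF group_free_group img_closed img_closed, of b c] inv_FG[OF bc]
        inv_FG[OF img_closed] lt by simp
    then have w: "foldr push_letter (winv (img c)) (winv (img b)) = winv (p @ z)"
      using d'(3) A' by (simp add: free_group_simps(2))
    have "half_code n (winv (img c)) \<le> half_code n (winv (p @ z))"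
      using min_half[OF v] w img_inv[OF lt(2)] img_inv[OF lt(3)] d'(2) lpq by simp
    then have "half_code n (q @ z) \<le> half_code n (p @ z)"
      using d'(2) by (simp only: half_code_winv)
    moreover have "half_code n (p @ z) < half_code n (q @ z)"
    proof (rule half_code_mono[OF lpq 1])
      show "length q \<le> length z" using canc_le(2)[OF lt(2,3) ab(2)] d'(2,4) by simp
      show "\<forall>a\<in>set z. fst a < n" using img_letters[OF lt(3)] d'(2) by auto
    qed
    ultimately show False by simp
  next
    case 2
    \<comment> \<open>The move a \<mapsto> a b replaces the image A p^-1 of a by A q^-1; half codes
      are compared on the inverses, which begin with p and q.\<close>
    have v: "valid n a b" using lt ne by (simp add: valid_def)
    have "half_code n (img a) \<le> half_code n (A @ winv q)"
      using min_half[OF v] d y lpq by simp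
    then have "half_code n (winv (p @ winv A)) \<le> half_code n (winv (q @ winv A))"
      using d(1) by simp
    then have "half_code n (p @ winv A) \<le> half_code n (q @ winv A)" by (simp only: half_code_winv)
    moreover have "half_code n (q @ winv A) < half_code n (p @ winv A)"
    proof (rule half_code_mono[OF lpq[symmetric] 2])
      show "length p \<le> length (winv A)" using canc_le(1)[OF lt(1,2) ab(1)] d(1,4) by simp
      show "\<forall>c\<in>set (winv A). fst c < n" using img_letters[OF lt(1)] d(1) by (auto simp: winv_def)
    qed
    ultimately show False by simp
  qed
qed

text \<open>Nielsen's conditions leave at least one letter of every factor. The statement records
  exactly what survives of the first factor, because the next letter on the left cancels only into
  that part.\<close>

lemma reduced_product:
  assumes "a # w \<in> carrier (FG n)"
  shows "\<exists>s. f (a # w) = take (length (img a) - (case w of [] \<Rightarrow> 0 | b # _ \<Rightarrow> canc (img a) (img b))) (img a) @ s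
    \<and> length w \<le> length s"
  using assms
proof (induction w arbitrary: a)
  case Nil
  show ?case by simp
next
  case (Cons b w)
  have lt: "fst a < n" "fst b < n" and ab: "b \<noteq> inv_letter a" and bw: "b # w \<in> carrier (FG n)"
    using Cons.prems by (auto simp: free_group_simps dest: reduced_Cons)
  define c2 where "c2 = (case w of [] \<Rightarrow> 0 | c # _ \<Rightarrow> canc (img b) (img c))"
  obtain s where s: "f (b # w) = take (length (img b) - c2) (img b) @ s" "length w \<le> length s"
    using Cons.IH[OF bw] unfolding c2_def by blast
  obtain A p y where d: "img a = A @ winv p" "img b = p @ y" "reduced (A @ y)" "length p = canc (img a) (img b)"
    using canc[OF img_reduced img_reduced] lt by metis
  have c12: "canc (img a) (img b) + c2 < length (img b)"
  proof (cases w)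
    case Nil
    then show ?thesis using canc_le(2)[OF lt ab] img_neq_Nil[OF lt(2)] unfolding c2_def by (cases "img b") auto
  next
    case (Cons c w')
    then have "fst c < n" "c \<noteq> inv_letter b" using bw by (auto simp: free_group_simps)
    then show ?thesis using canc_sum_less[OF lt _ ab] Cons unfolding c2_def by simp
  qed
  define y' where "y' = take (length (img b) - c2 - length p) y"
  have tk: "take (length (img b) - c2) (img b) = p @ y'"
    using c12 d(2,4) unfolding y'_def by simp
  have y': "y' \<noteq> []" using c12 d(2,4) unfolding y'_def by auto
  have fbw: "f (b # w) = p @ (y' @ s)" using s(1) tk by simp
  have red: "reduced (p @ (y' @ s))"
    using auto_closed[OF f bw] fbw by (simp add: free_group_simps)
  then have red': "reduced (y' @ s)" by (simp add: reduced_append)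
  have "hd y' = hd y" using y' unfolding y'_def by (metis hd_take take_eq_Nil gr0I)
  then have red2: "reduced (A @ (y' @ s))"
    using d(3) red' y' by (auto simp: reduced_append y'_def)
  have "a # b # w = [a] \<otimes>\<^bsub>FG n\<^esub> (b # w)"
    using Cons.prems by (simp add: free_group_simps push_reduced)
  then have "f (a # b # w) = foldr push_letter (img a) (p @ (y' @ s))"
    using auto_mult[OF f, of "[a]" "b # w"] lt bw fbw by (simp add: free_group_simps(2))
  also have "\<dots> = foldr push_letter A (y' @ s)"
    using foldr_push_cancel[OF red' red] d(1) by simp
  also have "\<dots> = A @ y' @ s" using foldr_push_reduced[OF red2] by simp
  finally have "f (a # b # w) = A @ (y' @ s)" .
  moreover have "A = take (length (img a) - canc (img a) (img b)) (img a)" using d(1,4) by simp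
  moreover have "length (b # w) \<le> length (y' @ s)" using s(2) y' by (cases y') auto
  ultimately show ?case by (metis list.simps(5))
qed

lemma length_le:
  assumes w: "w \<in> carrier (FG n)" shows "length w \<le> length (f w)"
proof (cases w)
  case (Cons a w')
  have a: "fst a < n" using w Cons by (auto simp: free_group_simps)
  define c where "c = (case w' of [] \<Rightarrow> 0 | b # _ \<Rightarrow> canc (img a) (img b))"
  obtain s where s: "f (a # w') = take (length (img a) - c) (img a) @ s" "length w' \<le> length s"
    using reduced_product[of a w'] w Cons unfolding c_def by blast
  have "c < length (img a)"
  proof (cases w')
    case Nil
    then show ?thesis using img_neq_Nil[OF a] unfolding c_def by simp
  next
    case (Cons b w'')
    then have "fst b < n" "b \<noteq> inv_letter a" using w \<open>w = a # w'\<close> by (auto simp: free_group_simps)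
    then show ?thesis using canc_le(1)[OF a, of b] img_neq_Nil[OF a] Cons unfolding c_def by (cases "img a") auto
  qed
  then have "1 \<le> length (take (length (img a) - c) (img a))" by simp
  then show ?thesis using s Cons by simp
qed simp

text \<open>A minimal automorphism never shortens words, so the preimage of a letter, being
  nonempty, is a letter.\<close>

lemma minimal_is_sp: "\<exists>\<sigma>\<in>sperm n. f = sp n \<sigma>"
proof -
  have bij: "bij_betw f (carrier (FG n)) (carrier (FG n))" using f by (auto simp: auto_def Bij_def)
  have "\<exists>c. fst c < n \<and> f [c] = [a]" if a: "fst a < n" for a
  proof -
    obtain w where w: "w \<in> carrier (FG n)" "f w = [a]"
    proof -
      have "[a] \<in> f ` carrier (FG n)" using bij letter_closed[OF a] by (simp add: bij_betw_def)
      then show ?thesis using that by (elim imageE) simp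
    qed
    have "w \<noteq> []"
      using w(2) group_hom.hom_one[OF auto_group_hom[OF f]] by (auto simp: free_group_simps)
    moreover have "length w \<le> 1" using length_le[OF w(1)] w(2) by simp
    ultimately obtain c where "w = [c]" by (cases w) auto
    then show ?thesis using w by (auto simp: free_group_simps)
  qed
  then have "\<forall>a. \<exists>c. fst a < n \<longrightarrow> fst c < n \<and> f [c] = [a]" by blast
  from choice[OF this] obtain \<tau> where \<tau>: "\<And>a. fst a < n \<Longrightarrow> fst (\<tau> a) < n \<and> f [\<tau> a] = [a]" by blast
  let ?S = "{..<n} \<times> (UNIV :: bool set)"
  have "inj_on \<tau> ?S"
  proof (rule inj_onI)
    fix a b assume ab: "a \<in> ?S" "b \<in> ?S" "\<tau> a = \<tau> b"
    then have lt: "fst a < n" "fst b < n" by (simp_all add: mem_Times_iff)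
    have "[a] = [b]" using \<tau>[OF lt(1)] \<tau>[OF lt(2)] ab(3) by metis
    then show "a = b" by simp
  qed
  moreover have "\<tau> ` ?S \<subseteq> ?S"
  proof (rule image_subsetI)
    fix a assume "a \<in> ?S"
    then have "fst a < n" by (simp add: mem_Times_iff)
    from \<tau>[OF this] show "\<tau> a \<in> ?S" by (simp add: mem_Times_iff)
  qed
  ultimately have img: "\<tau> ` ?S = ?S" by (intro endo_inj_surj) auto
  then have "\<exists>a. fst a < n \<and> f [c] = [a]" if "fst c < n" for c
  proof -
    have "c \<in> \<tau> ` ?S" unfolding img using that by (simp add: mem_Times_iff)
    then obtain a where "a \<in> ?S" "c = \<tau> a" by (elim imageE) simp
    then have "fst a < n" "c = \<tau> a" by (simp_all add: mem_Times_iff)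
    then show ?thesis using \<tau>[of a] by blast
  qed
  then have "\<forall>c. \<exists>a. fst c < n \<longrightarrow> fst a < n \<and> f [c] = [a]" by blast
  from choice[OF this] obtain \<sigma>' where \<sigma>': "\<And>c. fst c < n \<Longrightarrow> fst (\<sigma>' c) < n \<and> f [c] = [\<sigma>' c]" by blast
  define \<sigma> where "\<sigma> c = (if fst c < n then \<sigma>' c else c)" for c
  have \<sigma>: "fst (\<sigma> c) < n" "f [c] = [\<sigma> c]" if "fst c < n" for c using \<sigma>' that by (auto simp: \<sigma>_def)
  have "\<sigma> \<in> sperm n"
  proof (rule spermI)
    show "\<sigma> c = c" if "n \<le> fst c" for c using that by (simp add: \<sigma>_def)
    show "\<sigma> (inv_letter c) = inv_letter (\<sigma> c)" for c
    proof (cases "fst c < n")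
      case True
      then have "[\<sigma> (inv_letter c)] = winv [\<sigma> c]" using img_inv[OF True] \<sigma>(2)[of c] \<sigma>(2)[of "inv_letter c"] by simp
      then show ?thesis by (simp add: winv_def)
    qed (simp add: \<sigma>_def)
    have "inj \<sigma>"
    proof (rule injI)
      fix c d assume eq: "\<sigma> c = \<sigma> d"
      show "c = d"
      proof (cases "fst c < n \<and> fst d < n")
        case True
        then have "f [c] = f [d]" using \<sigma>(2) eq by simp
        then show ?thesis using bij True letter_closed[of c n] letter_closed[of d n]
          unfolding bij_betw_def inj_on_def by blast
      next
        case False
        then show ?thesis using eq \<sigma>(1)[of c] \<sigma>(1)[of d] by (auto simp: \<sigma>_def split: if_splits)
      qed
    qed
    moreover have "surj \<sigma>"
    proof (rule surjI)
      fix a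
      show "\<sigma> (if fst a < n then \<tau> a else a) = a"
        using \<tau>[of a] \<sigma>(2)[of "\<tau> a"] by (auto simp: \<sigma>_def)
    qed
    ultimately show "bij \<sigma>" by (simp add: bij_def)
  qed
  moreover have "f = sp n \<sigma>"
    by (rule auto_eqI[OF f sp_auto[OF \<open>\<sigma> \<in> sperm n\<close>]])
      (simp add: sp_letter[OF \<open>\<sigma> \<in> sperm n\<close>] \<sigma>(2))
  ultimately show ?thesis by blast
qed

end
end

theorem nielsen: "f \<in> auto (FG n) \<Longrightarrow> f \<in> elem n"
proof (induction f rule: wf_induct_rule[OF wf_inv_image[of "less_than <*lex*> less_than" "nielsen_measure n"]])
  case 1
  show ?case by (simp add: wf_lex_prod)
next
  case (2 f)
  interpret A: group "AFG n" by (rule group_AFG)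
  show ?case
  proof (cases "\<exists>a b. valid n a b \<and>
      (nielsen_measure n (f \<otimes>\<^bsub>AFG n\<^esub> tv n a b), nielsen_measure n f) \<in> less_than <*lex*> less_than")
    case True
    then obtain a b where ab: "valid n a b"
      "(nielsen_measure n (f \<otimes>\<^bsub>AFG n\<^esub> tv n a b), nielsen_measure n f) \<in> less_than <*lex*> less_than" by blast
    have "f \<otimes>\<^bsub>AFG n\<^esub> tv n a b \<in> elem n" using 2(1)[of "f \<otimes>\<^bsub>AFG n\<^esub> tv n a b"] ab(2) 2(2) by (simp add: AFG_closed tv_auto)
    then have "f \<otimes>\<^bsub>AFG n\<^esub> tv n a b \<otimes>\<^bsub>AFG n\<^esub> tv n a (inv_letter b) \<in> elem n"
      using elem_tv[of _ n a "inv_letter b"] ab(1) by simp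
    moreover have "f \<otimes>\<^bsub>AFG n\<^esub> tv n a b \<otimes>\<^bsub>AFG n\<^esub> tv n a (inv_letter b) = f"
      using A.m_assoc[of f "tv n a b" "tv n a (inv_letter b)"] tv_inv[OF ab(1)] 2(2) A.r_one[of f]
      by (simp add: carrier_AutoGroup tv_auto)
    ultimately show ?thesis by simp
  next
    case False
    then obtain \<sigma> where "\<sigma> \<in> sperm n" "f = sp n \<sigma>" using minimal_is_sp[OF 2(2)] by blast
    then show ?thesis by (simp add: elem_sp)
  qed
qed

section \<open>The action on the abelianisation\<close>

text \<open>A vector \<open>v\<close> assigns to the letter \<open>a\<close> the coordinate \<open>ev v a\<close>, with a minus sign for inverse generators. The
  automorphism \<open>tv n a b\<close> acts by adding the coordinate of \<open>a\<close> to that of \<open>b\<close>.\<close>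

definition ev :: "(nat \<Rightarrow> int) \<Rightarrow> letter \<Rightarrow> int" where
  "ev v a = (if snd a then v (fst a) else - v (fst a))"

lemma ev_inv [simp]: "ev v (inv_letter a) = - ev v a"
  by (cases a) (simp add: ev_def)

lemma abs_ev: "\<bar>ev v a\<bar> = \<bar>v (fst a)\<bar>" by (simp add: ev_def)

definition actE :: "letter \<Rightarrow> letter \<Rightarrow> (nat \<Rightarrow> int) \<Rightarrow> nat \<Rightarrow> int" where
  "actE b a v = v(fst b := v (fst b) + (if snd b then ev v a else - ev v a))"

lemma ev_actE:
  "ev (actE b a v) b = ev v b + ev v a"
  "fst c \<noteq> fst b \<Longrightarrow> ev (actE b a v) c = ev v c"
  by (auto simp: actE_def ev_def)

lemma actE_fixed: "ev v a = 0 \<Longrightarrow> actE b a v = v"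
  by (auto simp: actE_def ev_def)

definition actS :: "(letter \<Rightarrow> letter) \<Rightarrow> (nat \<Rightarrow> int) \<Rightarrow> nat \<Rightarrow> int" where
  "actS \<sigma> v = (\<lambda>i. ev v (inv_into UNIV \<sigma> (i, True)))"

lemma ev_actS: "\<sigma> \<in> sperm n \<Longrightarrow> ev (actS \<sigma> v) c = ev v (inv_into UNIV \<sigma> c)"
proof -
  assume s: "\<sigma> \<in> sperm n"
  obtain i b where c: "c = (i, b)" by (cases c)
  have "(i, False) = inv_letter (i, True)" by simp
  then show ?thesis
    using sperm_inv_letter[OF sperm_inverse(1)[OF s], of "(i, True)"] unfolding c actS_def
    by (cases b) (simp_all add: ev_def[of "\<lambda>i. ev v (inv_into UNIV \<sigma> (i, True))"])
qed

lemma ev_actS': "\<sigma> \<in> sperm n \<Longrightarrow> ev (actS \<sigma> v) (\<sigma> c) = ev v c"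
  using ev_actS[of \<sigma> n v "\<sigma> c"] spermD(1)[of \<sigma> n] by (simp add: bij_is_inj)

definition norm1 :: "nat \<Rightarrow> (nat \<Rightarrow> int) \<Rightarrow> int" where "norm1 k v = (\<Sum>i<k. \<bar>v i\<bar>)"

lemma norm1_nonneg: "0 \<le> norm1 k v" by (simp add: norm1_def sum_nonneg)

lemma norm1_actE:
  assumes "fst b < k"
  shows "norm1 k (actE b a v) + \<bar>ev v b\<bar> = norm1 k v + \<bar>ev v b + ev v a\<bar>"
proof -
  have "norm1 k w = \<bar>w (fst b)\<bar> + (\<Sum>i\<in>{..<k} - {fst b}. \<bar>w i\<bar>)" for w
    unfolding norm1_def using assms by (simp add: sum.remove)
  moreover have "(\<Sum>i\<in>{..<k} - {fst b}. \<bar>actE b a v i\<bar>) = (\<Sum>i\<in>{..<k} - {fst b}. \<bar>v i\<bar>)"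
    by (rule sum.cong) (auto simp: actE_def)
  ultimately show ?thesis
    using abs_ev[of "actE b a v" b] abs_ev[of v b] ev_actE(1)[of b a v] by simp
qed

lemma norm1_actS:
  assumes s: "\<sigma> \<in> sperm k" shows "norm1 k (actS \<sigma> v) = norm1 k v"
proof -
  note s' = sperm_inverse[OF s]
  have c: "inv_into UNIV \<sigma> (\<sigma> c) = c" "\<sigma> (inv_into UNIV \<sigma> c) = c" for c
    using s'(2,3) by (metis comp_apply id_apply)+
  have f: "fst (\<sigma> (fst c, True)) = fst (\<sigma> c)" "fst (inv_into UNIV \<sigma> (fst c, True)) = fst (inv_into UNIV \<sigma> c)" for c
    using sperm_fst[OF s, of "(fst c, True)" c] sperm_fst[OF s'(1), of "(fst c, True)" c] by simp_all
  have "bij_betw (\<lambda>i. fst (inv_into UNIV \<sigma> (i, True))) {..<k} {..<k}"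
    by (rule bij_betwI[where g = "\<lambda>i. fst (\<sigma> (i, True))"])
      (auto simp: f c sperm_less[OF s] sperm_less[OF s'(1)])
  then have "(\<Sum>i<k. \<bar>v (fst (inv_into UNIV \<sigma> (i, True)))\<bar>) = (\<Sum>i<k. \<bar>v i\<bar>)"
    by (rule sum.reindex_bij_betw)
  then show ?thesis by (simp add: norm1_def actS_def abs_ev)
qed

lemma sperm_mono: "k \<le> n \<Longrightarrow> \<sigma> \<in> sperm k \<Longrightarrow> \<sigma> \<in> sperm n"
  by (rule spermI) (auto simp: spermD)

lemma valid_mono: "k \<le> n \<Longrightarrow> valid k a b \<Longrightarrow> valid n a b"
  by (auto simp: valid_def)

text \<open>Here \<open>E b a\<close> plays the role of \<open>tv n a b\<close>. Because of \<open>E_bar\<close>, the subgroup generated by the \<open>E b a\<close>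
  and the \<open>s \<sigma>\<close> turns out to act faithfully on the integer vectors.\<close>

locale steinberg_group = group Q for Q (structure) +
  fixes n :: nat and E :: "letter \<Rightarrow> letter \<Rightarrow> 'a" and s :: "(letter \<Rightarrow> letter) \<Rightarrow> 'a"
    and act :: "'a \<Rightarrow> (nat \<Rightarrow> int) \<Rightarrow> nat \<Rightarrow> int"
  assumes E_closed: "valid n a b \<Longrightarrow> E b a \<in> carrier Q"
    and s_closed: "\<sigma> \<in> sperm n \<Longrightarrow> s \<sigma> \<in> carrier Q"
    and s_id: "s id = \<one>"
    and s_mult: "\<lbrakk>\<sigma> \<in> sperm n; \<tau> \<in> sperm n\<rbrakk> \<Longrightarrow> s \<sigma> \<otimes> s \<tau> = s (\<sigma> \<circ> \<tau>)"
    and E_bar: "valid n a b \<Longrightarrow> E (inv_letter b) (inv_letter a) = E b a"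
    and E_inv: "valid n a b \<Longrightarrow> E b a \<otimes> E b (inv_letter a) = \<one>"
    and E_comm: "\<lbrakk>valid n a b; valid n c d; fst a \<noteq> fst d; fst c \<noteq> fst b\<rbrakk>
        \<Longrightarrow> E b a \<otimes> E d c = E d c \<otimes> E b a"
    and E_stein: "\<lbrakk>valid n a b; valid n b c; valid n a c\<rbrakk>
        \<Longrightarrow> E c b \<otimes> E b a = E b a \<otimes> E c b \<otimes> E c a"
    and s_E: "\<lbrakk>\<sigma> \<in> sperm n; valid n a b\<rbrakk> \<Longrightarrow> s \<sigma> \<otimes> E b a = E (\<sigma> b) (\<sigma> a) \<otimes> s \<sigma>"
    and E_weyl: "valid n a b \<Longrightarrow> E b a \<otimes> E (inv_letter a) b \<otimes> E b a = s (wperm a b)"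
    and act_one: "act \<one> v = v"
    and act_mult: "\<lbrakk>q \<in> carrier Q; r \<in> carrier Q\<rbrakk> \<Longrightarrow> act (q \<otimes> r) v = act q (act r v)"
    and act_E: "valid n a b \<Longrightarrow> act (E b a) v = actE b a v"
    and act_s: "\<sigma> \<in> sperm n \<Longrightarrow> act (s \<sigma>) v = actS \<sigma> v"
begin

abbreviation M :: "letter \<Rightarrow> letter" where "M \<equiv> inv_letter"

lemma inv_cancel: "valid n a b \<Longrightarrow> x \<in> carrier Q \<Longrightarrow> E b (M a) \<otimes> (E b a \<otimes> x) = x"
  "valid n a b \<Longrightarrow> x \<in> carrier Q \<Longrightarrow> E b a \<otimes> (E b (M a) \<otimes> x) = x"
  using E_inv[of a b] E_inv[of "M a" b] E_closed[of a b] E_closed[of "M a" b]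
  by (simp_all flip: m_assoc)

lemma comm_left:
  assumes "valid n a b" "valid n c d" "fst a \<noteq> fst d" "fst c \<noteq> fst b" "x \<in> carrier Q"
  shows "E b a \<otimes> (E d c \<otimes> x) = E d c \<otimes> (E b a \<otimes> x)"
  using E_comm[OF assms(1-4)] assms E_closed by (simp flip: m_assoc)

lemma stein_left:
  assumes "valid n a b" "valid n b c" "valid n a c" "x \<in> carrier Q"
  shows "E c b \<otimes> (E b a \<otimes> x) = E b a \<otimes> (E c b \<otimes> (E c a \<otimes> x))"
proof -
  have "E c b \<otimes> (E b a \<otimes> x) = (E c b \<otimes> E b a) \<otimes> x" using assms E_closed by (simp add: m_assoc)
  also have "\<dots> = E b a \<otimes> (E c b \<otimes> (E c a \<otimes> x))"
    unfolding E_stein[OF assms(1-3)] using assms E_closed by (simp add: m_assoc)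
  finally show ?thesis .
qed

lemma bar1: "valid n a b \<Longrightarrow> E (M b) a = E b (M a)" using E_bar[of "M a" b] by simp

section \<open>Relations that go around a peak\<close>

context
  fixes a b c x
  assumes v: "valid n a b" "valid n b c" "valid n a c" and x: "x \<in> carrier Q"
begin

private lemma v': "valid n b a" "valid n c b" "valid n c a" using v by (auto simp: valid_def)
private lemma ne: "fst a \<noteq> fst b" "fst b \<noteq> fst c" "fst a \<noteq> fst c" "fst b \<noteq> fst a" "fst c \<noteq> fst b" "fst c \<noteq> fst a"
  using v by (auto simp: valid_def)

private lemma cl: "E b a \<in> carrier Q" "E c b \<in> carrier Q" "E c a \<in> carrier Q"
  "E b c \<in> carrier Q" "E a b \<in> carrier Q" "E a c \<in> carrier Q"
  "E b (M a) \<in> carrier Q" "E c (M b) \<in> carrier Q" "E c (M a) \<in> carrier Q"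
  "E b (M c) \<in> carrier Q" "E a (M b) \<in> carrier Q" "E a (M c) \<in> carrier Q"
  using v v' by (auto intro!: E_closed)

text \<open>Adding a to b and then subtracting c from b: when c is at most a, subtract c from a
  first, add the result to b, and restore a.\<close>

lemma path_same_target_ge:
  "E b (M c) \<otimes> (E b a \<otimes> x) = E a c \<otimes> (E b a \<otimes> (E a (M c) \<otimes> x))"
proof -
  have "E b a \<otimes> (E a (M c) \<otimes> x) = E a (M c) \<otimes> (E b a \<otimes> (E b (M c) \<otimes> x))"
    using stein_left[of "M c" a b x] v v' x by simp
  then have "E a c \<otimes> (E b a \<otimes> (E a (M c) \<otimes> x)) = E b a \<otimes> (E b (M c) \<otimes> x)"
    using inv_cancel(2)[of c a "E b a \<otimes> (E b (M c) \<otimes> x)"] v v' x cl by simp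
  also have "\<dots> = E b (M c) \<otimes> (E b a \<otimes> x)"
    using comm_left[of a b "M c" b x] v v' ne x by simp
  finally show ?thesis by simp
qed

text \<open>When a is at most c, subtract a from c first, subtract the result from b, and restore
  c.\<close>

lemma path_same_target_le:
  "E b (M c) \<otimes> (E b a \<otimes> x) = E c a \<otimes> (E b (M c) \<otimes> (E c (M a) \<otimes> x))"
proof -
  have "E (M b) c \<otimes> (E c (M a) \<otimes> x) = E c (M a) \<otimes> (E (M b) c \<otimes> (E (M b) (M a) \<otimes> x))"
    using stein_left[of "M a" c "M b" x] v v' x by simp
  then have "E b (M c) \<otimes> (E c (M a) \<otimes> x) = E c (M a) \<otimes> (E b (M c) \<otimes> (E b a \<otimes> x))"
    using bar1[of c b] E_bar[of a b] v v' by simp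
  then show ?thesis
    using inv_cancel(2)[of a c "E b (M c) \<otimes> (E b a \<otimes> x)"] v v' x cl by simp
qed

lemma path_chain_up:
  "E c (M b) \<otimes> (E b a \<otimes> x) = E b a \<otimes> (E c (M b) \<otimes> (E c (M a) \<otimes> x))"
  using stein_left[of a b "M c" x] bar1[of b c] bar1[of a c] v v' x by simp

lemma path_chain_down:
  "E a (M c) \<otimes> (E b a \<otimes> x) = E b c \<otimes> (E b a \<otimes> (E a (M c) \<otimes> x))"
proof -
  have "E b a \<otimes> (E a (M c) \<otimes> (E b c \<otimes> x)) = E a (M c) \<otimes> (E b a \<otimes> (E b (M c) \<otimes> (E b c \<otimes> x)))"
    using stein_left[of "M c" a b "E b c \<otimes> x"] v v' x cl by simp
  also have "E b (M c) \<otimes> (E b c \<otimes> x) = x" using inv_cancel(1)[of c b x] v v' x by simp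
  finally have "E a (M c) \<otimes> (E b a \<otimes> x) = E b a \<otimes> (E a (M c) \<otimes> (E b c \<otimes> x))" by simp
  also have "E a (M c) \<otimes> (E b c \<otimes> x) = E b c \<otimes> (E a (M c) \<otimes> x)"
    using comm_left[of "M c" a c b x] v v' ne x by simp
  also have "E b a \<otimes> (E b c \<otimes> (E a (M c) \<otimes> x)) = E b c \<otimes> (E b a \<otimes> (E a (M c) \<otimes> x))"
    using comm_left[of a b c b "E a (M c) \<otimes> x"] v v' ne x cl by simp
  finally show ?thesis .
qed

lemma path_fix:
  "E b a \<otimes> (E c b \<otimes> x) = E c b \<otimes> (E b a \<otimes> (E c (M a) \<otimes> x))"
proof -
  have "E c b \<otimes> (E b a \<otimes> (E c (M a) \<otimes> x)) = E b a \<otimes> (E c b \<otimes> (E c a \<otimes> (E c (M a) \<otimes> x)))"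
    using stein_left[OF v, of "E c (M a) \<otimes> x"] x cl by simp
  also have "E c a \<otimes> (E c (M a) \<otimes> x) = x" using inv_cancel(2)[of a c x] v x by simp
  finally show ?thesis by simp
qed

end

text \<open>The rank two case, where no third coordinate is available: a quarter turn absorbs the
  two moves.\<close>

lemma path_weyl:
  assumes v: "valid n a b" and x: "x \<in> carrier Q"
  shows "E a (M b) \<otimes> (E b a \<otimes> x) = E b (M a) \<otimes> (s (wperm a b) \<otimes> x)"
    and "E b (M a) \<otimes> x = s (inv_into UNIV (wperm a b)) \<otimes> (E b a \<otimes> (E a (M b) \<otimes> x))"
proof -
  have v': "valid n b a" using v by (auto simp: valid_def)
  note w = wperm_sperm[OF v] and w' = sperm_inverse[OF wperm_sperm[OF v]]
  have cl: "E b a \<in> carrier Q" "E a (M b) \<in> carrier Q" "E b (M a) \<in> carrier Q" "E a b \<in> carrier Q"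
    "s (wperm a b) \<in> carrier Q" "s (inv_into UNIV (wperm a b)) \<in> carrier Q"
    using v v' w w'(1) by (auto intro!: E_closed s_closed)
  have W: "s (wperm a b) \<otimes> y = E b a \<otimes> (E a (M b) \<otimes> (E b a \<otimes> y))" if "y \<in> carrier Q" for y
  proof -
    have "s (wperm a b) = E b a \<otimes> E a (M b) \<otimes> E b a" using E_weyl[OF v] bar1[of b a] v' by simp
    then show ?thesis using cl that by (simp add: m_assoc)
  qed
  show "E a (M b) \<otimes> (E b a \<otimes> x) = E b (M a) \<otimes> (s (wperm a b) \<otimes> x)"
    using W[OF x] inv_cancel(1)[OF v, of "E a (M b) \<otimes> (E b a \<otimes> x)"] cl x by simp
  have "s (wperm a b) \<otimes> (E b (M a) \<otimes> x) = E b a \<otimes> (E a (M b) \<otimes> x)"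
    using W[of "E b (M a) \<otimes> x"] inv_cancel(2)[OF v x] cl x by simp
  moreover have "s (inv_into UNIV (wperm a b)) \<otimes> (s (wperm a b) \<otimes> (E b (M a) \<otimes> x)) = E b (M a) \<otimes> x"
    using s_mult[OF w'(1) w] w'(3) s_id cl x by (simp flip: m_assoc)
  ultimately show "E b (M a) \<otimes> x = s (inv_into UNIV (wperm a b)) \<otimes> (E b a \<otimes> (E a (M b) \<otimes> x))" by simp
qed

text \<open>This is a subgroup: \<open>E b (M a)\<close> inverts \<open>E b a\<close>, and the
  signed permutations are closed under inverses.\<close>

inductive_set Gen :: "nat \<Rightarrow> 'a set" for k where
  Gen_one: "\<one> \<in> Gen k"
| Gen_E: "q \<in> Gen k \<Longrightarrow> valid k a b \<Longrightarrow> E b a \<otimes> q \<in> Gen k"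
| Gen_s: "q \<in> Gen k \<Longrightarrow> \<sigma> \<in> sperm k \<Longrightarrow> s \<sigma> \<otimes> q \<in> Gen k"

lemma Gen_closed: "q \<in> Gen k \<Longrightarrow> k \<le> n \<Longrightarrow> q \<in> carrier Q"
  by (induction rule: Gen.induct) (auto intro!: E_closed s_closed intro: valid_mono sperm_mono)

end

definition unit_at :: "nat \<Rightarrow> nat \<Rightarrow> int" where "unit_at m = (\<lambda>i. if i = m then 1 else 0)"

context steinberg_group begin

lemma s_E_left:
  assumes "\<sigma> \<in> sperm n" "valid n a b" "x \<in> carrier Q"
  shows "s \<sigma> \<otimes> (E b a \<otimes> x) = E (\<sigma> b) (\<sigma> a) \<otimes> (s \<sigma> \<otimes> x)"
proof -
  have "valid n (\<sigma> a) (\<sigma> b)"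
    using assms sperm_less[OF assms(1)] sperm_fst[OF assms(1)] by (simp add: valid_def)
  then have "E (\<sigma> b) (\<sigma> a) \<in> carrier Q" by (rule E_closed)
  then show ?thesis
    using s_E[OF assms(1,2)] assms E_closed s_closed by (simp flip: m_assoc)
qed

lemma Gen_act_ge:
  assumes "q \<in> Gen m" "m \<le> n" "m \<le> i" shows "act q v i = v i"
  using assms(1)
proof (induction)
  case Gen_one
  then show ?case by (simp add: act_one)
next
  case (Gen_E q a b)
  then have "valid n a b" "fst b \<noteq> i" using assms by (auto simp: valid_def)
  then show ?case using Gen_E Gen_closed[OF Gen_E.hyps(1)] assms E_closed by (simp add: act_mult act_E actE_def)
next
  case (Gen_s q \<sigma>)
  have s: "\<sigma> \<in> sperm n" by (rule sperm_mono[OF assms(2) Gen_s.hyps(2)])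
  have "inv_into UNIV \<sigma> (i, True) = (i, True)"
    using spermD(3)[OF sperm_inverse(1)[OF Gen_s.hyps(2)], of "(i, True)"] assms by simp
  then show ?case using Gen_s Gen_closed[OF Gen_s.hyps(1)] assms s s_closed
    by (simp add: act_mult act_s actS_def ev_def)
qed

text \<open>The commutative unipotent group that adds multiples of the first l coordinates to
  coordinate m.\<close>

inductive_set row :: "nat \<Rightarrow> nat \<Rightarrow> 'a set" for m l where
  row_one: "\<one> \<in> row m l"
| row_E: "u \<in> row m l \<Longrightarrow> fst a < l \<Longrightarrow> E (m, True) a \<otimes> u \<in> row m l"

lemma row_closed: "u \<in> row m l \<Longrightarrow> l \<le> m \<Longrightarrow> m < n \<Longrightarrow> u \<in> carrier Q"
  by (induction rule: row.induct) (auto intro!: E_closed simp: valid_def)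

lemma row_act:
  assumes "u \<in> row m l" "l \<le> m" "m < n" "i \<noteq> m" shows "act u v i = v i"
  using assms(1)
proof induction
  case (row_E u a)
  then have "valid n a (m, True)" using assms by (auto simp: valid_def)
  then show ?case using row_E row_closed[OF row_E.hyps(1)] assms E_closed
    by (simp add: act_mult act_E actE_def)
qed (simp add: act_one)

lemma row_comm:
  assumes "u \<in> row m l" "l \<le> m" "m < n" "fst a < m"
  shows "u \<otimes> E (m, True) a = E (m, True) a \<otimes> u"
  using assms(1)
proof induction
  case row_one
  have "valid n a (m, True)" using assms by (auto simp: valid_def)
  then show ?case using E_closed by simp
next
  case (row_E u c)
  have v: "valid n a (m, True)" "valid n c (m, True)" using assms row_E by (auto simp: valid_def)
  note u = row_closed[OF row_E.hyps(1) assms(2,3)]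
  have "E (m, True) c \<otimes> u \<otimes> E (m, True) a = E (m, True) c \<otimes> (E (m, True) a \<otimes> u)"
    using row_E.IH v[THEN E_closed] u by (simp add: m_assoc)
  also have "\<dots> = E (m, True) a \<otimes> (E (m, True) c \<otimes> u)"
    using comm_left[OF v(2) v(1) _ _ u] v by (auto simp: valid_def)
  finally show ?case .
qed

text \<open>The factors commute, so those with source l can be collected into one power. The
  exponent is the matrix entry, read off from the basis vector at l.\<close>

lemma row_Suc:
  assumes "u \<in> row m (Suc l)" "l < m" "m < n"
  shows "\<exists>u'\<in>row m l. \<exists>k::int. u = u' \<otimes> E (m, True) (l, True) [^] k
    \<and> act u (\<lambda>i. if i = l then 1 else 0) m = k"
  using assms(1)
proof induction
  case row_one
  have "\<one> = \<one> \<otimes> E (m, True) (l, True) [^] (0::int)" by simp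
  then show ?case using row.row_one assms by (force simp: act_one)
next
  case (row_E u a)
  define T where "T = E (m, True) (l, True)"
  let ?d = "\<lambda>i. if i = l then 1 else 0 :: int"
  obtain u' k where u': "u' \<in> row m l" "u = u' \<otimes> T [^] (k::int)" and k: "act u ?d m = k"
    using row_E.IH[folded T_def] by (elim bexE exE conjE) (rule that)
  have v: "valid n a (m, True)" "valid n (l, True) (m, True)" using assms row_E by (auto simp: valid_def)
  note c = row_closed[OF row_E.hyps(1)] row_closed[OF u'(1)] E_closed[OF v(1)]
  have T: "T \<in> carrier Q" using E_closed[OF v(2)] by (simp add: T_def)
  have cu: "u \<in> carrier Q" "u' \<in> carrier Q" using c assms by auto
  have au: "act (E (m, True) a \<otimes> u) ?d m = k + ev ?d a"
    using row_act[OF row_E.hyps(1), of l ?d] row_act[OF row_E.hyps(1), of "fst a" ?d] v k c cu assms row_E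
    by (auto simp: act_mult act_E actE_def ev_def)
  show ?case
  proof (cases "fst a < l")
    case True
    then have "E (m, True) a \<otimes> u = (E (m, True) a \<otimes> u') \<otimes> T [^] k" "ev ?d a = 0"
      using u'(2) c cu T by (auto simp: m_assoc ev_def)
    then show ?thesis using au row.row_E[OF u'(1) True] unfolding T_def by fastforce
  next
    case False
    then have l: "fst a = l" using row_E by simp
    have Ta: "E (m, True) a = T [^] (ev ?d a)"
    proof (cases "snd a")
      case True
      then have "a = (l, True)" using l by (cases a) simp
      then show ?thesis using T by (simp add: ev_def T_def int_pow_1)
    next
      case False
      then have a: "a = inv_letter (l, True)" using l by (cases a) simp
      have "T \<otimes> E (m, True) a = \<one>" using E_inv[OF v(2)] by (simp add: T_def a)
      then have "E (m, True) a = inv T"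
        using T c by (metis inv_equality r_inv inv_closed l_cancel)
      moreover have "ev ?d a = - 1" using a by (simp add: ev_def)
      ultimately show ?thesis using T int_pow_neg[of T 1] by (simp add: int_pow_1)
    qed
    have "E (m, True) a \<otimes> u = u' \<otimes> E (m, True) a \<otimes> T [^] k"
      using row_comm[OF u'(1) _ assms(3), of a] l assms u'(2) c cu T by (simp add: m_assoc)
    also have "\<dots> = u' \<otimes> T [^] (k + ev ?d a)"
      using int_pow_mult[OF T, of "ev ?d a" k] cu T by (simp add: Ta m_assoc add.commute)
    finally show ?thesis using au u'(1) unfolding T_def by blast
  qed
qed

lemma row_eq_one:
  assumes "u \<in> row m l" "l \<le> m" "m < n" "\<And>v. act u v = v" shows "u = \<one>"
  using assms
proof (induction l arbitrary: u)
  case 0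
  from 0(1) show ?case by cases auto
next
  case (Suc l)
  obtain u' k where u': "u' \<in> row m l" "u = u' \<otimes> E (m, True) (l, True) [^] (k::int)"
    "act u (\<lambda>i. if i = l then 1 else 0) m = k"
    using row_Suc[OF Suc.prems(1) Suc_le_lessD[OF Suc.prems(2)] Suc.prems(3)]
    by (elim bexE exE conjE) (rule that)
  have "k = 0" using u'(3) Suc.prems by simp
  then have "u = u'" using u' row_closed[OF u'(1)] Suc.prems by simp
  then show ?case using Suc u'(1) by auto
qed

lemma row_conj_E:
  assumes "u \<in> row m m" "m < n" "valid m a b"
  shows "\<exists>u'\<in>row m m. E b a \<otimes> u = u' \<otimes> E b a"
  using assms(1)
proof induction
  case row_one
  have "valid n a b" using assms(2,3) by (auto simp: valid_def)
  then have "E b a \<in> carrier Q" by (rule E_closed)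
  then show ?case by (intro bexI[OF _ row.row_one]) simp
next
  case (row_E u c)
  obtain u' where u': "u' \<in> row m m" "E b a \<otimes> u = u' \<otimes> E b a" using row_E.IH by (elim bexE) (rule that)
  let ?M = "(m, True)"
  have v: "valid n a b" "valid n c ?M" "valid n a ?M" "valid n b ?M" using assms row_E by (auto simp: valid_def)
  note cl = v[THEN E_closed] row_closed[OF row_E.hyps(1) order_refl assms(2)] row_closed[OF u'(1) order_refl assms(2)]
  have am: "fst a \<noteq> m" "fst b \<noteq> m" "fst b < m" "fst a < m" "fst (M a) < m" using assms by (auto simp: valid_def)
  have step: "E b a \<otimes> (E ?M d \<otimes> u) = E ?M d \<otimes> u' \<otimes> E b a" if "fst d \<noteq> fst b" "fst d < m" for d
  proof -
    have vd: "valid n d ?M" using that assms(2) by (auto simp: valid_def)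
    show ?thesis
      using comm_left[OF v(1) vd _ that(1) cl(5)] am u'(2) E_closed[OF vd] cl by (simp add: m_assoc)
  qed
  \<comment> \<open>The only case with a nontrivial commutator: the source of the row factor is the
    target of the move. The commutator is again a row factor, by \<open>path_fix\<close>.\<close>
  have chain: "\<exists>u''\<in>row m m. E d e \<otimes> (E ?M d \<otimes> u) = u'' \<otimes> E b a"
    if de: "valid m e d" "E d e = E b a" for d e
  proof -
    have ve: "valid n e d" "valid n d ?M" "valid n e ?M" "fst (M e) < m" "fst d < m"
      using de assms(2) by (auto simp: valid_def)
    have eb: "fst (M e) \<noteq> fst d" "fst e \<noteq> m" "fst d \<noteq> m" using de by (auto simp: valid_def)
    have ve': "valid n (M e) ?M" using ve by (auto simp: valid_def)
    have "E d e \<otimes> (E ?M d \<otimes> u) = E ?M d \<otimes> (E d e \<otimes> (E ?M (M e) \<otimes> u))"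
      by (rule path_fix[OF ve(1-3) cl(5)])
    also have "E d e \<otimes> (E ?M (M e) \<otimes> u) = E ?M (M e) \<otimes> (E d e \<otimes> u)"
      using comm_left[OF ve(1) ve' _ _ cl(5)] eb by simp
    also have "E ?M d \<otimes> (E ?M (M e) \<otimes> (E d e \<otimes> u)) = (E ?M d \<otimes> (E ?M (M e) \<otimes> u')) \<otimes> E b a"
      using de(2) u'(2) cl E_closed[OF ve(2)] E_closed[OF ve'] by (simp add: m_assoc)
    finally show ?thesis using row.row_E[OF row.row_E[OF u'(1) ve(4)] ve(5)] by blast
  qed
  consider "fst c \<noteq> fst b" | "c = b" | "c = M b" using same_index[of c b] by auto
  then show ?case
  proof cases
    case 1
    then show ?thesis using step[of c] row.row_E[OF u'(1) row_E.hyps(2)] row_E.hyps(2) by blast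
  next
    case 2
    then show ?thesis using chain[of a b] assms(3) by auto
  next
    case 3
    then show ?thesis using chain[of "M a" "M b"] assms(3) E_bar[OF v(1)] by (auto simp: valid_def)
  qed
qed

lemma row_conj_s:
  assumes "u \<in> row m m" "m < n" "\<sigma> \<in> sperm m"
  shows "\<exists>u'\<in>row m m. s \<sigma> \<otimes> u = u' \<otimes> s \<sigma>"
  using assms(1)
proof induction
  case row_one
  have "\<sigma> \<in> sperm n" using sperm_mono[of m n] assms by simp
  then have "s \<sigma> \<in> carrier Q" by (rule s_closed)
  then show ?case by (intro bexI[OF _ row.row_one]) simp
next
  case (row_E u c)
  have s: "\<sigma> \<in> sperm n" using sperm_mono[of m n] assms by simp
  obtain u' where u': "u' \<in> row m m" "s \<sigma> \<otimes> u = u' \<otimes> s \<sigma>" using row_E.IH by (elim bexE) (rule that)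
  have v: "valid n c (m, True)" "valid n (\<sigma> c) (m, True)" "fst (\<sigma> c) < m"
    using assms row_E sperm_less[OF assms(3), of c] by (auto simp: valid_def)
  have "\<sigma> (m, True) = (m, True)" using spermD(3)[OF assms(3)] by simp
  then have "s \<sigma> \<otimes> (E (m, True) c \<otimes> u) = (E (m, True) (\<sigma> c) \<otimes> u') \<otimes> s \<sigma>"
    using s_E_left[OF s v(1)] row_closed[OF row_E.hyps(1)] row_closed[OF u'(1)] assms(2) u'(2)
      E_closed[OF v(2)] s_closed[OF s] by (simp add: m_assoc)
  then show ?case using row.row_E[OF u'(1) v(3)] by blast
qed

text \<open>The relations suffice to write every product of generators fixing the last basis vector in this
  form.\<close>

definition Stab :: "nat \<Rightarrow> 'a set" where
  "Stab m = {u \<otimes> h | u h. u \<in> row m m \<and> h \<in> Gen m}"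

lemma Stab_one: "\<one> \<in> Stab m"
proof -
  have "\<one> = \<one> \<otimes> \<one>" by simp
  then show ?thesis unfolding Stab_def using row_one Gen_one by blast
qed

lemma Stab_closed: "q \<in> Stab m \<Longrightarrow> m < n \<Longrightarrow> q \<in> carrier Q"
  by (auto simp: Stab_def row_closed Gen_closed)

lemma Stab_row:
  assumes "q \<in> Stab m" "m < n" "fst a < m" shows "E (m, True) a \<otimes> q \<in> Stab m"
proof -
  obtain u h where q: "q = u \<otimes> h" "u \<in> row m m" "h \<in> Gen m" using assms(1) by (auto simp: Stab_def)
  have "valid n a (m, True)" using assms by (auto simp: valid_def)
  then have "E (m, True) a \<otimes> q = (E (m, True) a \<otimes> u) \<otimes> h"
    using q row_closed[OF q(2)] Gen_closed[OF q(3)] E_closed assms(2) by (simp add: m_assoc)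
  then show ?thesis unfolding Stab_def using row_E[OF q(2) assms(3)] q(3) by blast
qed

text \<open>A move into coordinate m extends the row part; any other move normalises the row part
  and joins the factor of smaller rank.\<close>

lemma Stab_E:
  assumes q: "q \<in> Stab m" and m: "m < n" and v: "valid (Suc m) a b" and a: "fst a \<noteq> m"
  shows "E b a \<otimes> q \<in> Stab m"
proof (cases "fst b = m")
  case True
  have am: "fst a < m" using v a by (auto simp: valid_def)
  have "b = (m, True) \<or> b = M (m, True)" using True by (cases b) auto
  then show ?thesis
  proof
    assume b: "b = M (m, True)"
    have "valid n a (m, True)" using m am by (auto simp: valid_def)
    then have "E b a = E (m, True) (M a)" unfolding b by (rule bar1)
    then show ?thesis using Stab_row[OF q m, of "M a"] am by simp
  qed (use Stab_row[OF q m am] in simp)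
next
  case False
  then have v: "valid m a b" using v a by (auto simp: valid_def)
  then have vn: "valid n a b" using m by (auto simp: valid_def)
  obtain u h where q: "q = u \<otimes> h" "u \<in> row m m" "h \<in> Gen m" using assms(1) by (auto simp: Stab_def)
  obtain u' where u': "u' \<in> row m m" "E b a \<otimes> u = u' \<otimes> E b a" using row_conj_E[OF q(2) m v] by (elim bexE) (rule that)
  have "E b a \<otimes> q = (E b a \<otimes> u) \<otimes> h"
    using q row_closed[OF q(2)] Gen_closed[OF q(3)] E_closed[OF vn] m by (simp add: m_assoc)
  also have "\<dots> = u' \<otimes> (E b a \<otimes> h)"
    unfolding u'(2) using row_closed[OF u'(1)] Gen_closed[OF q(3)] E_closed[OF vn] m by (simp add: m_assoc)
  finally show ?thesis unfolding Stab_def using u'(1) Gen_E[OF q(3) v] by blast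
qed

lemma Stab_s:
  assumes q: "q \<in> Stab m" and m: "m < n" and s: "\<sigma> \<in> sperm m"
  shows "s \<sigma> \<otimes> q \<in> Stab m"
proof -
  have sn: "\<sigma> \<in> sperm n" using sperm_mono[of m n] s m by simp
  obtain u h where q: "q = u \<otimes> h" "u \<in> row m m" "h \<in> Gen m" using assms(1) by (auto simp: Stab_def)
  obtain u' where u': "u' \<in> row m m" "s \<sigma> \<otimes> u = u' \<otimes> s \<sigma>" using row_conj_s[OF q(2) m s] by (elim bexE) (rule that)
  have "s \<sigma> \<otimes> q = (s \<sigma> \<otimes> u) \<otimes> h"
    using q row_closed[OF q(2)] Gen_closed[OF q(3)] s_closed[OF sn] m by (simp add: m_assoc)
  also have "\<dots> = u' \<otimes> (s \<sigma> \<otimes> h)"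
    unfolding u'(2) using row_closed[OF u'(1)] Gen_closed[OF q(3)] s_closed[OF sn] m by (simp add: m_assoc)
  finally show ?thesis unfolding Stab_def using u'(1) Gen_s[OF q(3) s] by blast
qed

lemma Stab_act:
  assumes "q \<in> Stab m" "m < n" shows "act q (unit_at m) = unit_at m"
proof -
  obtain u h where q: "q = u \<otimes> h" "u \<in> row m m" "h \<in> Gen m" using assms(1) by (auto simp: Stab_def)
  have "act h (unit_at m) = unit_at m"
    using q(3)
  proof induction
    case (Gen_E q a b)
    then have "valid n a b" "ev (unit_at m) a = 0" using assms by (auto simp: valid_def ev_def unit_at_def)
    then show ?case using Gen_E Gen_closed[OF Gen_E.hyps(1)] assms E_closed by (simp add: act_mult act_E actE_fixed)
  next
    case (Gen_s q \<sigma>)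
    have s: "\<sigma> \<in> sperm n" using sperm_mono[of m n] Gen_s.hyps(2) assms by simp
    have "actS \<sigma> (unit_at m) = unit_at m"
    proof
      fix i
      note s' = sperm_inverse(1)[OF Gen_s.hyps(2)]
      show "actS \<sigma> (unit_at m) i = unit_at m i"
        using spermD(3)[OF s', of "(i, True)"] sperm_less[OF s', of "(i, True)"]
        by (cases "i < m") (auto simp: actS_def ev_def unit_at_def)
    qed
    then show ?case using Gen_s Gen_closed[OF Gen_s.hyps(1)] assms s s_closed by (simp add: act_mult act_s)
  qed (rule act_one)
  moreover have "act u (unit_at m) = unit_at m"
    using q(2)
  proof induction
    case (row_E u a)
    then have "valid n a (m, True)" "ev (unit_at m) a = 0" using assms by (auto simp: valid_def ev_def unit_at_def)
    then show ?case using row_E row_closed[OF row_E.hyps(1)] assms E_closed by (simp add: act_mult act_E actE_fixed)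
  qed (rule act_one)
  ultimately show ?thesis using q row_closed[OF q(2)] Gen_closed[OF q(3)] assms by (simp add: act_mult)
qed

text \<open>\<open>Reach m\<close> consists of the products in which the image of the last basis vector never decreases
  while the factors are applied one after the other.\<close>

inductive_set Reach :: "nat \<Rightarrow> 'a set" for m where
  Reach_Stab: "q \<in> Stab m \<Longrightarrow> q \<in> Reach m"
| Reach_s: "q \<in> Reach m \<Longrightarrow> \<sigma> \<in> sperm (Suc m) \<Longrightarrow> s \<sigma> \<otimes> q \<in> Reach m"
| Reach_up: "q \<in> Reach m \<Longrightarrow> valid (Suc m) a b \<Longrightarrow> 0 < ev (act q (unit_at m)) a
    \<Longrightarrow> 0 \<le> ev (act q (unit_at m)) b \<Longrightarrow> E b a \<otimes> q \<in> Reach m"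

lemma Reach_closed: "q \<in> Reach m \<Longrightarrow> m < n \<Longrightarrow> q \<in> carrier Q"
proof (induction rule: Reach.induct)
  case (Reach_s q \<sigma>)
  then show ?case using s_closed sperm_mono[of "Suc m" n \<sigma>] by simp
next
  case (Reach_up q a b)
  then show ?case using E_closed valid_mono[of "Suc m" n a b] by simp
qed (rule Stab_closed)

context
  fixes m :: nat assumes m: "m < n"
begin

section \<open>Peak reduction for the image of the last basis vector\<close>

definition val :: "'a \<Rightarrow> letter \<Rightarrow> int" where "val q = ev (act q (unit_at m))"
definition size1 :: "'a \<Rightarrow> int" where "size1 q = norm1 (Suc m) (act q (unit_at m))"

lemma val_inv: "val q (M a) = - val q a" by (simp add: val_def)

lemma val_E:
  assumes "valid (Suc m) a b" "q \<in> carrier Q"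
  shows "val (E b a \<otimes> q) b = val q b + val q a" "fst c \<noteq> fst b \<Longrightarrow> val (E b a \<otimes> q) c = val q c"
proof -
  have v: "valid n a b" using valid_mono[of "Suc m" n] m assms(1) by simp
  show "val (E b a \<otimes> q) b = val q b + val q a" "fst c \<noteq> fst b \<Longrightarrow> val (E b a \<otimes> q) c = val q c"
    using v assms(2) E_closed[OF v] by (simp_all add: val_def act_mult act_E ev_actE)
qed

lemma size1_E:
  assumes "valid (Suc m) a b" "q \<in> carrier Q"
  shows "size1 (E b a \<otimes> q) + \<bar>val q b\<bar> = size1 q + \<bar>val q b + val q a\<bar>"
proof -
  have v: "valid n a b" "fst b < Suc m" using valid_mono[of "Suc m" n] m assms(1) by (simp_all add: valid_def)
  then show ?thesis using assms(2) E_closed[OF v(1)] norm1_actE[OF v(2)] by (simp add: size1_def val_def act_mult act_E)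
qed

lemma val_s:
  assumes "\<sigma> \<in> sperm (Suc m)" "q \<in> carrier Q"
  shows "val (s \<sigma> \<otimes> q) (\<sigma> c) = val q c" "size1 (s \<sigma> \<otimes> q) = size1 q"
proof -
  have s: "\<sigma> \<in> sperm n" using sperm_mono[of "Suc m" n] m assms(1) by simp
  show "val (s \<sigma> \<otimes> q) (\<sigma> c) = val q c" "size1 (s \<sigma> \<otimes> q) = size1 q"
    using s assms(2) s_closed[OF s] ev_actS'[OF s] norm1_actS[OF assms(1)]
    by (simp_all add: val_def size1_def act_mult act_s)
qed

lemma size1_nonneg: "0 \<le> size1 q" by (simp add: size1_def norm1_nonneg)

text \<open>A move that decreases or preserves the size of the vector can be absorbed: if the preceding
  move was increasing, then the relations replace the peak by a detour through smaller vectors.\<close>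

definition Good :: "'a \<Rightarrow> bool" where
  "Good q \<longleftrightarrow> (\<forall>a b. valid (Suc m) a b \<longrightarrow>
     (0 < val q a \<and> val q a \<le> val q b \<longrightarrow> E b (M a) \<otimes> q \<in> Reach m) \<and>
     (val q a = 0 \<longrightarrow> E b a \<otimes> q \<in> Reach m))"

lemma Good_fix: "Good q \<Longrightarrow> valid (Suc m) a b \<Longrightarrow> val q a = 0 \<Longrightarrow> E b a \<otimes> q \<in> Reach m"
  by (simp add: Good_def del: split_paired_All)

lemma Good_down:
  assumes "Good q" "valid (Suc m) a b" "0 \<le> val q a" "val q a \<le> val q b"
  shows "E b (M a) \<otimes> q \<in> Reach m"
proof (cases "val q a = 0")
  case True
  then show ?thesis using Good_fix[of q "M a" b] assms by (simp add: val_inv)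
next
  case False
  then show ?thesis using assms unfolding Good_def by (simp del: split_paired_All)
qed

lemma Good_up:
  assumes "Good q" "q \<in> Reach m" "valid (Suc m) a b" "0 \<le> val q a" "0 \<le> val q b"
  shows "E b a \<otimes> q \<in> Reach m"
proof (cases "val q a = 0")
  case True
  then show ?thesis using Good_fix assms by simp
next
  case False
  then show ?thesis using Reach_up[of q m a b] assms by (simp add: val_def)
qed

text \<open>An increasing move followed by a decreasing one is rewritten by the detour relations.
  The nonincreasing steps of each detour start from vectors no larger than that of r, hence below
  the peak, where \<open>good\<close> applies.\<close>

lemma up_down:
  assumes r: "r \<in> Reach m" and v: "valid (Suc m) a b" and pos: "0 < val r a" "0 \<le> val r b"
    and good: "\<And>q. q \<in> Reach m \<Longrightarrow> size1 q < size1 (E b a \<otimes> r) \<Longrightarrow> Good q"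
    and w: "valid (Suc m) c d" and le: "0 < val (E b a \<otimes> r) c" "val (E b a \<otimes> r) c \<le> val (E b a \<otimes> r) d"
  shows "E d (M c) \<otimes> (E b a \<otimes> r) \<in> Reach m"
proof -
  note cl = Reach_closed[OF _ m]
  note vE = val_E[OF _ cl]
  have rq: "r \<in> carrier Q" by (rule cl[OF r])
  have sz: "size1 (E b a \<otimes> r) = size1 r + val r a" using size1_E[OF v rq] pos by simp
  have down: "E y (M x) \<otimes> q \<in> Reach m" "size1 (E y (M x) \<otimes> q) \<le> size1 r"
     "val (E y (M x) \<otimes> q) y = val q y - val q x"
     "\<And>z. fst z \<noteq> fst y \<Longrightarrow> val (E y (M x) \<otimes> q) z = val q z"
    if "q \<in> Reach m" "size1 q \<le> size1 r" "valid (Suc m) x y" "0 \<le> val q x" "val q x \<le> val q y" for q x y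
  proof -
    have "Good q" using good that(1,2) sz pos by simp
    then show "E y (M x) \<otimes> q \<in> Reach m" by (rule Good_down[OF _ that(3-5)])
    show "size1 (E y (M x) \<otimes> q) \<le> size1 r" "val (E y (M x) \<otimes> q) y = val q y - val q x"
      using that size1_E[of "M x" y q] vE[of "M x" y q] cl[OF that(1)] by (simp_all add: val_inv)
    show "val (E y (M x) \<otimes> q) z = val q z" if "fst z \<noteq> fst y" for z
      using that \<open>valid (Suc m) x y\<close> vE(2)[OF _ \<open>q \<in> Reach m\<close>, of "M x" y z] by simp
  qed
  have fixs: "E y x \<otimes> q \<in> Reach m" if "q \<in> Reach m" "size1 q \<le> size1 r" "valid (Suc m) x y" "val q x = 0" for q x y
    using good[OF that(1)] Good_fix[of q x y] that sz pos by simp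
  have up: "E y x \<otimes> q \<in> Reach m" "val (E y x \<otimes> q) y = val q y + val q x"
     "\<And>z. fst z \<noteq> fst y \<Longrightarrow> val (E y x \<otimes> q) z = val q z"
    if "q \<in> Reach m" "valid (Suc m) x y" "0 \<le> val q x" "0 \<le> val q y" "val q x > 0 \<or> size1 q \<le> size1 r" for q x y
  proof -
    show "E y x \<otimes> q \<in> Reach m"
    proof (cases "val q x = 0")
      case True
      then show ?thesis using fixs that by simp
    next
      case False
      then show ?thesis using Reach_up[OF that(1,2)] that(3,4) by (simp add: val_def)
    qed
  qed (use vE[OF that(2,1)] in auto)
  have v': "valid n a b" "valid n b a" "valid (Suc m) b a" and w': "valid n c d" "valid n d c" "valid (Suc m) d c"
    using v w m by (auto simp: valid_def)
  have vb: "val (E b a \<otimes> r) b = val r b + val r a" and vo: "\<And>z. fst z \<noteq> fst b \<Longrightarrow> val (E b a \<otimes> r) z = val r z"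
    using vE[OF v r] by auto
  have va: "val (E b a \<otimes> r) a = val r a" using vo[of a] v by (simp add: valid_def)
  have dpos: "0 < val (E b a \<otimes> r) d" using le by simp
  \<comment> \<open>At the peak all four letters have positive value, so letters of equal index are
    equal. This leaves six configurations.\<close>
  have same: "x = y" if "fst x = fst y" "0 < val (E b a \<otimes> r) x" "0 < val (E b a \<otimes> r) y" for x y
  proof -
    have "x = y \<or> x = M y" using same_index[of x y] that(1) by auto
    then show ?thesis using that by (auto simp: val_inv)
  qed
  have cb: "fst c = fst b \<Longrightarrow> c = b" and db: "fst d = fst b \<Longrightarrow> d = b"
    and ca: "fst c = fst a \<Longrightarrow> c = a" and da: "fst d = fst a \<Longrightarrow> d = a"
    using same le dpos va vb pos by auto
  have ne: "fst c \<noteq> fst d" "fst a \<noteq> fst b" using v w by (auto simp: valid_def)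
  consider "d = b" "c = a" | "d = b" "fst c \<noteq> fst a" "fst c \<noteq> fst b" | "c = b" "fst d \<noteq> fst a" "fst d \<noteq> fst b"
    | "c = b" "d = a" | "d = a" "fst c \<noteq> fst a" "fst c \<noteq> fst b" | "fst c \<noteq> fst b" "fst d \<noteq> fst a" "fst d \<noteq> fst b"
    using cb db ca da ne by metis
  then show ?thesis
  proof cases
    case 1
    then show ?thesis using inv_cancel(1)[OF v'(1) rq] r by simp
  next
    case 2
    have vc: "val (E b a \<otimes> r) c = val r c" by (rule vo[OF 2(3)])
    have tri: "valid n a b" "valid n b c" "valid n a c" "valid (Suc m) c a" "valid (Suc m) a c" "valid (Suc m) c b"
      using v' w w' v 2 by (auto simp: valid_def)
    show ?thesis
    proof (cases "val r c \<le> val r a")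
      case True
      define r1 where "r1 = E a (M c) \<otimes> r"
      have 1: "r1 \<in> Reach m" "size1 r1 \<le> size1 r" "val r1 a = val r a - val r c" "val r1 b = val r b" "val r1 c = val r c"
        using down[OF r order_refl tri(4)] True le vc 2 ne by (auto simp: r1_def)
      define r2 where "r2 = E b a \<otimes> r1"
      have 2: "r2 \<in> Reach m" "val r2 a = val r a - val r c" "val r2 c = val r c"
        using up[OF 1(1) v] 1 True pos 2 ne by (auto simp: r2_def)
      have "E a c \<otimes> r2 \<in> Reach m"
        using up[OF 2(1) tri(4)] 2 True le vc by auto
      then show ?thesis
        using path_same_target_ge[OF tri(1-3) rq] \<open>d = b\<close> by (simp add: r1_def r2_def)
    next
      case False
      define r1 where "r1 = E c (M a) \<otimes> r"
      have 1: "r1 \<in> Reach m" "size1 r1 \<le> size1 r" "val r1 c = val r c - val r a" "val r1 b = val r b" "val r1 a = val r a"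
        using down[OF r order_refl tri(5)] False pos 2 ne by (auto simp: r1_def)
      define r2 where "r2 = E b (M c) \<otimes> r1"
      have 2: "r2 \<in> Reach m" "val r2 a = val r a" "val r2 c = val r c - val r a"
        using down[OF 1(1,2) tri(6)] 1 False le vc vb pos 2 ne by (auto simp: r2_def)
      have "E c a \<otimes> r2 \<in> Reach m"
        using up[OF 2(1) tri(5)] 2 False pos by auto
      then show ?thesis
        using path_same_target_le[OF tri(1-3) rq] \<open>d = b\<close> by (simp add: r1_def r2_def)
    qed
  next
    case 3
    have vd: "val (E b a \<otimes> r) d = val r d" by (rule vo[OF 3(3)])
    have tri: "valid n a b" "valid n b d" "valid n a d" "valid (Suc m) a d" "valid (Suc m) b d"
      using v' w w' v 3 by (auto simp: valid_def)
    define r1 where "r1 = E d (M a) \<otimes> r"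
    have 1: "r1 \<in> Reach m" "size1 r1 \<le> size1 r" "val r1 d = val r d - val r a" "val r1 b = val r b" "val r1 a = val r a"
      using down[OF r order_refl tri(4)] pos le vb vd 3 ne by (auto simp: r1_def)
    define r2 where "r2 = E d (M b) \<otimes> r1"
    have 2: "r2 \<in> Reach m" "val r2 a = val r a" "val r2 b = val r b"
      using down[OF 1(1,2) tri(5)] 1 le vd vb pos 3 ne by (auto simp: r2_def)
    have "E b a \<otimes> r2 \<in> Reach m" using up[OF 2(1) v] 2 pos by auto
    then show ?thesis
      using path_chain_up[OF tri(1-3) rq] \<open>c = b\<close> by (simp add: r1_def r2_def)
  next
    case 4
    \<comment> \<open>Subtracting b from a is nonincreasing only if a is at least a + b, which
      forces the value of b to vanish. The move left after the quarter turn therefore fixes the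
      vector.\<close>
    have z: "val r b = 0" using le va vb pos 4 by simp
    have ws: "wperm a b \<in> sperm (Suc m)" by (rule wperm_sperm[OF v])
    have "val (s (wperm a b) \<otimes> r) (wperm a b b) = val r b" by (rule val_s(1)[OF ws rq])
    moreover have "wperm a b b = M a" using ne by (auto simp: wperm_def)
    ultimately have "val (s (wperm a b) \<otimes> r) (M a) = 0" using z by simp
    then have "E b (M a) \<otimes> (s (wperm a b) \<otimes> r) \<in> Reach m"
      using fixs[OF Reach_s[OF r ws], of "M a" b] val_s(2)[OF ws rq] v by simp
    then show ?thesis using path_weyl(1)[OF v'(1) rq] 4 by simp
  next
    case 5
    have vc: "val (E b a \<otimes> r) c = val r c" by (rule vo[OF 5(3)])
    have tri: "valid n a b" "valid n b c" "valid n a c" "valid (Suc m) c a" "valid (Suc m) c b"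
      using v' w w' v 5 by (auto simp: valid_def)
    define r1 where "r1 = E a (M c) \<otimes> r"
    have 1: "r1 \<in> Reach m" "size1 r1 \<le> size1 r" "val r1 a = val r a - val r c" "val r1 b = val r b" "val r1 c = val r c"
      using down[OF r order_refl tri(4)] le va vc 5 ne by (auto simp: r1_def)
    define r2 where "r2 = E b a \<otimes> r1"
    have 2: "r2 \<in> Reach m" "val r2 b = val r b + val r a - val r c" "val r2 c = val r c"
      using up[OF 1(1) v] 1 le va vc 5 pos ne by (auto simp: r2_def)
    have "E b c \<otimes> r2 \<in> Reach m" using up[OF 2(1) tri(5)] 2 le va vc 5 pos by auto
    then show ?thesis
      using path_chain_down[OF tri(1-3) rq] \<open>d = a\<close> by (simp add: r1_def r2_def)
  next
    case 6
    define r1 where "r1 = E d (M c) \<otimes> r"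
    have 1: "r1 \<in> Reach m" "val r1 a = val r a" "val r1 b = val r b"
      using down[OF r order_refl w] le vo[OF 6(1)] vo[OF 6(3)] 6 ne by (auto simp: r1_def)
    have "E b a \<otimes> r1 \<in> Reach m" using up[OF 1(1) v] 1 pos by auto
    then show ?thesis
      using comm_left[of "M c" d a b r] w' v' 6 rq by (simp add: r1_def)
  qed
qed

text \<open>A move that fixes the vector can be performed before the increasing move. If it changes
  the source a, the Steinberg relation adds one more move fixing the vector.\<close>

lemma up_fix:
  assumes r: "r \<in> Reach m" and v: "valid (Suc m) a b" and pos: "0 < val r a" "0 \<le> val r b"
    and good: "\<And>q. q \<in> Reach m \<Longrightarrow> size1 q < size1 (E b a \<otimes> r) \<Longrightarrow> Good q"
    and w: "valid (Suc m) c d" and z: "val (E b a \<otimes> r) c = 0"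
  shows "E d c \<otimes> (E b a \<otimes> r) \<in> Reach m"
proof -
  note cl = Reach_closed[OF _ m]
  note vE = val_E[OF _ cl]
  have rq: "r \<in> carrier Q" by (rule cl[OF r])
  have sz: "size1 (E b a \<otimes> r) = size1 r + val r a" using size1_E[OF v rq] pos by simp
  have fixs: "E y x \<otimes> q \<in> Reach m" "size1 (E y x \<otimes> q) = size1 q" "\<And>z. val (E y x \<otimes> q) z = val q z"
    if "q \<in> Reach m" "size1 q \<le> size1 r" "valid (Suc m) x y" "val q x = 0" for q x y
  proof -
    show "E y x \<otimes> q \<in> Reach m" using good[OF that(1)] Good_fix[of q x y] that sz pos by simp
    show "size1 (E y x \<otimes> q) = size1 q" using that size1_E[OF that(3) cl[OF that(1)]] by simp
    show "val (E y x \<otimes> q) z = val q z" for z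
      using vE[OF that(3,1)] that(4) same_index[of z y] by (cases "fst z = fst y") (auto simp: val_inv)
  qed
  have v': "valid n a b" "valid n b a" "valid (Suc m) b a" and w': "valid n c d" "valid n d c"
    using v w m by (auto simp: valid_def)
  have vb: "val (E b a \<otimes> r) b = val r b + val r a" and vo: "\<And>z. fst z \<noteq> fst b \<Longrightarrow> val (E b a \<otimes> r) z = val r z"
    using vE[OF v r] by auto
  have va: "val (E b a \<otimes> r) a = val r a" using vo[of a] v by (simp add: valid_def)
  have zero: "val (E b a \<otimes> r) x = 0" if "fst x = fst c" for x
    using same_index[of x c] z that by (auto simp: val_inv)
  have cne: "fst c \<noteq> fst a" "fst c \<noteq> fst b"
    using zero[of a] zero[of b] va vb pos by auto
  have zr: "val r c = 0" using z vo[OF cne(2)] by simp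
  show ?thesis
  proof (cases "fst d = fst a")
    case False
    define r1 where "r1 = E d c \<otimes> r"
    have 1: "r1 \<in> Reach m" "val r1 x = val r x" for x
      using fixs[OF r order_refl w zr] by (auto simp: r1_def)
    have "E b a \<otimes> r1 \<in> Reach m" using Reach_up[OF 1(1) v] 1(2) pos by (simp add: val_def)
    then show ?thesis
      using comm_left[of c d a b r] w' v' False cne rq by (simp add: r1_def)
  next
    case True
    obtain c' where c': "E d c = E a c'" "fst c' = fst c" "val r c' = 0"
    proof -
      have "d = a \<or> d = M a" using same_index[of d a] True by auto
      then show ?thesis
      proof
        assume d: "d = M a"
        have "valid n c a" using w' d by (auto simp: valid_def)
        then have "E d c = E a (M c)" unfolding d by (rule bar1)
        then show ?thesis using that[of "M c"] zr by (simp add: val_inv)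
      qed (use that[of c] zr in simp)
    qed
    have tri: "valid n c' a" "valid n a b" "valid n c' b" "valid (Suc m) c' b" "valid (Suc m) c' a"
      using v' w w' v True cne c'(2) by (auto simp: valid_def)
    define r1 where "r1 = E b (M c') \<otimes> r"
    have mc: "val r (M c') = 0" "valid (Suc m) (M c') b" using c'(3) tri by (simp_all add: val_inv)
    have 1: "r1 \<in> Reach m" "size1 r1 \<le> size1 r" "val r1 x = val r x" for x
      using fixs[OF r order_refl mc(2,1)] by (auto simp: r1_def)
    define r2 where "r2 = E a c' \<otimes> r1"
    have c1: "val r1 c' = 0" using 1(3) c'(3) by simp
    have 2: "r2 \<in> Reach m" "val r2 x = val r x" for x
      using fixs[OF 1(1,2) tri(5) c1] 1(3) by (auto simp: r2_def)
    have "E b a \<otimes> r2 \<in> Reach m" using Reach_up[OF 2(1) v] 2(2) pos by (simp add: val_def)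
    then show ?thesis
      using path_fix[OF tri(1-3) rq] c'(1) by (simp add: r1_def r2_def)
  qed
qed

text \<open>The outer induction is on the size of the vector, the inner one on the construction of
  q; if its last factor was increasing, the peak lemmas apply.\<close>

lemma Reach_Good: "q \<in> Reach m \<Longrightarrow> Good q"
proof (induction "nat (size1 q)" arbitrary: q rule: less_induct)
  case less
  have smaller: "Good r" if "r \<in> Reach m" "size1 r < size1 q" for r
    using less.hyps[of r] that size1_nonneg[of r] by auto
  from less.prems smaller show ?case
  proof (induction rule: Reach.induct)
    case (Reach_Stab q)
    have val: "val q = ev (unit_at m)" using Stab_act[OF Reach_Stab.hyps m] by (simp add: val_def)
    show ?case
      unfolding Good_def
    proof (intro allI impI conjI)
      fix a b :: letter assume v: "valid (Suc m) a b"
      show "E b a \<otimes> q \<in> Reach m" if "val q a = 0"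
      proof (rule Reach.Reach_Stab[OF Stab_E[OF Reach_Stab.hyps m v]])
        show "fst a \<noteq> m" using that unfolding val by (auto simp: ev_def unit_at_def split: if_splits)
      qed
      show "E b (M a) \<otimes> q \<in> Reach m" if "0 < val q a \<and> val q a \<le> val q b"
        using that v unfolding val by (auto simp: ev_def unit_at_def valid_def split: if_splits)
    qed
  next
    case (Reach_s q \<sigma>)
    note rq = Reach_closed[OF Reach_s.hyps(1) m]
    note sv = val_s[OF Reach_s.hyps(2) rq]
    have s: "\<sigma> \<in> sperm n" using sperm_mono[of "Suc m" n] m Reach_s.hyps(2) by simp
    note s' = sperm_inverse[OF Reach_s.hyps(2)]
    have si: "\<sigma> (inv_into UNIV \<sigma> c) = c" for c using s'(2) by (metis comp_apply id_apply)
    have G: "Good q" using Reach_s.IH Reach_s.prems sv(2) by simp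
    have step: "E b a \<otimes> (s \<sigma> \<otimes> q) \<in> Reach m"
      if v: "valid (Suc m) a b" and r: "E (inv_into UNIV \<sigma> b) (inv_into UNIV \<sigma> a) \<otimes> q \<in> Reach m" for a b
    proof -
      have "valid (Suc m) (inv_into UNIV \<sigma> a) (inv_into UNIV \<sigma> b)"
        using v sperm_less[OF s'(1)] sperm_fst[OF s'(1)] by (simp add: valid_def)
      then have "valid n (inv_into UNIV \<sigma> a) (inv_into UNIV \<sigma> b)"
        using valid_mono[of "Suc m" n] m by simp
      then show ?thesis using s_E_left[OF s _ rq] Reach.Reach_s[OF r Reach_s.hyps(2)] si by simp
    qed
    show ?case
      unfolding Good_def
    proof (intro allI impI conjI)
      fix a b :: letter assume v: "valid (Suc m) a b"
      let ?a = "inv_into UNIV \<sigma> a" and ?b = "inv_into UNIV \<sigma> b"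
      have v': "valid (Suc m) ?a ?b"
        using v sperm_less[OF s'(1)] sperm_fst[OF s'(1)] by (auto simp: valid_def)
      have va: "val (s \<sigma> \<otimes> q) a = val q ?a" "val (s \<sigma> \<otimes> q) b = val q ?b"
        using sv(1)[of ?a] sv(1)[of ?b] si by simp_all
      show "E b a \<otimes> (s \<sigma> \<otimes> q) \<in> Reach m" if "val (s \<sigma> \<otimes> q) a = 0"
        using step[OF v] Good_fix[OF G v'] that va by simp
      show "E b (M a) \<otimes> (s \<sigma> \<otimes> q) \<in> Reach m" if "0 < val (s \<sigma> \<otimes> q) a \<and> val (s \<sigma> \<otimes> q) a \<le> val (s \<sigma> \<otimes> q) b"
        using step[of "M a" b] Good_down[OF G v'] that va v sperm_inv_letter[OF s'(1), of a] by simp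
    qed
  next
    case (Reach_up r a b)
    have pos: "0 < val r a" "0 \<le> val r b" using Reach_up.hyps by (simp_all add: val_def)
    show ?case
      unfolding Good_def
      using up_down[OF Reach_up.hyps(1,2) pos Reach_up.prems] up_fix[OF Reach_up.hyps(1,2) pos Reach_up.prems]
      by blast
  qed
qed

text \<open>If a exceeds b, subtracting a from b changes the sign of that coordinate. By
  \<open>path_weyl\<close> this equals subtracting b from a, adding a to b and a quarter turn, and
  during these steps the coordinates stay nonnegative.\<close>

lemma Reach_cross:
  assumes q: "q \<in> Reach m" and v: "valid (Suc m) a b" and pos: "0 \<le> val q a" "0 \<le> val q b"
  shows "E b (M a) \<otimes> q \<in> Reach m"
proof (cases "val q a \<le> val q b")
  case True
  then show ?thesis using Good_down[OF Reach_Good[OF q] v] pos by simp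
next
  case False
  have v': "valid (Suc m) b a" "valid n a b" using v m by (auto simp: valid_def)
  note cl = Reach_closed[OF q m]
  define r where "r = E a (M b) \<otimes> q"
  have r: "r \<in> Reach m" using Good_down[OF Reach_Good[OF q] v'(1)] pos False by (simp add: r_def)
  have "val r a = val q a - val q b" "val r b = val q b"
    using val_E[of "M b" a q] v' v cl by (simp_all add: r_def val_inv valid_def)
  then have "E b a \<otimes> r \<in> Reach m" using Good_up[OF Reach_Good[OF r] r v] pos False by simp
  then have "s (inv_into UNIV (wperm a b)) \<otimes> (E b a \<otimes> r) \<in> Reach m"
    using Reach_s sperm_inverse(1)[OF wperm_sperm[OF v]] by blast
  then show ?thesis using path_weyl(2)[OF v'(2) cl] by (simp add: r_def)
qed

lemma Reach_E:
  assumes q: "q \<in> Reach m" and v: "valid (Suc m) a b"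
  shows "E b a \<otimes> q \<in> Reach m"
proof -
  have vn: "valid n a b" using v m by (auto simp: valid_def)
  have bar: "E (M b) (M a) = E b a" by (rule E_bar[OF vn])
  have bar': "E (M b) a = E b (M a)" by (rule bar1[OF vn])
  note up = Good_up[OF Reach_Good[OF q] q]
  consider "0 \<le> val q a" "0 \<le> val q b" | "0 \<le> val q a" "val q b \<le> 0" | "val q a \<le> 0" "0 \<le> val q b"
    | "val q a \<le> 0" "val q b \<le> 0" by linarith
  then show ?thesis
  proof cases
    case 1
    then show ?thesis using up[OF v] by simp
  next
    case 2
    then show ?thesis using Reach_cross[OF q, of a "M b"] v bar by (simp add: val_inv)
  next
    case 3
    then show ?thesis using Reach_cross[OF q, of "M a" b] v by (simp add: val_inv)
  next
    case 4
    then show ?thesis using up[of "M a" "M b"] v bar by (simp add: val_inv)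
  qed
qed

lemma Gen_Reach: "q \<in> Gen (Suc m) \<Longrightarrow> q \<in> Reach m"
  by (induction rule: Gen.induct) (auto intro: Reach_Stab[OF Stab_one] Reach_s Reach_E)

text \<open>Increasing moves enlarge the vector strictly, so size 1 is possible only if none
  occurs.\<close>

lemma Reach_minimal:
  assumes "q \<in> Reach m"
  shows "1 \<le> size1 q \<and> (size1 q = 1 \<longrightarrow> (\<exists>\<sigma>\<in>sperm (Suc m). \<exists>q0\<in>Stab m. q = s \<sigma> \<otimes> q0))"
  using assms
proof induction
  case (Reach_Stab q)
  have "size1 q = 1" using Stab_act[OF Reach_Stab m] by (simp add: size1_def norm1_def unit_at_def)
  moreover have "q = s id \<otimes> q" using Stab_closed[OF Reach_Stab m] s_id by simp
  ultimately show ?case using Reach_Stab sperm_id by fastforce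
next
  case (Reach_s q \<sigma>)
  note rq = Reach_closed[OF Reach_s.hyps(1) m]
  show ?case
  proof (intro conjI impI)
    show "1 \<le> size1 (s \<sigma> \<otimes> q)" using val_s(2)[OF Reach_s.hyps(2) rq] Reach_s.IH by simp
    assume "size1 (s \<sigma> \<otimes> q) = 1"
    then obtain \<tau> q0 where t: "\<tau> \<in> sperm (Suc m)" "q0 \<in> Stab m" "q = s \<tau> \<otimes> q0"
      using val_s(2)[OF Reach_s.hyps(2) rq] Reach_s.IH by auto
    have sn: "\<sigma> \<in> sperm n" "\<tau> \<in> sperm n" using sperm_mono[of "Suc m" n] m Reach_s.hyps(2) t(1) by auto
    have "s \<sigma> \<otimes> q = s (\<sigma> \<circ> \<tau>) \<otimes> q0"
      using t(3) s_mult[OF sn] s_closed sn Stab_closed[OF t(2) m] by (simp flip: m_assoc)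
    then show "\<exists>\<sigma>'\<in>sperm (Suc m). \<exists>q0\<in>Stab m. s \<sigma> \<otimes> q = s \<sigma>' \<otimes> q0"
      using t(2) sperm_comp[OF Reach_s.hyps(2) t(1)] by blast
  qed
next
  case (Reach_up r a b)
  have pos: "0 < val r a" "0 \<le> val r b" using Reach_up.hyps by (simp_all add: val_def)
  have "size1 (E b a \<otimes> r) = size1 r + val r a"
    using size1_E[OF Reach_up.hyps(2) Reach_closed[OF Reach_up.hyps(1) m]] pos by simp
  then show ?case using Reach_up.IH pos by auto
qed

lemma Gen_Stab:
  assumes q: "q \<in> Gen (Suc m)" and a: "act q (unit_at m) = unit_at m"
  shows "q \<in> Stab m"
proof -
  have "size1 q = 1" using a by (simp add: size1_def norm1_def unit_at_def)
  then obtain \<sigma> q0 where t: "\<sigma> \<in> sperm (Suc m)" "q0 \<in> Stab m" "q = s \<sigma> \<otimes> q0"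
    using Reach_minimal[OF Gen_Reach[OF q]] by auto
  have v: "val q c = ev (unit_at m) c" "val q0 c = ev (unit_at m) c" for c
    using a Stab_act[OF t(2) m] by (simp_all add: val_def)
  have vs: "ev (unit_at m) (\<sigma> c) = ev (unit_at m) c" for c
    using val_s(1)[OF t(1) Stab_closed[OF t(2) m], of c] v t(3) by simp
  have T: "\<sigma> (m, True) = (m, True)"
    using vs[of "(m, True)"] by (cases "\<sigma> (m, True)") (auto simp: ev_def unit_at_def split: if_splits)
  then have F: "\<sigma> (m, False) = (m, False)"
    using sperm_inv_letter[OF t(1), of "(m, True)"] by simp
  have "\<sigma> \<in> sperm m"
  proof (rule spermI)
    show "bij \<sigma>" "\<sigma> (M c) = M (\<sigma> c)" for c using spermD[OF t(1)] by auto
    show "\<sigma> c = c" if "m \<le> fst c" for c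
    proof (cases "fst c = m")
      case True
      then show ?thesis using T F by (cases c; cases "snd c") auto
    next
      case False
      then show ?thesis using spermD(3)[OF t(1), of c] that by simp
    qed
  qed
  then show ?thesis using Stab_s[OF t(2) m] t(3) by simp
qed

end

lemma Gen_mult:
  assumes "q \<in> Gen n" "r \<in> Gen n" shows "q \<otimes> r \<in> Gen n"
  using assms(1)
proof induction
  case (Gen_E q a b)
  then show ?case using Gen.Gen_E[OF Gen_E.IH Gen_E.hyps(2)] E_closed Gen_closed assms(2) by (simp add: m_assoc)
next
  case (Gen_s q \<sigma>)
  then show ?case using Gen.Gen_s[OF Gen_s.IH Gen_s.hyps(2)] s_closed Gen_closed assms(2) by (simp add: m_assoc)
qed (use assms Gen_closed in simp)

text \<open>If q acts trivially, \<open>Gen_Stab\<close> writes it as a row part times an element of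
  smaller rank. The row part changes coordinate m only, so the other factor acts trivially, is
  trivial by induction, and leaves a row part with vanishing entries.\<close>

theorem Gen_faithful:
  assumes "q \<in> Gen k" "k \<le> n" "\<And>v. act q v = v" shows "q = \<one>"
  using assms
proof (induction k arbitrary: q)
  case 0
  from \<open>q \<in> Gen 0\<close> show ?case
  proof induction
    case (Gen_s q \<sigma>)
    have "\<sigma> = id" using spermD(3)[OF Gen_s.hyps(2)] by auto
    then show ?case using Gen_s s_id by simp
  qed (auto simp: valid_def)
next
  case (Suc m)
  have m: "m < n" using Suc.prems by simp
  obtain u h where q: "q = u \<otimes> h" "u \<in> row m m" "h \<in> Gen m"
    using Gen_Stab[OF m Suc.prems(1)] Suc.prems(3) by (auto simp: Stab_def)
  note cl = row_closed[OF q(2) order_refl m] Gen_closed[OF q(3)]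
  have "act h v = v" for v
  proof
    fix i
    show "act h v i = v i"
    proof (cases "i < m")
      case True
      have "act q v i = act h v i" using row_act[OF q(2) order_refl m, of i "act h v"] True q(1) cl m by (simp add: act_mult)
      then show ?thesis using Suc.prems(3) by simp
    next
      case False
      then show ?thesis using Gen_act_ge[OF q(3), of i v] m by simp
    qed
  qed
  then have h: "h = \<one>" using Suc.IH[OF q(3)] m by simp
  then have "q = u" using q(1) cl by simp
  then show ?case using row_eq_one[OF q(2) order_refl m] Suc.prems(3) by simp
qed

end

section \<open>Lifting invertible matrices\<close>

definition mact :: "nat \<Rightarrow> int mat \<Rightarrow> (nat \<Rightarrow> int) \<Rightarrow> nat \<Rightarrow> int" where
  \<comment> \<open>Vectors are functions on all naturals, fixed from n on, so that the subgroups of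
    all ranks share one action.\<close>
  "mact n A v = (\<lambda>i. if i < n then (\<Sum>j<n. A $$ (i, j) * v j) else v i)"

lemma mact_mult_vec:
  assumes "A \<in> carrier_mat n n" shows "mact n A v = (\<lambda>i. if i < n then (A *\<^sub>v vec n v) $ i else v i)"
  using assms by (auto simp: mact_def fun_eq_iff scalar_prod_def atLeast0LessThan intro!: sum.cong)

lemma mact_mult:
  assumes A: "A \<in> carrier_mat n n" and B: "B \<in> carrier_mat n n"
  shows "mact n (A * B) v = mact n A (mact n B v)"
proof -
  have "vec n (mact n B v) = B *\<^sub>v vec n v"
    using B by (intro eq_vecI) (auto simp: mact_mult_vec[OF B])
  then show ?thesis
    using A B by (auto simp: mact_mult_vec fun_eq_iff assoc_mult_mat_vec[of _ n n _ n])
qed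

lemma mact_one: "mact n (1\<^sub>m n) v = v"
  by (auto simp: mact_mult_vec[of _ n] fun_eq_iff)

lemma mact_unit: "mact n A (unit_at k) i = (if i < n then (if k < n then A $$ (i, k) else 0) else unit_at k i)"
  by (simp add: mact_def unit_at_def if_distrib[of "\<lambda>x. _ * x"] cong: if_cong)

lemma action_mat_entry:
  "i < n \<Longrightarrow> j < n \<Longrightarrow> action_mat n f $$ (i, j) = abelianise n (f [(j, True)]) $ i"
  by (simp add: action_mat_def gen_def)

lemma abelianise_letter: "i < n \<Longrightarrow> abelianise n [a] $ i = ev (unit_at i) a"
  by (cases a) (auto simp: abelianise_def ev_def unit_at_def)

lemma mact_tv:
  assumes v: "valid n a b" shows "mact n (action_mat n (tv n a b)) v = actE b a v"
proof
  fix i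
  show "mact n (action_mat n (tv n a b)) v i = actE b a v i"
  proof (cases "i < n")
    case i: True
    let ?c = "ev (unit_at i) b * (if snd a then 1 else - 1)"
    have "action_mat n (tv n a b) $$ (i, j) = (if j = i then 1 else 0) + (if j = fst a then ?c else 0)"
      if j: "j < n" for j
    proof (cases "j = fst a")
      case True
      have "(j, True) = (if snd a then a else inv_letter a)" using True by (cases a) auto
      then have "tv n a b [(j, True)] = (if snd a then [a] \<otimes>\<^bsub>FG n\<^esub> [b] else [inv_letter b] \<otimes>\<^bsub>FG n\<^esub> [inv_letter a])"
        using tv_letter(1,2)[OF v] by simp
      then show ?thesis
        using i j True by (auto simp: action_mat_entry abelianise_mult abelianise_letter) (auto simp: ev_def unit_at_def)
    next
      case False
      then show ?thesis using tv_letter(3)[OF v, of "(j, True)"] i j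
        by (simp add: action_mat_entry abelianise_letter) (simp add: ev_def unit_at_def)
    qed
    then have entry: "action_mat n (tv n a b) $$ (i, j) * v j = (if j = i then v j else 0) + (if j = fst a then ?c * v j else 0)"
      if "j < n" for j using that by (simp add: distrib_right)
    have "mact n (action_mat n (tv n a b)) v i = (\<Sum>j<n. action_mat n (tv n a b) $$ (i, j) * v j)"
      using i by (simp add: mact_def)
    also have "\<dots> = (\<Sum>j<n. (if j = i then v j else 0) + (if j = fst a then ?c * v j else 0))"
      by (intro sum.cong refl, rule entry) simp
    also have "\<dots> = v i + ?c * v (fst a)"
      using i v by (simp add: sum.distrib valid_def)
    also have "\<dots> = actE b a v i" by (auto simp: actE_def ev_def unit_at_def)
    finally show ?thesis .
  qed (use v in \<open>auto simp: mact_def actE_def valid_def\<close>)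
qed

lemma mact_sp:
  assumes s: "\<sigma> \<in> sperm n" shows "mact n (action_mat n (sp n \<sigma>)) v = actS \<sigma> v"
proof
  fix i
  note s' = sperm_inverse[OF s]
  have si: "\<sigma> (inv_into UNIV \<sigma> c) = c" "inv_into UNIV \<sigma> (\<sigma> c) = c" for c using s'(2,3) by (metis comp_apply id_apply)+
  show "mact n (action_mat n (sp n \<sigma>)) v i = actS \<sigma> v i"
  proof (cases "i < n")
    case i: True
    obtain k r where kr: "inv_into UNIV \<sigma> (i, True) = (k, r)" by fastforce
    have k: "k < n" using sperm_less[OF s'(1), of "(i, True)"] i kr by simp
    have sk: "\<sigma> (k, r) = (i, True)" using si(1)[of "(i, True)"] kr by simp
    have "action_mat n (sp n \<sigma>) $$ (i, j) = (if j = k then (if r then 1 else - 1) else 0)" if j: "j < n" for j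
    proof (cases "j = k")
      case True
      have "\<sigma> (j, True) = (i, r)" using sk sperm_inv_letter[OF s, of "(k, r)"] True by (cases r) auto
      then show ?thesis using i j True sp_letter[OF s, of "(j, True)"]
        by (simp add: action_mat_entry abelianise_letter) (simp add: ev_def unit_at_def)
    next
      case False
      then have "fst (\<sigma> (j, True)) \<noteq> i" using sperm_fst[OF s, of "(j, True)" "(k, r)"] sk by simp
      then show ?thesis using i j False sp_letter[OF s, of "(j, True)"]
        by (simp add: action_mat_entry abelianise_letter) (simp add: ev_def unit_at_def)
    qed
    then have entry: "action_mat n (sp n \<sigma>) $$ (i, j) * v j = (if j = k then (if r then v j else - v j) else 0)"
      if "j < n" for j using that by simp
    have "mact n (action_mat n (sp n \<sigma>)) v i = (\<Sum>j<n. action_mat n (sp n \<sigma>) $$ (i, j) * v j)"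
      using i by (simp add: mact_def)
    also have "\<dots> = (\<Sum>j<n. if j = k then (if r then v j else - v j) else 0)"
      by (intro sum.cong refl, rule entry) simp
    also have "\<dots> = actS \<sigma> v i" using k kr by (auto simp: actS_def ev_def)
    finally show ?thesis .
  next
    case False
    then have "inv_into UNIV \<sigma> (i, True) = (i, True)" using spermD(3)[OF s'(1), of "(i, True)"] by simp
    then show ?thesis using False by (simp add: mact_def actS_def ev_def)
  qed
qed

lemma action_mat_one: "action_mat n \<one>\<^bsub>AFG n\<^esub> = 1\<^sub>m n"
  by (auto simp: action_mat_def one_AutoGroup gen_closed abelianise_gen intro!: eq_matI)

lemma action_mat_cancel:
  assumes f: "f \<in> auto (FG n)" and A: "A \<in> carrier_mat n n" and "action_mat n f * A \<in> action_mat n ` auto (FG n)"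
  shows "A \<in> action_mat n ` auto (FG n)"
proof -
  interpret G: group "AFG n" by (rule group_AFG)
  obtain g where g: "g \<in> auto (FG n)" "action_mat n f * A = action_mat n g" using assms(3) by auto
  let ?f = "inv\<^bsub>AFG n\<^esub> f"
  have f': "?f \<in> auto (FG n)" "?f \<otimes>\<^bsub>AFG n\<^esub> f = \<one>\<^bsub>AFG n\<^esub>"
    using G.inv_closed[of f] G.l_inv[of f] f by (simp_all add: carrier_AutoGroup)
  have "action_mat n (?f \<otimes>\<^bsub>AFG n\<^esub> g) = (action_mat n ?f * action_mat n f) * A"
    using g A action_mat_compose[OF f'(1) g(1)] by (simp flip: g(2) add: assoc_mult_mat[of _ n n _ n _ n])
  also have "action_mat n ?f * action_mat n f = 1\<^sub>m n"
    unfolding action_mat_compose[OF f'(1) f, symmetric] f'(2) by (rule action_mat_one)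
  also have "1\<^sub>m n * A = A" using A by simp
  finally show ?thesis using AFG_closed[OF f'(1) g(1)] by (metis imageI)
qed

text \<open>With no decreasing move left, a nonzero entry at an index up to k exceeds all other
  entries in absolute value. So there is just one such entry; the linear relation makes it a unit,
  and all others vanish.\<close>

lemma reduced_column:
  fixes v w :: "nat \<Rightarrow> int"
  assumes k: "k < n" and one: "(\<Sum>i\<le>k. w i * v i) = 1"
    and red: "\<And>a b. \<lbrakk>valid n a b; fst a \<le> k; 0 < ev v a; ev v a \<le> ev v b\<rbrakk> \<Longrightarrow> False"
  shows "\<exists>c. fst c \<le> k \<and> ev v c = 1 \<and> (\<forall>i<n. i \<noteq> fst c \<longrightarrow> v i = 0)"
proof -
  have "\<exists>i\<le>k. v i \<noteq> 0"
  proof (rule ccontr)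
    assume "\<not> (\<exists>i\<le>k. v i \<noteq> 0)"
    then have "(\<Sum>i\<le>k. w i * v i) = 0" by (intro sum.neutral) auto
    then show False using one by simp
  qed
  then obtain i where i: "i \<le> k" "v i \<noteq> 0" by (elim exE conjE) (rule that)
  have less: "\<bar>v y\<bar> < \<bar>v x\<bar>" if "x \<le> k" "v x \<noteq> 0" "y < n" "x \<noteq> y" for x y
  proof (rule ccontr)
    assume "\<not> \<bar>v y\<bar> < \<bar>v x\<bar>"
    then show False
      using red[of "(x, 0 < v x)" "(y, 0 < v y)"] that k
      by (cases "0 < v x"; cases "0 < v y") (auto simp: valid_def ev_def)
  qed
  have z: "v j = 0" if "j \<le> k" "j \<noteq> i" for j
  proof (rule ccontr)
    assume "v j \<noteq> 0"
    then show False using less[of i j] less[of j i] i that k by simp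
  qed
  have "(\<Sum>j\<le>k. w j * v j) = (\<Sum>j\<le>k. if j = i then w i * v i else 0)"
    using z by (intro sum.cong) auto
  then have "w i * v i = 1" using one i by simp
  then have "\<bar>v i\<bar> = 1" by (metis abs_one abs_zmult_eq_1 mult.commute)
  then have "ev v (i, 0 < v i) = 1" "\<forall>j<n. j \<noteq> i \<longrightarrow> v j = 0"
    using less[of i] i by (auto simp: ev_def)
  then show ?thesis using i by (intro exI[of _ "(i, 0 < v i)"]) simp
qed

lemma signed_transposition:
  assumes "fst c \<le> k" shows "\<exists>\<sigma>\<in>sperm (Suc k). \<sigma> c = (k, True)"
proof (cases "fst c = k")
  case False
  then have "wperm c (k, True) \<in> sperm (Suc k)" using assms by (intro wperm_sperm) (auto simp: valid_def)
  then show ?thesis by (intro bexI[of _ "wperm c (k, True)"]) (auto simp: wperm_def)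
next
  case True
  define \<sigma> :: "letter \<Rightarrow> letter" where "\<sigma> = (\<lambda>d. if fst d = k then inv_letter d else d)"
  have "\<sigma> \<in> sperm (Suc k)"
    by (rule spermI) (auto simp: \<sigma>_def intro!: bijI'[of \<sigma>] bij_betw_byWitness[where f' = \<sigma>])
  moreover have "c = (k, True) \<or> \<sigma> c = (k, True)" using True by (cases c) (auto simp: \<sigma>_def)
  ultimately show ?thesis using sperm_id by (metis id_apply)
qed

text \<open>A Euclidean descent on the column \<open>k\<close>, given that the later columns are already those of the
  identity.\<close>

lemma action_mat_surj_aux:
  assumes "k \<le> n" "A \<in> carrier_mat n n" "B \<in> carrier_mat n n" "B * A = 1\<^sub>m n"
    and "\<And>j. k \<le> j \<Longrightarrow> mact n A (unit_at j) = unit_at j"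
  shows "A \<in> action_mat n ` auto (FG n)"
  using assms
proof (induction k arbitrary: A B)
  case 0
  have "A $$ (i, j) = 1\<^sub>m n $$ (i, j)" if "i < n" "j < n" for i j
    using 0(5)[of j] mact_unit[of n A j i] that by (auto simp: unit_at_def)
  then have "A = 1\<^sub>m n" using 0(2) by (intro eq_matI) auto
  then show ?case using action_mat_one one_AFG(1) by (metis imageI)
next
  case (Suc k)
  show ?case
    using Suc.prems
  proof (induction "nat (norm1 n (mact n A (unit_at k)))" arbitrary: A B rule: less_induct)
    case less
    note A = less.prems(2) and B = less.prems(3)
    let ?v = "mact n A (unit_at k)"
    have k: "k < n" using less.prems by simp
    have BA: "mact n B (mact n A u) = u" for u
      using mact_mult[OF B A, of u] less.prems(4) mact_one by simp
    have step: "A' \<in> carrier_mat n n" "\<exists>B'\<in>carrier_mat n n. B' * A' = 1\<^sub>m n"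
      if "f \<in> auto (FG n)" "A' = action_mat n f * A" for f A'
    proof -
      interpret G: group "AFG n" by (rule group_AFG)
      let ?f = "inv\<^bsub>AFG n\<^esub> f"
      have f': "?f \<in> auto (FG n)" "?f \<otimes>\<^bsub>AFG n\<^esub> f = \<one>\<^bsub>AFG n\<^esub>"
        using G.inv_closed[of f] G.l_inv[of f] that(1) by (simp_all add: carrier_AutoGroup)
      have fA: "action_mat n f * A \<in> carrier_mat n n" by (rule mult_carrier_mat[OF action_mat_carrier A])
      then show A': "A' \<in> carrier_mat n n" using that(2) by simp
      have "B * action_mat n ?f * A' = B * (action_mat n ?f * (action_mat n f * A))"
        unfolding that(2) using fA B by (simp add: assoc_mult_mat[of _ n n _ n _ n])
      also have "action_mat n ?f * (action_mat n f * A) = (action_mat n ?f * action_mat n f) * A"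
        using A by (simp add: assoc_mult_mat[of _ n n _ n _ n])
      also have "action_mat n ?f * action_mat n f = 1\<^sub>m n"
        unfolding action_mat_compose[OF f'(1) that(1), symmetric] f'(2) by (rule action_mat_one)
      finally have "B * action_mat n ?f * A' = 1\<^sub>m n" using A less.prems(4) by simp
      then show "\<exists>B'\<in>carrier_mat n n. B' * A' = 1\<^sub>m n"
        by (rule bexI) (rule mult_carrier_mat[OF B action_mat_carrier])
    qed
    show ?case
    proof (cases "\<exists>a b. valid n a b \<and> fst a \<le> k \<and> 0 < ev ?v a \<and> ev ?v a \<le> ev ?v b")
      case True
      then obtain a b where ab: "valid n a b" "fst a \<le> k" "0 < ev ?v a" "ev ?v a \<le> ev ?v b"
        by (elim exE conjE) (rule that)
      \<comment> \<open>This subtracts coordinate a from coordinate b. As the source has index at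
        most k, the later basis vectors stay fixed.\<close>
      let ?f = "tv n (inv_letter a) b"
      have v: "valid n (inv_letter a) b" using ab(1) by simp
      have m: "mact n (action_mat n ?f * A) u = actE b (inv_letter a) (mact n A u)" for u
        using mact_mult[OF action_mat_carrier A] mact_tv[OF v] by simp
      obtain B' where B': "B' \<in> carrier_mat n n" "B' * (action_mat n ?f * A) = 1\<^sub>m n"
        using step(2)[OF tv_auto refl, of "inv_letter a" b] by (elim bexE) (rule that)
      have "action_mat n ?f * A \<in> action_mat n ` auto (FG n)"
      proof (rule less.hyps[OF _ less.prems(1) step(1)[OF tv_auto refl] B'])
        show "nat (norm1 n (mact n (action_mat n ?f * A) (unit_at k))) < nat (norm1 n ?v)"
          using norm1_actE[of b n "inv_letter a" ?v] ab norm1_nonneg[of n "actE b (inv_letter a) ?v"]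
          by (simp add: m valid_def)
        fix j assume j: "Suc k \<le> j"
        have "ev (unit_at j) (inv_letter a) = 0" using j ab(2) by (simp add: ev_def unit_at_def)
        then show "mact n (action_mat n ?f * A) (unit_at j) = unit_at j"
          unfolding m less.prems(5)[OF j] by (rule actE_fixed)
      qed
      then show ?thesis by (rule action_mat_cancel[OF tv_auto A])
    next
      case False
      \<comment> \<open>Since A fixes the later basis vectors, so does its left inverse B. Row k of
        B therefore gives a relation among the entries of column k of A up to index k.\<close>
      have B0: "B $$ (k, i) = 0" if "i < n" "k < i" for i
      proof -
        have "mact n B (unit_at i) = unit_at i" using BA[of "unit_at i"] less.prems(5)[of i] that by simp
        then show ?thesis using mact_unit[of n B i k] k that by (simp add: unit_at_def)
      qed
      have "1 = (\<Sum>i<n. B $$ (k, i) * ?v i)"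
        using fun_cong[OF BA[of "unit_at k"], of k] k by (simp add: mact_def[of n B] unit_at_def)
      also have "\<dots> = (\<Sum>i\<le>k. B $$ (k, i) * ?v i)"
        by (rule sum.mono_neutral_right) (use k B0 in auto)
      finally have "\<exists>c. fst c \<le> k \<and> ev ?v c = 1 \<and> (\<forall>i<n. i \<noteq> fst c \<longrightarrow> ?v i = 0)"
        by (intro reduced_column[OF k]) (use False in auto)
      then obtain c where c: "fst c \<le> k" "ev ?v c = 1" "\<And>i. i < n \<Longrightarrow> i \<noteq> fst c \<Longrightarrow> ?v i = 0"
        by (elim exE conjE) (rule that, assumption, assumption, blast)
      obtain \<sigma> where s: "\<sigma> \<in> sperm (Suc k)" "\<sigma> c = (k, True)" using signed_transposition[OF c(1)] by (elim bexE) (rule that)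
      have sn: "\<sigma> \<in> sperm n" using sperm_mono[OF _ s(1)] k by simp
      have m: "mact n (action_mat n (sp n \<sigma>) * A) u = actS \<sigma> (mact n A u)" for u
        using mact_mult[OF action_mat_carrier A] mact_sp[OF sn] by simp
      obtain B' where B': "B' \<in> carrier_mat n n" "B' * (action_mat n (sp n \<sigma>) * A) = 1\<^sub>m n"
        using step(2)[OF sp_auto[OF sn] refl] by (elim bexE) (rule that)
      have si: "\<sigma> (inv_into UNIV \<sigma> d) = d" "inv_into UNIV \<sigma> (\<sigma> d) = d" for d
        using sperm_inverse(2,3)[OF sn] by (metis comp_apply id_apply)+
      have "action_mat n (sp n \<sigma>) * A \<in> action_mat n ` auto (FG n)"
      proof (rule Suc.IH[OF _ step(1)[OF sp_auto[OF sn] refl] B'])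
        fix j assume j: "k \<le> j"
        show "mact n (action_mat n (sp n \<sigma>) * A) (unit_at j) = unit_at j"
        proof (cases "j = k")
          case True
          have "actS \<sigma> ?v i = unit_at k i" for i
          proof (cases "i = k")
            case True
            have "ev (actS \<sigma> ?v) (\<sigma> c) = 1" using ev_actS'[OF sn, of ?v c] c(2) by simp
            then show ?thesis using True s(2) by (simp add: ev_def unit_at_def)
          next
            case False
            let ?d = "inv_into UNIV \<sigma> (i, True)"
            have "?v (fst ?d) = 0"
            proof (cases "fst ?d < n")
              case True
              have "fst ?d \<noteq> fst c" using sperm_fst[OF sn, of ?d c] si(1)[of "(i, True)"] s(2) False by simp
              then show ?thesis using c(3) True by blast
            next
              case False
              then show ?thesis using k by (simp add: mact_def unit_at_def)
            qed
            then show ?thesis using False by (simp add: actS_def ev_def unit_at_def)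
          qed
          then show ?thesis unfolding m True by (rule ext)
        next
          case False
          have "actS \<sigma> (unit_at j) i = unit_at j i" for i
          proof -
            note s' = sperm_inverse(1)[OF s(1)]
            show ?thesis
            proof (cases "i \<le> k")
              case True
              then have "fst (inv_into UNIV \<sigma> (i, True)) < Suc k" using sperm_less[OF s', of "(i, True)"] by simp
              then show ?thesis using True False j by (simp add: actS_def ev_def unit_at_def)
            next
              case False
              then show ?thesis using spermD(3)[OF s', of "(i, True)"] by (simp add: actS_def ev_def)
            qed
          qed
          then have "actS \<sigma> (unit_at j) = unit_at j" by (rule ext)
          then show ?thesis unfolding m using less.prems(5)[of j] False j by simp
        qed
      qed (use k in simp)
      then show ?thesis by (rule action_mat_cancel[OF sp_auto[OF sn] A])
    qed
  qed
qed

lemma carrier_GLZ: "A \<in> carrier (GLZ n) \<longleftrightarrow> A \<in> carrier_mat n n \<and> (\<exists>B\<in>carrier_mat n n. A * B = 1\<^sub>m n \<and> B * A = 1\<^sub>m n)"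
  by (auto simp: GLZ_def units_of_carrier Units_def ring_mat_simps)

theorem action_mat_surj:
  assumes "A \<in> carrier (GLZ n)" shows "\<exists>f\<in>auto (FG n). action_mat n f = A"
proof -
  obtain B where AB: "A \<in> carrier_mat n n" "B \<in> carrier_mat n n" "B * A = 1\<^sub>m n"
    using assms carrier_GLZ by blast
  have "mact n A (unit_at j) = unit_at j" if "n \<le> j" for j
    by (rule ext) (use that in \<open>simp add: mact_unit, simp add: unit_at_def\<close>)
  then have "A \<in> action_mat n ` auto (FG n)" by (rule action_mat_surj_aux[OF order_refl AB])
  then show ?thesis by auto
qed

section \<open>The factorisation\<close>

text \<open>The bound on the index puts this into \<open>sperm n\<close> for every i;
  \<open>signed_rep\<close> states several laws of \<open>e\<close> for all indices.\<close>

definition flip :: "nat \<Rightarrow> nat \<Rightarrow> letter \<Rightarrow> letter" where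
  "flip n i c = (if i < n \<and> fst c = i then inv_letter c else c)"

definition swap :: "nat \<Rightarrow> nat \<Rightarrow> nat \<Rightarrow> letter \<Rightarrow> letter" where
  "swap n a b c = (if a < n \<and> b < n then (transpose a b (fst c), snd c) else c)"

lemma flip_flip [simp]: "flip n i \<circ> flip n i = id"
  by (auto simp: flip_def fun_eq_iff)

lemma swap_swap [simp]: "swap n a b \<circ> swap n a b = id"
  by (auto simp: swap_def fun_eq_iff)

lemma flip_sperm: "flip n i \<in> sperm n"
proof (rule spermI)
  show "bij (flip n i)" by (rule o_bij[OF flip_flip flip_flip])
qed (auto simp: flip_def)

lemma swap_sperm: "swap n a b \<in> sperm n"
proof (rule spermI)
  show "bij (swap n a b)" by (rule o_bij[OF swap_swap swap_swap])
  show "swap n a b (inv_letter c) = inv_letter (swap n a b c)" for c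
    by (cases c) (simp add: swap_def)
  show "swap n a b c = c" if "n \<le> fst c" for c
    using that by (cases c) (auto simp: swap_def transpose_def)
qed

lemma mact_inject:
  assumes "A \<in> carrier_mat n n" "B \<in> carrier_mat n n" "\<And>v. mact n A v = mact n B v"
  shows "A = B"
proof (rule eq_matI)
  show "A $$ (i, j) = B $$ (i, j)" if "i < dim_row B" "j < dim_col B" for i j
    using that assms(1,2) fun_cong[OF assms(3)[of "unit_at j"], of i] by (simp add: mact_unit)
qed (use assms in auto)

lemma group_GLZ: "group (GLZ n)"
  unfolding GLZ_def
  by (intro monoid.units_group ring.is_monoid ring_mat)

lemma action_mat_GLZ: "f \<in> auto (FG n) \<Longrightarrow> action_mat n f \<in> carrier (GLZ n)"
proof -
  assume f: "f \<in> auto (FG n)"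
  interpret F: group "FG n" by (rule group_free_group)
  have "Inn (FG n) #>\<^bsub>AFG n\<^esub> f \<in> carrier (Out (FG n))"
    using f by (auto simp: Out_def carrier_FactGroup carrier_AutoGroup)
  then show ?thesis
    using natural_proj_hom[of n] natural_proj_coset[OF f] by (metis hom_in_carrier)
qed

lemma GLZ_simps: "A \<otimes>\<^bsub>GLZ n\<^esub> B = A * B" "\<one>\<^bsub>GLZ n\<^esub> = 1\<^sub>m n"
  by (simp_all add: GLZ_def units_of_def ring_mat_simps)

section \<open>The representation pulled back to automorphisms\<close>

locale out_rep = finite_dimensional_vector_space scale Basis
  for scale :: "'k::field \<Rightarrow> 'v::ab_group_add \<Rightarrow> 'v" and Basis +
  fixes n :: nat and \<phi> :: "(letter list \<Rightarrow> letter list) set \<Rightarrow> 'v \<Rightarrow> 'v"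
  assumes char: "CHAR('k) = 0 \<or> CHAR('k) > n + 1"
    and dim: "dim (UNIV :: 'v set) < (n + 1) choose 2"
    and rep: "\<phi> \<in> hom (Out (FG n)) (GL scale)"
    and n: "6 \<le> n"
begin

definition rho :: "(letter list \<Rightarrow> letter list) \<Rightarrow> 'v \<Rightarrow> 'v" where
  "rho f = \<phi> (Inn (FG n) #>\<^bsub>AFG n\<^esub> f)"

lemma rho_hom: "rho \<in> hom (AFG n) (GL scale)"
proof -
  interpret F: group "FG n" by (rule group_free_group)
  interpret I: normal "Inn (FG n)" "AFG n" by (rule F.Inn_normal)
  have "\<phi> \<circ> (\<lambda>f. Inn (FG n) #>\<^bsub>AFG n\<^esub> f) \<in> hom (AFG n) (GL scale)"
    using I.r_coset_hom_Mod rep unfolding Out_def by (rule hom_compose)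
  moreover have "rho = \<phi> \<circ> (\<lambda>f. Inn (FG n) #>\<^bsub>AFG n\<^esub> f)" by (simp add: fun_eq_iff rho_def)
  ultimately show ?thesis by simp
qed

lemma group_GL_scale: "group (GL scale)" by (rule group_GL) (rule vector_space_axioms)

lemma rho_linear: "f \<in> auto (FG n) \<Longrightarrow> Vector_Spaces.linear scale scale (rho f)"
  using hom_in_carrier[OF rho_hom] by (auto simp: carrier_AutoGroup GL_def)

lemma rho_mult: "f \<in> auto (FG n) \<Longrightarrow> g \<in> auto (FG n) \<Longrightarrow> rho (f \<otimes>\<^bsub>AFG n\<^esub> g) v = rho f (rho g v)"
  using hom_mult[OF rho_hom, of f g] by (simp add: carrier_AutoGroup GL_def)

lemma rho_one: "rho \<one>\<^bsub>AFG n\<^esub> v = v"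
  using hom_one[OF rho_hom group_AFG group_GL_scale] by (simp add: GL_def)

lemma rho_inner:
  assumes "c \<in> Inn (FG n)" "f \<in> auto (FG n)"
  shows "rho (c \<otimes>\<^bsub>AFG n\<^esub> f) = rho f"
proof -
  interpret F: group "FG n" by (rule group_free_group)
  interpret A: group "AFG n" by (rule group_AFG)
  have sub: "subgroup (Inn (FG n)) (AFG n)" using F.Inn_normal by (rule normal_imp_subgroup)
  then have c: "c \<in> carrier (AFG n)" using assms(1) by (rule subgroup.mem_carrier)
  have "Inn (FG n) #>\<^bsub>AFG n\<^esub> (c \<otimes>\<^bsub>AFG n\<^esub> f) = (Inn (FG n) #>\<^bsub>AFG n\<^esub> c) #>\<^bsub>AFG n\<^esub> f"
    using A.coset_mult_assoc[of "Inn (FG n)" c f] subgroup.subset[OF sub] c assms(2) by (simp add: carrier_AutoGroup)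
  also have "Inn (FG n) #>\<^bsub>AFG n\<^esub> c = Inn (FG n)" using A.coset_join2[OF c sub assms(1)] .
  finally show ?thesis by (simp add: rho_def)
qed

definition T :: "letter \<Rightarrow> letter \<Rightarrow> 'v \<Rightarrow> 'v" where "T a b = rho (tv n a b)"
definition S :: "(letter \<Rightarrow> letter) \<Rightarrow> 'v \<Rightarrow> 'v" where "S \<sigma> = rho (sp n \<sigma>)"

lemma S_mult: "\<sigma> \<in> sperm n \<Longrightarrow> \<tau> \<in> sperm n \<Longrightarrow> S \<sigma> (S \<tau> v) = S (\<sigma> \<circ> \<tau>) v"
  unfolding S_def by (simp add: sp_auto sp_mult flip: rho_mult)

lemma S_id: "S id v = v" unfolding S_def by (simp add: sp_id rho_one)

lemma S_T: "\<sigma> \<in> sperm n \<Longrightarrow> valid n a b \<Longrightarrow> S \<sigma> (T a b v) = T (\<sigma> a) (\<sigma> b) (S \<sigma> v)"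
  unfolding S_def T_def by (simp add: sp_auto tv_auto sp_tv flip: rho_mult)

lemma T_inv: "valid n a b \<Longrightarrow> T a b (T a (inv_letter b) v) = v"
  unfolding T_def by (simp add: tv_auto tv_inv rho_one flip: rho_mult)

lemma T_comm: "\<lbrakk>valid n a b; valid n c d; a \<noteq> c; fst a \<noteq> fst d; fst b \<noteq> fst c\<rbrakk>
    \<Longrightarrow> T a b (T c d v) = T c d (T a b v)"
  unfolding T_def using tv_commute[of n a b c d] by (simp add: tv_auto flip: rho_mult)

lemma T_steinberg:
  assumes "valid n a b" "valid n b c" "valid n a c"
  shows "T b c (T a b v) = T a b (T b c (T a c v))"
proof -
  have "rho (tv n a b \<otimes>\<^bsub>AFG n\<^esub> tv n b c \<otimes>\<^bsub>AFG n\<^esub> tv n a c) v = T a b (T b c (T a c v))"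
    by (simp add: rho_mult AFG_closed tv_auto T_def)
  then show ?thesis unfolding tv_steinberg[OF assms, symmetric] by (simp add: rho_mult tv_auto T_def)
qed

lemma T_weyl:
  assumes "valid n a b"
  shows "T a b (T b (inv_letter a) (T (inv_letter a) (inv_letter b) v)) = S (wperm a b) v"
  unfolding S_def tv_weyl[OF assms, symmetric] by (simp add: rho_mult AFG_closed tv_auto T_def)

lemma T_prod:
  assumes "distinct xs" "\<forall>k\<in>set xs. k < n \<and> k \<noteq> j" "j < n"
  shows "rho (tvprod n s j xs) v = foldr (\<lambda>k. T (k, s) (j, s)) xs v"
  using assms
proof (induction xs)
  case Nil
  then show ?case by (simp add: tvprod_def rho_one)
next
  case (Cons k xs)
  have "tvprod n s j xs \<in> auto (FG n)" using tvprod[of xs n j s] Cons.prems by auto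
  then show ?case using Cons rho_mult[OF tv_auto] by (simp add: tvprod_def T_def)
qed

lemma T_outer:
  assumes i: "i < n" "j < n" "i \<noteq> j"
  defines "xs \<equiv> i # filter (\<lambda>k. k \<noteq> i \<and> k \<noteq> j) [0..<n]"
  shows "foldr (\<lambda>k. T (k, True) (j, True)) xs v = foldr (\<lambda>k. T (k, False) (j, False)) xs v"
proof -
  have xs: "distinct xs" "set xs = {..<n} - {j}" "\<forall>k\<in>set xs. k < n \<and> k \<noteq> j"
    using i by (auto simp: xs_def)
  have "(\<lambda>x \<in> carrier (FG n). [(j, True)] \<otimes>\<^bsub>FG n\<^esub> x \<otimes>\<^bsub>FG n\<^esub> inv\<^bsub>FG n\<^esub> [(j, True)]) \<in> Inn (FG n)"
    unfolding Inn_def by (intro CollectI exI[of _ "[(j, True)]"] conjI refl letter_closed) (use i in simp)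
  then have "rho (tvprod n False j xs) = rho (tvprod n True j xs)"
    unfolding tvprod_outer[OF i(2) xs(1,2)]
    by (rule rho_inner) (use tvprod[OF xs(1,3) i(2)] in blast)
  then show ?thesis using T_prod[OF xs(1,3) i(2)] by metis
qed

lemma signed_rep_T: "signed_rep scale Basis n (\<lambda>i j. T (i, True) (j, True)) (\<lambda>i j. T (i, False) (j, False))
  (\<lambda>a b. S (swap n a b)) (\<lambda>i. S (flip n i))"
proof (intro signed_rep.intro signed_rep_axioms.intro finite_dimensional_vector_space_axioms)
  have char': "of_nat k \<noteq> (0::'k)" if "0 < k" "k \<le> n + 1" for k
    using char that by (auto simp: of_nat_eq_0_iff_char_dvd dest: dvd_imp_le)
  show "(2::'k) \<noteq> 0" using char'[of 2] n by simp
  show "of_nat (n - 1) \<noteq> (0::'k)" using char'[of "n - 1"] n by simp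
  show "6 \<le> n" "dim (UNIV :: 'v set) < (n + 1) choose 2" by (fact n dim)+
  show "Vector_Spaces.linear scale scale (T a b)" for a b
    unfolding T_def by (rule rho_linear[OF tv_auto])
  show "Vector_Spaces.linear scale scale (S (swap n i j))" "Vector_Spaces.linear scale scale (S (flip n i))" for i j
    unfolding S_def by (auto intro: rho_linear sp_auto swap_sperm flip_sperm)
  have V: "valid n (i, s) (j, t)" if "i < n" "j < n" "i \<noteq> j" for i j s t
    using that by (simp add: valid_def)
  have eT: "S (flip n k) (T a b v) = T (flip n k a) (flip n k b) (S (flip n k) v)" if "valid n a b" for k a b v
    using S_T[OF flip_sperm that] .
  show ee: "S (flip n i) (S (flip n i) v) = v" for i v
    by (simp add: S_mult flip_sperm S_id)
  have "flip n i \<circ> flip n j = flip n j \<circ> flip n i" for i j by (auto simp: flip_def fun_eq_iff)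
  then show e_comm: "S (flip n i) (S (flip n j) v) = S (flip n j) (S (flip n i) v)" for i j v
    by (simp add: S_mult flip_sperm)
  show "T (i, False) (j, False) v = S (flip n i) (S (flip n j) (T (i, True) (j, True) (S (flip n i) (S (flip n j) v))))"
    if ij: "i < n" "j < n" "i \<noteq> j" for i j v
  proof -
    have "S (flip n j) (T (i, True) (j, True) w) = T (i, True) (j, False) (S (flip n j) w)" for w
      using eT[OF V[OF ij]] ij by (simp add: flip_def[of n j "(_, _)"])
    moreover have "S (flip n i) (T (i, True) (j, False) w) = T (i, False) (j, False) (S (flip n i) w)" for w
      using eT[OF V[OF ij]] ij by (simp add: flip_def[of n i "(_, _)"])
    ultimately show ?thesis using e_comm[of i j] by (simp add: ee)
  qed
  show "S (flip n k) (T (i, True) (j, True) v) = T (i, True) (j, True) (S (flip n k) v)"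
    if "i < n" "j < n" "i \<noteq> j" "k \<noteq> i" "k \<noteq> j" for i j k v
    using eT[OF V[OF that(1-3)]] that by (simp add: flip_def[of n k "(_, _)"])
  show "T (i, True) (j, True) (S (flip n j) (T (i, True) (j, True) v)) = S (flip n j) v"
    if ij: "i < n" "j < n" "i \<noteq> j" for i j v
    using eT[OF V[OF ij]] T_inv[OF V[OF ij, of True True]] ij by (simp add: flip_def[of n j "(_, _)"])
  show "T (i, True) (j, True) (T (k, True) (l, True) v) = T (k, True) (l, True) (T (i, True) (j, True) v)"
    if "i < n" "j < n" "k < n" "l < n" "i \<noteq> j" "k \<noteq> l" "i \<noteq> k" "i \<noteq> l" "j \<noteq> k" for i j k l v
    by (rule T_comm) (use that in \<open>auto simp: valid_def\<close>)
  show "T (i, True) (j, True) (T (i, False) (k, False) v) = T (i, False) (k, False) (T (i, True) (j, True) v)"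
    if "i < n" "j < n" "k < n" "i \<noteq> j" "i \<noteq> k" for i j k v
    by (rule T_comm) (use that in \<open>auto simp: valid_def\<close>)
  show "T (j, True) (k, True) (T (i, True) (j, True) v) = T (i, True) (j, True) (T (j, True) (k, True) (T (i, True) (k, True) v))"
    if "i < n" "j < n" "k < n" "i \<noteq> j" "i \<noteq> k" "j \<noteq> k" for i j k v
    by (rule T_steinberg) (use that in \<open>auto simp: valid_def\<close>)
  show "S (swap n i j) (S (swap n i j) v) = v" for i j v
    by (simp add: S_mult swap_sperm S_id)
  have "swap n i j = swap n j i" for i j by (auto simp: swap_def fun_eq_iff transpose_commute)
  then show "S (swap n i j) v = S (swap n j i) v" for i j v by simp
  show "S (swap n a b) (T (i, True) (j, True) v)
      = T (transpose a b i, True) (transpose a b j, True) (S (swap n a b) v)"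
    if "a < n" "b < n" "i < n" "j < n" "i \<noteq> j" for a b i j v
    using S_T[OF swap_sperm V[OF that(3-5)]] that by (simp add: swap_def[of n a b "(_, _)"])
  have sw: "swap n a b \<circ> flip n i = flip n (transpose a b i) \<circ> swap n a b"
    if "a < n" "b < n" "i < n" for a b i
    using that by (auto simp: swap_def flip_def fun_eq_iff transpose_def)
  show "S (swap n a b) (S (flip n i) v) = S (flip n (transpose a b i)) (S (swap n a b) v)"
    if "a < n" "b < n" "i < n" for a b i v
    using sw[OF that] by (simp add: S_mult swap_sperm flip_sperm)
  have sw2: "swap n a b \<circ> swap n c d = swap n (transpose a b c) (transpose a b d) \<circ> swap n a b"
    if "a < n" "b < n" "c < n" "d < n" for a b c d
    using that by (auto simp: swap_def fun_eq_iff transpose_def)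
  show "S (swap n a b) (S (swap n c d) v) = S (swap n (transpose a b c) (transpose a b d)) (S (swap n a b) v)"
    if "a < n" "b < n" "c < n" "d < n" for a b c d v
    using sw2[OF that] by (simp add: S_mult swap_sperm)
  show "T (a, True) (b, True) (S (flip n a) (T (b, True) (a, True) (S (flip n a) (T (a, False) (b, False) v))))
      = S (swap n a b) (S (flip n b) v)" if ab: "a < n" "b < n" "a \<noteq> b" for a b v
  proof -
    have "S (flip n a) (T (b, True) (a, True) w) = T (b, True) (a, False) (S (flip n a) w)" for w
      using eT[OF V[of b a True True]] ab by (simp add: flip_def[of n a "(_, _)"])
    moreover have "T (a, True) (b, True) (T (b, True) (a, False) (T (a, False) (b, False) v)) = S (wperm (a, True) (b, True)) v"
      using T_weyl[OF V[OF ab, of True True]] by simp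
    moreover have "wperm (a, True) (b, True) = swap n a b \<circ> flip n b"
      using ab by (auto simp: wperm_def swap_def flip_def fun_eq_iff transpose_def)
    ultimately show ?thesis by (simp add: ee S_mult swap_sperm flip_sperm)
  qed
  show "T (i, True) (j, True) (foldr (\<lambda>k. T (k, True) (j, True)) (filter (\<lambda>k. k \<noteq> i \<and> k \<noteq> j) [0..<n]) v)
      = T (i, False) (j, False) (foldr (\<lambda>k. T (k, False) (j, False)) (filter (\<lambda>k. k \<noteq> i \<and> k \<noteq> j) [0..<n]) v)"
    if "i < n" "j < n" "i \<noteq> j" for i j v
    using T_outer[OF that, of v] by simp
qed

text \<open>\<open>R_eq_L\<close> is the case of equal signs; the mixed case follows by passing to
  inverses.\<close>

lemma T_bar:
  assumes v: "valid n a b" shows "T (inv_letter a) (inv_letter b) = T a b"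
proof -
  have 1: "T (i, True) (j, True) = T (i, False) (j, False)" if "i < n" "j < n" "i \<noteq> j" for i j
    using signed_rep.R_eq_L[OF signed_rep_T that] by (rule ext)
  have 2: "T (i, True) (j, False) = T (i, False) (j, True)" if ij: "i < n" "j < n" "i \<noteq> j" for i j
  proof
    fix v
    have V: "valid n (i, s) (j, t)" for s t using ij by (simp add: valid_def)
    have "T (i, True) (j, False) v = T (i, True) (j, False) (T (i, False) (j, False) (T (i, False) (j, True) v))"
      using T_inv[OF V, of False False v] by simp
    also have "\<dots> = T (i, False) (j, True) v"
      using T_inv[OF V, of True False] 1[OF ij] by simp
    finally show "T (i, True) (j, False) v = T (i, False) (j, True) v" .
  qed
  have ab: "fst a < n" "fst b < n" "fst a \<noteq> fst b" using v by (auto simp: valid_def)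
  obtain i s j t where "a = (i, s)" "b = (j, t)" by (cases a, cases b) blast
  then show ?thesis using 1[OF ab] 2[OF ab] by (cases s; cases t) simp_all
qed

text \<open>The graph of \<open>rho\<close> over the matrices, as a homomorphism into a product
  group. Triviality of a pair is decided by its matrix, by \<open>Gen_faithful\<close>.\<close>

definition pair :: "(letter list \<Rightarrow> letter list) \<Rightarrow> ('v \<Rightarrow> 'v) \<times> int mat" where
  "pair f = (rho f, action_mat n f)"

abbreviation Q :: "(('v \<Rightarrow> 'v) \<times> int mat) monoid" where "Q \<equiv> GL scale \<times>\<times> GLZ n"

lemma pair_closed: "f \<in> auto (FG n) \<Longrightarrow> pair f \<in> carrier Q"
  using hom_in_carrier[OF rho_hom] by (simp add: pair_def action_mat_GLZ carrier_AutoGroup)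

lemma pair_mult: "f \<in> auto (FG n) \<Longrightarrow> g \<in> auto (FG n) \<Longrightarrow> pair f \<otimes>\<^bsub>Q\<^esub> pair g = pair (f \<otimes>\<^bsub>AFG n\<^esub> g)"
  using hom_mult[OF rho_hom, of f g] by (simp add: pair_def carrier_AutoGroup GLZ_simps action_mat_compose)

lemma pair_one: "pair \<one>\<^bsub>AFG n\<^esub> = \<one>\<^bsub>Q\<^esub>"
  using hom_one[OF rho_hom group_AFG group_GL_scale] by (simp add: pair_def GLZ_simps action_mat_one)

lemma pair_bar:
  assumes v: "valid n a b" shows "pair (tv n (inv_letter a) (inv_letter b)) = pair (tv n a b)"
proof -
  have "action_mat n (tv n (inv_letter a) (inv_letter b)) = action_mat n (tv n a b)"
  proof (rule mact_inject[OF action_mat_carrier action_mat_carrier])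
    fix u :: "nat \<Rightarrow> int"
    have "snd (inv_letter b) = (\<not> snd b)" by (cases b) simp
    then show "mact n (action_mat n (tv n (inv_letter a) (inv_letter b))) u = mact n (action_mat n (tv n a b)) u"
      using v by (simp add: mact_tv actE_def)
  qed
  then show ?thesis using T_bar[OF v] by (simp add: pair_def T_def)
qed

sublocale st: steinberg_group Q n "\<lambda>b a. pair (tv n a b)" "\<lambda>\<sigma>. pair (sp n \<sigma>)" "\<lambda>q. mact n (snd q)"
proof (rule steinberg_group.intro[OF DirProd_group[OF group_GL_scale group_GLZ]], unfold_locales)
  note mult = pair_mult AFG_closed tv_auto sp_auto
  show "pair (tv n a b) \<in> carrier Q" for a b by (rule pair_closed[OF tv_auto])
  show "pair (sp n \<sigma>) \<in> carrier Q" if "\<sigma> \<in> sperm n" for \<sigma> by (rule pair_closed[OF sp_auto[OF that]])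
  show "pair (sp n id) = \<one>\<^bsub>Q\<^esub>" by (simp only: sp_id pair_one)
  show "pair (sp n \<sigma>) \<otimes>\<^bsub>Q\<^esub> pair (sp n \<tau>) = pair (sp n (\<sigma> \<circ> \<tau>))" if "\<sigma> \<in> sperm n" "\<tau> \<in> sperm n" for \<sigma> \<tau>
    using that by (simp only: mult sp_mult)
  show bar: "pair (tv n (inv_letter a) (inv_letter b)) = pair (tv n a b)" if "valid n a b" for a b
    by (rule pair_bar[OF that])
  show "pair (tv n a b) \<otimes>\<^bsub>Q\<^esub> pair (tv n (inv_letter a) b) = \<one>\<^bsub>Q\<^esub>" if v: "valid n a b" for a b
  proof -
    have "pair (tv n (inv_letter a) b) = pair (tv n a (inv_letter b))"
      using bar[of a "inv_letter b"] v by simp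
    then show ?thesis using tv_inv[OF v] by (simp only: mult pair_one)
  qed
  show "pair (tv n a b) \<otimes>\<^bsub>Q\<^esub> pair (tv n c d) = pair (tv n c d) \<otimes>\<^bsub>Q\<^esub> pair (tv n a b)"
    if v: "valid n a b" "valid n c d" "fst a \<noteq> fst d" "fst c \<noteq> fst b" for a b c d
  proof -
    \<comment> \<open>If a = c, two right moves of the same letter must commute. Replacing one of
      them by the left move with the same pair brings \<open>tv_commute\<close> into play.\<close>
    obtain c' d' where c: "pair (tv n c d) = pair (tv n c' d')" "a \<noteq> c'" "fst c' = fst c" "fst d' = fst d" "valid n c' d'"
    proof (cases "a = c")
      case True
      then show ?thesis using that[of "inv_letter c" "inv_letter d"] bar[OF v(2)] v by simp
    next
      case False
      then show ?thesis using that[of c d] v by simp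
    qed
    then show ?thesis using tv_commute[OF v(1) c(5)] v by (simp add: mult)
  qed
  show "pair (tv n b c) \<otimes>\<^bsub>Q\<^esub> pair (tv n a b) = pair (tv n a b) \<otimes>\<^bsub>Q\<^esub> pair (tv n b c) \<otimes>\<^bsub>Q\<^esub> pair (tv n a c)"
    if "valid n a b" "valid n b c" "valid n a c" for a b c
    using tv_steinberg[OF that] by (simp only: mult)
  show "pair (sp n \<sigma>) \<otimes>\<^bsub>Q\<^esub> pair (tv n a b) = pair (tv n (\<sigma> a) (\<sigma> b)) \<otimes>\<^bsub>Q\<^esub> pair (sp n \<sigma>)"
    if "\<sigma> \<in> sperm n" "valid n a b" for \<sigma> a b
    using sp_tv[OF that] that by (simp only: mult)
  show "pair (tv n a b) \<otimes>\<^bsub>Q\<^esub> pair (tv n b (inv_letter a)) \<otimes>\<^bsub>Q\<^esub> pair (tv n a b) = pair (sp n (wperm a b))"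
    if v: "valid n a b" for a b
  proof -
    have "pair (tv n a b) \<otimes>\<^bsub>Q\<^esub> pair (tv n b (inv_letter a)) \<otimes>\<^bsub>Q\<^esub> pair (tv n (inv_letter a) (inv_letter b))
       = pair (sp n (wperm a b))"
      using tv_weyl[OF v] by (simp only: mult)
    then show ?thesis by (simp only: bar[OF v])
  qed
  show "mact n (snd \<one>\<^bsub>Q\<^esub>) v = v" for v by (simp add: GLZ_simps mact_one)
  show "mact n (snd (q \<otimes>\<^bsub>Q\<^esub> r)) v = mact n (snd q) (mact n (snd r) v)"
    if "q \<in> carrier Q" "r \<in> carrier Q" for q r v
    using that mact_mult[of "snd q" n "snd r" v] by (auto simp: GLZ_simps carrier_GLZ)
  show "mact n (snd (pair (tv n a b))) v = actE b a v" if "valid n a b" for a b v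
    using mact_tv[OF that] by (simp add: pair_def)
  show "mact n (snd (pair (sp n \<sigma>))) v = actS \<sigma> v" if "\<sigma> \<in> sperm n" for \<sigma> v
    using mact_sp[OF that] by (simp add: pair_def)
qed

lemma pair_Gen: "f \<in> auto (FG n) \<Longrightarrow> pair f \<in> st.Gen n"
proof -
  assume "f \<in> auto (FG n)"
  then have "f \<in> elem n" by (rule nielsen)
  then show ?thesis
  proof induction
    case (elem_sp \<sigma>)
    have "pair (sp n \<sigma>) \<otimes>\<^bsub>Q\<^esub> \<one>\<^bsub>Q\<^esub> \<in> st.Gen n" by (rule st.Gen_s[OF st.Gen_one elem_sp])
    then show ?case by (simp only: st.r_one[OF st.s_closed[OF elem_sp]])
  next
    case (elem_tv f a b)
    have "pair (tv n a b) \<otimes>\<^bsub>Q\<^esub> \<one>\<^bsub>Q\<^esub> \<in> st.Gen n" by (rule st.Gen_E[OF st.Gen_one elem_tv.hyps(2)])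
    then have "pair (tv n a b) \<in> st.Gen n" by (simp only: st.r_one[OF st.E_closed[OF elem_tv.hyps(2)]])
    then have "pair f \<otimes>\<^bsub>Q\<^esub> pair (tv n a b) \<in> st.Gen n"
      using elem_tv.IH st.Gen_mult by blast
    then show ?case by (simp only: pair_mult[OF elem_auto[OF elem_tv.hyps(1)] tv_auto])
  qed
qed

text \<open>The quotient of f by g acts trivially on the abelianisation, and its pair is a product
  of generators by Nielsen's theorem, so \<open>Gen_faithful\<close> applies.\<close>

lemma rho_eq:
  assumes f: "f \<in> auto (FG n)" and g: "g \<in> auto (FG n)" and eq: "action_mat n f = action_mat n g"
  shows "rho f = rho g"
proof -
  interpret A: group "AFG n" by (rule group_AFG)
  let ?g = "inv\<^bsub>AFG n\<^esub> g"
  have g': "?g \<in> auto (FG n)" "?g \<otimes>\<^bsub>AFG n\<^esub> g = \<one>\<^bsub>AFG n\<^esub>" "g \<otimes>\<^bsub>AFG n\<^esub> ?g = \<one>\<^bsub>AFG n\<^esub>"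
    using A.inv_closed[of g] g by (simp_all add: carrier_AutoGroup)
  let ?h = "f \<otimes>\<^bsub>AFG n\<^esub> ?g"
  have h: "?h \<in> auto (FG n)" using AFG_closed[OF f g'(1)] .
  have "action_mat n ?h = action_mat n (g \<otimes>\<^bsub>AFG n\<^esub> ?g)"
    by (simp only: action_mat_compose[OF f g'(1)] action_mat_compose[OF g g'(1)] eq)
  then have "action_mat n ?h = 1\<^sub>m n" by (simp only: g'(3) action_mat_one)
  then have "pair ?h = \<one>\<^bsub>Q\<^esub>"
    by (intro st.Gen_faithful[OF pair_Gen[OF h] order_refl]) (simp add: pair_def mact_one)
  then have "rho ?h v = v" for v by (simp add: pair_def GL_def)
  then have "rho f (rho ?g (rho g v)) = rho g v" for v
    using rho_mult[OF f g'(1)] by simp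
  moreover have "rho ?g (rho g v) = v" for v
    using rho_mult[OF g'(1) g] by (simp add: g'(2) rho_one)
  ultimately show ?thesis by auto
qed

definition psi :: "int mat \<Rightarrow> 'v \<Rightarrow> 'v" where
  "psi A = rho (SOME f. f \<in> auto (FG n) \<and> action_mat n f = A)"

lemma psi_action: "f \<in> auto (FG n) \<Longrightarrow> psi (action_mat n f) = rho f"
  unfolding psi_def by (rule someI2[of _ f]) (auto intro: rho_eq)

lemma psi_hom: "psi \<in> hom (GLZ n) (GL scale)"
proof (rule homI)
  fix A assume "A \<in> carrier (GLZ n)"
  then obtain f where "f \<in> auto (FG n)" "action_mat n f = A" using action_mat_surj by blast
  then show "psi A \<in> carrier (GL scale)"
    using psi_action hom_in_carrier[OF rho_hom] by (auto simp: carrier_AutoGroup)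
next
  fix A B assume "A \<in> carrier (GLZ n)" "B \<in> carrier (GLZ n)"
  then obtain f g where fg: "f \<in> auto (FG n)" "action_mat n f = A" "g \<in> auto (FG n)" "action_mat n g = B"
    using action_mat_surj by meson
  then have "psi (A \<otimes>\<^bsub>GLZ n\<^esub> B) = rho (f \<otimes>\<^bsub>AFG n\<^esub> g)"
    using psi_action[OF AFG_closed[of f n g]] action_mat_compose[of f n g] by (simp add: GLZ_simps)
  also have "\<dots> = psi A \<otimes>\<^bsub>GL scale\<^esub> psi B"
    using hom_mult[OF rho_hom, of f g] fg psi_action by (auto simp: carrier_AutoGroup)
  finally show "psi (A \<otimes>\<^bsub>GLZ n\<^esub> B) = psi A \<otimes>\<^bsub>GL scale\<^esub> psi B" .
qed

lemma psi_natural_proj: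
  assumes "\<Phi> \<in> carrier (Out (FG n))" shows "\<phi> \<Phi> = psi (natural_proj n \<Phi>)"
proof -
  obtain f where "f \<in> auto (FG n)" "\<Phi> = Inn (FG n) #>\<^bsub>AFG n\<^esub> f"
    using assms by (auto simp: Out_def carrier_FactGroup carrier_AutoGroup)
  then show ?thesis using natural_proj_coset psi_action by (simp add: rho_def)
qed

end

theorem theorem3p13:
  fixes scale :: "'k::field \<Rightarrow> 'v::ab_group_add \<Rightarrow> 'v"
    and Basis :: "'v set"
    and n m :: nat
    and \<phi> :: "(letter list \<Rightarrow> letter list) set \<Rightarrow> ('v \<Rightarrow> 'v)"
  assumes char: "CHAR('k) = 0 \<or> CHAR('k) > n + 1"
    and V: "finite_dimensional_vector_space scale Basis"
    and dim: "vector_space.dim scale (UNIV :: 'v set) = m"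
    and rep: "\<phi> \<in> hom (Out (free_group n)) (GL scale)"
    and n: "n \<ge> 6"
    and m: "m < (n + 1) choose 2"
  shows "\<exists>\<psi> \<in> hom (GLZ n) (GL scale).
           \<forall>\<Phi> \<in> carrier (Out (free_group n)). \<phi> \<Phi> = \<psi> (natural_proj n \<Phi>)"
proof -
  interpret finite_dimensional_vector_space scale Basis by (rule V)
  interpret out_rep scale Basis n \<phi>
    by unfold_locales (use char dim rep n m in auto)
  show ?thesis using psi_hom psi_natural_proj by blast
qed

end
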